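(* Let $B$ be a simplicial $d$-ball ($d\ge2$). Then the following are equivalent: 1. $B$ is LC (locally constructible); 2. $K^T$ collapses onto some seepage $C$ of $B$, for some spanning tree $T$ of the dual graph of $B$; 3. there exists a seepage $C$ such that for every facet $\Delta$ of $B$ one has $B-\Delta\searrow C$; 4. $B-\Delta\searrow C$, for some facet $\Delta$ of $B$, and for some seepage $C$; 5. there exists a seepage $C$ such that for every facet $\sigma$ of $\partial B$ one has $B\searrow C-\sigma$; 6. $B\searrow C-\sigma$, for some facet $\sigma$ of $\partial B$, and for some seepage $C$.
   Context: All complexes are finite. A simplicial $d$-ball is a simplicial complex whose underlying space is homeomorphic to the $d$-ball; facets of $B$ are its $d$-faces and facets of $\partial B$ are the boundary $(d-1)$-faces. $B-\Delta$ (resp. $C-\sigma$) denotes deletion of only the face $\Delta$ (resp. $\sigma$), keeping its proper faces. The dual graph of $B$ has the facets as nodes, two nodes joined by an arc iff the facets share a $(d-1)$-face. For a spanning tree $T$ of the dual graph, $K^T$ is the subcomplex of $B$ formed by all $(d-1)$-faces of $B$ (with their faces) that are not hit by $T$, i.e. that do not correspond to arcs of $T$ (in particular $K^T\supseteq\partial B$). A seepage of $B$ is a $(d-1)$-dimensional subcomplex $C$ of $B$ whose $(d-1)$-faces are exactly the $(d-1)$-faces of $\partial B$. Collapse: an elementary collapse removes from a complex a pair of faces $(\sigma,\Sigma)$ with $\dim\Sigma=\dim\sigma+1$, $\sigma$ a proper face of $\Sigma$ and of no other face. $C\searrow D$ ($C$ collapses onto $D$) if $D$ is obtained from $C$ by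 a finite sequence of elementary collapses. LC: A regular CW complex is simplicial if every lower interval $[0,F]$ in its face poset is boolean. A $d$-pseudomanifold is a finite, pure $d$-dimensional, simplicial regular CW complex in which each $(d-1)$-cell belongs to at most two $d$-cells; its boundary is the smallest subcomplex containing all $(d-1)$-cells that lie in exactly one $d$-cell. For $d\ge2$, a local construction for a pure $d$-dimensional simplicial complex $C$ with $N$ facets is a sequence $T_1,\dots,T_N,\dots,T_k$ ($k\ge N$) of $d$-pseudomanifolds such that: (1) $T_1$ is a $d$-simplex; (2) for $i\le N-1$, $T_{i+1}$ is obtained from $T_i$ by gluing a new $d$-simplex to $T_i$ along one of the $(d-1)$-cells of $\partial T_i$; (3) for $i\ge N$, $T_{i+1}$ is obtained from $T_i$ by identifying a pair of $(d-1)$-cells $\sigma,\tau$ in $\partial T_i$ whose intersection contains a $(d-2)$-cell $F$ (the identification being the simplicial one that fixes $F$ pointwise); (4) $T_k=C$. $C$ is LC if a local construction for $C$ exists. *)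

theory Defs
  imports "HOL-Analysis.Analysis"
begin

section \<open>Simplicial balls\<close>

definition unit_ball :: "nat \<Rightarrow> (nat \<Rightarrow> real) topology" where
  "unit_ball n = subtopology (Euclidean_space n) {x. (\<Sum>i<n. x i ^ 2) \<le> 1}"

definition unit_sphere_of_ball :: "nat \<Rightarrow> (nat \<Rightarrow> real) set" where
  "unit_sphere_of_ball n = {x \<in> topspace (unit_ball n). (\<Sum>i<n. x i ^ 2) = 1}"

text \<open>
  Complexes are the geometric ones of \<^const>\<open>simplicial_complex\<close> (finite by definition), in a
  Euclidean space of arbitrary dimension. The faces of a simplex include the empty one, so every
  nonempty complex contains the empty face, of dimension \<open>-1\<close>.
\<close>

definition simplicial_ball :: "nat \<Rightarrow> 'a::euclidean_space set set \<Rightarrow> bool" where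
  "simplicial_ball d B \<longleftrightarrow>
     simplicial_complex B \<and> top_of_set (\<Union>B) homeomorphic_space unit_ball d"

definition faces :: "int \<Rightarrow> 'a::euclidean_space set set \<Rightarrow> 'a set set" where
  "faces k C = {F \<in> C. aff_dim F = k}"

abbreviation facets :: "nat \<Rightarrow> 'a::euclidean_space set set \<Rightarrow> 'a set set" where
  "facets d B \<equiv> faces (int d) B"

text \<open>The boundary is the smallest subcomplex containing the \<open>(d-1)\<close>-faces that lie in exactly one
  \<open>d\<close>-face.\<close>

definition boundary :: "nat \<Rightarrow> 'a::euclidean_space set set \<Rightarrow> 'a set set" where
  "boundary d B = {F. \<exists>\<rho> \<in> faces (int d - 1) B.
     card {\<Delta> \<in> facets d B. \<rho> face_of \<Delta>} = 1 \<and> F face_of \<rho>}"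

definition subcomplex :: "'a::euclidean_space set set \<Rightarrow> 'a set set \<Rightarrow> bool" where
  "subcomplex C B \<longleftrightarrow> simplicial_complex C \<and> C \<subseteq> B"

definition seepage :: "nat \<Rightarrow> 'a::euclidean_space set set \<Rightarrow> 'a set set \<Rightarrow> bool" where
  "seepage d B C \<longleftrightarrow>
     subcomplex C B \<and>
     (\<forall>F \<in> C. aff_dim F \<le> int d - 1) \<and> (\<exists>F \<in> C. aff_dim F = int d - 1) \<and>
     faces (int d - 1) C = faces (int d - 1) (boundary d B)"

section \<open>Collapses\<close>

text \<open>The empty face is never removed (so a point does not collapse to nothing).\<close>

definition elementary_collapse :: "'a::euclidean_space set set \<Rightarrow> 'a set set \<Rightarrow> bool" where
  "elementary_collapse C D \<longleftrightarrow>
     (\<exists>\<sigma> \<in> C. \<exists>\<Sigma> \<in> C. \<sigma> \<noteq> {} \<and> \<sigma> face_of \<Sigma> \<and> aff_dim \<Sigma> = aff_dim \<sigma> + 1 \<and>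
        (\<forall>F \<in> C. \<sigma> face_of F \<and> F \<noteq> \<sigma> \<longrightarrow> F = \<Sigma>) \<and>
        D = C - {\<sigma>, \<Sigma>})"

definition collapses_onto :: "'a::euclidean_space set set \<Rightarrow> 'a set set \<Rightarrow> bool"
    (infix \<open>\<searrow>\<close> 50) where
  "C \<searrow> D \<longleftrightarrow> elementary_collapse\<^sup>*\<^sup>* C D"

section \<open>Dual graph and spanning trees\<close>

text \<open>Undirected graphs without loops and parallel arcs; an arc is the two-element set of its
  end nodes.\<close>

definition dual_arcs :: "nat \<Rightarrow> 'a::euclidean_space set set \<Rightarrow> 'a set set set" where
  "dual_arcs d B = {{\<Delta>, \<Delta>'} | \<Delta> \<Delta>'. \<Delta> \<in> facets d B \<and> \<Delta>' \<in> facets d B \<and> \<Delta> \<noteq> \<Delta>' \<and>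
     (\<exists>\<rho> \<in> faces (int d - 1) B. \<rho> face_of \<Delta> \<and> \<rho> face_of \<Delta>')}"

definition connected_graph :: "'v set \<Rightarrow> 'v set set \<Rightarrow> bool" where
  "connected_graph N A \<longleftrightarrow> N \<noteq> {} \<and> (\<forall>u \<in> N. \<forall>v \<in> N. (u, v) \<in> {(x, y). {x, y} \<in> A}\<^sup>*)"

definition graph_cycle :: "'v set set \<Rightarrow> 'v list \<Rightarrow> bool" where
  "graph_cycle A vs \<longleftrightarrow> length vs \<ge> 3 \<and> distinct vs \<and>
     (\<forall>i < length vs. {vs ! i, vs ! (Suc i mod length vs)} \<in> A)"

definition dual_spanning_tree :: "nat \<Rightarrow> 'a::euclidean_space set set \<Rightarrow> 'a set set set \<Rightarrow> bool" where
  "dual_spanning_tree d B T \<longleftrightarrow>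
     T \<subseteq> dual_arcs d B \<and> connected_graph (facets d B) T \<and> \<not> (\<exists>vs. graph_cycle T vs)"

text \<open>The \<open>(d-1)\<close>-face \<open>\<rho>\<close> is hit by \<open>T\<close> if it is shared by the two ends of an arc of \<open>T\<close>.\<close>

definition hit_by :: "'a::euclidean_space set set set \<Rightarrow> 'a set \<Rightarrow> bool" where
  "hit_by T \<rho> \<longleftrightarrow> (\<exists>e \<in> T. \<forall>\<Delta> \<in> e. \<rho> face_of \<Delta>)"

definition K_complex :: "nat \<Rightarrow> 'a::euclidean_space set set \<Rightarrow> 'a set set set \<Rightarrow> 'a set set" where
  "K_complex d B T = {F. \<exists>\<rho> \<in> faces (int d - 1) B. \<not> hit_by T \<rho> \<and> F face_of \<rho>}"

section \<open>Regular CW complexes and pseudomanifolds\<close>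

text \<open>A complex is given by its underlying space and its set of closed (nonempty) cells.\<close>

record 'p cell_complex =
  space_of :: "'p topology"
  cells :: "'p set set"

definition cells_of_dim :: "nat \<Rightarrow> 'p cell_complex \<Rightarrow> 'p set set" where
  "cells_of_dim n T = {c \<in> cells T. subtopology (space_of T) c homeomorphic_space unit_ball n}"

definition proper_faces_union :: "'p cell_complex \<Rightarrow> 'p set \<Rightarrow> 'p set" where
  "proper_faces_union T c = \<Union>{c' \<in> cells T. c' \<subset> c}"

text \<open>
  A finite regular CW complex is a Hausdorff space with finitely many closed cells, each
  homeomorphic to a ball whose boundary sphere is a union of cells (necessarily: of all the cells
  properly contained in it), such that the interiors of the cells partition the space.
\<close>

definition finite_regular_CW :: "'p cell_complex \<Rightarrow> bool" where
  "finite_regular_CW T \<longleftrightarrow>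
     Hausdorff_space (space_of T) \<and>
     finite (cells T) \<and>
     topspace (space_of T) = \<Union>(cells T) \<and>
     (\<forall>c \<in> cells T. \<exists>n h. homeomorphic_map (unit_ball n) (subtopology (space_of T) c) h \<and>
        h ` unit_sphere_of_ball n = proper_faces_union T c) \<and>
     (\<forall>c \<in> cells T. \<forall>c' \<in> cells T. c \<noteq> c' \<longrightarrow>
        (c - proper_faces_union T c) \<inter> (c' - proper_faces_union T c') = {})"

text \<open>The face poset consists of the cells and the empty set as bottom element \<open>0\<close>, ordered by
  inclusion.\<close>

definition lower_interval :: "'p cell_complex \<Rightarrow> 'p set \<Rightarrow> 'p set set" where
  "lower_interval T c = insert {} {c' \<in> cells T. c' \<subseteq> c}"

definition boolean_family :: "'p set set \<Rightarrow> bool" where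
  "boolean_family I \<longleftrightarrow> (\<exists>(V::nat set) f. finite V \<and> bij_betw f (Pow V) I \<and>
     (\<forall>A \<in> Pow V. \<forall>A' \<in> Pow V. A \<subseteq> A' \<longleftrightarrow> f A \<subseteq> f A'))"

definition simplicial_CW :: "'p cell_complex \<Rightarrow> bool" where
  "simplicial_CW T \<longleftrightarrow>
     finite_regular_CW T \<and> (\<forall>c \<in> cells T. boolean_family (lower_interval T c))"

definition pseudomanifold :: "nat \<Rightarrow> 'p cell_complex \<Rightarrow> bool" where
  "pseudomanifold d T \<longleftrightarrow>
     simplicial_CW T \<and>
     (\<forall>c \<in> cells T. \<exists>D \<in> cells_of_dim d T. c \<subseteq> D) \<and>
     (\<forall>\<rho> \<in> cells_of_dim (d - 1) T. card {D \<in> cells_of_dim d T. \<rho> \<subseteq> D} \<le> 2)"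

text \<open>The \<open>(d-1)\<close>-cells of the boundary of a \<open>d\<close>-pseudomanifold.\<close>

definition boundary_facets :: "nat \<Rightarrow> 'p cell_complex \<Rightarrow> 'p set set" where
  "boundary_facets d T =
     {\<rho> \<in> cells_of_dim (d - 1) T. card {D \<in> cells_of_dim d T. \<rho> \<subseteq> D} = 1}"

definition cell_complex_iso :: "'p cell_complex \<Rightarrow> 'q cell_complex \<Rightarrow> bool" where
  "cell_complex_iso T T' \<longleftrightarrow> (\<exists>f. homeomorphic_map (space_of T) (space_of T') f \<and>
     cells T' = (\<lambda>c. f ` c) ` cells T)"

definition as_cell_complex :: "'a::euclidean_space set set \<Rightarrow> 'a cell_complex" where
  "as_cell_complex C = \<lparr> space_of = top_of_set (\<Union>C), cells = C - {{}} \<rparr>"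

section \<open>Local constructions\<close>

text \<open>
  In a simplicial regular CW complex a \<open>d\<close>-cell together with its faces is a \<open>d\<close>-simplex. The
  definitions below are used only for pseudomanifolds.
\<close>

definition is_d_simplex :: "nat \<Rightarrow> 'p cell_complex \<Rightarrow> bool" where
  "is_d_simplex d T \<longleftrightarrow> (\<exists>D \<in> cells_of_dim d T. \<forall>c \<in> cells T. c \<subseteq> D)"

text \<open>
  \<open>T'\<close> is a copy of \<open>T\<close>, embedded by \<open>e\<close>, together with a \<open>d\<close>-simplex \<open>D\<close> that meets this copy
  exactly in the boundary cell \<open>\<rho>\<close>.
\<close>

definition glue_simplex :: "nat \<Rightarrow> 'p cell_complex \<Rightarrow> 'q cell_complex \<Rightarrow> bool" where
  "glue_simplex d T T' \<longleftrightarrow>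
     (\<exists>\<rho> \<in> boundary_facets d T. \<exists>D \<in> cells_of_dim d T'. \<exists>e.
        embedding_map (space_of T) (space_of T') e \<and>
        cells T' = (\<lambda>c. e ` c) ` cells T \<union> {c \<in> cells T'. c \<subseteq> D} \<and>
        e ` topspace (space_of T) \<inter> D = e ` \<rho>)"

text \<open>
  \<open>h\<close> is the identification of \<open>\<sigma>\<close> with \<open>\<tau>\<close> and \<open>q\<close> the projection onto the resulting quotient
  space, whose cells are the images of the cells of \<open>T\<close>. A simplicial \<open>h\<close> that fixes the common
  \<open>(d-2)\<close>-cell \<open>F\<close> fixes every common face of \<open>\<sigma>\<close> and \<open>\<tau>\<close>: such a face not contained in \<open>F\<close>
  contains the vertex opposite to \<open>F\<close> both in \<open>\<sigma>\<close> and in \<open>\<tau>\<close>. Cells carry no affine structure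
  here, so a simplicial map is a homeomorphism taking faces to faces, and it is required to fix all
  of \<open>\<sigma> \<inter> \<tau>\<close> pointwise.
\<close>

definition identify_facets :: "nat \<Rightarrow> 'p cell_complex \<Rightarrow> 'q cell_complex \<Rightarrow> bool" where
  "identify_facets d T T' \<longleftrightarrow>
     (\<exists>\<sigma> \<in> boundary_facets d T. \<exists>\<tau> \<in> boundary_facets d T. \<exists>F \<in> cells_of_dim (d - 2) T. \<exists>h q.
        \<sigma> \<noteq> \<tau> \<and> F \<subseteq> \<sigma> \<inter> \<tau> \<and>
        homeomorphic_map (subtopology (space_of T) \<sigma>) (subtopology (space_of T) \<tau>) h \<and>
        (\<lambda>c. h ` c) ` {c \<in> cells T. c \<subseteq> \<sigma>} = {c \<in> cells T. c \<subseteq> \<tau>} \<and>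
        (\<forall>x \<in> \<sigma> \<inter> \<tau>. h x = x) \<and>
        quotient_map (space_of T) (space_of T') q \<and>
        (\<forall>x \<in> topspace (space_of T). \<forall>y \<in> topspace (space_of T).
           q x = q y \<longleftrightarrow> x = y \<or> x \<in> \<sigma> \<and> y = h x \<or> y \<in> \<sigma> \<and> x = h y) \<and>
        cells T' = (\<lambda>c. q ` c) ` cells T)"

text \<open>
  The points of the intermediate complexes are taken from the type \<^typ>\<open>nat \<Rightarrow> real\<close>. This is no
  restriction: every finite regular CW complex is homeomorphic to a subspace of some Euclidean space.
\<close>

definition LC :: "nat \<Rightarrow> 'a::euclidean_space set set \<Rightarrow> bool" where
  "LC d C \<longleftrightarrow>
     (\<exists>(T :: nat \<Rightarrow> (nat \<Rightarrow> real) cell_complex) k. let N = card (facets d C) in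
        N \<ge> 1 \<and> k \<ge> N \<and>
        (\<forall>i \<in> {1..k}. pseudomanifold d (T i)) \<and>
        is_d_simplex d (T 1) \<and>
        (\<forall>i \<in> {1..<N}. glue_simplex d (T i) (T (i + 1))) \<and>
        (\<forall>i \<in> {N..<k}. identify_facets d (T i) (T (i + 1))) \<and>
        cell_complex_iso (T k) (as_cell_complex C))"

section \<open>Equivalence of several statements\<close>

definition all_equivalent :: "bool list \<Rightarrow> bool" where
  "all_equivalent ps \<longleftrightarrow> (\<forall>p \<in> set ps. \<forall>q \<in> set ps. p \<longleftrightarrow> q)"

end

theory Submission
  imports Defs "HOL-Homology.Homology"
begin

text \<open>All six statements are compared with one combinatorial statement,
  \<open>constructible\<close>. Call the (d-1)-faces ridges. A construction starts from one facet,
  attaches the other facets one at a time through a ridge shared with an earlier facet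
  (\<open>attach\<close>), and then closes the remaining interior ridges one at a time
  (\<open>seal\<close>); a ridge may be closed when, around one of its (d-2)-faces, all other ridges
  are closed already.

  Seen from what is left over, an attachment removes a pair (ridge, facet) and a closing removes a
  pair ((d-2)-face, ridge); both are elementary collapses. The attachments grow a spanning tree T of
  the dual graph, the ridges then left are those of K^T, and the closings collapse K^T onto a
  complex whose ridges are the boundary ridges, that is, onto a seepage
  (\<open>constructible_imp_tree_collapse\<close>). For every facet, B without it collapses onto K^T
  along T (\<open>collapse_onto_K_complex\<close>), so one seepage serves all facets. Conversely a
  collapse of B minus a facet onto a seepage is sorted by dimension: its (ridge, facet) pairs give
  the attachments, its ((d-2)-face, ridge) pairs the closings, and smaller pairs are forgotten
  (\<open>collapse_decompose\<close>). The statements about a boundary facet \<sigma> differ from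
  those about a facet by a single pair (\<open>boundary_facet_collapse\<close>,
  \<open>facet_collapse_of_boundary\<close>).

  From a construction to LC: every state is realised by the disjoint union of the facets present,
  glued along the ridges closed so far (locale \<open>glued\<close>). Attachments become gluings of
  simplices (\<open>glue_step\<close>), closings become identifications of boundary cells
  (\<open>identify_step\<close>), and the last state is B itself (\<open>iso_CX\<close>). From LC to
  a construction: the final isomorphism with B is pulled back through the local construction to maps
  of all the stages into B that are injective on cells (locale \<open>folded\<close>). Counting
  shows that they are injective on d-cells (\<open>facets_inj\<close>), and the ridges lying in two
  d-cells form the states of a construction. An identification is a \<open>seal\<close> step because
  of two invariants: around each (d-2)-cell there are at most two boundary facets
  (\<open>normal_boundary\<close>, carried forward from the first simplex), and a (d-2)-cell off the
  boundary is the only cell over its image (\<open>unique_lifts\<close>, carried backward from the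
  last stage).

  That B is a ball enters through few facts: B is pure, a ridge lies in at most two facets, some
  ridge lies in exactly one, and the facets around a nonempty face are connected through ridges
  containing that face (\<open>star_strongly_connected\<close>). The triangulation is not assumed
  piecewise linear, so these facts rest on invariance of domain and on the theorem that a subset of
  codimension two does not separate (\<open>lowdim_not_separating\<close>), itself a consequence of
  the nonexistence of retractions onto the frontier. Instead of describing the links of (d-2)-faces,
  a parity count (\<open>odd_star_parity\<close>) shows that going around such a face leads from one
  side of a ridge to the other.\<close>

section \<open>No retraction onto the frontier, and no separation by sets of codimension two\<close>

text \<open>A retract of a convex set is contractible. If the frontier were contractible, so would
  be the round sphere of the same dimension; then the identity of that sphere would extend over its
  ball, and the antipode of the extension would contradict Brouwer's fixed point theorem.\<close>

lemma rel_frontier_not_retract: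
  fixes W :: "'a::euclidean_space set"
  assumes "convex W" "bounded W" "p \<in> rel_interior W"
  shows "\<not> rel_frontier W retract_of W"
proof
  assume "rel_frontier W retract_of W"
  with \<open>convex W\<close> have "contractible (rel_frontier W)"
    using convex_imp_contractible retract_of_contractible by blast
  define A where "A = affine hull W"
  define D where "D = cball p 1 \<inter> A"
  define S where "S = sphere p 1 \<inter> A"
  have pA: "p \<in> A"
    using assms(3) rel_interior_subset[of W] hull_subset[of W affine] unfolding A_def by blast
  have pI: "p \<in> interior (cball p 1) \<inter> A" using pA by (simp add: interior_cball)
  have A: "affine A" by (simp add: A_def)
  have hullD: "affine hull D = A"
  proof -
    have "affine hull (A \<inter> cball p 1) = affine hull A"
      by (rule affine_hull_convex_Int_nonempty_interior)
        (use A pI in \<open>auto simp: affine_imp_convex\<close>)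
    then show ?thesis by (simp add: D_def A_def Int_commute)
  qed
  have rfD: "rel_frontier D = S"
  proof -
    have "interior (cball p 1) \<inter> A \<noteq> {}"
      using pI by blast
    then show ?thesis
      by (simp add: D_def S_def convex_affine_rel_frontier_Int A interior_cball)
  qed
  have cD: "convex D" "bounded D" "compact D"
    using A by (auto simp: D_def affine_imp_convex convex_Int affine_closed compact_Int_closed bounded_Int)
  have pD: "p \<in> rel_interior D"
  proof -
    have "rel_interior (cball p 1 \<inter> A) = interior (cball p 1) \<inter> A"
      by (rule rel_interior_convex_Int_affine[OF convex_cball A]) (use pI in blast)
    then show ?thesis
      using pI by (auto simp: D_def)
  qed
  \<comment> \<open>The frontier of \<open>W\<close> and the round sphere \<open>S\<close> are both
    homotopy equivalent to the punctured affine hull. Passing to \<open>S\<close> makes the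
    reflection in \<open>p\<close> available.\<close>
  have "rel_frontier W homotopy_eqv (A - {p})"
    unfolding A_def by (rule homotopy_eqv_rel_frontier_punctured_affine_hull) (use assms in auto)
  with \<open>contractible (rel_frontier W)\<close> have "contractible (A - {p})"
    using homotopy_eqv_contractibility by blast
  moreover have "rel_frontier D homotopy_eqv (A - {p})"
    using homotopy_eqv_rel_frontier_punctured_affine_hull[of D p] cD pD hullD by simp
  ultimately have "contractible S"
    unfolding rfD using homotopy_eqv_contractibility by blast
  then obtain a where a: "homotopic_with_canon (\<lambda>x. True) S S (\<lambda>x. a) id"
    by (auto simp: contractible_def intro: homotopic_with_symD)
  show False
  proof (cases "S = {}")
    case True
    then have "rel_frontier D = {}" by (simp add: rfD)
    then have "affine D"
      using rel_frontier_eq_empty by blast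
    then have "D = {p}"
      using cD(2) pD rel_interior_subset[of D] affine_bounded_eq_trivial[of D] by auto
    then have "A = {p}" using hullD by simp
    then have "W = {p}"
      using assms(3) rel_interior_subset[of W] hull_subset[of W affine] by (auto simp: A_def)
    then have "rel_frontier W = {}" by simp
    with \<open>rel_frontier W retract_of W\<close> assms(3) show False
      using rel_interior_subset by (auto simp: retract_of_def retraction_def)
  next
    case False
    have clS: "closedin (top_of_set D) S"
      by (intro closed_subset) (auto simp: S_def D_def A_def)
    have aS: "a \<in> S"
      using a False homotopic_with_imp_subset1 by fastforce
    have "ANR S"
      using ANR_rel_frontier_convex[of D] cD rfD by simp
    \<comment> \<open>A constant map extends over \<open>D\<close>, so by homotopy extension the
      identity, being homotopic to it, extends as well.\<close>
    obtain g where g: "continuous_on D g" "g ` D \<subseteq> S" "\<And>x. x \<in> S \<Longrightarrow> g x = id x"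
      by (rule Borsuk_homotopy_extension_homotopic[OF clS _ continuous_on_const _ a])
        (use \<open>ANR S\<close> aS in auto)
    \<comment> \<open>The antipode of \<open>g\<close>: a fixed point of \<open>f\<close> lies on
      \<open>S\<close>, where \<open>g\<close> is the identity, and would be its own
      antipode.\<close>
    define f where "f = (\<lambda>x. 2 *\<^sub>R p - g x)"
    have fD: "f x \<in> S" if "x \<in> D" for x
    proof -
      have gx: "g x \<in> S" using that g by auto
      have "2 *\<^sub>R p + (-1) *\<^sub>R g x \<in> A"
        using A pA gx by (intro mem_affine[of A]) (auto simp: S_def)
      moreover have "dist p (2 *\<^sub>R p - g x) = dist p (g x)"
      proof -
        have "p - (2 *\<^sub>R p - g x) = g x - p" by (simp add: scaleR_2)
        then show ?thesis by (metis dist_commute dist_norm)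
      qed
      ultimately show ?thesis
        using gx by (auto simp: f_def S_def)
    qed
    have "S \<subseteq> D" by (auto simp: S_def D_def)
    obtain x where x: "x \<in> D" "f x = x"
    proof (rule brouwer[of D f])
      show "continuous_on D f" unfolding f_def by (intro continuous_intros g)
    qed (use cD pD fD \<open>S \<subseteq> D\<close> rel_interior_subset in auto)
    then have "x \<in> S" using fD by force
    then have "2 *\<^sub>R p - x = x" using x g(3) by (simp add: f_def)
    then have "2 *\<^sub>R p = 2 *\<^sub>R x" by (simp add: scaleR_2 algebra_simps)
    then have "p = x" by simp
    with \<open>x \<in> S\<close> show False by (simp add: S_def)
  qed
qed

text \<open>The prism lies in the affine hull of its bottom and one point \<open>(a, 1)\<close> of
  its top. It is used for the cells of a homotopy parameter space.\<close>

lemma aff_dim_Times_interval_le: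
  fixes K :: "'a::euclidean_space set"
  shows "aff_dim (K \<times> {0..1::real}) \<le> aff_dim K + 1"
proof (cases "K = {}")
  case False
  then obtain a where a: "a \<in> K" by blast
  define j where "j = (\<lambda>x::'a. (x, 0::real))"
  have lj: "linear j"
    by (auto simp: j_def intro!: linearI)
  have "K \<times> {0..1::real} \<subseteq> affine hull (insert (a, 1) (j ` K))"
  proof clarsimp
    fix x and t :: real
    assume "x \<in> K"
    have "j x \<in> affine hull (insert (a, 1) (j ` K))" "j a \<in> affine hull (insert (a, 1) (j ` K))"
      "(a,1) \<in> affine hull (insert (a, 1) (j ` K))"
      using a \<open>x \<in> K\<close> by (auto intro: hull_inc)
    then have "1 *\<^sub>R j x + t *\<^sub>R (a,1) + (-t) *\<^sub>R j a \<in> affine hull (insert (a, 1) (j ` K))"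
      by (intro mem_affine_3) auto
    then show "(x, t) \<in> affine hull (insert (a, 1) (j ` K))"
      by (simp add: j_def)
  qed
  then have "aff_dim (K \<times> {0..1::real}) \<le> aff_dim (insert (a, 1) (j ` K))"
    by (metis aff_dim_affine_hull aff_dim_subset)
  also have "\<dots> \<le> aff_dim (j ` K) + 1"
    by (simp add: aff_dim_insert)
  also have "aff_dim (j ` K) \<le> aff_dim K"
    by (rule aff_dim_linear_image_le[OF lj])
  finally show ?thesis by simp
qed auto

text \<open>On \<open>C2\<close> there is the radial retraction away from \<open>p\<close>, on
  \<open>C1\<close> the one away from \<open>p'\<close>. On the common part, which carries a
  polyhedral structure of codimension at least two through \<open>\<phi>\<close>, the two maps into
  the frontier are homotopic, because a complex of dimension less than that of \<open>W\<close> has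
  no obstruction to extending maps into the frontier. Homotopy extension then corrects the map on
  \<open>C1\<close> so that both fit together to a retraction of \<open>W\<close> onto its frontier.
  The set is only a topological image of a polyhedron, since faces of the ball are bent by the
  chart.\<close>

lemma lowdim_not_separating:
  fixes W :: "'a::euclidean_space set" and \<phi> :: "'b::euclidean_space \<Rightarrow> 'a"
  assumes W: "compact W" "convex W"
    and Z: "finite Z" "\<And>K. K \<in> Z \<Longrightarrow> polytope K" "\<And>K. K \<in> Z \<Longrightarrow> aff_dim K + 1 < aff_dim W"
      "\<And>K L. K \<in> Z \<Longrightarrow> L \<in> Z \<Longrightarrow> (K \<inter> L) face_of K"
    and \<phi>: "continuous_on (\<Union>Z) \<phi>" "inj_on \<phi> (\<Union>Z)"
    and C: "closed C1" "closed C2" "C1 \<union> C2 = W" "C1 \<inter> C2 \<subseteq> \<phi> ` \<Union>Z"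
    and p: "p \<in> rel_interior W" "p \<notin> C2" and p': "p' \<in> rel_interior W" "p' \<notin> C1"
  shows False
proof -
  define R where "R = rel_frontier W"
  have bW: "bounded W" using W compact_imp_bounded by blast
  have RW: "R \<subseteq> W"
    using W by (metis Diff_subset R_def closure_closed compact_imp_closed rel_frontier_def)
  have clR: "closed R" by (simp add: R_def closed_rel_frontier)
  have WA: "W \<subseteq> affine hull W" by (rule hull_subset)
  obtain r1 where r1: "retraction (affine hull W - {p}) R r1"
    unfolding R_def using rel_frontier_retract_of_punctured_affine_hull[OF bW W(2) p(1)] by (auto simp: retract_of_def)
  obtain r2 where r2: "retraction (affine hull W - {p'}) R r2"
    unfolding R_def using rel_frontier_retract_of_punctured_affine_hull[OF bW W(2) p'(1)] by (auto simp: retract_of_def)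
  have r1R: "\<And>x. x \<in> R \<Longrightarrow> r1 x = x" and r2R: "\<And>x. x \<in> R \<Longrightarrow> r2 x = x"
    using r1 r2 by (auto simp: retraction_def)
  have C12: "C1 \<subseteq> affine hull W - {p'}" "C2 \<subseteq> affine hull W - {p}"
    using C WA p p' by auto
  have cr1: "continuous_on C2 r1" and cr2: "continuous_on C1 r2"
    and r1m: "\<And>x. x \<in> C2 \<Longrightarrow> r1 x \<in> R" and r2m: "\<And>x. x \<in> C1 \<Longrightarrow> r2 x \<in> R"
    using r1 r2 C12 by (auto simp: retraction_def intro: continuous_on_subset)
  define L where "L = C1 \<inter> C2"
  have clL: "closed L" unfolding L_def by (intro closed_Int C)
  have cmZ: "compact (\<Union>Z)"
    using Z by (auto intro: compact_Union polytope_imp_compact)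
  define Q where "Q = \<Union>Z \<inter> \<phi> -` L"
  have clQ: "closed Q" unfolding Q_def
    by (rule continuous_closed_preimage[OF \<phi>(1) compact_imp_closed[OF cmZ] clL])
  define Q' where "Q' = \<Union>Z \<inter> \<phi> -` (L \<inter> R)"
  have clQ': "closed Q'" unfolding Q'_def
    by (rule continuous_closed_preimage[OF \<phi>(1) compact_imp_closed[OF cmZ] closed_Int[OF clL clR]])
  have QZ: "Q \<subseteq> \<Union>Z" "Q' \<subseteq> Q" by (auto simp: Q_def Q'_def)
  have cmQ: "compact Q"
    using clQ cmZ QZ by (metis compact_Int_closed inf.absorb_iff2)
  have c\<phi>Q: "continuous_on Q \<phi>" "continuous_on Q' \<phi>"
    using \<phi>(1) QZ continuous_on_subset by (metis, meson)
  \<comment> \<open>The prescribed part of the homotopy: \<open>r2\<close> at time 0,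
    \<open>r1\<close> at time 1, and stationary over points already in the frontier, where both
    retractions are the identity.\<close>
  define f where "f = (\<lambda>(z,t). if t = 0 then r2 (\<phi> z) else if t = (1::real) then r1 (\<phi> z) else \<phi> z)"
  define E where "E = Q \<times> {0} \<union> (Q \<times> {1} \<union> Q' \<times> {0..1::real})"
  have contf: "continuous_on E f"
    unfolding E_def
  proof (intro continuous_on_closed_Un closed_Times closed_Un clQ clQ' closed_singleton closed_atLeastAtMost)
    have "continuous_on (Q \<times> {0}) (\<lambda>z. r2 (\<phi> (fst z)))"
      by (rule continuous_on_compose2[OF cr2])
        (auto intro!: continuous_on_compose2[OF c\<phi>Q(1)] continuous_intros simp: Q_def L_def)
    then show "continuous_on (Q \<times> {0}) f"
      by (rule continuous_on_eq) (auto simp: f_def)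
    have "continuous_on (Q \<times> {1}) (\<lambda>z. r1 (\<phi> (fst z)))"
      by (rule continuous_on_compose2[OF cr1])
        (auto intro!: continuous_on_compose2[OF c\<phi>Q(1)] continuous_intros simp: Q_def L_def)
    then show "continuous_on (Q \<times> {1}) f"
      by (rule continuous_on_eq) (auto simp: f_def)
    have "continuous_on (Q' \<times> {0..1::real}) (\<lambda>z. \<phi> (fst z))"
      by (auto intro!: continuous_on_compose2[OF c\<phi>Q(2)] continuous_intros)
    then show "continuous_on (Q' \<times> {0..1}) f"
      by (rule continuous_on_eq) (auto simp: f_def Q'_def r1R r2R)
  qed
  have fE: "f \<in> E \<rightarrow> R"
    by (auto simp: E_def f_def Q_def Q'_def L_def r1m r2m)
  define F where "F = (\<lambda>K. K \<times> {0..1::real}) ` Z"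
  have UF: "\<Union>F = \<Union>Z \<times> {0..1}" by (auto simp: F_def)
  \<comment> \<open>The prisms over \<open>Z\<close> form a cell complex of dimension less than
    \<open>W\<close>, so \<open>f\<close> extends over all of them with values in the
    frontier.\<close>
  obtain g where g: "continuous_on (\<Union>F) g" "g \<in> (\<Union>F) \<rightarrow> R" "\<And>x. x \<in> E \<Longrightarrow> g x = f x"
  proof (rule extend_map_cell_complex_to_sphere[of F E W f])
    show "finite F" using Z by (simp add: F_def)
    show "E \<subseteq> \<Union>F" using QZ by (auto simp: UF E_def)
    show "closed E" unfolding E_def
      by (intro closed_Un closed_Times clQ clQ' closed_singleton closed_atLeastAtMost)
    show "polytope X" if "X \<in> F" for X
      using that Z polytope_interval[of 0 "1::real"] by (auto simp: F_def intro!: polytope_Times)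
    show "aff_dim X < aff_dim W" if "X \<in> F" for X
    proof -
      obtain K where "K \<in> Z" "X = K \<times> {0..1}" using \<open>X \<in> F\<close> unfolding F_def by auto
      then show ?thesis using Z(3)[of K] aff_dim_Times_interval_le[of K] by simp
    qed
    show "X \<inter> Y face_of X" if "X \<in> F" "Y \<in> F" for X Y
    proof -
      obtain K L where K: "K \<in> Z" "X = K \<times> {0..1}" and L: "L \<in> Z" "Y = L \<times> {0..1}"
        using \<open>X \<in> F\<close> \<open>Y \<in> F\<close> unfolding F_def by auto
      have "X \<inter> Y = (K \<inter> L) \<times> {0..1}" by (auto simp: K(2) L(2))
      moreover have "{0..1::real} face_of {0..1}"
        by (simp add: face_of_refl)
      ultimately show ?thesis
        using K L Z(4) by (simp add: face_of_Times)
    qed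
  qed (use W bW contf fE in \<open>auto simp: R_def\<close>)
  define \<psi> where "\<psi> = the_inv_into Q \<phi>"
  have inj: "inj_on \<phi> Q" using \<phi>(2) QZ inj_on_subset by blast
  have imQ: "\<phi> ` Q = L" using C(4) unfolding Q_def L_def by blast
  have c\<psi>: "continuous_on L \<psi>"
    using continuous_on_inv_into[OF c\<phi>Q(1) cmQ inj] by (simp add: imQ \<psi>_def)
  have \<psi>: "\<psi> x \<in> Q" "\<phi> (\<psi> x) = x" if "x \<in> L" for x
    using that imQ inj by (auto simp: \<psi>_def the_inv_into_into f_the_inv_into_f)
  \<comment> \<open>The homotopy is extended from \<open>S\<close> rather than from \<open>L\<close>
    alone so that the corrected map stays the identity on the frontier part of
    \<open>C1\<close>.\<close>
  define S where "S = L \<union> (C1 \<inter> R)"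
  define h where "h = (\<lambda>(t,x). if x \<in> L then g (\<psi> x, t) else x)"
  have conth: "continuous_on ({0..1} \<times> S) h"
  proof -
    have eq: "{0..1} \<times> S = ({0..1} \<times> L) \<union> ({0..1::real} \<times> (C1 \<inter> R))"
      by (auto simp: S_def)
    have 1: "continuous_on ({0..1} \<times> L) h"
    proof -
      have "continuous_on ({0..1} \<times> L) (\<lambda>z. g (\<psi> (snd z), fst z))"
      proof (rule continuous_on_compose2[OF g(1)])
        show "continuous_on ({0..1} \<times> L) (\<lambda>z. (\<psi> (snd z), fst z))"
          by (intro continuous_on_Pair continuous_on_compose2[OF c\<psi>] continuous_intros) auto
        show "(\<lambda>z. (\<psi> (snd z), fst z)) ` ({0..1} \<times> L) \<subseteq> \<Union> F"
        proof clarify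
          fix t :: real and x assume "t \<in> {0..1}" "x \<in> L"
          then show "(\<psi> (snd (t,x)), fst (t,x)) \<in> \<Union>F"
            unfolding UF using \<psi>(1)[of x] QZ(1) by (simp add: subset_iff)
        qed
      qed
      then show ?thesis by (rule continuous_on_eq) (auto simp: h_def)
    qed
    have 2: "continuous_on ({0..1} \<times> (C1 \<inter> R)) h"
    proof -
      have "snd z = h z" if zz: "z \<in> {0..1} \<times> (C1 \<inter> R)" for z
      proof (cases "snd z \<in> L")
        case True
        obtain t x where z: "z = (t,x)" "t \<in> {0..1}" "x \<in> R" using zz by auto
        then have "\<psi> x \<in> Q'" using True \<psi> by (auto simp: Q'_def Q_def)
        then have "(\<psi> x, t) \<in> E" using z by (auto simp: E_def)
        then have "g (\<psi> x, t) = f (\<psi> x, t)" using g by simp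
        also have "\<dots> = x" using z True \<psi> r1R r2R by (auto simp: f_def)
        finally show ?thesis using True z by (simp add: h_def)
      qed (simp add: h_def split_beta)
      then show ?thesis
        by (rule continuous_on_eq[OF continuous_on_snd[OF continuous_on_id]])
    qed
    show ?thesis unfolding eq
      by (rule continuous_on_closed_Un[OF _ _ 1 2])
        (auto intro!: closed_Times clL closed_Int C clR)
  qed
  have h01: "h (0, x) = r2 x" "h (1, x) = r1 x" if "x \<in> S" for x
  proof -
    have "h (0, x) = r2 x \<and> h (1, x) = r1 x"
    proof (cases "x \<in> L")
      case True
      then have "(\<psi> x, 0) \<in> E" "(\<psi> x, 1) \<in> E" using \<psi> by (auto simp: E_def)
      then show ?thesis using True \<psi> g(3) by (simp add: h_def f_def)
    next
      case False
      then have "x \<in> R" using that by (auto simp: S_def)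
      then show ?thesis using False r1R r2R by (simp add: h_def)
    qed
    then show "h (0, x) = r2 x" "h (1, x) = r1 x" by auto
  qed
  have him: "h \<in> ({0..1} \<times> S) \<rightarrow> R"
  proof
    fix z :: "real \<times> 'a" assume "z \<in> {0..1} \<times> S"
    then obtain t x where z: "z = (t,x)" "t \<in> {0..1}" "x \<in> S" by auto
    show "h z \<in> R"
    proof (cases "x \<in> L")
      case True
      then have "\<psi> x \<in> \<Union>Z" using \<psi>(1) QZ(1) by blast
      then have "(\<psi> x, t) \<in> \<Union>F" using z unfolding UF by simp
      then show ?thesis using g(2) z True by (auto simp: h_def)
    qed (use z in \<open>auto simp: h_def S_def\<close>)
  qed
  have hom: "homotopic_with_canon (\<lambda>x. True) S R r2 r1"
    by (subst homotopic_with, simp, rule exI[of _ h])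
      (use conth him h01 in \<open>simp add: image_subset_iff_funcset\<close>)
  have SC1: "closedin (top_of_set C1) S"
    using clL clR C by (intro closed_subset) (auto simp: S_def L_def)
  obtain g' where g': "continuous_on C1 g'" "g' ` C1 \<subseteq> R" "\<And>x. x \<in> S \<Longrightarrow> g' x = r1 x"
    by (rule Borsuk_homotopy_extension_homotopic[OF SC1 _ cr2 _ hom])
      (use r2m ANR_rel_frontier_convex[OF bW W(2)] in \<open>auto simp: R_def\<close>)
  \<comment> \<open>\<open>g'\<close> and \<open>r1\<close> agree on \<open>L\<close>, so they paste
    to the forbidden retraction.\<close>
  define G where "G = (\<lambda>x. if x \<in> C1 then g' x else r1 x)"
  have "continuous_on (C1 \<union> C2) G"
    unfolding G_def
    by (rule continuous_on_cases[OF C(1,2) g'(1) cr1]) (use g'(3) in \<open>auto simp: S_def L_def\<close>)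
  moreover have "G ` W \<subseteq> R" using g'(2) r1m C(3) by (auto simp: G_def)
  moreover have "G x = x" if "x \<in> R" for x
    using that g'(3) r1R by (auto simp: G_def S_def)
  ultimately have "retraction W R G"
    using RW C(3) by (auto simp: retraction_def)
  then have "rel_frontier W retract_of W"
    by (auto simp: R_def retract_of_def)
  with rel_frontier_not_retract[OF W(2) bW p(1)] show False ..
qed

section \<open>Unit balls: invariance of dimension and of the boundary sphere, and convex
  models\<close>

definition open_unit_ball :: "nat \<Rightarrow> (nat \<Rightarrow> real) set" where
  "open_unit_ball n = {x \<in> topspace (Euclidean_space n). (\<Sum>i<n. x i ^ 2) < 1}"

lemma topspace_unit_ball: "topspace (unit_ball n) = {x \<in> topspace (Euclidean_space n). (\<Sum>i<n. x i ^ 2) \<le> 1}"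
  by (auto simp: unit_ball_def)

lemma open_unit_ball_subset: "open_unit_ball n \<subseteq> topspace (unit_ball n)"
  by (auto simp: open_unit_ball_def topspace_unit_ball)

lemma unit_ball_minus_sphere: "topspace (unit_ball n) - unit_sphere_of_ball n = open_unit_ball n"
  by (auto simp: open_unit_ball_def topspace_unit_ball unit_sphere_of_ball_def)

lemma zero_in_open_unit_ball: "(\<lambda>i. 0) \<in> open_unit_ball n"
  by (auto simp: open_unit_ball_def topspace_Euclidean_space)

lemma continuous_map_sum_squares: "continuous_map (Euclidean_space n) euclideanreal (\<lambda>x. \<Sum>i<n. x i ^ 2)"
  unfolding Euclidean_space_def
  by (intro continuous_intros continuous_map_from_subtopology continuous_map_product_projection) auto

lemma openin_open_unit_ball: "openin (Euclidean_space n) (open_unit_ball n)"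
proof -
  have "openin (Euclidean_space n) {x \<in> topspace (Euclidean_space n). (\<Sum>i<n. x i ^ 2) \<in> {..<1}}"
    by (rule openin_continuous_map_preimage[OF continuous_map_sum_squares]) auto
  then show ?thesis by (simp add: open_unit_ball_def)
qed

text \<open>The consequence of openness used below: there is room to move from \<open>x\<close> in
  any prescribed direction \<open>y\<close>.\<close>

lemma openin_Euclidean_space_line:
  assumes "openin (Euclidean_space n) U" "x \<in> U" "y \<in> topspace (Euclidean_space n)"
  obtains e where "e > 0" "(\<lambda>i. x i + e * y i) \<in> U"
proof -
  have x: "x \<in> topspace (Euclidean_space n)" using assms openin_subset by blast
  define f where "f = (\<lambda>t i. x i + t * y i :: real)"
  have "continuous_map euclideanreal (Euclidean_space n) f"
    unfolding Euclidean_space_def continuous_map_in_subtopology f_def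
    using x assms(3)
    by (auto simp: continuous_map_componentwise_UNIV topspace_Euclidean_space intro!: continuous_intros)
  then have "openin euclideanreal {t \<in> topspace euclideanreal. f t \<in> U}"
    using assms(1) by (rule openin_continuous_map_preimage)
  then have "open {t. f t \<in> U}" by simp
  moreover have "f 0 \<in> U" using assms by (simp add: f_def)
  ultimately obtain e where "e > 0" "\<And>t. dist t 0 < e \<Longrightarrow> f t \<in> U"
    by (metis mem_Collect_eq open_dist)
  from this(2)[of "e/2"] this(1) show thesis
    by (intro that[of "e/2"]) (auto simp: f_def)
qed

text \<open>From a point of the sphere one can move radially outwards inside \<open>U\<close>, and
  that leaves the ball.\<close>

lemma open_subset_of_unit_ball:
  assumes "openin (Euclidean_space n) U" "U \<subseteq> topspace (unit_ball n)"
  shows "U \<subseteq> open_unit_ball n"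
proof
  fix x assume x: "x \<in> U"
  then have xt: "x \<in> topspace (Euclidean_space n)" using assms openin_subset by blast
  show "x \<in> open_unit_ball n"
  proof (rule ccontr)
    assume "x \<notin> open_unit_ball n"
    with x assms xt have 1: "(\<Sum>i<n. x i ^ 2) = 1"
      by (force simp: open_unit_ball_def topspace_unit_ball)
    obtain e where e: "e > 0" "(\<lambda>i. x i + e * x i) \<in> U"
      using openin_Euclidean_space_line[OF assms(1) x xt] by blast
    have "(\<Sum>i<n. (x i + e * x i) ^ 2) = (1+e)^2 * (\<Sum>i<n. x i ^ 2)"
      by (simp add: sum_distrib_left power_mult_distrib flip: distrib_right) (simp add: algebra_simps power2_eq_square)
    also have "\<dots> > 1" using e 1 by (simp add: power2_eq_square algebra_simps add_pos_nonneg)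
    finally show False using e assms by (auto simp: topspace_unit_ball)
  qed
qed

text \<open>By invariance of domain the image would be open, so it would contain points moved in the
  direction of coordinate \<open>j\<close>.\<close>

lemma open_unit_ball_not_into_hyperplane:
  assumes f: "continuous_map (subtopology (Euclidean_space n) (open_unit_ball n)) (Euclidean_space n) f"
    and inj: "inj_on f (open_unit_ball n)" and j: "j < n" "\<And>x. x \<in> open_unit_ball n \<Longrightarrow> f x j = 0"
  shows False
proof -
  let ?U = "f ` open_unit_ball n"
  have op: "openin (Euclidean_space n) ?U"
    by (rule invariance_of_domain_Euclidean_space[OF openin_open_unit_ball f inj])
  have x: "f (\<lambda>i. 0) \<in> ?U" using zero_in_open_unit_ball by blast
  have y: "(\<lambda>i. if i = j then 1 else 0) \<in> topspace (Euclidean_space n)"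
    using j by (auto simp: topspace_Euclidean_space)
  obtain e where "e > 0" "(\<lambda>i. f (\<lambda>i. 0) i + e * (if i = j then 1 else 0)) \<in> ?U"
    using openin_Euclidean_space_line[OF op x y] by blast
  then obtain z where z: "z \<in> open_unit_ball n" "(\<lambda>i. f (\<lambda>i. 0) i + e * (if i = j then 1 else 0)) = f z"
    by blast
  then have "f z j = f (\<lambda>i. 0) j + e"
    using fun_cong[OF z(2), of j] by simp
  with z(1) show False using j(2)[of z] j(2)[OF zero_in_open_unit_ball] \<open>e > 0\<close> by simp
qed

text \<open>If \<open>m < n\<close>, the target is a part of the hyperplane of vanishing coordinate
  \<open>m\<close> in dimension \<open>n\<close>.\<close>

lemma unit_ball_embedding_dim_le:
  assumes f: "continuous_map (unit_ball n) (Euclidean_space m) f" "inj_on f (topspace (unit_ball n))"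
  shows "n \<le> m"
proof (rule ccontr)
  assume "\<not> n \<le> m"
  then have m: "m < n" by simp
  have "continuous_map (Euclidean_space m) (Euclidean_space n) id"
    using m by (auto simp: Euclidean_space_def continuous_map_in_subtopology intro: continuous_map_from_subtopology)
  then have "continuous_map (unit_ball n) (Euclidean_space n) (id \<circ> f)"
    using f(1) continuous_map_compose by blast
  then have c: "continuous_map (subtopology (Euclidean_space n) (open_unit_ball n)) (Euclidean_space n) f"
    unfolding unit_ball_def
    by (auto simp: id_comp open_unit_ball_def elim!: continuous_map_from_subtopology_mono)
  show False
  proof (rule open_unit_ball_not_into_hyperplane[OF c _ m])
    show "inj_on f (open_unit_ball n)"
      using f(2) open_unit_ball_subset inj_on_subset by blast
    show "f x m = 0" if "x \<in> open_unit_ball n" for x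
    proof -
      have "f x \<in> topspace (Euclidean_space m)"
        using that f(1) open_unit_ball_subset by (auto simp: continuous_map_def)
      then show ?thesis by (simp add: topspace_Euclidean_space)
    qed
  qed
qed

lemma continuous_map_unit_ball_Euclidean: "continuous_map X (unit_ball n) f \<Longrightarrow> continuous_map X (Euclidean_space n) f"
  by (simp add: unit_ball_def continuous_map_in_subtopology)

lemma homeomorphic_unit_balls_dim:
  assumes "homeomorphic_map (unit_ball n) (unit_ball m) g"
  shows "n = m"
proof -
  obtain g' where "homeomorphic_maps (unit_ball n) (unit_ball m) g g'"
    using assms homeomorphic_map_maps by blast
  then have g': "homeomorphic_map (unit_ball m) (unit_ball n) g'"
    using homeomorphic_maps_map by blast
  have "n \<le> m"
    by (rule unit_ball_embedding_dim_le[OF continuous_map_unit_ball_Euclidean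
          [OF homeomorphic_imp_continuous_map[OF assms]] homeomorphic_imp_injective_map[OF assms]])
  moreover have "m \<le> n"
    by (rule unit_ball_embedding_dim_le[OF continuous_map_unit_ball_Euclidean
          [OF homeomorphic_imp_continuous_map[OF g']] homeomorphic_imp_injective_map[OF g']])
  ultimately show ?thesis by simp
qed

text \<open>By invariance of domain the image of the open ball is open in Euclidean space, hence
  misses the sphere; the same holds for the inverse map. This makes the boundary of a cell a
  topological notion.\<close>

lemma homeomorphic_unit_ball_sphere:
  assumes g: "homeomorphic_map (unit_ball n) (unit_ball m) g"
  shows "g ` unit_sphere_of_ball n = unit_sphere_of_ball m"
proof -
  have nm: "m = n" using homeomorphic_unit_balls_dim[OF g] by simp
  have *: "h ` open_unit_ball n \<subseteq> open_unit_ball n" if h: "homeomorphic_map (unit_ball n) (unit_ball n) h" for h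
  proof (rule open_subset_of_unit_ball)
    have "continuous_map (unit_ball n) (Euclidean_space n) h"
      by (rule continuous_map_unit_ball_Euclidean[OF homeomorphic_imp_continuous_map[OF h]])
    then have "continuous_map (subtopology (Euclidean_space n) (open_unit_ball n)) (Euclidean_space n) h"
      unfolding unit_ball_def
      by (auto simp: open_unit_ball_def elim!: continuous_map_from_subtopology_mono)
    moreover have "inj_on h (open_unit_ball n)"
      using inj_on_subset[OF homeomorphic_imp_injective_map[OF h] open_unit_ball_subset] .
    ultimately show "openin (Euclidean_space n) (h ` open_unit_ball n)"
      by (rule invariance_of_domain_Euclidean_space[OF openin_open_unit_ball])
    show "h ` open_unit_ball n \<subseteq> topspace (unit_ball n)"
      using homeomorphic_imp_surjective_map[OF h] open_unit_ball_subset by blast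
  qed
  obtain g' where gg': "homeomorphic_maps (unit_ball n) (unit_ball n) g g'"
    using g nm homeomorphic_map_maps by blast
  then have "homeomorphic_map (unit_ball n) (unit_ball n) g'"
    using homeomorphic_maps_map by blast
  from *[OF this] *[of g] g nm have 1: "g ` open_unit_ball n \<subseteq> open_unit_ball n" "g' ` open_unit_ball n \<subseteq> open_unit_ball n"
    by auto
  have 2: "\<And>x. x \<in> topspace (unit_ball n) \<Longrightarrow> g x \<in> topspace (unit_ball n) \<and> g' (g x) = x"
       "\<And>x. x \<in> topspace (unit_ball n) \<Longrightarrow> g' x \<in> topspace (unit_ball n) \<and> g (g' x) = x"
    using gg' by (auto simp: homeomorphic_maps_def continuous_map_def)
  have "unit_sphere_of_ball n = topspace (unit_ball n) - open_unit_ball n"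
    by (auto simp: unit_ball_minus_sphere[symmetric] unit_sphere_of_ball_def)
  moreover have "g ` (topspace (unit_ball n) - open_unit_ball n) = topspace (unit_ball n) - open_unit_ball n"
  proof safe
    fix x assume x: "x \<in> topspace (unit_ball n)" "x \<notin> open_unit_ball n"
    show "g x \<in> topspace (unit_ball n)" using 2 x by auto
    show False if "g x \<in> open_unit_ball n"
      using that 1(2) 2(1)[of x] x by (metis image_subset_iff)
    show "x \<in> g ` (topspace (unit_ball n) - open_unit_ball n)"
    proof (rule image_eqI[of _ _ "g' x"])
      show "g' x \<in> topspace (unit_ball n) - open_unit_ball n"
        using 1(1) 2(2)[of x] x by (metis Diff_iff image_subset_iff)
    qed (use 2 x in auto)
  qed
  ultimately show ?thesis using nm by simp
qed

text \<open>A round ball inside \<open>'a\<close> in the span of the first \<open>n\<close> vectors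
  of an enumerated basis. It connects \<open>unit_ball\<close>, whose points are real sequences,
  with convex geometry in \<open>'a\<close>.\<close>

definition coord_ball :: "(nat \<Rightarrow> 'a) \<Rightarrow> nat \<Rightarrow> 'a::euclidean_space set" where
  "coord_ball b n = cball 0 1 \<inter> span (b ` {..<n})"

definition coord_map :: "(nat \<Rightarrow> 'a) \<Rightarrow> nat \<Rightarrow> 'a::euclidean_space \<Rightarrow> nat \<Rightarrow> real" where
  "coord_map b n y = (\<lambda>i. if i < n then y \<bullet> b i else 0)"

text \<open>Orthonormality turns the squared norm into the sum of squared coordinates, so the
  coordinate map is a continuous bijection of balls preserving spheres; compactness makes it a
  homeomorphism.\<close>

lemma coord_ball_homeomorphism:
  fixes b :: "nat \<Rightarrow> 'a::euclidean_space"
  assumes b: "bij_betw b {..<DIM('a)} Basis" and n: "n \<le> DIM('a)"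
  shows "homeomorphic_map (top_of_set (coord_ball b n)) (unit_ball n) (coord_map b n)"
    and "coord_map b n ` {y \<in> coord_ball b n. norm y = 1} = unit_sphere_of_ball n"
    and "aff_dim (coord_ball b n) = n" and "compact (coord_ball b n)" and "convex (coord_ball b n)"
    and "rel_frontier (coord_ball b n) = {y \<in> coord_ball b n. norm y = 1}"
proof -
  let ?c = "coord_map b n"
  note c = coord_map_def
  define S where "S = span (b ` {..<n})"
  have inj: "inj_on b {..<n}" and sub: "b ` {..<n} \<subseteq> Basis"
    using b n by (auto simp: bij_betw_def inj_on_def)
  have bb: "b i \<bullet> b j = (if i = j then 1 else 0)" if "i < n" "j < n" for i j
  proof -
    have "b i \<in> Basis" "b j \<in> Basis" "b i = b j \<longleftrightarrow> i = j"
      using that sub inj by (auto simp: inj_on_def)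
    then show ?thesis by (simp add: inner_Basis)
  qed
  have rep: "y = (\<Sum>i<n. (y \<bullet> b i) *\<^sub>R b i)" if y: "y \<in> S" for y
  proof -
    have "\<exists>u. y = (\<Sum>v\<in>b ` {..<n}. u v *\<^sub>R v)"
      using y unfolding S_def by (subst (asm) span_finite) auto
    then obtain u where "y = (\<Sum>v\<in>b ` {..<n}. u v *\<^sub>R v)" ..
    then have u: "y = (\<Sum>i<n. u (b i) *\<^sub>R b i)"
      using inj by (simp add: sum.reindex)
    have "y \<bullet> b j = u (b j)" if "j < n" for j
    proof -
      have "y \<bullet> b j = (\<Sum>i<n. u (b i) * (b i \<bullet> b j))"
        by (simp add: u inner_sum_left)
      also have "\<dots> = (\<Sum>i<n. if i = j then u (b i) else 0)"
        using that by (intro sum.cong) (auto simp: bb)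
      finally show ?thesis using that by simp
    qed
    then show ?thesis by (subst u) (auto intro!: sum.cong)
  qed
  have nrm: "(norm y)\<^sup>2 = (\<Sum>i<n. (?c y i)\<^sup>2)" if y: "y \<in> S" for y
  proof -
    have "(norm y)\<^sup>2 = y \<bullet> y" by (simp add: power2_norm_eq_inner)
    also have "\<dots> = y \<bullet> (\<Sum>i<n. (y \<bullet> b i) *\<^sub>R b i)" using rep[OF y] by simp
    also have "\<dots> = (\<Sum>i<n. (?c y i)\<^sup>2)"
      by (simp add: inner_sum_right power2_eq_square c)
    finally show ?thesis .
  qed
  have injS: "inj_on ?c S"
  proof (rule inj_onI)
    fix x y assume xy: "x \<in> S" "y \<in> S" "?c x = ?c y"
    have "x \<bullet> b i = y \<bullet> b i" if "i < n" for i
      using fun_cong[OF xy(3), of i] that by (simp add: c)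
    then show "x = y" by (subst rep[OF xy(1)], subst rep[OF xy(2)]) simp
  qed
  have sur: "\<exists>y\<in>S. x = ?c y" if "x \<in> topspace (Euclidean_space n)" for x
  proof -
    define y where "y = (\<Sum>i<n. x i *\<^sub>R b i)"
    have "y \<in> S" unfolding y_def S_def by (intro span_sum span_scale span_base) auto
    moreover have "y \<bullet> b j = x j" if "j < n" for j
    proof -
      have "y \<bullet> b j = (\<Sum>i<n. x i * (b i \<bullet> b j))"
        by (simp add: y_def inner_sum_left)
      also have "\<dots> = (\<Sum>i<n. if i = j then x i else 0)"
        using that by (intro sum.cong) (auto simp: bb)
      finally show ?thesis using that by simp
    qed
    ultimately show ?thesis
      using that by (intro bexI[of _ y]) (auto simp: topspace_Euclidean_space fun_eq_iff c)
  qed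
  have D: "coord_ball b n = {y \<in> S. norm y \<le> 1}"
    by (auto simp: coord_ball_def S_def)
  have nle: "norm y \<le> 1 \<longleftrightarrow> (\<Sum>i<n. (?c y i)\<^sup>2) \<le> 1" "norm y = 1 \<longleftrightarrow> (\<Sum>i<n. (?c y i)\<^sup>2) = 1" if "y \<in> S" for y
    by (simp_all add: nrm[OF that, symmetric] abs_square_le_1 abs_square_eq_1)
  have tE: "?c y \<in> topspace (Euclidean_space n)" for y by (simp add: topspace_Euclidean_space c)
  have im: "?c ` coord_ball b n = topspace (unit_ball n)"
  proof (intro subset_antisym subsetI)
    fix x assume x: "x \<in> topspace (unit_ball n)"
    then obtain y where "y \<in> S" "x = ?c y" using sur by (auto simp: topspace_unit_ball)
    then show "x \<in> ?c ` coord_ball b n" using x nle(1)[of y] by (auto simp: D topspace_unit_ball)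
  qed (use nle tE in \<open>auto simp: D topspace_unit_ball\<close>)
  show im2: "?c ` {y \<in> coord_ball b n. norm y = 1} = unit_sphere_of_ball n"
  proof (intro subset_antisym subsetI)
    fix x assume x: "x \<in> unit_sphere_of_ball n"
    then obtain y where "y \<in> S" "x = ?c y" using sur by (auto simp: topspace_unit_ball unit_sphere_of_ball_def)
    then show "x \<in> ?c ` {y \<in> coord_ball b n. norm y = 1}"
      using x nle(2)[of y] by (auto simp: D topspace_unit_ball unit_sphere_of_ball_def)
  qed (use nle tE in \<open>auto simp: D topspace_unit_ball unit_sphere_of_ball_def\<close>)
  have A: "subspace S" "affine S" "closed S"
    by (auto simp: S_def subspace_imp_affine closed_subspace)
  show cm: "compact (coord_ball b n)" "convex (coord_ball b n)"
    unfolding coord_ball_def S_def[symmetric]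
    using A by (auto intro: compact_Int_closed convex_Int subspace_imp_convex)
  have 0: "0 \<in> interior (cball 0 1) \<inter> S"
    using A subspace_0 by (auto simp: interior_cball)
  have "affine hull (S \<inter> cball 0 1) = affine hull S"
  proof (rule affine_hull_convex_Int_nonempty_interior)
    show "convex S" by (rule subspace_imp_convex[OF A(1)])
    show "S \<inter> interior (cball 0 1) \<noteq> {}" using 0 by blast
  qed
  then have hD: "affine hull (coord_ball b n) = S"
    using A(2) unfolding coord_ball_def S_def[symmetric] by (simp add: Int_commute)
  have "aff_dim (coord_ball b n) = aff_dim S"
    using hD aff_dim_affine_hull by metis
  also have "\<dots> = int (dim S)" using A by (simp add: aff_dim_subspace)
  also have "dim S = card (b ` {..<n})"
    unfolding S_def by (rule dim_span_eq_card_independent[OF independent_mono[OF independent_Basis sub]])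
  finally show "aff_dim (coord_ball b n) = n" using inj by (simp add: card_image)
  have "rel_frontier (cball 0 1 \<inter> S) = frontier (cball 0 1) \<inter> S"
    using 0 by (intro convex_affine_rel_frontier_Int[OF convex_cball A(2)]) blast
  then show "rel_frontier (coord_ball b n) = {y \<in> coord_ball b n. norm y = 1}"
    by (auto simp: coord_ball_def S_def)
  show "homeomorphic_map (top_of_set (coord_ball b n)) (unit_ball n) ?c"
  proof (rule continuous_imp_homeomorphic_map)
    show "compact_space (top_of_set (coord_ball b n))"
      using cm by (simp add: compact_space_subtopology)
    show "Hausdorff_space (unit_ball n)"
      by (simp add: unit_ball_def Hausdorff_space_subtopology Hausdorff_Euclidean_space)
    show "continuous_map (top_of_set (coord_ball b n)) (unit_ball n) ?c"
      unfolding unit_ball_def continuous_map_in_subtopology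
    proof
      show "continuous_map (top_of_set (coord_ball b n)) (Euclidean_space n) ?c"
        unfolding c continuous_map_componentwise_Euclidean_space by (auto intro!: continuous_intros)
    qed (use nle in \<open>auto simp: D\<close>)
    show "?c ` topspace (top_of_set (coord_ball b n)) = topspace (unit_ball n)" using im by simp
    show "inj_on ?c (topspace (top_of_set (coord_ball b n)))"
      using injS by (auto simp: D inj_on_def)
  qed
qed

text \<open>The relative interior is dense in a convex set and open in its affine hull. This turns
  open sets of the chart domain into sets to which invariance of domain applies.\<close>

lemma closure_Int_openin_convex_rel_interior:
  fixes D :: "'a::euclidean_space set"
  assumes "convex D" "openin (top_of_set D) U" "U \<noteq> {}"
  shows "U \<inter> rel_interior D \<noteq> {}" "openin (top_of_set (affine hull D)) (U \<inter> rel_interior D)"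
proof -
  obtain O' where O': "open O'" "U = D \<inter> O'"
    using assms(2) openin_open by blast
  then have "O' \<inter> closure D \<noteq> {}"
    using assms(3) closure_subset by fastforce
  then have "O' \<inter> closure (rel_interior D) \<noteq> {}"
    using convex_closure_rel_interior[OF assms(1)] by simp
  then have "O' \<inter> rel_interior D \<noteq> {}"
    using O'(1) open_Int_closure_eq_empty by blast
  then show "U \<inter> rel_interior D \<noteq> {}"
    using O'(2) rel_interior_subset[of D] by blast
  have "U \<inter> rel_interior D = rel_interior D \<inter> O'"
    using O'(2) rel_interior_subset[of D] by blast
  moreover have "openin (top_of_set (affine hull D)) (rel_interior D \<inter> O')"
    by (rule openin_Int_open[OF openin_rel_interior O'(1)])
  ultimately show "openin (top_of_set (affine hull D)) (U \<inter> rel_interior D)" by (simp only:)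
qed

text \<open>Invariance of domain between affine hulls; the dimension hypothesis is what allows
  it.\<close>

lemma homeomorphism_image_rel_interior:
  fixes f :: "'a::euclidean_space \<Rightarrow> 'b::euclidean_space"
  assumes "continuous_on S f" "inj_on f S" "f ` S \<subseteq> T" "aff_dim T \<le> aff_dim S"
  shows "f ` rel_interior S \<subseteq> rel_interior T"
    and "openin (top_of_set (affine hull T)) (f ` rel_interior S)"
proof -
  show "openin (top_of_set (affine hull T)) (f ` rel_interior S)"
  proof (rule Further_Topology.invariance_of_domain_affine_sets[OF openin_rel_interior])
    show "continuous_on (rel_interior S) f" "inj_on f (rel_interior S)"
      using continuous_on_subset[OF assms(1) rel_interior_subset] inj_on_subset[OF assms(2) rel_interior_subset] by auto
    show "f \<in> rel_interior S \<rightarrow> affine hull T"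
      using assms(3) rel_interior_subset[of S] hull_subset[of T affine] by blast
  qed (use assms in \<open>auto simp: aff_dim_affine_hull\<close>)
  then show "f ` rel_interior S \<subseteq> rel_interior T"
    using assms(3) rel_interior_subset[of S] by (intro rel_interior_maximal) auto
qed

text \<open>Compact convex sets of equal dimension are homeomorphic, and by invariance of domain
  such a homeomorphism preserves relative interiors. Hence the frontier corresponds to the
  sphere.\<close>

lemma convex_compact_unit_ball:
  fixes K :: "'a::euclidean_space set"
  assumes K: "compact K" "convex K" "aff_dim K = int n"
  obtains h where "homeomorphic_map (unit_ball n) (top_of_set K) h" "h ` unit_sphere_of_ball n = rel_frontier K"
proof -
  have n: "n \<le> DIM('a)"
    using aff_dim_le_DIM[of K] K by simp
  obtain b where b: "bij_betw b {..<DIM('a)} (Basis :: 'a set)"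
    using ex_bij_betw_nat_finite[of "Basis :: 'a set"] by (auto simp: atLeast0LessThan)
  let ?D = "coord_ball b n"
  note D = coord_ball_homeomorphism[OF b n]
  obtain c' where c': "homeomorphic_maps (top_of_set ?D) (unit_ball n) (coord_map b n) c'"
    using D(1) homeomorphic_map_maps by blast
  then have c'h: "homeomorphic_map (unit_ball n) (top_of_set ?D) c'"
    using homeomorphic_maps_map by blast
  have "?D homeomorphic K"
    using D K by (intro homeomorphic_convex_compact_sets) auto
  then obtain f g where fg: "homeomorphism ?D K f g" by (auto simp: homeomorphic_def)
  then have fm: "homeomorphic_maps (top_of_set ?D) (top_of_set K) f g"
    by (auto simp: homeomorphic_maps_def homeomorphism_def)
  have f: "homeomorphic_map (top_of_set ?D) (top_of_set K) f"
    using homeomorphic_map_maps fm by blast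
  have fr: "f ` rel_interior ?D = rel_interior K"
  proof
    show "f ` rel_interior ?D \<subseteq> rel_interior K"
      using fg D K by (intro homeomorphism_image_rel_interior(1))
        (auto simp: homeomorphism_def intro: inj_on_inverseI)
    have "g ` rel_interior K \<subseteq> rel_interior ?D"
      using fg D K by (intro homeomorphism_image_rel_interior(1))
        (auto simp: homeomorphism_def intro: inj_on_inverseI)
    then show "rel_interior K \<subseteq> f ` rel_interior ?D"
      using fg rel_interior_subset[of K] unfolding homeomorphism_def by force
  qed
  have cl: "closure ?D = ?D" "closure K = K"
    using D K by (auto simp: compact_imp_closed)
  have inj: "inj_on f ?D"
    using fg by (auto simp: homeomorphism_def intro: inj_on_inverseI)
  have "f ` (?D - rel_interior ?D) = f ` ?D - f ` rel_interior ?D"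
    using rel_interior_subset[of ?D] by (intro inj_on_image_set_diff[OF inj]) auto
  then have ff: "f ` rel_frontier ?D = rel_frontier K"
    using fr fg by (simp add: rel_frontier_def cl homeomorphism_def)
  have "c' (coord_map b n y) = y" if "y \<in> ?D" for y
    using c' that by (auto simp: homeomorphic_maps_def)
  then have "c' ` coord_map b n ` {y \<in> ?D. norm y = 1} = {y \<in> ?D. norm y = 1}"
    by (force simp: image_image)
  then have cs: "c' ` unit_sphere_of_ball n = rel_frontier ?D"
    using D(2,6) by simp
  show thesis
  proof (rule that)
    show "homeomorphic_map (unit_ball n) (top_of_set K) (f \<circ> c')"
      using c'h f homeomorphic_map_compose by blast
    show "(f \<circ> c') ` unit_sphere_of_ball n = rel_frontier K"
      using cs ff by (metis image_comp)
  qed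
qed

text \<open>The model of the ball is chosen convex and in the same space \<open>'a\<close>, so that
  the affine versions of invariance of domain apply. That \<open>'a\<close> has room for it follows
  because the ball embeds in \<open>'a\<close>.\<close>

lemma simplicial_ball_homeomorphism:
  fixes B :: "'a::euclidean_space set set"
  assumes "simplicial_ball d B"
  obtains D :: "'a set" and \<phi> \<psi> where "compact D" "convex D" "aff_dim D = int d" "homeomorphism (\<Union>B) D \<phi> \<psi>"
proof -
  obtain b where b: "bij_betw b {..<DIM('a)} (Basis :: 'a set)"
    using ex_bij_betw_nat_finite[of "Basis :: 'a set"] by (auto simp: atLeast0LessThan)
  obtain k k' where k: "homeomorphic_maps (top_of_set (\<Union>B)) (unit_ball d) k k'"
    using assms by (auto simp: simplicial_ball_def homeomorphic_space_def)
  then have k': "homeomorphic_map (unit_ball d) (top_of_set (\<Union>B)) k'"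
    using homeomorphic_maps_map by blast
  have bb: "inj_on b {..<DIM('a)}" "b ` {..<DIM('a)} = Basis" using b by (auto simp: bij_betw_def)
  have d: "d \<le> DIM('a)"
  proof (rule unit_ball_embedding_dim_le)
    have "continuous_map euclidean (Euclidean_space DIM('a)) (coord_map b DIM('a))"
      unfolding coord_map_def continuous_map_componentwise_Euclidean_space by (auto intro!: continuous_intros)
    moreover have "continuous_map (unit_ball d) euclidean k'"
      using k' homeomorphic_imp_continuous_map continuous_map_in_subtopology by blast
    ultimately show "continuous_map (unit_ball d) (Euclidean_space DIM('a)) (coord_map b DIM('a) \<circ> k')"
      by (rule continuous_map_compose[rotated])
    have "inj (coord_map b DIM('a))"
    proof (rule injI)
      fix x y assume "coord_map b DIM('a) x = coord_map b DIM('a) y"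
      then have "x \<bullet> b i = y \<bullet> b i" if "i < DIM('a)" for i
        using that by (auto simp: coord_map_def dest: fun_cong[of _ _ i])
      then have "x \<bullet> v = y \<bullet> v" if "v \<in> Basis" for v
        using that bb(2) by (metis imageE lessThan_iff)
      then show "x = y" by (rule euclidean_eqI)
    qed
    then show "inj_on (coord_map b DIM('a) \<circ> k') (topspace (unit_ball d))"
      using homeomorphic_imp_injective_map[OF k'] by (intro comp_inj_on) (auto intro: inj_on_subset)
  qed
  note D = coord_ball_homeomorphism[OF b d]
  have "top_of_set (\<Union>B) homeomorphic_space unit_ball d"
    using assms by (simp add: simplicial_ball_def)
  also have "unit_ball d homeomorphic_space top_of_set (coord_ball b d)"
    using D(1) homeomorphic_map_imp_homeomorphic_space homeomorphic_space_sym by blast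
  finally have "(\<Union>B) homeomorphic (coord_ball b d)"
    by (simp add: homeomorphic_space_def homeomorphic_def)
  then show thesis
    using that D(3,4,5) by (auto simp: homeomorphic_def)
qed

section \<open>Combinatorics of a finite simplicial complex: carriers, vertices, intermediate
  faces\<close>

locale finite_complex =
  fixes B :: "'a::euclidean_space set set"
  assumes scB: "simplicial_complex B"
begin

lemma finB: "finite B"
  using scB by (simp add: simplicial_complex_def)

lemma face_in: "F \<in> B \<Longrightarrow> G face_of F \<Longrightarrow> G \<in> B"
  using scB by (auto simp: simplicial_complex_def)

lemma Int_face: "F \<in> B \<Longrightarrow> G \<in> B \<Longrightarrow> (F \<inter> G) face_of F"
  using scB by (auto simp: simplicial_complex_def)

lemma Int_in: "F \<in> B \<Longrightarrow> G \<in> B \<Longrightarrow> F \<inter> G \<in> B"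
  using Int_face face_in by blast

lemma face_iff_subset: "F \<in> B \<Longrightarrow> G \<in> B \<Longrightarrow> F face_of G \<longleftrightarrow> F \<subseteq> G"
  using Int_face[of G F] by (metis face_of_imp_subset inf.absorb2)

lemma is_simplex: "F \<in> B \<Longrightarrow> \<exists>n. n simplex F"
  using scB by (auto simp: simplicial_complex_def)

lemma polytopeB: "F \<in> B \<Longrightarrow> polytope F"
  using is_simplex simplex_imp_polytope by blast

lemma compactB: "F \<in> B \<Longrightarrow> compact F" and convexB: "F \<in> B \<Longrightarrow> convex F"
  and closedB: "F \<in> B \<Longrightarrow> closed F"
  using polytopeB polytope_imp_compact polytope_imp_convex polytope_imp_closed by blast+

lemma dim_less: "F \<in> B \<Longrightarrow> G \<in> B \<Longrightarrow> F \<subset> G \<Longrightarrow> aff_dim F < aff_dim G"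
  using face_of_aff_dim_lt[OF convexB, of G F] face_iff_subset by auto

lemma eq_if_dim: "F \<in> B \<Longrightarrow> G \<in> B \<Longrightarrow> F \<subseteq> G \<Longrightarrow> aff_dim F = aff_dim G \<Longrightarrow> F = G"
  using dim_less by fastforce

text \<open>\<open>F \<inter> G\<close> is a face of \<open>F\<close> that meets the relative
  interior of \<open>F\<close>, hence is all of \<open>F\<close>.\<close>

lemma carrier_subset:
  assumes "F \<in> B" "G \<in> B" "x \<in> rel_interior F" "x \<in> G"
  shows "F \<subseteq> G"
proof -
  have "F \<subseteq> F \<inter> G"
    using subset_of_face_of[OF Int_face[OF assms(1,2)], of F] assms rel_interior_subset[of F] by blast
  then show ?thesis by blast
qed

lemma carrier_unique:
  assumes "F \<in> B" "G \<in> B" "x \<in> rel_interior F" "x \<in> rel_interior G"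
  shows "F = G"
  using assms carrier_subset[of F G x] carrier_subset[of G F x] rel_interior_subset[of F] rel_interior_subset[of G] by blast

lemma carrier_exists:
  assumes "x \<in> S" "S \<in> B"
  obtains F where "F \<in> B" "F \<subseteq> S" "x \<in> rel_interior F"
proof -
  let ?A = "{F \<in> B. x \<in> F \<and> F \<subseteq> S}"
  have "finite ?A" "S \<in> ?A" using finB assms by auto
  then obtain F where F: "F \<in> ?A" "\<And>G. G \<in> ?A \<Longrightarrow> G \<subseteq> F \<Longrightarrow> F = G"
    by (metis (no_types, lifting) finite_has_minimal2)
  have "x \<in> rel_interior F"
  proof (rule ccontr)
    assume "x \<notin> rel_interior F"
    then have "x \<in> rel_frontier F"
      using F closedB by (auto simp: rel_frontier_def)
    then obtain G where G: "G face_of F" "G \<noteq> F" "x \<in> G"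
      using rel_frontier_of_polyhedron_alt[of F] F polytopeB polytope_imp_polyhedron by blast
    then have "G \<in> ?A" "G \<subseteq> F" using F face_in face_of_imp_subset by blast+
    with F(2) G(2) show False by blast
  qed
  with F that show thesis by auto
qed

lemma rel_interior_nonempty: "F \<in> B \<Longrightarrow> F \<noteq> {} \<Longrightarrow> rel_interior F \<noteq> {}"
  using convexB rel_interior_eq_empty by blast

lemma rel_interior_subset_facets: "F \<in> B \<Longrightarrow> x \<in> rel_interior F \<Longrightarrow> G \<in> B \<Longrightarrow> x \<in> G \<longleftrightarrow> F \<subseteq> G"
  using carrier_subset[of F G x] rel_interior_subset[of F] by blast

definition verts :: "'a set \<Rightarrow> 'a set" where
  "verts F = {v. v extreme_point_of F}"

lemma verts_hull:
  assumes "\<not> affine_dependent C" shows "verts (convex hull C) = C"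
  using extreme_point_of_convex_hull_affine_independent[OF assms] by (auto simp: verts_def)

lemma simplex_verts:
  assumes "F \<in> B"
  shows "finite (verts F)" "\<not> affine_dependent (verts F)" "F = convex hull (verts F)"
    "int (card (verts F)) = aff_dim F + 1"
proof -
  obtain n C where C: "finite C" "\<not> affine_dependent C" "int (card C) = n + 1" "F = convex hull C" "n simplex F"
    using is_simplex[OF assms] simplex by metis
  then have "verts F = C" using verts_hull by blast
  then show "finite (verts F)" "\<not> affine_dependent (verts F)" "F = convex hull (verts F)"
    "int (card (verts F)) = aff_dim F + 1"
    using C aff_dim_simplex by auto
qed

lemma subset_verts:
  assumes "F \<in> B" "W \<subseteq> verts F"
  shows "convex hull W \<in> B" "verts (convex hull W) = W" "convex hull W \<subseteq> F"
proof -
  have "convex hull W face_of convex hull (verts F)"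
    using face_of_convex_hull_affine_independent[OF simplex_verts(2)[OF assms(1)]] assms(2) by blast
  then have f: "convex hull W face_of F" using simplex_verts(3)[OF assms(1)] by simp
  then show "convex hull W \<in> B" using face_in assms by blast
  show "convex hull W \<subseteq> F" using f face_of_imp_subset by blast
  have "\<not> affine_dependent W"
    using assms simplex_verts(2) affine_independent_subset by blast
  then show "verts (convex hull W) = W" by (rule verts_hull)
qed

lemma verts_mono_iff:
  assumes "F \<in> B" "G \<in> B" shows "F \<subseteq> G \<longleftrightarrow> verts F \<subseteq> verts G"
proof
  assume "F \<subseteq> G"
  then have "F face_of G" using face_iff_subset assms by blast
  then have "F face_of convex hull (verts G)" using simplex_verts(3)[OF assms(2)] by simp
  then obtain c where "c \<subseteq> verts G" "F = convex hull c"
    using face_of_convex_hull_affine_independent[OF simplex_verts(2)[OF assms(2)]] by blast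
  then show "verts F \<subseteq> verts G" using subset_verts(2)[OF assms(2)] by auto
next
  assume "verts F \<subseteq> verts G"
  then show "F \<subseteq> G" using simplex_verts(3)[OF assms(1)] subset_verts(3)[OF assms(2)] by auto
qed

lemma verts_inj: "inj_on verts B"
  using verts_mono_iff by (intro inj_onI) blast

text \<open>\<open>G\<close> has exactly two vertices outside \<open>F\<close>, and an intermediate
  face adds one of them. This is the source of all parity counts around (d-2)-faces.\<close>

lemma codim_one_between:
  assumes "F \<in> B" "G \<in> B" "F \<subseteq> G" "aff_dim F + 2 = aff_dim G"
  shows "card {H \<in> B. F \<subseteq> H \<and> H \<subseteq> G \<and> aff_dim H = aff_dim F + 1} = 2"
proof -
  have sub: "verts F \<subseteq> verts G" using assms verts_mono_iff by blast
  have "int (card (verts G)) = int (card (verts F)) + 2"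
    using assms simplex_verts(4) by simp
  then have "card (verts G - verts F) = 2"
    using sub simplex_verts(1) assms by (simp add: card_Diff_subset)
  moreover have "bij_betw (\<lambda>v. convex hull (insert v (verts F))) (verts G - verts F)
      {H \<in> B. F \<subseteq> H \<and> H \<subseteq> G \<and> aff_dim H = aff_dim F + 1}"
  proof (rule bij_betw_imageI)
    have V: "verts (convex hull (insert v (verts F))) = insert v (verts F)" "convex hull (insert v (verts F)) \<in> B"
      if "v \<in> verts G" for v
      using subset_verts[OF assms(2)] that sub by auto
    show "inj_on (\<lambda>v. convex hull (insert v (verts F))) (verts G - verts F)"
      using V(1) by (intro inj_onI) (metis DiffE insertE insertI1)
    show "(\<lambda>v. convex hull (insert v (verts F))) ` (verts G - verts F) =
      {H \<in> B. F \<subseteq> H \<and> H \<subseteq> G \<and> aff_dim H = aff_dim F + 1}"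
    proof safe
      fix v assume v: "v \<in> verts G" "v \<notin> verts F"
      let ?H = "convex hull (insert v (verts F))"
      show H: "?H \<in> B" using V v by blast
      show "x \<in> ?H" if "x \<in> F" for x
      proof -
        have "F \<subseteq> ?H" using verts_mono_iff[OF assms(1) H] V(1)[OF v(1)] by auto
        then show ?thesis using that by blast
      qed
      show "x \<in> G" if "x \<in> ?H" for x
      proof -
        have "?H \<subseteq> G" using verts_mono_iff[OF H assms(2)] V(1)[OF v(1)] v sub by simp
        then show ?thesis using that by blast
      qed
      show "aff_dim ?H = aff_dim F + 1"
        using simplex_verts(4)[OF H] simplex_verts(4)[OF assms(1)] V(1)[OF v(1)] v simplex_verts(1)[OF assms(1)] by simp
    next
      fix H assume H: "H \<in> B" "F \<subseteq> H" "H \<subseteq> G" "aff_dim H = aff_dim F + 1"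
      have s: "verts F \<subseteq> verts H" "verts H \<subseteq> verts G" using H assms verts_mono_iff by auto
      have "card (verts H) = Suc (card (verts F))"
        using H simplex_verts(4)[OF H(1)] simplex_verts(4)[OF assms(1)] by simp
      then have "card (verts H - verts F) = 1"
        using s simplex_verts(1) assms by (simp add: card_Diff_subset)
      then obtain v where v: "verts H - verts F = {v}" using card_1_singletonE by blast
      then have "verts H = insert v (verts F)" using s by blast
      then have "H = convex hull (insert v (verts F))" using simplex_verts(3)[OF H(1)] by simp
      then show "H \<in> (\<lambda>v. convex hull (insert v (verts F))) ` (verts G - verts F)"
        using v s by blast
    qed
  qed
  ultimately show ?thesis using bij_betw_same_card by fastforce
qed

text \<open>A face of the right dimension is spanned by any vertex set of the right size between
  those of \<open>F\<close> and \<open>G\<close>.\<close>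

lemma intermediate_face:
  assumes "F \<in> B" "G \<in> B" "F \<subseteq> G" "aff_dim F \<le> k" "k \<le> aff_dim G"
  obtains H where "H \<in> B" "F \<subseteq> H" "H \<subseteq> G" "aff_dim H = k"
proof -
  have sub: "verts F \<subseteq> verts G" using assms verts_mono_iff by blast
  have "card (verts F) \<le> nat (k + 1)" "nat (k + 1) \<le> card (verts G)"
    using assms(4,5) simplex_verts(4)[OF assms(1)] simplex_verts(4)[OF assms(2)] by linarith+
  then obtain W where W: "verts F \<subseteq> W" "W \<subseteq> verts G" "card W = nat (k+1)"
    using exists_subset_between[OF _ _ sub simplex_verts(1)[OF assms(2)]] by blast
  note V = subset_verts[OF assms(2) W(2)]
  show thesis
  proof (rule that[OF V(1) _ V(3)])
    show "F \<subseteq> convex hull W" using verts_mono_iff[OF assms(1) V(1)] V(2) W(1) by simp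
    show "aff_dim (convex hull W) = k"
      using simplex_verts(4)[OF V(1)] V(2) W(3) assms(4) simplex_verts(4)[OF assms(1)] by simp
  qed
qed

lemma empty_dim: "F \<in> B \<Longrightarrow> aff_dim F \<ge> 0 \<longleftrightarrow> F \<noteq> {}"
  using aff_dim_geq[of F] aff_dim_empty[of F] by force

end

lemma openin_meets_closure:
  assumes "openin (top_of_set X) U" "x \<in> U" "x \<in> closure R" "R \<subseteq> X"
  shows "U \<inter> R \<noteq> {}"
proof -
  obtain O' where "open O'" "U = X \<inter> O'" using assms(1) openin_open by blast
  then have "O' \<inter> R \<noteq> {}"
    using assms open_Int_closure_eq_empty[of O' R] by blast
  with \<open>U = X \<inter> O'\<close> assms(4) show ?thesis by blast
qed

section \<open>Local topology of a triangulated ball: purity, ridges, connectedness of stars\<close>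

locale ball_chart = finite_complex B for B :: "'a::euclidean_space set set" +
  fixes d :: nat and D :: "'a set" and \<phi> \<psi> :: "'a \<Rightarrow> 'a"
  assumes d2: "d \<ge> 2" and cD: "compact D" and vD: "convex D" and aD: "aff_dim D = int d"
    and hom: "homeomorphism (\<Union>B) D \<phi> \<psi>"
begin

lemma cont\<phi>: "continuous_on (\<Union>B) \<phi>" and cont\<psi>: "continuous_on D \<psi>"
  and im\<phi>: "\<phi> ` \<Union>B = D" and im\<psi>: "\<psi> ` D = \<Union>B"
  and \<psi>\<phi>: "x \<in> \<Union>B \<Longrightarrow> \<psi> (\<phi> x) = x" and \<phi>\<psi>: "y \<in> D \<Longrightarrow> \<phi> (\<psi> y) = y"
  using hom by (auto simp: homeomorphism_def)

lemma inj\<phi>: "inj_on \<phi> (\<Union>B)" using \<psi>\<phi> by (rule inj_on_inverseI)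

lemma inj\<psi>: "inj_on \<psi> D" using \<phi>\<psi> by (rule inj_on_inverseI)

text \<open>The set is the open star of \<open>G\<close>; only finitely many closed faces are taken
  away.\<close>

lemma open_star: "openin (top_of_set (\<Union>B)) (\<Union>B - \<Union>{H\<in>B. \<not> G \<subseteq> H})"
proof -
  have "closed (\<Union>{H\<in>B. \<not> G \<subseteq> H})" using finB closedB by (intro closed_Union) auto
  then have "openin (top_of_set (\<Union>B)) (\<Union>B \<inter> - \<Union>{H\<in>B. \<not> G \<subseteq> H})"
    by (intro openin_open_Int) auto
  then show ?thesis by (simp add: Diff_eq)
qed

lemma rel_interior_in_open_star:
  assumes "G \<in> B" shows "rel_interior G \<subseteq> \<Union>B - \<Union>{H\<in>B. \<not> G \<subseteq> H}"
  using assms carrier_subset[OF assms] rel_interior_subset[of G] by blast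

text \<open>By maximality, every point of the open star of \<open>G\<close> has \<open>G\<close>
  itself as its carrier.\<close>

lemma rel_interior_maximal_open:
  assumes G: "G \<in> B" "\<And>H. H \<in> B \<Longrightarrow> G \<subseteq> H \<Longrightarrow> H = G"
  shows "openin (top_of_set (\<Union>B)) (rel_interior G)"
proof -
  have "\<Union>B - \<Union>{H\<in>B. \<not> G \<subseteq> H} \<subseteq> rel_interior G"
  proof
    fix x assume x: "x \<in> \<Union>B - \<Union>{H\<in>B. \<not> G \<subseteq> H}"
    then obtain S where "x \<in> S" "S \<in> B" by blast
    then obtain F where F: "F \<in> B" "x \<in> rel_interior F" using carrier_exists by metis
    then have "G \<subseteq> F" using x rel_interior_subset[of F] by blast
    then show "x \<in> rel_interior G" using G(2) F by blast
  qed
  then show ?thesis using open_star[of G] rel_interior_in_open_star[OF G(1)] by (simp add: subset_antisym)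
qed

lemma open_image: "openin (top_of_set (\<Union>B)) U \<Longrightarrow> openin (top_of_set D) (\<phi> ` U)"
  using homeomorphism_imp_open_map[OF hom] .

lemma D_nonempty: "D \<noteq> {}" using aD by auto

text \<open>The relative interior of a maximal face is open in the ball. Invariance of dimension for
  the chart bounds its dimension above, and for the inverse chart on an open piece of
  \<open>D\<close> bounds it below.\<close>

lemma maximal_dim:
  assumes G: "G \<in> B" "\<And>H. H \<in> B \<Longrightarrow> G \<subseteq> H \<Longrightarrow> H = G"
  shows "aff_dim G = int d"
proof -
  have "G \<noteq> {}"
  proof
    assume "G = {}"
    then have "B \<subseteq> {{}}" using G(2) by blast
    then have "D = {}" using im\<phi> by auto
    then show False using D_nonempty by simp
  qed
  have sG: "rel_interior G \<subseteq> \<Union>B" using G rel_interior_subset[of G] by blast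
  have ne: "rel_interior G \<noteq> {}" using rel_interior_nonempty G \<open>G \<noteq> {}\<close> by blast
  let ?V = "\<phi> ` rel_interior G"
  have V: "openin (top_of_set D) ?V" by (rule open_image[OF rel_interior_maximal_open[OF G]])
  have VD: "?V \<subseteq> D" using V openin_imp_subset by blast
  note V' = closure_Int_openin_convex_rel_interior[OF vD V]
  have "aff_dim (affine hull D) \<le> aff_dim (affine hull G)"
  proof (rule Further_Topology.invariance_of_dimension_affine_sets[OF V'(2)])
    show "continuous_on (?V \<inter> rel_interior D) \<psi>"
      using cont\<psi> VD by (auto intro: continuous_on_subset)
    show "inj_on \<psi> (?V \<inter> rel_interior D)" using inj\<psi> VD by (auto intro: inj_on_subset)
    show "\<psi> \<in> ?V \<inter> rel_interior D \<rightarrow> affine hull G"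
    proof
      fix y assume "y \<in> ?V \<inter> rel_interior D"
      then obtain x where x: "x \<in> rel_interior G" "y = \<phi> x" by blast
      then have "\<psi> y = x" using \<psi>\<phi> sG by blast
      then show "\<psi> y \<in> affine hull G" using x rel_interior_subset[of G] hull_subset[of G affine] by auto
    qed
  qed (use ne V' in auto)
  moreover have "aff_dim (affine hull G) \<le> aff_dim (affine hull D)"
  proof (rule Further_Topology.invariance_of_dimension_affine_sets[OF openin_rel_interior])
    show "continuous_on (rel_interior G) \<phi>" using cont\<phi> sG by (auto intro: continuous_on_subset)
    show "inj_on \<phi> (rel_interior G)" using inj\<phi> sG by (auto intro: inj_on_subset)
    show "\<phi> \<in> rel_interior G \<rightarrow> affine hull D" using VD hull_subset[of D affine] by blast
  qed (use ne in auto)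
  ultimately show ?thesis using aD by (simp add: aff_dim_affine_hull)
qed

lemma pure:
  assumes "F \<in> B" obtains \<Delta> where "\<Delta> \<in> B" "F \<subseteq> \<Delta>" "aff_dim \<Delta> = int d"
proof -
  let ?A = "{G \<in> B. F \<subseteq> G}"
  have "finite ?A" "F \<in> ?A" using finB assms by auto
  then obtain G where G: "G \<in> ?A" "\<And>H. H \<in> ?A \<Longrightarrow> G \<subseteq> H \<Longrightarrow> G = H"
    by (metis (no_types, lifting) finite_has_maximal2)
  have "aff_dim G = int d"
  proof (rule maximal_dim)
    show "H = G" if "H \<in> B" "G \<subseteq> H" for H using G(1) G(2)[of H] that by auto
  qed (use G(1) in auto)
  then show thesis using that G by blast
qed

lemma dim_le: assumes "F \<in> B" shows "aff_dim F \<le> int d"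
proof -
  obtain \<Delta> where "\<Delta> \<in> B" "F \<subseteq> \<Delta>" "aff_dim \<Delta> = int d" using pure[OF assms] by blast
  then show ?thesis using aff_dim_subset[of F \<Delta>] by simp
qed

lemma facet_maximal:
  assumes "\<Delta> \<in> B" "aff_dim \<Delta> = int d" "H \<in> B" "\<Delta> \<subseteq> H" shows "H = \<Delta>"
  using dim_less[OF assms(1,3)] dim_le[OF assms(3)] assms by auto

lemma facet_Int_dim:
  assumes "\<Delta> \<in> B" "aff_dim \<Delta> = int d" "\<Delta>' \<in> B" "aff_dim \<Delta>' = int d" "\<Delta> \<noteq> \<Delta>'"
  shows "aff_dim (\<Delta> \<inter> \<Delta>') < int d"
  using dim_less[OF Int_in[OF assms(1,3)] assms(1)] facet_maximal[OF assms(1,2,3)] assms by auto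

text \<open>Near an interior point of a common ridge, the union of two facets is a topological open
  \<open>d\<close>-disc: bend one half of an affine \<open>d\<close>-space along the ridge.\<close>

lemma two_facets_neighbourhood:
  assumes r: "\<rho> \<in> B" "aff_dim \<rho> = int d - 1" "\<rho> \<subseteq> \<Delta>" "\<rho> \<subseteq> \<Delta>'"
    and D: "\<Delta> \<in> B" "aff_dim \<Delta> = int d" "\<Delta>' \<in> B" "aff_dim \<Delta>' = int d" "\<Delta> \<noteq> \<Delta>'"
    and b: "b \<in> rel_interior \<rho>"
  obtains U where "openin (top_of_set (affine hull D)) U" "\<phi> b \<in> U" "U \<subseteq> \<phi> ` (\<Delta> \<union> \<Delta>')"
proof -
  have outside: "\<exists>v\<in>E. v \<notin> affine hull \<rho>" if "aff_dim E = int d" for E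
  proof (rule ccontr)
    assume "\<not> ?thesis"
    then have "E \<subseteq> affine hull \<rho>" by blast
    then have "aff_dim E \<le> aff_dim \<rho>" using aff_dim_subset[of E "affine hull \<rho>"] by (simp add: aff_dim_affine_hull)
    then show False using r that by simp
  qed
  obtain v1 v2 where v: "v1 \<in> \<Delta>" "v1 \<notin> affine hull \<rho>" "v2 \<in> \<Delta>'" "v2 \<notin> affine hull \<rho>"
    using outside[OF D(2)] outside[OF D(4)] by blast
  define S where "S = (\<lambda>x. x - b) ` (affine hull \<rho>)"
  have bA: "b \<in> affine hull \<rho>" using b rel_interior_subset[of \<rho>] hull_subset[of \<rho> affine] by blast
  have S: "subspace S" unfolding S_def by (rule affine_diffs_subspace_subtract) (use bA in auto)
  define w1 w2 where "w1 = v1 - b" and "w2 = v2 - b"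
  have w: "w1 \<notin> S" "w2 \<notin> S" using v by (auto simp: S_def w1_def w2_def)
  have SA: "b + p \<in> affine hull \<rho>" if "p \<in> S" for p using that by (auto simp: S_def)
  have AS: "x - b \<in> S" if "x \<in> affine hull \<rho>" for x using that by (auto simp: S_def)
  obtain e where e: "e > 0" "cball b e \<inter> affine hull \<rho> \<subseteq> \<rho>"
    using b by (auto simp: mem_rel_interior_cball)
  obtain y a where ya: "y \<in> span S" "\<And>s. s \<in> span S \<Longrightarrow> orthogonal a s" "w1 = y + a"
    using orthogonal_subspace_decomp_exists[of S w1] by blast
  have spS: "span S = S" using S span_eq_iff by blast
  have a0: "a \<noteq> 0" using ya w(1) spS by auto
  have aS: "s \<bullet> a = 0" if "s \<in> S" for s using ya(2)[of s] that spS unfolding orthogonal_def by (simp add: inner_commute[of s])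
  have aw1: "w1 \<bullet> a = a \<bullet> a" using ya aS spS by (simp add: inner_add_left)
  define L where "L = span (insert w1 S)"
  define t where "t = (\<lambda>x. (x \<bullet> a) / (a \<bullet> a))"
  define p where "p = (\<lambda>x. x - t x *\<^sub>R w1)"
  have pS: "p x \<in> S" if xL: "x \<in> L" for x
  proof -
    obtain k where k: "x - k *\<^sub>R w1 \<in> S" using xL by (auto simp: L_def span_insert spS)
    have "(x - k *\<^sub>R w1) \<bullet> a = 0" using aS k by blast
    then have "x \<bullet> a = k * (a \<bullet> a)" by (simp add: inner_diff_left aw1)
    then have "t x = k" using a0 by (simp add: t_def)
    then show ?thesis using k by (simp add: p_def)
  qed
  have "aff_dim L = int d"
  proof -
    have "aff_dim S = aff_dim (affine hull \<rho>)"
      unfolding S_def by (rule aff_dim_translation_eq_subtract)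
    then have "int (dim S) = int d - 1" using S r(2) by (simp add: aff_dim_subspace aff_dim_affine_hull)
    moreover have "dim L = dim S + 1" unfolding L_def dim_span using w(1) spS by (simp only: dim_insert if_False)
    ultimately show ?thesis unfolding L_def by (simp add: aff_dim_subspace)
  qed
  define N where "N = {x \<in> L. norm (p x) < e / 2 \<and> \<bar>t x\<bar> < 1 / 2}"
  have ct: "continuous_on UNIV t" unfolding t_def by (intro continuous_intros) (use a0 in auto)
  have cp: "continuous_on UNIV p" unfolding p_def
    by (intro continuous_on_diff continuous_on_scaleR continuous_on_id continuous_on_const ct)
  have "open {x. norm (p x) < e / 2}"
    by (intro open_Collect_less continuous_on_norm cp continuous_on_const)
  moreover have "open {x. \<bar>t x\<bar> < 1 / 2}"
    by (intro open_Collect_less continuous_on_rabs ct continuous_on_const)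
  ultimately have "open {x. norm (p x) < e / 2 \<and> \<bar>t x\<bar> < 1 / 2}"
    by (rule open_Collect_conj)
  then have "openin (top_of_set L) (L \<inter> {x. norm (p x) < e / 2 \<and> \<bar>t x\<bar> < 1 / 2})"
    by (rule openin_open_Int)
  moreover have "N = L \<inter> {x. norm (p x) < e / 2 \<and> \<bar>t x\<bar> < 1 / 2}" by (auto simp: N_def)
  ultimately have No: "openin (top_of_set L) N" by (simp only:)
  \<comment> \<open>In \<open>L\<close> each point is \<open>p x + t x *\<^sub>R w1\<close>. The map
    keeps the part along the ridge and follows \<open>w1\<close> into \<open>\<Delta>\<close> for
    positive \<open>t\<close>, but \<open>w2\<close> into \<open>\<Delta>'\<close> for negative
    \<open>t\<close>, so that \<open>S\<close> is the crease of the bend.\<close>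
  define g where "g = (\<lambda>x. b + p x + max (t x) 0 *\<^sub>R w1 + max (- t x) 0 *\<^sub>R w2)"
  have "continuous_on UNIV g" unfolding g_def
    by (intro continuous_on_add continuous_on_scaleR continuous_on_max continuous_on_minus continuous_on_const ct cp)
  then have cg: "continuous_on N g" by (rule continuous_on_subset) auto
  \<comment> \<open>The point is a convex combination of \<open>v\<close>, with weight
    \<open>s\<close>, and of \<open>b + q'\<close>, where \<open>q'\<close> is \<open>q\<close>
    divided by \<open>1 - s\<close>. The bounds in \<open>N\<close> keep \<open>q'\<close> short
    enough for \<open>b + q'\<close> to stay in the ridge.\<close>
  have inside: "b + q + s *\<^sub>R (v - b) \<in> E"
    if q: "q \<in> S" "norm q < e / 2" and s: "0 \<le> s" "s < 1 / 2" and E: "v \<in> E" "\<rho> \<subseteq> E" "convex E" for q s v E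
  proof -
    define q' where "q' = inverse (1 - s) *\<^sub>R q"
    have q'S: "q' \<in> S" unfolding q'_def using S q(1) subspace_scale by blast
    have "norm q' = norm q / (1 - s)" using s by (simp add: q'_def field_simps)
    also have "\<dots> \<le> e"
    proof -
      have "e * (1 / 2) \<le> e * (1 - s)" using s e(1) by (intro mult_left_mono) auto
      then show ?thesis using q(2) s by (simp add: divide_le_eq)
    qed
    finally have "b + q' \<in> \<rho>" using e(2) SA[OF q'S] by (auto simp: dist_norm)
    then have "(1 - s) *\<^sub>R (b + q') + s *\<^sub>R v \<in> E"
      using E s by (intro convexD_alt) auto
    moreover have "(1 - s) *\<^sub>R (b + q') + s *\<^sub>R v = b + q + s *\<^sub>R (v - b)"
    proof -
      have "(1 - s) *\<^sub>R q' = q" using s by (simp add: q'_def)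
      then show ?thesis unfolding scaleR_add_right by (simp add: algebra_simps)
    qed
    ultimately show ?thesis by simp
  qed
  have g1: "g x \<in> \<Delta>" if "x \<in> N" "t x \<ge> 0" for x
    using inside[of "p x" "t x" v1 \<Delta>] that pS r D v convexB by (auto simp: g_def N_def w1_def max_def)
  have g2: "g x \<in> \<Delta>'" if "x \<in> N" "t x \<le> 0" for x
    using inside[of "p x" "- t x" v2 \<Delta>'] that pS r D v convexB by (auto simp: g_def N_def w2_def max_def)
  have gN: "g ` N \<subseteq> \<Delta> \<union> \<Delta>'" using g1 g2 by (metis UnI1 UnI2 image_subsetI linear)
  have int: "\<Delta> \<inter> \<Delta>' = \<rho>"
  proof -
    have "aff_dim \<rho> \<le> aff_dim (\<Delta> \<inter> \<Delta>')" using r by (intro aff_dim_subset) auto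
    then have "aff_dim \<rho> = aff_dim (\<Delta> \<inter> \<Delta>')" using facet_Int_dim[OF D] r(2) by simp
    then show ?thesis using eq_if_dim[OF r(1) Int_in[OF D(1,3)]] r by auto
  qed
  have w2S: "s = 0" if "s *\<^sub>R w2 \<in> S" for s
  proof (rule ccontr)
    assume "s \<noteq> 0"
    then have "inverse s *\<^sub>R (s *\<^sub>R w2) \<in> S" using S that subspace_scale by blast
    then show False using \<open>s \<noteq> 0\<close> w(2) by simp
  qed
  have xpt: "x = p x + t x *\<^sub>R w1" for x by (simp add: p_def)
  \<comment> \<open>A value common to both halves lies in
    \<open>\<Delta> \<inter> \<Delta>' = \<rho>\<close>, which would put a nonzero multiple of
    \<open>w2\<close> into \<open>S\<close>.\<close>
  have mixed: "False" if x: "x \<in> N" "0 \<le> t x" and y: "y \<in> N" "t y < 0" and eq: "g x = g y" for x y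
  proof -
    have "g y \<in> \<rho>" using g1[OF x] g2[of y] y eq int by auto
    then have "g y - b \<in> S" using AS hull_subset[of \<rho> affine] by blast
    then have "p y + (- t y) *\<^sub>R w2 \<in> S" using y by (simp add: g_def max_def)
    then have "(- t y) *\<^sub>R w2 \<in> S"
      using subspace_diff[OF S _ pS[of y], of "p y + (- t y) *\<^sub>R w2"] y by (simp add: N_def)
    then show False using w2S[of "- t y"] y by simp
  qed
  have "inj_on g N"
  proof (rule inj_onI)
    fix x y assume xy: "x \<in> N" "y \<in> N" "g x = g y"
    consider "0 \<le> t x" "0 \<le> t y" | "t x < 0" "t y < 0" | "0 \<le> t x" "t y < 0" | "t x < 0" "0 \<le> t y"
      by linarith
    then show "x = y"
    proof cases
      case 1
      then have "p x + t x *\<^sub>R w1 = p y + t y *\<^sub>R w1" using xy(3) by (simp add: g_def max_def)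
      then show ?thesis using xpt by metis
    next
      case 2
      then have eq: "p x + (- t x) *\<^sub>R w2 = p y + (- t y) *\<^sub>R w2" using xy(3) by (simp add: g_def max_def)
      then have "(t y - t x) *\<^sub>R w2 = p y - p x" by (simp add: algebra_simps)
      moreover have "p y - p x \<in> S" using xy pS S by (auto simp: N_def intro: subspace_diff)
      ultimately have "t y = t x" using w2S[of "t y - t x"] by simp
      then show ?thesis using eq xpt by (metis add_right_cancel)
    qed (use mixed xy in metis)+
  qed
  have gNB: "g ` N \<subseteq> \<Union>B" using gN D by blast
  have "openin (top_of_set (affine hull D)) ((\<phi> \<circ> g) ` N)"
  proof (rule Further_Topology.invariance_of_domain_affine_sets[OF No])
    show "affine L" by (simp add: L_def subspace_imp_affine)
    show "aff_dim (affine hull D) \<le> aff_dim L" using \<open>aff_dim L = int d\<close> aD by (simp add: aff_dim_affine_hull)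
    show "continuous_on N (\<phi> \<circ> g)"
      by (rule continuous_on_compose[OF cg continuous_on_subset[OF cont\<phi> gNB]])
    show "\<phi> \<circ> g \<in> N \<rightarrow> affine hull D" 
    proof
      fix x assume "x \<in> N"
      then have "\<phi> (g x) \<in> D" using im\<phi> gNB by blast
      then show "(\<phi> \<circ> g) x \<in> affine hull D" using hull_subset[of D affine] by auto
    qed
    show "inj_on (\<phi> \<circ> g) N" by (rule comp_inj_on[OF \<open>inj_on g N\<close> inj_on_subset[OF inj\<phi> gNB]])
  qed auto
  moreover have "0 \<in> N" using e by (simp add: N_def L_def p_def t_def span_zero)
  then have "\<phi> b \<in> (\<phi> \<circ> g) ` N"
    by (rule rev_image_eqI) (simp add: g_def p_def t_def)
  moreover have "(\<phi> \<circ> g) ` N \<subseteq> \<phi> ` (\<Delta> \<union> \<Delta>')" using gN by auto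
  ultimately show thesis using that by blast
qed

lemma closure_rel_interior_face: "F \<in> B \<Longrightarrow> closure (rel_interior F) = F"
  using convex_closure_rel_interior[OF convexB] closedB by simp

text \<open>Two of the facets already cover a neighbourhood of an interior point of the ridge. A
  third facet has interior points arbitrarily close to it, and these lie in no other facet.\<close>

lemma ridge_in_at_most_two:
  assumes r: "\<rho> \<in> B" "aff_dim \<rho> = int d - 1"
  shows "card {\<Delta> \<in> B. aff_dim \<Delta> = int d \<and> \<rho> \<subseteq> \<Delta>} \<le> 2"
proof (rule ccontr)
  let ?A = "{\<Delta> \<in> B. aff_dim \<Delta> = int d \<and> \<rho> \<subseteq> \<Delta>}"
  assume "\<not> card ?A \<le> 2"
  then have "3 \<le> card ?A" by simp
  then obtain T where "T \<subseteq> ?A" "card T = 3" by (meson obtain_subset_with_card_n)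
  then obtain x y z where T: "T = {x, y, z}" "x \<noteq> y" "x \<noteq> z" "y \<noteq> z"
    unfolding card_3_iff by blast
  then have xyz: "x \<in> ?A" "y \<in> ?A" "z \<in> ?A" "x \<noteq> y" "x \<noteq> z" "y \<noteq> z"
    using \<open>T \<subseteq> ?A\<close> by blast+
  have "\<rho> \<noteq> {}" using r d2 by auto
  then obtain b where b: "b \<in> rel_interior \<rho>" using rel_interior_nonempty r by blast
  obtain U where U: "openin (top_of_set (affine hull D)) U" "\<phi> b \<in> U" "U \<subseteq> \<phi> ` (x \<union> y)"
    using two_facets_neighbourhood[OF r, of x y b] xyz b by blast
  obtain O' where O': "open O'" "U = affine hull D \<inter> O'" using U(1) openin_open by blast
  have "openin (top_of_set (\<Union>B)) (\<Union>B \<inter> \<phi> -` O')"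
    using cont\<phi> O'(1) continuous_openin_preimage_gen by blast
  moreover have "b \<in> \<Union>B \<inter> \<phi> -` O'" using b rel_interior_subset[of \<rho>] r U O' by blast
  moreover have "b \<in> closure (rel_interior z)"
    using closure_rel_interior_face[of z] xyz b rel_interior_subset[of \<rho>] by auto
  moreover have "rel_interior z \<subseteq> \<Union>B" using xyz rel_interior_subset[of z] by blast
  ultimately obtain q where q: "q \<in> \<Union>B" "\<phi> q \<in> O'" "q \<in> rel_interior z"
    using openin_meets_closure by blast
  then have "\<phi> q \<in> U" using O' im\<phi> hull_subset[of D affine] by blast
  then obtain q' where "q' \<in> x \<union> y" "\<phi> q = \<phi> q'" using U(3) by blast
  then have "q \<in> x \<union> y" 
  proof -
    have "q' \<in> \<Union>B" using \<open>q' \<in> x \<union> y\<close> xyz by blast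
    then have "q = q'" using inj_onD[OF inj\<phi> \<open>\<phi> q = \<phi> q'\<close>] q(1) by blast
    then show ?thesis using \<open>q' \<in> x \<union> y\<close> by simp
  qed
  then have "z \<subseteq> x \<or> z \<subseteq> y" using carrier_subset[of z x q] carrier_subset[of z y q] q(3) xyz by blast
  then show False using facet_maximal[of z x] facet_maximal[of z y] xyz by blast
qed

text \<open>Otherwise every ridge lies in at least two facets, so the frontier of \<open>D\<close>,
  a topological (d-1)-sphere, would be covered by images of faces of dimension at most d-2. An open
  piece of it would then embed in one such face, against invariance of dimension.\<close>

lemma boundary_ridge_exists:
  obtains \<rho> where "\<rho> \<in> B" "aff_dim \<rho> = int d - 1" "card {\<Delta> \<in> B. aff_dim \<Delta> = int d \<and> \<rho> \<subseteq> \<Delta>} = 1"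
proof (rule ccontr)
  assume "\<not> thesis"
  then have no1: "card {\<Delta> \<in> B. aff_dim \<Delta> = int d \<and> \<rho> \<subseteq> \<Delta>} \<noteq> 1" if "\<rho> \<in> B" "aff_dim \<rho> = int d - 1" for \<rho>
    using that \<open>\<not> thesis\<close> \<open>\<And>\<rho>. \<lbrakk>\<rho> \<in> B; aff_dim \<rho> = int d - 1; card {\<Delta> \<in> B. aff_dim \<Delta> = int d \<and> \<rho> \<subseteq> \<Delta>} = 1\<rbrakk> \<Longrightarrow> thesis\<close> by blast
  define X where "X = rel_frontier D"
  have clD: "closure D = D" using cD by (simp add: compact_imp_closed)
  have XD: "X \<subseteq> D" "X \<inter> rel_interior D = {}" by (auto simp: X_def rel_frontier_def clD)
  \<comment> \<open>The relative interior of a facet is sent to the relative interior of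
    \<open>D\<close> by invariance of domain, and that of a ridge by the disc formed by its two
    facets.\<close>
  have low: "aff_dim F \<le> int d - 2" if F: "F \<in> B" "x \<in> rel_interior F" "\<phi> x \<in> X" for F x
  proof (rule ccontr)
    assume "\<not> ?thesis"
    then consider "aff_dim F = int d" | "aff_dim F = int d - 1" using dim_le[OF F(1)] by linarith
    then have "\<phi> x \<in> rel_interior D"
    proof cases
      case 1
      have FB: "F \<subseteq> \<Union>B" using F by blast
      have "\<phi> ` rel_interior F \<subseteq> rel_interior D"
        by (rule homeomorphism_image_rel_interior(1)[of F])
          (use 1 aD im\<phi> FB continuous_on_subset[OF cont\<phi> FB] inj_on_subset[OF inj\<phi> FB] in auto)
      then show ?thesis using F by blast
    next
      case 2
      obtain \<Delta> where \<Delta>: "\<Delta> \<in> B" "F \<subseteq> \<Delta>" "aff_dim \<Delta> = int d" using pure[OF F(1)] by blast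
      have "{\<Delta> \<in> B. aff_dim \<Delta> = int d \<and> F \<subseteq> \<Delta>} \<noteq> {\<Delta>}" using no1[OF F(1) 2] by auto
      then obtain \<Delta>' where \<Delta>': "\<Delta>' \<in> B" "F \<subseteq> \<Delta>'" "aff_dim \<Delta>' = int d" "\<Delta> \<noteq> \<Delta>'" using \<Delta> by blast
      obtain U where U: "openin (top_of_set (affine hull D)) U" "\<phi> x \<in> U" "U \<subseteq> \<phi> ` (\<Delta> \<union> \<Delta>')"
        using two_facets_neighbourhood[OF F(1) 2 \<Delta>(2) \<Delta>'(2) \<Delta>(1,3) \<Delta>'(1,3,4) F(2)] by blast
      then have "U \<subseteq> D" using im\<phi> \<Delta> \<Delta>' by blast
      then have "U \<subseteq> rel_interior D" using U rel_interior_maximal by blast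
      then show ?thesis using U by blast
    qed
    then show False using F XD by blast
  qed
  define \<C> where "\<C> = {F \<in> B. \<exists>x \<in> rel_interior F. \<phi> x \<in> X}"
  have Xne: "X \<noteq> {}"
  proof
    assume "X = {}"
    then have "affine D" using rel_frontier_eq_empty[of D] by (simp add: X_def)
    then obtain a where "D = {a}" using cD compact_imp_bounded affine_bounded_eq_trivial D_nonempty by blast
    then show False using aD d2 by simp
  qed
  have C: "\<exists>F\<in>\<C>. x \<in> rel_interior F" if "x \<in> \<Union>B" "\<phi> x \<in> X" for x
  proof -
    obtain S where "x \<in> S" "S \<in> B" using \<open>x \<in> \<Union>B\<close> by blast
    then obtain F where "F \<in> B" "x \<in> rel_interior F" using carrier_exists by metis
    then show ?thesis using that by (auto simp: \<C>_def)
  qed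
  have "finite \<C>" using finB by (simp add: \<C>_def)
  moreover have "\<C> \<noteq> {}" using Xne C XD im\<phi> by blast
  \<comment> \<open>For a maximal carrier \<open>F\<close>, all frontier points whose preimages lie
    in the open star of \<open>F\<close> have preimages in the relative interior of
    \<open>F\<close>.\<close>
  ultimately obtain F where F: "F \<in> \<C>" "\<And>G. G \<in> \<C> \<Longrightarrow> F \<subseteq> G \<Longrightarrow> F = G"
    using finite_has_maximal by metis
  have FB: "F \<in> B" using F by (simp add: \<C>_def)
  have dF: "aff_dim F \<le> int d - 2" using low F by (auto simp: \<C>_def)
  obtain \<Delta> where \<Delta>: "\<Delta> \<in> B" "F \<subseteq> \<Delta>" "aff_dim \<Delta> = int d" using pure[OF FB] by blast
  \<comment> \<open>\<open>R\<close> supplies a target of dimension d-1 containing \<open>F\<close>: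
    in its affine hull the preimage of the frontier piece is open, although it lies in the smaller
    affine hull of \<open>F\<close>.\<close>
  obtain R where R: "R \<in> B" "F \<subseteq> R" "aff_dim R = int d - 1"
  proof (rule intermediate_face[OF FB \<Delta>(1,2), of "int d - 1"])
    show "aff_dim F \<le> int d - 1" "int d - 1 \<le> aff_dim \<Delta>" using dF \<Delta>(3) by auto
  qed blast
  define Y where "Y = X \<inter> \<phi> ` (\<Union>B - \<Union>{H\<in>B. \<not> F \<subseteq> H})"
  have YF: "\<psi> ` Y \<subseteq> rel_interior F"
  proof clarify
    fix y assume "y \<in> Y"
    then obtain x where x: "y = \<phi> x" "x \<in> \<Union>B" "x \<notin> \<Union>{H\<in>B. \<not> F \<subseteq> H}" "\<phi> x \<in> X" by (auto simp: Y_def)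
    then obtain G where G: "G \<in> \<C>" "x \<in> rel_interior G" using C by blast
    then have "F \<subseteq> G" using x rel_interior_subset[of G] by (auto simp: \<C>_def)
    then have "F = G" using F G by blast
    then show "\<psi> y \<in> rel_interior F" using G x \<psi>\<phi> by simp
  qed
  have Yo: "openin (top_of_set X) Y"
  proof -
    obtain O' where "open O'" "\<phi> ` (\<Union>B - \<Union>{H\<in>B. \<not> F \<subseteq> H}) = D \<inter> O'"
      using open_image[OF open_star[of F]] unfolding openin_open by blast
    then have "Y = X \<inter> (D \<inter> O')" by (simp only: Y_def)
    then have "Y = X \<inter> O'" using XD(1) by blast
    then show ?thesis using openin_open_Int[OF \<open>open O'\<close>] by simp
  qed
  have YD: "Y \<subseteq> D" using XD by (auto simp: Y_def)
  have "Y \<noteq> {}"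
  proof -
    obtain x where "x \<in> rel_interior F" "\<phi> x \<in> X" using F(1) by (auto simp: \<C>_def)
    then have "\<phi> x \<in> Y" unfolding Y_def using rel_interior_in_open_star[OF FB] by blast
    then show ?thesis by blast
  qed
  have op: "openin (top_of_set (affine hull R)) (\<psi> ` Y)"
  proof (rule Further_Topology.invariance_of_domain_sphere_affine_set_gen)
    show "continuous_on Y \<psi>" "inj_on \<psi> Y"
      using continuous_on_subset[OF cont\<psi> YD] inj_on_subset[OF inj\<psi> YD] by auto
    show "\<psi> \<in> Y \<rightarrow> affine hull R"
      using YF R(2) rel_interior_subset[of F] hull_subset[of R affine] by blast
    show "openin (top_of_set (rel_frontier D)) Y" using Yo by (simp add: X_def)
    show "aff_dim (affine hull R) < aff_dim D" using R aD by (simp add: aff_dim_affine_hull)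
  qed (use cD vD compact_imp_bounded in auto)
  have "aff_dim (affine hull R) \<le> aff_dim (affine hull F)"
  proof (rule Further_Topology.invariance_of_dimension_affine_sets[OF op _ _ continuous_on_id])
    show "(\<lambda>x. x) \<in> \<psi> ` Y \<rightarrow> affine hull F"
      using YF rel_interior_subset[of F] hull_subset[of F affine] by blast
  qed (use \<open>Y \<noteq> {}\<close> in auto)
  then show False using R dF by (simp add: aff_dim_affine_hull)
qed

text \<open>Split the facets around \<open>G\<close> into those reachable from
  \<open>\<Delta>1\<close> and the others. Two facets from different classes meet in a face
  containing \<open>G\<close>, which cannot be a ridge, so it has dimension at most d-2. Near an
  interior point of \<open>G\<close> the two classes cover the ball, so faces of codimension two
  would separate a convex piece of \<open>D\<close>, contradicting
  \<open>lowdim_not_separating\<close>.\<close>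

lemma star_strongly_connected:
  assumes G: "G \<in> B" "G \<noteq> {}"
    and \<Delta>1: "\<Delta>1 \<in> B" "aff_dim \<Delta>1 = int d" "G \<subseteq> \<Delta>1" and \<Delta>2: "\<Delta>2 \<in> B" "aff_dim \<Delta>2 = int d" "G \<subseteq> \<Delta>2"
  shows "(\<Delta>1, \<Delta>2) \<in> {(\<Delta>, \<Delta>'). \<Delta> \<in> B \<and> aff_dim \<Delta> = int d \<and> \<Delta>' \<in> B \<and> aff_dim \<Delta>' = int d \<and>
      (\<exists>\<rho>\<in>B. aff_dim \<rho> = int d - 1 \<and> G \<subseteq> \<rho> \<and> \<rho> \<subseteq> \<Delta> \<and> \<rho> \<subseteq> \<Delta>')}\<^sup>*" (is "_ \<in> ?r\<^sup>*")
proof (rule ccontr)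
  assume no: "(\<Delta>1, \<Delta>2) \<notin> ?r\<^sup>*"
  define \<S> where "\<S> = {\<Delta> \<in> B. aff_dim \<Delta> = int d \<and> G \<subseteq> \<Delta>}"
  define \<A>1 where "\<A>1 = {\<Delta> \<in> \<S>. (\<Delta>1, \<Delta>) \<in> ?r\<^sup>*}"
  define \<A>2 where "\<A>2 = \<S> - \<A>1"
  have in1: "\<Delta>1 \<in> \<A>1" and in2: "\<Delta>2 \<in> \<A>2" using no \<Delta>1 \<Delta>2 by (auto simp: \<A>1_def \<A>2_def \<S>_def)
  have sub: "\<A>1 \<subseteq> \<S>" "\<A>2 \<subseteq> \<S>" "\<S> \<subseteq> B" by (auto simp: \<A>1_def \<A>2_def \<S>_def)
  obtain x0 where x0: "x0 \<in> rel_interior G" using G rel_interior_nonempty by blast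
  define U where "U = \<Union>B - \<Union>{H\<in>B. \<not> G \<subseteq> H}"
  have Uo: "openin (top_of_set (\<Union>B)) U" unfolding U_def by (rule open_star)
  have x0U: "x0 \<in> U" unfolding U_def using x0 rel_interior_in_open_star[OF G(1)] by blast
  have cover: "U \<subseteq> \<Union>\<A>1 \<union> \<Union>\<A>2"
  proof
    fix y assume y: "y \<in> U"
    then obtain S where "y \<in> S" "S \<in> B" by (auto simp: U_def)
    then have "G \<subseteq> S" using y by (auto simp: U_def)
    obtain \<Delta> where "\<Delta> \<in> B" "S \<subseteq> \<Delta>" "aff_dim \<Delta> = int d" using pure[OF \<open>S \<in> B\<close>] by blast
    then have "\<Delta> \<in> \<S>" "y \<in> \<Delta>" using \<open>G \<subseteq> S\<close> \<open>y \<in> S\<close> by (auto simp: \<S>_def)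
    then show "y \<in> \<Union>\<A>1 \<union> \<Union>\<A>2" by (auto simp: \<A>2_def)
  qed
  obtain N0 where N0: "open N0" "\<phi> ` U = D \<inter> N0" using open_image[OF Uo] unfolding openin_open by blast
  then have "\<phi> x0 \<in> N0" using x0U by blast
  then obtain e where e: "e > 0" "ball (\<phi> x0) e \<subseteq> N0" using N0(1) openE by blast
  \<comment> \<open>A convex neighbourhood that stays in the image of the open star; only facets
    containing \<open>G\<close> matter there.\<close>
  define M where "M = ball (\<phi> x0) e \<inter> rel_interior D"
  have vM: "convex M" unfolding M_def using vD by (intro convex_Int convex_ball convex_rel_interior)
  have MU: "M \<subseteq> \<phi> ` U" unfolding M_def N0(2) using e rel_interior_subset[of D] by blast
  have oM: "openin (top_of_set (affine hull D)) M"
    unfolding M_def Int_commute[of "ball _ _"] by (rule openin_Int_open[OF openin_rel_interior open_ball])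
  have pt: "\<exists>q\<in>rel_interior \<Delta>. \<phi> q \<in> M" if \<Delta>: "\<Delta> \<in> \<S>" for \<Delta>
  proof -
    have \<Delta>': "\<Delta> \<in> B" "aff_dim \<Delta> = int d" "G \<subseteq> \<Delta>" using \<Delta> by (auto simp: \<S>_def)
    have ro: "openin (top_of_set (\<Union>B)) (rel_interior \<Delta>)"
      by (rule rel_interior_maximal_open) (use \<Delta>' facet_maximal in auto)
    have 1: "openin (top_of_set (\<Union>B)) (\<Union>B \<inter> \<phi> -` ball (\<phi> x0) e)"
      using cont\<phi> open_ball continuous_openin_preimage_gen by blast
    have "x0 \<in> closure (rel_interior \<Delta>)"
      using closure_rel_interior_face[OF \<Delta>'(1)] x0 rel_interior_subset[of G] \<Delta>'(3) by blast
    moreover have "x0 \<in> \<Union>B \<inter> \<phi> -` ball (\<phi> x0) e" using x0U e by (auto simp: U_def)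
    ultimately have ne: "(\<Union>B \<inter> \<phi> -` ball (\<phi> x0) e) \<inter> rel_interior \<Delta> \<noteq> {}"
      using openin_meets_closure[OF 1] openin_imp_subset[OF ro] by blast
    have o: "openin (top_of_set D) (\<phi> ` ((\<Union>B \<inter> \<phi> -` ball (\<phi> x0) e) \<inter> rel_interior \<Delta>))"
      by (rule open_image[OF openin_Int[OF 1 ro]])
    show ?thesis
      using closure_Int_openin_convex_rel_interior(1)[OF vD o] ne by (auto simp: M_def)
  qed
  obtain q1 q2 where q: "q1 \<in> rel_interior \<Delta>1" "\<phi> q1 \<in> M" "q2 \<in> rel_interior \<Delta>2" "\<phi> q2 \<in> M"
    using pt[OF subsetD[OF sub(1) in1]] pt[OF subsetD[OF sub(2) in2]] by blast
  obtain e1 where e1: "e1 > 0" "cball (\<phi> q1) e1 \<inter> affine hull D \<subseteq> M"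
    using oM q(2) unfolding openin_contains_cball by blast
  obtain e2 where e2: "e2 > 0" "cball (\<phi> q2) e2 \<inter> affine hull D \<subseteq> M"
    using oM q(4) unfolding openin_contains_cball by blast
  define K1 K2 where "K1 = cball (\<phi> q1) e1 \<inter> affine hull D" and "K2 = cball (\<phi> q2) e2 \<inter> affine hull D"
  \<comment> \<open>A compact convex set of full dimension inside \<open>M\<close>. The small balls
    around the two test points make them relative interior points of it.\<close>
  define W where "W = convex hull (K1 \<union> K2)"
  have W: "compact W" "convex W"
    unfolding W_def K1_def K2_def by (auto intro!: compact_convex_hull compact_Un compact_Int_closed)
  have WM: "W \<subseteq> M" unfolding W_def by (rule hull_minimal) (use e1(2) e2(2) vM in \<open>simp_all add: K1_def K2_def\<close>)
  have MA: "M \<subseteq> affine hull D" using oM openin_imp_subset by blast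
  have KW: "K1 \<subseteq> W" "K2 \<subseteq> W" unfolding W_def using hull_subset[of "K1 \<union> K2" convex] by auto
  have affW: "affine hull W = affine hull D"
  proof
    show "affine hull W \<subseteq> affine hull D" using WM MA by (intro hull_minimal) auto
    have "\<phi> q1 \<in> affine hull D \<inter> interior (cball (\<phi> q1) e1)" using q(2) MA e1 by (auto simp: interior_cball)
    then have "affine hull (affine hull D \<inter> cball (\<phi> q1) e1) = affine hull (affine hull D)"
      by (intro affine_hull_convex_Int_nonempty_interior) (auto simp: affine_imp_convex)
    then have "affine hull K1 = affine hull D" by (simp add: K1_def Int_commute)
    then show "affine hull D \<subseteq> affine hull W" using hull_mono[OF KW(1), of affine] by simp
  qed
  have dW: "aff_dim W = int d" using affW aD aff_dim_affine_hull by metis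
  have "\<phi> q1 \<in> K1" "\<phi> q2 \<in> K2" using q MA e1(1) e2(1) by (auto simp: K1_def K2_def)
  then have pW: "\<phi> q1 \<in> rel_interior W" "\<phi> q2 \<in> rel_interior W"
    unfolding mem_rel_interior_cball affW using KW e1(1) e2(1) unfolding K1_def K2_def by blast+
  define Z where "Z = {K \<in> B. aff_dim K + 1 < int d}"
  have ZB: "Z \<subseteq> B" "\<Union>Z \<subseteq> \<Union>B" by (auto simp: Z_def)
  have clA: "compact (\<phi> ` \<Union>\<A>)" if "\<A> \<subseteq> B" for \<A>
  proof -
    have "compact (\<Union>\<A>)" using that finB compactB finite_subset by (intro compact_Union) auto
    then show ?thesis using cont\<phi> that by (intro compact_continuous_image) (auto intro: continuous_on_subset)
  qed
  show False
  proof (rule lowdim_not_separating[of W Z \<phi> "\<phi> ` \<Union>\<A>1 \<inter> W" "\<phi> ` \<Union>\<A>2 \<inter> W" "\<phi> q1" "\<phi> q2", OF W])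
    show "finite Z" using finB by (simp add: Z_def)
    show "polytope K" "aff_dim K + 1 < aff_dim W" if "K \<in> Z" for K
      using that dW polytopeB by (auto simp: Z_def)
    show "(K \<inter> L) face_of K" if "K \<in> Z" "L \<in> Z" for K L
      using that Int_face by (auto simp: Z_def)
    show "continuous_on (\<Union>Z) \<phi>" "inj_on \<phi> (\<Union>Z)"
      using continuous_on_subset[OF cont\<phi> ZB(2)] inj_on_subset[OF inj\<phi> ZB(2)] by auto
    show "closed (\<phi> ` \<Union>\<A>1 \<inter> W)" "closed (\<phi> ` \<Union>\<A>2 \<inter> W)"
      using clA[of \<A>1] clA[of \<A>2] sub W by (auto intro!: closed_Int compact_imp_closed)
    show "\<phi> ` \<Union>\<A>1 \<inter> W \<union> \<phi> ` \<Union>\<A>2 \<inter> W = W"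
      using WM MU cover by blast
    show "\<phi> ` \<Union>\<A>1 \<inter> W \<inter> (\<phi> ` \<Union>\<A>2 \<inter> W) \<subseteq> \<phi> ` \<Union>Z"
    proof
      fix w assume "w \<in> \<phi> ` \<Union>\<A>1 \<inter> W \<inter> (\<phi> ` \<Union>\<A>2 \<inter> W)"
      then obtain y y' \<Delta> \<Delta>' where y: "w = \<phi> y" "y \<in> \<Delta>" "\<Delta> \<in> \<A>1" "w = \<phi> y'" "y' \<in> \<Delta>'" "\<Delta>' \<in> \<A>2" by blast
      have \<Delta>: "\<Delta> \<in> B" "aff_dim \<Delta> = int d" "G \<subseteq> \<Delta>" and \<Delta>': "\<Delta>' \<in> B" "aff_dim \<Delta>' = int d" "G \<subseteq> \<Delta>'"
        using y sub by (auto simp: \<S>_def)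
      have "y = y'" 
      proof (rule inj_onD[OF inj\<phi>])
        show "\<phi> y = \<phi> y'" using y by simp
        show "y \<in> \<Union>B" "y' \<in> \<Union>B" using y(2,5) \<Delta>(1) \<Delta>'(1) by blast+
      qed
      have ne: "\<Delta> \<noteq> \<Delta>'" using y by (auto simp: \<A>2_def)
      have lt: "aff_dim (\<Delta> \<inter> \<Delta>') < int d" by (rule facet_Int_dim[OF \<Delta>(1,2) \<Delta>'(1,2) ne])
      \<comment> \<open>If the intersection were a ridge, it would contain \<open>G\<close> and link
        the two classes.\<close>
      have "aff_dim (\<Delta> \<inter> \<Delta>') \<noteq> int d - 1"
      proof
        assume "aff_dim (\<Delta> \<inter> \<Delta>') = int d - 1"
        then have "\<exists>\<rho>\<in>B. aff_dim \<rho> = int d - 1 \<and> G \<subseteq> \<rho> \<and> \<rho> \<subseteq> \<Delta> \<and> \<rho> \<subseteq> \<Delta>'"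
          using \<Delta>(3) \<Delta>'(3) Int_in[OF \<Delta>(1) \<Delta>'(1)] by (intro bexI[of _ "\<Delta> \<inter> \<Delta>'"]) auto
        then have "(\<Delta>, \<Delta>') \<in> ?r" using \<Delta>(1,2) \<Delta>'(1,2) by simp
        moreover have "(\<Delta>1, \<Delta>) \<in> ?r\<^sup>*" using y(3) unfolding \<A>1_def by blast
        ultimately have "(\<Delta>1, \<Delta>') \<in> ?r\<^sup>*" by (rule rtrancl_into_rtrancl[rotated])
        then have "\<Delta>' \<in> \<A>1" unfolding \<A>1_def using y(6) sub(2) by blast
        then show False using y(6) by (simp add: \<A>2_def)
      qed
      then have "\<Delta> \<inter> \<Delta>' \<in> Z" using lt Int_in[OF \<Delta>(1) \<Delta>'(1)] by (simp add: Z_def)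
      moreover have "y \<in> \<Delta> \<inter> \<Delta>'" using y(2,5) \<open>y = y'\<close> by simp
      ultimately show "w \<in> \<phi> ` \<Union>Z" unfolding y(1) by (intro imageI UnionI)
    qed
    have out: "\<phi> q \<notin> \<phi> ` \<Union>\<A>" if "q \<in> rel_interior \<Delta>" "\<Delta> \<in> \<S>" "\<A> \<subseteq> \<S>" "\<Delta> \<notin> \<A>" for q \<Delta> \<A>
    proof
      assume "\<phi> q \<in> \<phi> ` \<Union>\<A>"
      then obtain y H where y: "\<phi> q = \<phi> y" "y \<in> H" "H \<in> \<A>" by blast
      have HB: "H \<in> B" "aff_dim H = int d" and \<Delta>B: "\<Delta> \<in> B" "aff_dim \<Delta> = int d" using y that by (auto simp: \<S>_def)
      have qB: "q \<in> \<Union>B" using that(1) rel_interior_subset[of \<Delta>] \<Delta>B by blast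
      have "q = y"
      proof (rule inj_onD[OF inj\<phi>])
        show "y \<in> \<Union>B" using y(2) HB(1) by blast
      qed (use y(1) qB in auto)
      then have "\<Delta> \<subseteq> H" using carrier_subset[OF \<Delta>B(1) HB(1) that(1)] y by simp
      then have "H = \<Delta>" by (rule facet_maximal[OF \<Delta>B HB(1)])
      then show False using y that by simp
    qed
    show "\<phi> q1 \<notin> \<phi> ` \<Union>\<A>2 \<inter> W" using out[OF q(1), of \<A>2] in1 sub by (auto simp: \<A>2_def)
    show "\<phi> q2 \<notin> \<phi> ` \<Union>\<A>1 \<inter> W" using out[OF q(3), of \<A>1] in2 sub by (auto simp: \<A>2_def)
  qed (use pW in auto)
qed

end

section \<open>Acyclic graphs: arcs are bridges, leaves create no cycles\<close>

lemma graph_cycle_mono: "graph_cycle T vs \<Longrightarrow> T \<subseteq> T' \<Longrightarrow> graph_cycle T' vs"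
  by (auto simp: graph_cycle_def)

text \<open>A shortest path between the ends that avoids the arc would be closed by the arc to a
  cycle.\<close>

lemma acyclic_bridge:
  assumes acyc: "\<not> (\<exists>vs. graph_cycle T vs)" and uv: "{u, v} \<in> T" "u \<noteq> v"
  shows "(u, v) \<notin> {(x, y). {x, y} \<in> T \<and> {x, y} \<noteq> {u, v}}\<^sup>*" (is "_ \<notin> ?r\<^sup>*")
proof
  assume "(u, v) \<in> ?r\<^sup>*"
  then have ex: "\<exists>n. (u, v) \<in> ?r ^^ n" by (simp add: rtrancl_is_UN_relpow)
  \<comment> \<open>Minimal length excludes repeated nodes. Since \<open>u \<noteq> v\<close> and
    the arc itself is excluded, the length is at least 2, so the cycle has at least the three nodes
    that \<open>graph_cycle\<close> demands.\<close>
  define n where "n = (LEAST n. (u, v) \<in> ?r ^^ n)"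
  have n: "(u, v) \<in> ?r ^^ n" unfolding n_def using LeastI_ex[OF ex] .
  have least: "n \<le> m" if "(u, v) \<in> ?r ^^ m" for m unfolding n_def using that by (rule Least_le)
  obtain f where f: "f 0 = u" "f n = v" "\<And>i. i < n \<Longrightarrow> (f i, f (Suc i)) \<in> ?r"
    using n unfolding relpow_fun_conv by blast
  have seg: "(f a, f b) \<in> ?r ^^ (b - a)" if "a \<le> b" "b \<le> n" for a b
    unfolding relpow_fun_conv
    by (rule exI[of _ "\<lambda>i. f (a + i)"]) (use that f(3) in auto)
  have distinct: "f i \<noteq> f j" if "i < j" "j \<le> n" for i j
  proof
    assume "f i = f j"
    have "(u, f i) \<in> ?r ^^ i" using seg[of 0 i] f(1) that by simp
    moreover have "(f j, v) \<in> ?r ^^ (n - j)" using seg[of j n] f(2) that by simp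
    ultimately have "(u, v) \<in> ?r ^^ (i + (n - j))" unfolding relpow_add using \<open>f i = f j\<close> by auto
    then show False using least[of "i + (n - j)"] that by simp
  qed
  have "n \<noteq> 0" using f uv by metis
  moreover have "n \<noteq> 1" using f(3)[of 0] f(1,2) by auto
  ultimately have n2: "n \<ge> 2" by simp
  have "graph_cycle T (map f [0..<Suc n])"
    unfolding graph_cycle_def
  proof (intro conjI allI impI)
    show "3 \<le> length (map f [0..<Suc n])" using n2 by simp
    show "distinct (map f [0..<Suc n])"
      unfolding distinct_map
    proof
      show "inj_on f (set [0..<Suc n])"
      proof (rule inj_onI)
        fix x y assume "x \<in> set [0..<Suc n]" "y \<in> set [0..<Suc n]" "f x = f y"
        then show "x = y" using distinct[of x y] distinct[of y x] by (cases x y rule: linorder_cases) auto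
      qed
    qed simp
    fix i assume i: "i < length (map f [0..<Suc n])"
    show "{map f [0..<Suc n] ! i, map f [0..<Suc n] ! (Suc i mod length (map f [0..<Suc n]))} \<in> T"
    proof (cases "i = n")
      case True
      then show ?thesis using f(1,2) uv by (simp add: insert_commute del: upt_Suc)
    next
      case False
      then have "i < n" using i by simp
      then show ?thesis using f(3)[of i] by (simp del: upt_Suc)
    qed
  qed
  then show False using acyc by blast
qed

text \<open>The new node \<open>w\<close> has \<open>a\<close> as its only neighbour, whereas a node
  on a cycle has two different ones.\<close>

lemma acyclic_insert_leaf:
  assumes acyc: "\<not> (\<exists>vs. graph_cycle T vs)" and new: "w \<notin> \<Union>T" and "w \<noteq> a"
  shows "\<not> (\<exists>vs. graph_cycle (insert {w, a} T) vs)"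
proof
  assume "\<exists>vs. graph_cycle (insert {w, a} T) vs"
  then obtain vs where vs: "length vs \<ge> 3" "distinct vs"
    "\<And>i. i < length vs \<Longrightarrow> {vs ! i, vs ! (Suc i mod length vs)} \<in> insert {w, a} T"
    unfolding graph_cycle_def by blast
  let ?n = "length vs"
  show False
  proof (cases "w \<in> set vs")
    case False
    have "{vs ! i, vs ! (Suc i mod ?n)} \<in> T" if "i < ?n" for i
    proof -
      have "Suc i mod ?n < ?n" using vs(1) by (intro mod_less_divisor) linarith
      then have "vs ! i \<noteq> w" "vs ! (Suc i mod ?n) \<noteq> w" using False that nth_mem by metis+
      then show ?thesis using vs(3)[OF that] by (auto simp: doubleton_eq_iff)
    qed
    then have "graph_cycle T vs" unfolding graph_cycle_def using vs by blast
    then show False using acyc by blast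
  next
    case True
    then obtain i where i: "i < ?n" "vs ! i = w" by (auto simp: in_set_conv_nth)
    define j where "j = Suc i mod ?n"
    \<comment> \<open>The cyclic predecessor of \<open>i\<close>.\<close>
    define k where "k = (if i = 0 then ?n - 1 else i - 1)"
    have k: "k < ?n" "Suc k mod ?n = i" using i vs(1) by (auto simp: k_def)
    have j: "j < ?n" unfolding j_def using vs(1) by (intro mod_less_divisor) linarith
    have ji: "j \<noteq> i" "k \<noteq> i" "j \<noteq> k"
      using i vs(1) unfolding j_def k_def by (auto simp: mod_Suc split: if_splits)
    have "{w, vs ! j} \<in> insert {w, a} T" using vs(3)[OF i(1)] i(2) by (simp add: j_def)
    then have "{w, vs ! j} = {w, a}" using new by blast
    moreover have "{vs ! k, w} \<in> insert {w, a} T" using vs(3)[OF k(1)] k(2) i(2) by simp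
    then have "{vs ! k, w} = {w, a}" using new by blast
    ultimately have "vs ! j = a \<or> vs ! j = w" "vs ! k = a \<or> vs ! k = w" by (auto simp: doubleton_eq_iff)
    moreover have "vs ! j \<noteq> w" "vs ! k \<noteq> w" 
      using nth_eq_iff_index_eq[OF vs(2) j i(1)] nth_eq_iff_index_eq[OF vs(2) k(1) i(1)] ji i(2) by auto
    ultimately have "vs ! j = vs ! k" by simp
    then show False using nth_eq_iff_index_eq[OF vs(2) j k(1)] ji by simp
  qed
qed

lemma rtrancl_exits:
  assumes "(a, b) \<in> r\<^sup>*" "a \<in> X" "b \<notin> X"
  obtains x y where "(x, y) \<in> r" "x \<in> X" "y \<notin> X"
  using assms by (induction rule: rtrancl_induct) blast+

section \<open>Combinatorial facts about the ball, and constructions by attaching and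
  sealing\<close>

locale ball_complex = finite_complex B for B :: "'a::euclidean_space set set" +
  fixes d :: nat
  assumes d2: "d \<ge> 2" and sb: "simplicial_ball d B"
begin

abbreviation "Fac \<equiv> facets d B"
abbreviation "Rid \<equiv> faces (int d - 1) B"

definition cofac :: "'a set \<Rightarrow> 'a set set" where
  "cofac \<rho> = {\<Delta> \<in> Fac. \<rho> \<subseteq> \<Delta>}"

text \<open>The interior ridges. Since a ridge has one or two facets above it, the remaining ridges
  are those of the boundary (\<open>boundary_ridges'\<close>).\<close>

definition IR :: "'a set set" where
  "IR = {\<rho> \<in> Rid. card (cofac \<rho>) = 2}"

lemma chart: obtains D \<phi> \<psi> where "ball_chart B d D \<phi> \<psi>"
proof -
  obtain D :: "'a set" and \<phi> \<psi> where "compact D" "convex D" "aff_dim D = int d" "homeomorphism (\<Union>B) D \<phi> \<psi>"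
    using simplicial_ball_homeomorphism[OF sb] .
  then have "ball_chart B d D \<phi> \<psi>" by unfold_locales (use d2 in auto)
  then show thesis by (rule that)
qed

lemma Fac_B: "\<Delta> \<in> Fac \<longleftrightarrow> \<Delta> \<in> B \<and> aff_dim \<Delta> = int d" by (auto simp: faces_def)

lemma Rid_B: "\<rho> \<in> Rid \<longleftrightarrow> \<rho> \<in> B \<and> aff_dim \<rho> = int d - 1" by (auto simp: faces_def)

lemma in_facet: assumes "F \<in> B" obtains \<Delta> where "\<Delta> \<in> Fac" "F \<subseteq> \<Delta>"
proof -
  obtain D \<phi> \<psi> where "ball_chart B d D \<phi> \<psi>" by (rule chart)
  then interpret ball_chart B d D \<phi> \<psi> .
  show thesis using pure[OF assms] that Fac_B by blast
qed

lemma dim_le: assumes "F \<in> B" shows "aff_dim F \<le> int d"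
proof -
  obtain \<Delta> where "\<Delta> \<in> Fac" "F \<subseteq> \<Delta>" by (rule in_facet[OF assms])
  then show ?thesis using aff_dim_subset[of F \<Delta>] Fac_B by simp
qed

lemma card_cofac_le: assumes "\<rho> \<in> Rid" shows "card (cofac \<rho>) \<le> 2"
proof -
  obtain D \<phi> \<psi> where "ball_chart B d D \<phi> \<psi>" by (rule chart)
  then interpret ball_chart B d D \<phi> \<psi> .
  have "cofac \<rho> = {\<Delta> \<in> B. aff_dim \<Delta> = int d \<and> \<rho> \<subseteq> \<Delta>}" by (auto simp: cofac_def Fac_B)
  then show ?thesis using ridge_in_at_most_two[of \<rho>] assms Rid_B by simp
qed

lemma boundary_ridge: obtains \<rho> where "\<rho> \<in> Rid" "card (cofac \<rho>) = 1"
proof -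
  obtain D \<phi> \<psi> where "ball_chart B d D \<phi> \<psi>" by (rule chart)
  then interpret ball_chart B d D \<phi> \<psi> .
  have "cofac \<rho> = {\<Delta> \<in> B. aff_dim \<Delta> = int d \<and> \<rho> \<subseteq> \<Delta>}" for \<rho> by (auto simp: cofac_def Fac_B)
  then show thesis using boundary_ridge_exists Rid_B that by metis
qed

lemma star_connected:
  assumes "G \<in> B" "G \<noteq> {}" "\<Delta> \<in> Fac" "\<Delta>' \<in> Fac" "G \<subseteq> \<Delta>" "G \<subseteq> \<Delta>'"
  shows "(\<Delta>, \<Delta>') \<in> {(x, y). x \<in> Fac \<and> y \<in> Fac \<and> (\<exists>\<rho>\<in>Rid. G \<subseteq> \<rho> \<and> \<rho> \<subseteq> x \<and> \<rho> \<subseteq> y)}\<^sup>*"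
proof -
  obtain D \<phi> \<psi> where "ball_chart B d D \<phi> \<psi>" by (rule chart)
  then interpret ball_chart B d D \<phi> \<psi> .
  have path: "(\<Delta>, \<Delta>') \<in> {(\<Delta>, \<Delta>'). \<Delta> \<in> B \<and> aff_dim \<Delta> = int d \<and> \<Delta>' \<in> B \<and> aff_dim \<Delta>' = int d \<and>
      (\<exists>\<rho>\<in>B. aff_dim \<rho> = int d - 1 \<and> G \<subseteq> \<rho> \<and> \<rho> \<subseteq> \<Delta> \<and> \<rho> \<subseteq> \<Delta>')}\<^sup>*"
    using assms unfolding Fac_B by (intro star_strongly_connected) simp_all
  have sub: "{(\<Delta>, \<Delta>'). \<Delta> \<in> B \<and> aff_dim \<Delta> = int d \<and> \<Delta>' \<in> B \<and> aff_dim \<Delta>' = int d \<and>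
      (\<exists>\<rho>\<in>B. aff_dim \<rho> = int d - 1 \<and> G \<subseteq> \<rho> \<and> \<rho> \<subseteq> \<Delta> \<and> \<rho> \<subseteq> \<Delta>')}
    \<subseteq> {(x, y). x \<in> Fac \<and> y \<in> Fac \<and> (\<exists>\<rho>\<in>Rid. G \<subseteq> \<rho> \<and> \<rho> \<subseteq> x \<and> \<rho> \<subseteq> y)}"
    by (auto simp: Fac_B Rid_B)
  show ?thesis by (rule subsetD[OF rtrancl_mono[OF sub] path])
qed

lemma finFac: "finite Fac" and finRid: "finite Rid" and fincofac: "finite (cofac \<rho>)"
  using finB by (auto simp: faces_def cofac_def)

lemma facet_max: "\<Delta> \<in> Fac \<Longrightarrow> H \<in> B \<Longrightarrow> \<Delta> \<subseteq> H \<Longrightarrow> H = \<Delta>"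
  using dim_less[of \<Delta> H] dim_le[of H] Fac_B[of \<Delta>] by auto

lemma cofac_nonempty: assumes "\<rho> \<in> Rid" shows "cofac \<rho> \<noteq> {}"
proof -
  obtain \<Delta> where "\<Delta> \<in> Fac" "\<rho> \<subseteq> \<Delta>" using in_facet[of \<rho>] assms Rid_B by blast
  then show ?thesis by (auto simp: cofac_def)
qed

lemma card_cofac: "\<rho> \<in> Rid \<Longrightarrow> card (cofac \<rho>) = 1 \<or> card (cofac \<rho>) = 2"
  using card_cofac_le[of \<rho>] cofac_nonempty[of \<rho>] fincofac[of \<rho>] card_gt_0_iff[of "cofac \<rho>"] by fastforce

lemma cofac_pair: assumes "\<rho> \<in> Rid" "x \<in> cofac \<rho>" "y \<in> cofac \<rho>" "x \<noteq> y" shows "cofac \<rho> = {x, y}" "\<rho> \<in> IR"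
proof -
  have "card {x, y} = 2" using assms by simp
  moreover have "{x, y} \<subseteq> cofac \<rho>" using assms by simp
  ultimately show *: "cofac \<rho> = {x, y}" using card_seteq[OF fincofac, of "{x,y}"] card_cofac_le[OF assms(1)] by simp
  have "card (cofac \<rho>) = 2" unfolding * using assms(4) by simp
  then show "\<rho> \<in> IR" using assms(1) by (simp add: IR_def)
qed

lemma IR_pair: assumes "\<rho> \<in> IR" obtains x y where "x \<in> Fac" "y \<in> Fac" "x \<noteq> y" "cofac \<rho> = {x, y}"
proof -
  obtain x y where xy: "cofac \<rho> = {x, y}" "x \<noteq> y" using assms unfolding IR_def card_2_iff by blast
  then have "x \<in> cofac \<rho>" "y \<in> cofac \<rho>" by auto
  then show thesis using that[of x y] xy unfolding cofac_def by blast
qed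

text \<open>Consequently an arc of the dual graph determines its ridge; different ridges give
  different arcs.\<close>

lemma ridge_eq_Int:
  assumes "\<rho> \<in> Rid" "x \<in> Fac" "y \<in> Fac" "x \<noteq> y" "\<rho> \<subseteq> x" "\<rho> \<subseteq> y" shows "\<rho> = x \<inter> y"
proof -
  have B: "\<rho> \<in> B" "x \<in> B" "y \<in> B" "x \<inter> y \<in> B" using assms Fac_B Rid_B Int_in by auto
  have "x \<inter> y \<noteq> x" using facet_max[OF assms(2) B(3)] assms(4) by blast
  then have "aff_dim (x \<inter> y) < int d" using dim_less[OF B(4,2)] assms(2) Fac_B by auto
  moreover have "aff_dim \<rho> \<le> aff_dim (x \<inter> y)" using assms(5,6) by (intro aff_dim_subset) auto
  ultimately show ?thesis using eq_if_dim[OF B(1,4)] assms Rid_B by auto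
qed

lemma boundary_ridges: "faces (int d - 1) (boundary d B) = {\<rho> \<in> Rid. card (cofac \<rho>) = 1}"
proof -
  have c: "{\<Delta> \<in> Fac. \<rho> face_of \<Delta>} = cofac \<rho>" if "\<rho> \<in> Rid" for \<rho>
    using that face_iff_subset Fac_B Rid_B unfolding cofac_def by blast
  have r: "F = \<rho>" if "\<rho> \<in> Rid" "F face_of \<rho>" "aff_dim F = int d - 1" for F \<rho>
    using that face_in[of \<rho> F] Rid_B eq_if_dim[of F \<rho>] face_of_imp_subset[of F \<rho>] by auto
  have refl: "\<rho> face_of \<rho>" if "\<rho> \<in> Rid" for \<rho>
    using that Rid_B convexB by (simp add: face_of_refl)
  show ?thesis
  proof (intro subset_antisym subsetI)
    fix F assume "F \<in> faces (int d - 1) (boundary d B)"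
    then have F: "F \<in> boundary d B" "aff_dim F = int d - 1" by (simp_all add: faces_def)
    then obtain \<rho> where \<rho>: "\<rho> \<in> Rid" "card {\<Delta> \<in> Fac. \<rho> face_of \<Delta>} = 1" "F face_of \<rho>"
      unfolding boundary_def by blast
    then have "F = \<rho>" using r F(2) by blast
    then show "F \<in> {\<rho> \<in> Rid. card (cofac \<rho>) = 1}" using \<rho> c by simp
  next
    fix F assume F: "F \<in> {\<rho> \<in> Rid. card (cofac \<rho>) = 1}"
    then have "card {\<Delta> \<in> Fac. F face_of \<Delta>} = 1" using c by simp
    then have "F \<in> boundary d B" unfolding boundary_def using F refl by blast
    then show "F \<in> faces (int d - 1) (boundary d B)" using F Rid_B by (simp add: faces_def)
  qed
qed

lemma boundary_ridges': "faces (int d - 1) (boundary d B) = Rid - IR"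
proof -
  have "\<rho> \<in> {\<rho> \<in> Rid. card (cofac \<rho>) = 1} \<longleftrightarrow> \<rho> \<in> Rid - IR" for \<rho>
    using card_cofac[of \<rho>] by (auto simp: IR_def)
  then show ?thesis unfolding boundary_ridges by blast
qed

text \<open>Handshake argument around \<open>G\<close>: let \<open>X\<close> be the facets reachable
  from \<open>\<Delta>\<close> without crossing \<open>s\<close>, and count incidences between
  \<open>X\<close> and the ridges around \<open>G\<close> other than \<open>s\<close>. Each ridge
  contributes an even number. If \<open>\<Delta>'\<close> were not in \<open>X\<close>, each facet
  of \<open>X\<close> would contribute two except \<open>\<Delta>\<close>, which contributes one, so
  the total would be odd.\<close>

lemma odd_star_parity:
  assumes G: "G \<in> B" "aff_dim G = int d - 2" and s: "s \<in> Rid" "G \<subseteq> s"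
    and \<Delta>: "\<Delta> \<in> cofac s" "\<Delta>' \<in> cofac s" "\<Delta> \<noteq> \<Delta>'"
    and all2: "\<And>r. r \<in> Rid \<Longrightarrow> G \<subseteq> r \<Longrightarrow> r \<noteq> s \<Longrightarrow> card (cofac r) = 2"
  shows "(\<Delta>, \<Delta>') \<in> {(x, y). x \<in> Fac \<and> y \<in> Fac \<and> (\<exists>r\<in>Rid. G \<subseteq> r \<and> r \<noteq> s \<and> r \<subseteq> x \<and> r \<subseteq> y)}\<^sup>*" (is "_ \<in> ?r\<^sup>*")
proof (rule ccontr)
  assume no: "(\<Delta>, \<Delta>') \<notin> ?r\<^sup>*"
  define X where "X = {x \<in> Fac. G \<subseteq> x \<and> (\<Delta>, x) \<in> ?r\<^sup>*}"
  define RR where "RR = {r \<in> Rid. G \<subseteq> r \<and> r \<noteq> s}"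
  have finX: "finite X" "finite RR" using finFac finRid by (auto simp: X_def RR_def)
  have \<Delta>F: "\<Delta> \<in> Fac" "\<Delta>' \<in> Fac" "s \<subseteq> \<Delta>" "s \<subseteq> \<Delta>'" using \<Delta> by (auto simp: cofac_def)
  have \<Delta>X: "\<Delta> \<in> X" "\<Delta>' \<notin> X" using \<Delta>F s(2) no by (auto simp: X_def)
  have cs: "cofac s = {\<Delta>, \<Delta>'}" using cofac_pair(1)[OF s(1) \<Delta>] .
  have two: "card {r \<in> Rid. G \<subseteq> r \<and> r \<subseteq> x} = 2" if "x \<in> X" for x
  proof -
    have x: "x \<in> B" "G \<subseteq> x" "aff_dim x = int d" using that Fac_B by (auto simp: X_def)
    have "{r \<in> Rid. G \<subseteq> r \<and> r \<subseteq> x} = {H \<in> B. G \<subseteq> H \<and> H \<subseteq> x \<and> aff_dim H = aff_dim G + 1}"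
      using G(2) by (auto simp: faces_def)
    then show ?thesis using codim_one_between[OF G(1) x(1,2)] G(2) x(3) by simp
  qed
  \<comment> \<open>Every facet around \<open>G\<close> has exactly two ridges containing
    \<open>G\<close>. Only \<open>\<Delta>\<close> loses one of them, since \<open>s\<close> lies in
    no other member of \<open>X\<close>.\<close>
  have c1: "card {r \<in> RR. r \<subseteq> x} = (if x = \<Delta> then 1 else 2)" if x: "x \<in> X" for x
  proof (cases "x = \<Delta>")
    case True
    have eq: "{r \<in> RR. r \<subseteq> x} = {r \<in> Rid. G \<subseteq> r \<and> r \<subseteq> x} - {s}" by (auto simp: RR_def)
    have "s \<in> {r \<in> Rid. G \<subseteq> r \<and> r \<subseteq> x}" using s \<Delta>F True by simp
    then show ?thesis unfolding eq using two[OF x] finRid True by (simp add: card_Diff_singleton)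
  next
    case False
    have "\<not> s \<subseteq> x"
    proof
      assume "s \<subseteq> x"
      then have "x \<in> cofac s" using x by (auto simp: cofac_def X_def)
      then show False using cs False \<Delta>X x by auto
    qed
    then have eq: "{r \<in> RR. r \<subseteq> x} = {r \<in> Rid. G \<subseteq> r \<and> r \<subseteq> x}" by (auto simp: RR_def)
    show ?thesis unfolding eq using two[OF x] False by simp
  qed
  \<comment> \<open>\<open>X\<close> is closed under crossing \<open>r\<close>, so it contains both
    facets above \<open>r\<close> or neither.\<close>
  have c2: "even (card {x \<in> X. r \<subseteq> x})" if r: "r \<in> RR" for r
  proof (cases "\<exists>x\<in>X. r \<subseteq> x")
    case True
    then obtain x where x: "x \<in> X" "r \<subseteq> x" by blast
    have "cofac r \<subseteq> X"
    proof
      fix y assume y: "y \<in> cofac r"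
      have "(x, y) \<in> ?r" using x y r by (auto simp: X_def cofac_def RR_def)
      moreover have "(\<Delta>, x) \<in> ?r\<^sup>*" using x by (simp add: X_def)
      ultimately have "(\<Delta>, y) \<in> ?r\<^sup>*" by (rule rtrancl_into_rtrancl[rotated])
      then show "y \<in> X" using y r by (auto simp: X_def cofac_def RR_def)
    qed
    then have "{x \<in> X. r \<subseteq> x} = cofac r" by (auto simp: X_def cofac_def)
    then show ?thesis using all2[of r] r by (simp add: RR_def)
  next
    case False
    then have "{x \<in> X. r \<subseteq> x} = {}" by blast
    then show ?thesis by (simp only: card.empty even_zero)
  qed
  have "(\<Sum>x\<in>X. card {r \<in> RR. r \<subseteq> x}) = (\<Sum>x\<in>X. \<Sum>r\<in>RR. if r \<subseteq> x then 1 else 0)"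
    using sum.inter_filter[OF finX(2), of "\<lambda>_. 1::nat"] by (intro sum.cong refl) simp
  also have "\<dots> = (\<Sum>r\<in>RR. \<Sum>x\<in>X. if r \<subseteq> x then 1 else 0)" by (rule sum.swap)
  also have "\<dots> = (\<Sum>r\<in>RR. card {x \<in> X. r \<subseteq> x})"
    using sum.inter_filter[OF finX(1), of "\<lambda>_. 1::nat"] by (intro sum.cong refl) simp
  finally have "even (\<Sum>x\<in>X. card {r \<in> RR. r \<subseteq> x})" using c2 by (simp add: dvd_sum)
  moreover have "(\<Sum>x\<in>X. card {r \<in> RR. r \<subseteq> x}) = (\<Sum>x\<in>X. if x = \<Delta> then 1 else 2)"
    by (intro sum.cong refl) (rule c1)
  moreover have "\<dots> = 1 + (\<Sum>x\<in>X - {\<Delta>}. 2)"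
    using \<Delta>X finX by (simp add: sum.remove[of X \<Delta>])
  ultimately show False by simp
qed

text \<open>The state is the pair of the facets present and the ridges across which they are
  glued.\<close>

definition attach :: "'a set set \<times> 'a set set \<Rightarrow> 'a set set \<times> 'a set set \<Rightarrow> bool" where
  "attach p q \<longleftrightarrow> (\<exists>\<Delta> \<Delta>0 \<rho>. \<Delta> \<in> Fac \<and> \<Delta> \<notin> fst p \<and> \<Delta>0 \<in> fst p \<and> \<rho> \<in> Rid \<and> \<rho> \<subseteq> \<Delta> \<and> \<rho> \<subseteq> \<Delta>0 \<and>
     q = (insert \<Delta> (fst p), insert \<rho> (snd p)))"

text \<open>Here all facets are present and the state is the set of glued ridges. The condition at
  \<open>F\<close> has two readings: in what is left of the ball, \<open>F\<close> is a free face of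
  \<open>s\<close>; in the glued space, the two copies of \<open>s\<close> already share the copy of
  \<open>F\<close>.\<close>

definition seal :: "'a set set \<Rightarrow> 'a set set \<Rightarrow> bool" where
  "seal R R' \<longleftrightarrow> (\<exists>s F. s \<in> IR \<and> s \<notin> R \<and> F \<in> B \<and> aff_dim F = int d - 2 \<and> F \<subseteq> s \<and>
     (\<forall>r\<in>Rid. F \<subseteq> r \<longrightarrow> r \<in> insert s R) \<and> R' = insert s R)"

definition constructible :: bool where
  "constructible \<longleftrightarrow> (\<exists>\<Delta>\<in>Fac. \<exists>R. attach\<^sup>*\<^sup>* ({\<Delta>}, {}) (Fac, R) \<and> seal\<^sup>*\<^sup>* R IR)"

lemma elementary_collapse_iff:
  assumes "X \<subseteq> B"
  shows "elementary_collapse X Y \<longleftrightarrow> (\<exists>\<sigma>\<in>X. \<exists>\<Sigma>\<in>X. \<sigma> \<noteq> {} \<and> \<sigma> \<subseteq> \<Sigma> \<and> aff_dim \<Sigma> = aff_dim \<sigma> + 1 \<and>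
     (\<forall>F\<in>X. \<sigma> \<subseteq> F \<and> F \<noteq> \<sigma> \<longrightarrow> F = \<Sigma>) \<and> Y = X - {\<sigma>, \<Sigma>})"
proof -
  have f: "\<sigma> face_of F \<longleftrightarrow> \<sigma> \<subseteq> F" if "\<sigma> \<in> X" "F \<in> X" for \<sigma> F
    by (rule face_iff_subset) (use that assms in auto)
  have "(\<forall>F\<in>X. \<sigma> face_of F \<and> F \<noteq> \<sigma> \<longrightarrow> F = \<Sigma>) \<longleftrightarrow> (\<forall>F\<in>X. \<sigma> \<subseteq> F \<and> F \<noteq> \<sigma> \<longrightarrow> F = \<Sigma>)"
    if "\<sigma> \<in> X" for \<sigma> \<Sigma>
    by (intro ball_cong refl) (simp add: f[OF that])
  then show ?thesis unfolding elementary_collapse_def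
    by (intro bex_cong refl) (simp add: f)
qed

lemma elementary_collapse_subset: "elementary_collapse X Y \<Longrightarrow> Y \<subseteq> X"
  by (auto simp: elementary_collapse_def)

lemma collapses_subset: "elementary_collapse\<^sup>*\<^sup>* X Y \<Longrightarrow> Y \<subseteq> X"
  by (induction rule: rtranclp_induct) (use elementary_collapse_subset in blast)+

definition down_closed :: "'a set set \<Rightarrow> bool" where
  "down_closed X \<longleftrightarrow> (\<forall>F\<in>X. \<forall>G\<in>B. G \<subseteq> F \<longrightarrow> G \<in> X)"

lemma subcomplexI:
  assumes "X \<subseteq> B" "down_closed X" shows "subcomplex X B"
  unfolding subcomplex_def simplicial_complex_def
proof (intro conjI ballI allI impI)
  show "finite X" using assms finB finite_subset by blast
  show "\<exists>n. n simplex S" if "S \<in> X" for S using that assms is_simplex by blast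
  show "F \<in> X" if "S \<in> X \<and> F face_of S" for F S
    using that assms face_in[of S F] face_of_imp_subset[of F S] unfolding down_closed_def by blast
  show "S \<inter> S' face_of S" if "S \<in> X \<and> S' \<in> X" for S S' using that assms Int_face by blast
qed (use assms in auto)

lemma dim_cases: assumes "F \<in> B" "F \<notin> Fac" "F \<notin> Rid" shows "aff_dim F \<le> int d - 2"
  using assms dim_le[OF assms(1)] unfolding faces_def by auto

end

section \<open>From constructions to spanning trees, and from trees to collapses\<close>

context ball_complex
begin

lemma dual_arcsE:
  assumes "e \<in> dual_arcs d B"
  obtains a b \<rho> where "e = {a, b}" "a \<in> Fac" "b \<in> Fac" "a \<noteq> b" "\<rho> \<in> Rid" "\<rho> face_of a" "\<rho> face_of b"
  using assms unfolding dual_arcs_def by blast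

text \<open>A ridge lies in at most two facets, so the ends of an arc hitting it are all the facets
  above it.\<close>

lemma hit_cofac:
  assumes T: "T \<subseteq> dual_arcs d B" and \<rho>: "\<rho> \<in> Rid"
  shows "hit_by T \<rho> \<longleftrightarrow> (\<exists>x y. x \<noteq> y \<and> {x, y} \<in> T \<and> cofac \<rho> = {x, y})"
proof
  assume "hit_by T \<rho>"
  then obtain e where e: "e \<in> T" "\<And>\<Delta>. \<Delta> \<in> e \<Longrightarrow> \<rho> face_of \<Delta>" unfolding hit_by_def by blast
  obtain x y where xy: "e = {x, y}" "x \<in> Fac" "y \<in> Fac" "x \<noteq> y"
    by (rule dual_arcsE[OF subsetD[OF T e(1)]])
  have "x \<in> cofac \<rho>" "y \<in> cofac \<rho>"
    using face_of_imp_subset[OF e(2)[of x]] face_of_imp_subset[OF e(2)[of y]] xy by (simp_all add: cofac_def)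
  then have "cofac \<rho> = {x, y}" using cofac_pair(1)[OF \<rho>] xy(4) by blast
  then show "\<exists>x y. x \<noteq> y \<and> {x, y} \<in> T \<and> cofac \<rho> = {x, y}" using e(1) xy by blast
next
  assume "\<exists>x y. x \<noteq> y \<and> {x, y} \<in> T \<and> cofac \<rho> = {x, y}"
  then obtain x y where xy: "{x, y} \<in> T" "cofac \<rho> = {x, y}" by blast
  have "\<rho> face_of \<Delta>" if "\<Delta> \<in> {x, y}" for \<Delta>
  proof -
    have "\<Delta> \<in> cofac \<rho>" using that xy(2) by simp
    then have "\<Delta> \<in> B" "\<rho> \<subseteq> \<Delta>" by (auto simp: cofac_def Fac_B)
    then show ?thesis using face_iff_subset[of \<rho> \<Delta>] \<rho> Rid_B by simp
  qed
  then show "hit_by T \<rho>" unfolding hit_by_def using xy(1) by blast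
qed

lemma hit_cofacE:
  assumes "T \<subseteq> dual_arcs d B" "\<rho> \<in> Rid" "hit_by T \<rho>"
  obtains x y where "x \<noteq> y" "{x, y} \<in> T" "cofac \<rho> = {x, y}"
  using iffD1[OF hit_cofac[OF assms(1,2)] assms(3)] by blast

lemma dual_arc_ridge:
  assumes "{x, y} \<in> dual_arcs d B" "x \<noteq> y"
  obtains \<rho> where "\<rho> \<in> Rid" "cofac \<rho> = {x, y}" "x \<in> Fac" "y \<in> Fac"
proof -
  obtain a b \<rho> where ab: "{x, y} = {a, b}" "a \<in> Fac" "b \<in> Fac" "a \<noteq> b" "\<rho> \<in> Rid" "\<rho> face_of a" "\<rho> face_of b"
    by (rule dual_arcsE[OF assms(1)])
  have "a \<in> cofac \<rho>" "b \<in> cofac \<rho>"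
    using ab(2,3) face_of_imp_subset[OF ab(6)] face_of_imp_subset[OF ab(7)] by (simp_all add: cofac_def)
  then have "cofac \<rho> = {x, y}" unfolding ab(1) using cofac_pair(1)[OF ab(5)] ab(4) by blast
  moreover have "x \<in> Fac \<and> y \<in> Fac" using ab(1,2,3) unfolding doubleton_eq_iff by metis
  ultimately show thesis using that[OF ab(5)] by blast
qed

lemma dual_arcI:
  assumes "x \<in> Fac" "y \<in> Fac" "x \<noteq> y" "\<rho> \<in> Rid" "\<rho> \<subseteq> x" "\<rho> \<subseteq> y"
  shows "{x, y} \<in> dual_arcs d B"
proof -
  have "\<rho> face_of x" "\<rho> face_of y"
    using assms face_iff_subset[of \<rho> x] face_iff_subset[of \<rho> y] Fac_B Rid_B by auto
  then have "\<exists>\<rho>\<in>Rid. \<rho> face_of x \<and> \<rho> face_of y" using assms(4) by blast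
  then show ?thesis unfolding dual_arcs_def mem_Collect_eq using assms(1-3)
    by (intro exI[of _ x] exI[of _ y] conjI refl)
qed

text \<open>The point is that every face of dimension at most d-2 lies in a ridge not hit by
  \<open>T\<close>. If all ridges around a (d-2)-face \<open>G\<close> were hit, then by
  \<open>odd_star_parity\<close> the two facets of one of them would be joined in \<open>T\<close>
  by the arcs of the others, and \<open>T\<close> would contain a cycle.\<close>

lemma K_complex_eq:
  assumes T: "dual_spanning_tree d B T"
  shows "K_complex d B T = B - Fac - {\<rho> \<in> Rid. hit_by T \<rho>}"
proof (intro subset_antisym subsetI)
  fix F assume "F \<in> K_complex d B T"
  then obtain \<rho> where \<rho>: "\<rho> \<in> Rid" "\<not> hit_by T \<rho>" "F face_of \<rho>" unfolding K_complex_def by blast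
  have B: "\<rho> \<in> B" "F \<in> B" "F \<subseteq> \<rho>" using \<rho>(1) Rid_B face_in[OF _ \<rho>(3)] face_of_imp_subset[OF \<rho>(3)] by auto
  have le: "aff_dim F \<le> int d - 1" using aff_dim_subset[OF B(3)] \<rho>(1) Rid_B by simp
  moreover have "F = \<rho>" if "F \<in> Rid" using eq_if_dim[OF B(2,1,3)] that \<rho>(1) Rid_B by simp
  ultimately show "F \<in> B - Fac - {\<rho> \<in> Rid. hit_by T \<rho>}" using B(2) \<rho>(2) Fac_B by auto
next
  fix F assume F: "F \<in> B - Fac - {\<rho> \<in> Rid. hit_by T \<rho>}"
  have tree: "T \<subseteq> dual_arcs d B" "\<not> (\<exists>vs. graph_cycle T vs)" using T by (auto simp: dual_spanning_tree_def)
  have "\<exists>\<rho>\<in>Rid. \<not> hit_by T \<rho> \<and> F \<subseteq> \<rho>"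
  proof (cases "F \<in> Rid")
    case True
    then show ?thesis using F by blast
  next
    case False
    have FB: "F \<in> B" using F by blast
    have dF: "aff_dim F \<le> int d - 2" using dim_cases[of F] F False by blast
    obtain \<Delta>0 where \<Delta>0: "\<Delta>0 \<in> Fac" "F \<subseteq> \<Delta>0" by (rule in_facet[OF FB])
    have \<Delta>0B: "\<Delta>0 \<in> B" "aff_dim \<Delta>0 = int d" using \<Delta>0 Fac_B by auto
    obtain G where G: "G \<in> B" "F \<subseteq> G" "G \<subseteq> \<Delta>0" "aff_dim G = int d - 2"
      by (rule intermediate_face[OF FB \<Delta>0B(1) \<Delta>0(2) dF]) (use \<Delta>0B in auto)
    obtain s where s: "s \<in> B" "G \<subseteq> s" "aff_dim s = int d - 1"
      by (rule intermediate_face[OF G(1) \<Delta>0B(1) G(3), of "int d - 1"]) (use \<Delta>0B G(4) in auto)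
    have sR: "s \<in> Rid" using s Rid_B by simp
    show ?thesis
    proof (rule ccontr)
      assume "\<not> ?thesis"
      then have hit: "hit_by T r" if "r \<in> Rid" "G \<subseteq> r" for r using that G(2) by blast
      obtain x y where xy: "x \<noteq> y" "{x, y} \<in> T" "cofac s = {x, y}"
        by (rule hit_cofacE[OF tree(1) sR hit[OF sR s(2)]])
      have "(x, y) \<in> {(x, y). x \<in> Fac \<and> y \<in> Fac \<and> (\<exists>r\<in>Rid. G \<subseteq> r \<and> r \<noteq> s \<and> r \<subseteq> x \<and> r \<subseteq> y)}\<^sup>*"
      proof (rule odd_star_parity[OF G(1,4) sR s(2)])
        show "card (cofac r) = 2" if r: "r \<in> Rid" "G \<subseteq> r" for r
        proof -
          obtain a b where "a \<noteq> b" "cofac r = {a, b}" by (rule hit_cofacE[OF tree(1) r(1) hit[OF r]])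
          then show ?thesis by simp
        qed
      qed (use xy in auto)
      \<comment> \<open>A step across a hit ridge other than \<open>s\<close> is an arc of
        \<open>T\<close>, and it differs from \<open>{x, y}\<close> because an arc determines its
        ridge.\<close>
      moreover have "{(x, y). x \<in> Fac \<and> y \<in> Fac \<and> (\<exists>r\<in>Rid. G \<subseteq> r \<and> r \<noteq> s \<and> r \<subseteq> x \<and> r \<subseteq> y)}
          \<subseteq> ({(a, b). {a, b} \<in> T \<and> {a, b} \<noteq> {x, y}})\<^sup>*"
      proof clarify
        fix a b r assume ab: "a \<in> Fac" "b \<in> Fac" "r \<in> Rid" "G \<subseteq> r" "r \<noteq> s" "r \<subseteq> a" "r \<subseteq> b"
        show "(a, b) \<in> ({(a, b). {a, b} \<in> T \<and> {a, b} \<noteq> {x, y}})\<^sup>*"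
        proof (cases "a = b")
          case False
          have c: "cofac r = {a, b}" using cofac_pair(1)[OF ab(3), of a b] ab False by (simp add: cofac_def)
          obtain a' b' where "{a', b'} \<in> T" "cofac r = {a', b'}"
            by (rule hit_cofacE[OF tree(1) ab(3) hit[OF ab(3,4)]])
          then have "{a, b} \<in> T" using c by simp
          moreover have "{a, b} \<noteq> {x, y}"
          proof
            assume eq: "{a, b} = {x, y}"
            have "x \<in> cofac s" "y \<in> cofac s" "x \<in> cofac r" "y \<in> cofac r" using xy(3) c eq by auto
            then have "s = x \<inter> y" "r = x \<inter> y"
              using ridge_eq_Int[OF sR, of x y] ridge_eq_Int[OF ab(3), of x y] xy(1) by (auto simp: cofac_def)
            then show False using ab(5) by simp
          qed
          ultimately show ?thesis by blast
        qed simp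
      qed
      ultimately have "(x, y) \<in> {(a, b). {a, b} \<in> T \<and> {a, b} \<noteq> {x, y}}\<^sup>*"
        by (rule subsetD[OF rtrancl_subset_rtrancl, rotated])
      then show False using acyclic_bridge[OF tree(2) xy(2,1)] by simp
    qed
  qed
  then obtain \<rho> where "\<rho> \<in> Rid" "\<not> hit_by T \<rho>" "F \<subseteq> \<rho>" by blast
  then have "F face_of \<rho>" using face_iff_subset[of F \<rho>] F Rid_B by simp
  then show "F \<in> K_complex d B T" unfolding K_complex_def using \<open>\<rho> \<in> Rid\<close> \<open>\<not> hit_by T \<rho>\<close> by blast
qed

text \<open>Sealing \<open>s\<close> at \<open>F\<close> is the elementary collapse of the pair
  \<open>(F, s)\<close>: no facets are left, and \<open>s\<close> is the only remaining ridge
  containing \<open>F\<close>. The invariants carried along are what makes the end result a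
  seepage.\<close>

lemma seal_collapse:
  assumes "seal\<^sup>*\<^sup>* R R'" "R \<subseteq> IR"
  shows "R' \<subseteq> IR \<and> (\<exists>X. B - Fac - R \<searrow> X \<and> X \<subseteq> B \<and> down_closed X \<and> X \<inter> Fac = {} \<and> X \<inter> Rid = Rid - R')"
  using assms
proof (induction rule: rtranclp_induct)
  case base
  have "down_closed (B - Fac - R)"
    unfolding down_closed_def
  proof (intro ballI impI)
    fix F G assume F: "F \<in> B - Fac - R" and G: "G \<in> B" "G \<subseteq> F"
    have "G \<notin> Fac" using facet_max[of G F] F G by blast
    moreover have "G \<notin> R"
    proof
      assume "G \<in> R"
      then have "G \<in> Rid" using base by (auto simp: IR_def)
      have "aff_dim G \<le> aff_dim F" using G by (intro aff_dim_subset)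
      then have "F \<in> Rid" using dim_cases[of F] F \<open>G \<in> Rid\<close> Rid_B by force
      then have "G = F" using eq_if_dim[of G F] F G \<open>G \<in> Rid\<close> Rid_B by simp
      then show False using F \<open>G \<in> R\<close> by simp
    qed
    ultimately show "G \<in> B - Fac - R" using G by simp
  qed
  moreover have "(B - Fac - R) \<inter> Rid = Rid - R" unfolding faces_def by auto
  moreover have "B - Fac - R \<searrow> B - Fac - R" by (simp add: collapses_onto_def)
  moreover have "B - Fac - R \<subseteq> B" "(B - Fac - R) \<inter> Fac = {}" by blast+
  ultimately show ?case using base by blast
next
  case (step R1 R2)
  then obtain X where R1: "R1 \<subseteq> IR" and X: "B - Fac - R \<searrow> X" "X \<subseteq> B" "down_closed X" "X \<inter> Fac = {}" "X \<inter> Rid = Rid - R1"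
    by blast
  obtain s F where s: "s \<in> IR" "s \<notin> R1" "F \<in> B" "aff_dim F = int d - 2" "F \<subseteq> s"
    "\<And>r. r \<in> Rid \<Longrightarrow> F \<subseteq> r \<Longrightarrow> r \<in> insert s R1" "R2 = insert s R1"
    using step(2) unfolding seal_def by blast
  have sR: "s \<in> Rid" "s \<in> B" "aff_dim s = int d - 1" using s(1) Rid_B by (auto simp: IR_def)
  have sX: "s \<in> X" using X(5) sR s(2) by blast
  have FX: "F \<in> X" using X(3) sX s(3,5) unfolding down_closed_def by blast
  have free: "H = s" if H: "H \<in> X" "F \<subseteq> H" "H \<noteq> F" for H
  proof -
    have HB: "H \<in> B" "H \<notin> Fac" using H X by auto
    have "aff_dim F < aff_dim H" using dim_less[of F H] s(3) HB H by auto
    then have "H \<in> Rid" using dim_cases[OF HB] s(4) by force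
    then show ?thesis using s(6)[of H] H X(5) by blast
  qed
  have "elementary_collapse X (X - {F, s})"
    unfolding elementary_collapse_iff[OF X(2)]
  proof (rule bexI[of _ F], rule bexI[of _ s], intro conjI ballI impI)
    show "F \<noteq> {}" using s(4) d2 by auto
    show "aff_dim s = aff_dim F + 1" using s(4) sR by simp
    show "H = s" if "H \<in> X" "F \<subseteq> H \<and> H \<noteq> F" for H using free that by blast
  qed (use s FX sX in auto)
  then have "B - Fac - R \<searrow> X - {F, s}" using X(1) unfolding collapses_onto_def by (rule rtranclp.rtrancl_into_rtrancl[rotated])
  moreover have "down_closed (X - {F, s})"
    unfolding down_closed_def
  proof (intro ballI impI)
    fix H G assume H: "H \<in> X - {F, s}" and G: "G \<in> B" "G \<subseteq> H"
    have "G \<in> X" using X(3) H G unfolding down_closed_def by blast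
    moreover have "G \<noteq> F" using free[of H] H G by blast
    moreover have "G \<noteq> s" using free[of H] H G s(5) by blast
    ultimately show "G \<in> X - {F, s}" by blast
  qed
  moreover have "(X - {F, s}) \<inter> Rid = Rid - R2"
  proof -
    have "F \<notin> Rid" using s(4) Rid_B by simp
    then show ?thesis using X(5) s(7) by blast
  qed
  moreover have "R2 \<subseteq> IR" using R1 s(1,7) by simp
  moreover have "X - {F, s} \<subseteq> B" "(X - {F, s}) \<inter> Fac = {}" using X(2,4) by blast+
  ultimately show ?case by blast
qed

lemma seepageI:
  assumes X: "X \<subseteq> B" "down_closed X" "X \<inter> Fac = {}" "X \<inter> Rid = Rid - IR"
  shows "seepage d B X"
  unfolding seepage_def boundary_ridges'
proof (intro conjI ballI)
  show "subcomplex X B" using subcomplexI X by blast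
  show "aff_dim F \<le> int d - 1" if "F \<in> X" for F
  proof -
    have F: "F \<in> B" "F \<notin> Fac" using that X by auto
    then show ?thesis using dim_le[OF F(1)] Fac_B[of F] by auto
  qed
  obtain \<rho> where "\<rho> \<in> Rid" "card (cofac \<rho>) = 1" by (rule boundary_ridge)
  then have "\<rho> \<in> Rid - IR" by (simp add: IR_def)
  then have "\<rho> \<in> X" using X(4) by blast
  then show "\<exists>F\<in>X. aff_dim F = int d - 1" using \<open>\<rho> \<in> Rid\<close> Rid_B by blast
  have "faces (int d - 1) X = X \<inter> Rid" using X(1) unfolding faces_def by blast
  then show "faces (int d - 1) X = Rid - IR" using X(4) by simp
qed

lemma seepageD:
  assumes "seepage d B C"
  shows "C \<subseteq> B" "down_closed C" "C \<inter> Fac = {}" "C \<inter> Rid = Rid - IR"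
proof -
  show CB: "C \<subseteq> B" using assms by (auto simp: seepage_def subcomplex_def)
  have sc: "simplicial_complex C" using assms by (auto simp: seepage_def subcomplex_def)
  show "down_closed C" unfolding down_closed_def
  proof (intro ballI impI)
    fix F G assume "F \<in> C" "G \<in> B" "G \<subseteq> F"
    then have "G face_of F" using face_iff_subset[of G F] CB by blast
    then show "G \<in> C" using sc \<open>F \<in> C\<close> unfolding simplicial_complex_def by blast
  qed
  show "C \<inter> Fac = {}"
  proof -
    have "aff_dim F \<le> int d - 1" if "F \<in> C" for F using assms that by (simp add: seepage_def)
    then have "F \<notin> Fac" if "F \<in> C" for F using that Fac_B[of F] by fastforce
    then show ?thesis by blast
  qed
  have "faces (int d - 1) C = C \<inter> Rid" using CB unfolding faces_def by blast
  then show "C \<inter> Rid = Rid - IR" using assms unfolding seepage_def boundary_ridges' by simp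
qed

text \<open>Each attachment adds a leaf to the tree, which keeps it acyclic. The new arc hits only
  the ridge just used, because two facets share at most one ridge.\<close>

lemma attach_tree:
  assumes "attach\<^sup>*\<^sup>* ({\<Delta>}, {}) p" "\<Delta> \<in> Fac"
  shows "fst p \<subseteq> Fac \<and> \<Delta> \<in> fst p \<and> snd p \<subseteq> IR \<and>
    (\<exists>T. T \<subseteq> dual_arcs d B \<and> \<Union>T \<subseteq> fst p \<and> (\<forall>u\<in>fst p. (\<Delta>, u) \<in> {(x, y). {x, y} \<in> T}\<^sup>*) \<and>
      \<not> (\<exists>vs. graph_cycle T vs) \<and> (\<forall>\<rho>\<in>Rid. hit_by T \<rho> \<longleftrightarrow> \<rho> \<in> snd p))"
  using assms
proof (induction rule: rtranclp_induct)
  case base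
  have "\<not> graph_cycle {} vs" for vs :: "'a set list"
    unfolding graph_cycle_def by (cases vs) auto
  then have "\<not> (\<exists>vs :: 'a set list. graph_cycle {} vs)" by blast
  then show ?case using base by (intro conjI exI[of _ "{}"]) (simp_all add: hit_by_def)
next
  case (step p q)
  then obtain T where p: "fst p \<subseteq> Fac" "\<Delta> \<in> fst p" "snd p \<subseteq> IR" and
    T: "T \<subseteq> dual_arcs d B" "\<Union>T \<subseteq> fst p" "\<And>u. u \<in> fst p \<Longrightarrow> (\<Delta>, u) \<in> {(x, y). {x, y} \<in> T}\<^sup>*"
      "\<not> (\<exists>vs. graph_cycle T vs)" "\<And>\<rho>. \<rho> \<in> Rid \<Longrightarrow> hit_by T \<rho> \<longleftrightarrow> \<rho> \<in> snd p"
    by blast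
  obtain w a \<rho> where w: "w \<in> Fac" "w \<notin> fst p" "a \<in> fst p" "\<rho> \<in> Rid" "\<rho> \<subseteq> w" "\<rho> \<subseteq> a"
    "q = (insert w (fst p), insert \<rho> (snd p))"
    using step(2) unfolding attach_def by blast
  have aF: "a \<in> Fac" "w \<noteq> a" using w p by auto
  have \<rho>c: "cofac \<rho> = {w, a}" "\<rho> \<in> IR"
    using cofac_pair[OF w(4), of w a] w aF by (auto simp: cofac_def)
  define T' where "T' = insert {w, a} T"
  have arc: "{w, a} \<in> dual_arcs d B" by (rule dual_arcI[OF w(1) aF(1) aF(2) w(4,5,6)])
  have T'd: "T' \<subseteq> dual_arcs d B" using T(1) arc by (simp add: T'_def)
  have sub: "{(x, y). {x, y} \<in> T}\<^sup>* \<subseteq> {(x, y). {x, y} \<in> T'}\<^sup>*"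
    by (rule rtrancl_mono) (auto simp: T'_def)
  have reach: "(\<Delta>, u) \<in> {(x, y). {x, y} \<in> T'}\<^sup>*" if "u \<in> insert w (fst p)" for u
  proof (cases "u = w")
    case True
    have "(\<Delta>, a) \<in> {(x, y). {x, y} \<in> T'}\<^sup>*" using T(3)[OF w(3)] sub by blast
    moreover have "(a, w) \<in> {(x, y). {x, y} \<in> T'}" by (simp add: T'_def insert_commute)
    ultimately show ?thesis unfolding True by (rule rtrancl_into_rtrancl)
  next
    case False
    then show ?thesis using that T(3)[of u] sub by blast
  qed
  have acyc: "\<not> (\<exists>vs. graph_cycle T' vs)" unfolding T'_def
    by (rule acyclic_insert_leaf[OF T(4) _ aF(2)]) (use T(2) w(2) in blast)
  have hit: "hit_by T' r \<longleftrightarrow> r \<in> insert \<rho> (snd p)" if r: "r \<in> Rid" for r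
  proof -
    have "hit_by T' r \<longleftrightarrow> hit_by T r \<or> (\<forall>\<Delta>\<in>{w, a}. r face_of \<Delta>)" unfolding hit_by_def T'_def by blast
    moreover have "(\<forall>\<Delta>\<in>{w, a}. r face_of \<Delta>) \<longleftrightarrow> r = \<rho>"
    proof
      assume "\<forall>\<Delta>\<in>{w, a}. r face_of \<Delta>"
      then have "r \<subseteq> w" "r \<subseteq> a" using face_of_imp_subset by auto
      then show "r = \<rho>" using ridge_eq_Int[OF r w(1) aF] ridge_eq_Int[OF w(4) w(1) aF w(5,6)] by simp
    next
      assume "r = \<rho>"
      then show "\<forall>\<Delta>\<in>{w, a}. r face_of \<Delta>"
        using w aF face_iff_subset[of r w] face_iff_subset[of r a] Rid_B Fac_B by simp
    qed
    ultimately show ?thesis using T(5)[OF r] by blast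
  qed
  have "fst q \<subseteq> Fac" "\<Delta> \<in> fst q" "snd q \<subseteq> IR" "\<Union>T' \<subseteq> fst q"
    unfolding w(7) fst_conv snd_conv T'_def using p w(1,3) \<rho>c(2) T(2) by blast+
  moreover have "\<forall>u\<in>fst q. (\<Delta>, u) \<in> {(x, y). {x, y} \<in> T'}\<^sup>*" using reach unfolding w(7) fst_conv by (intro ballI)
  moreover have "\<forall>\<rho>\<in>Rid. hit_by T' \<rho> \<longleftrightarrow> \<rho> \<in> snd q" using hit unfolding w(7) snd_conv by (intro ballI)
  ultimately show ?case using T'd acyc by (intro conjI exI[of _ T'])
qed

lemma constructible_imp_tree_collapse:
  assumes constructible
  shows "\<exists>T C. dual_spanning_tree d B T \<and> seepage d B C \<and> K_complex d B T \<searrow> C"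
proof -
  obtain \<Delta> R where \<Delta>: "\<Delta> \<in> Fac" "attach\<^sup>*\<^sup>* ({\<Delta>}, {}) (Fac, R)" "seal\<^sup>*\<^sup>* R IR"
    using assms unfolding constructible_def by blast
  obtain T where RI: "R \<subseteq> IR" and T: "T \<subseteq> dual_arcs d B" "\<forall>u\<in>Fac. (\<Delta>, u) \<in> {(x, y). {x, y} \<in> T}\<^sup>*"
      "\<not> (\<exists>vs. graph_cycle T vs)" "\<forall>\<rho>\<in>Rid. hit_by T \<rho> \<longleftrightarrow> \<rho> \<in> R"
    using attach_tree[OF \<Delta>(2,1)] unfolding fst_conv snd_conv by blast
  have "sym ({(x, y). {x, y} \<in> T})" by (auto simp: sym_def insert_commute)
  then have symT: "sym ({(x, y). {x, y} \<in> T}\<^sup>*)" by (rule sym_rtrancl)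
  have "(u, v) \<in> {(x, y). {x, y} \<in> T}\<^sup>*" if "u \<in> Fac" "v \<in> Fac" for u v
  proof -
    have u: "(\<Delta>, u) \<in> {(x, y). {x, y} \<in> T}\<^sup>*" and v: "(\<Delta>, v) \<in> {(x, y). {x, y} \<in> T}\<^sup>*"
      using T(2) that by simp_all
    show ?thesis using symD[OF symT u] v by (rule rtrancl_trans)
  qed
  then have tree: "dual_spanning_tree d B T"
    unfolding dual_spanning_tree_def connected_graph_def using T(1,3) \<Delta>(1) by blast
  obtain X where X: "B - Fac - R \<searrow> X" "X \<subseteq> B" "down_closed X" "X \<inter> Fac = {}" "X \<inter> Rid = Rid - IR"
    using seal_collapse[OF \<Delta>(3) RI] by blast
  have "{\<rho> \<in> Rid. hit_by T \<rho>} = R" using T(4) RI by (auto simp: IR_def)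
  then have "K_complex d B T = B - Fac - R" using K_complex_eq[OF tree] by simp
  then show ?thesis using tree seepageI[OF X(2-5)] X(1) by (intro exI[of _ T] exI[of _ X] conjI) auto
qed

text \<open>Starting from the hole left by \<open>\<Delta>\<close>, facets are removed along
  \<open>T\<close>. If a maximal removed set \<open>\<D>\<close> were not everything, an arc of
  \<open>T\<close> would leave it through a ridge whose other facet is already gone; that ridge is
  free, so one more pair can be removed.\<close>

lemma collapse_onto_K_complex:
  assumes T: "dual_spanning_tree d B T" and \<Delta>: "\<Delta> \<in> Fac"
  shows "B - {\<Delta>} \<searrow> K_complex d B T"
proof -
  have tree: "T \<subseteq> dual_arcs d B" "\<not> (\<exists>vs. graph_cycle T vs)"
    and conn: "\<And>u v. u \<in> Fac \<Longrightarrow> v \<in> Fac \<Longrightarrow> (u, v) \<in> {(x, y). {x, y} \<in> T}\<^sup>*"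
    using T unfolding dual_spanning_tree_def connected_graph_def by blast+
  \<comment> \<open>The ridges that disappear together with the facets of \<open>\<D>\<close>: those
    hit by \<open>T\<close> with both facets in \<open>\<D>\<close>.\<close>
  define RR where "RR = (\<lambda>\<D>. {\<rho> \<in> Rid. hit_by T \<rho> \<and> cofac \<rho> \<subseteq> \<D>})"
  define S where "S = {\<D>. \<Delta> \<in> \<D> \<and> \<D> \<subseteq> Fac \<and> (\<forall>u\<in>\<D>. (\<Delta>, u) \<in> {(x, y). {x, y} \<in> T \<and> x \<in> \<D> \<and> y \<in> \<D>}\<^sup>*) \<and>
      B - {\<Delta>} \<searrow> B - \<D> - RR \<D>}"
  have "RR {\<Delta>} = {}"
  proof -
    have "\<not> cofac \<rho> \<subseteq> {\<Delta>}" if r: "\<rho> \<in> Rid" "hit_by T \<rho>" for \<rho>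
    proof -
      obtain x y where "x \<noteq> y" "cofac \<rho> = {x, y}" by (rule hit_cofacE[OF tree(1) r])
      then show ?thesis by auto
    qed
    then show ?thesis by (auto simp: RR_def)
  qed
  then have "{\<Delta>} \<in> S" using \<Delta> by (simp add: S_def collapses_onto_def)
  moreover have "finite S"
    by (rule finite_subset[of _ "Pow Fac"]) (use finFac in \<open>auto simp: S_def\<close>)
  ultimately obtain \<D> where \<D>: "\<D> \<in> S" "\<And>\<E>. \<E> \<in> S \<Longrightarrow> \<D> \<subseteq> \<E> \<Longrightarrow> \<D> = \<E>"
    using finite_has_maximal[of S] by blast
  have \<D>': "\<Delta> \<in> \<D>" "\<D> \<subseteq> Fac" "\<And>u. u \<in> \<D> \<Longrightarrow> (\<Delta>, u) \<in> {(x, y). {x, y} \<in> T \<and> x \<in> \<D> \<and> y \<in> \<D>}\<^sup>*"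
    "B - {\<Delta>} \<searrow> B - \<D> - RR \<D>" using \<D>(1) by (auto simp: S_def)
  have "\<D> = Fac"
  proof (rule ccontr)
    assume "\<D> \<noteq> Fac"
    then obtain u where u: "u \<in> Fac" "u \<notin> \<D>" using \<D>'(2) by blast
    obtain a w where aw: "{a, w} \<in> T" "a \<in> \<D>" "w \<notin> \<D>"
      using rtrancl_exits[OF conn[OF \<Delta> u(1)] \<D>'(1) u(2)] by blast
    have "a \<noteq> w" using aw by auto
    obtain \<rho> where \<rho>: "\<rho> \<in> Rid" "cofac \<rho> = {a, w}" "a \<in> Fac" "w \<in> Fac"
      by (rule dual_arc_ridge[OF subsetD[OF tree(1) aw(1)] \<open>a \<noteq> w\<close>])
    have hit\<rho>: "hit_by T \<rho>" unfolding hit_cofac[OF tree(1) \<rho>(1)] using aw(1) \<rho>(2) \<open>a \<noteq> w\<close> by blast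
    define \<E> where "\<E> = insert w \<D>"
    let ?r = "\<lambda>\<D>. {(x, y). {x, y} \<in> T \<and> x \<in> \<D> \<and> y \<in> \<D>}"
    have sub: "(?r \<D>)\<^sup>* \<subseteq> (?r \<E>)\<^sup>*" by (rule rtrancl_mono) (auto simp: \<E>_def)
    have reach: "(\<Delta>, u) \<in> (?r \<E>)\<^sup>*" if "u \<in> \<E>" for u
    proof (cases "u = w")
      case True
      have "(\<Delta>, a) \<in> (?r \<E>)\<^sup>*" using \<D>'(3)[OF aw(2)] sub by blast
      moreover have "(a, w) \<in> ?r \<E>" using aw by (simp add: \<E>_def)
      ultimately show ?thesis unfolding True by (rule rtrancl_into_rtrancl)
    next
      case False
      then show ?thesis using that \<D>'(3)[of u] sub by (auto simp: \<E>_def)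
    qed
    \<comment> \<open>Adding \<open>w\<close> makes exactly one further ridge disappear. A second
      one would give another arc of \<open>T\<close> from \<open>w\<close> into the connected set
      \<open>\<D>\<close>, hence a cycle.\<close>
    have RE: "RR \<E> = insert \<rho> (RR \<D>)"
    proof (intro subset_antisym subsetI)
      fix r assume "r \<in> insert \<rho> (RR \<D>)"
      then show "r \<in> RR \<E>" using \<rho> hit\<rho> aw by (auto simp: RR_def \<E>_def)
    next
      fix r assume r: "r \<in> RR \<E>"
      show "r \<in> insert \<rho> (RR \<D>)"
      proof (rule ccontr)
        assume nr: "r \<notin> insert \<rho> (RR \<D>)"
        have rR: "r \<in> Rid" "hit_by T r" "cofac r \<subseteq> insert w \<D>" using r by (auto simp: RR_def \<E>_def)
        then have "w \<in> cofac r" using nr by (auto simp: RR_def)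
        obtain x y where xy: "x \<noteq> y" "{x, y} \<in> T" "cofac r = {x, y}"
          by (rule hit_cofacE[OF tree(1) rR(1,2)])
        have "w = x \<or> w = y" using \<open>w \<in> cofac r\<close> xy(3) by simp
        then obtain z where z: "cofac r = {w, z}" "z \<noteq> w" "{w, z} \<in> T"
        proof
          assume "w = x"
          then show thesis using that[of y] xy by simp
        next
          assume "w = y"
          then show thesis using that[of x] xy by (simp add: insert_commute)
        qed
        have zD: "z \<in> \<D>" using rR(3) z by auto
        have "z \<noteq> a"
        proof
          assume "z = a"
          then have "w \<in> cofac \<rho>" "a \<in> cofac \<rho>" "w \<in> cofac r" "a \<in> cofac r" using z \<rho>(2) by auto
          then have "r = w \<inter> a" "\<rho> = w \<inter> a"
            using ridge_eq_Int[OF rR(1), of w a] ridge_eq_Int[OF \<rho>(1), of w a] \<open>a \<noteq> w\<close> by (auto simp: cofac_def)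
          then show False using nr by simp
        qed
        have "sym (?r \<D>)" by (auto simp: sym_def insert_commute)
        then have sy: "sym ((?r \<D>)\<^sup>*)" by (rule sym_rtrancl)
        have "(a, z) \<in> (?r \<D>)\<^sup>*"
          using symD[OF sy \<D>'(3)[OF aw(2)]] \<D>'(3)[OF zD] by (rule rtrancl_trans)
        moreover have "(?r \<D>)\<^sup>* \<subseteq> {(x, y). {x, y} \<in> T \<and> {x, y} \<noteq> {w, z}}\<^sup>*"
          by (rule rtrancl_mono) (use aw(3) in \<open>auto simp: doubleton_eq_iff\<close>)
        ultimately have "(a, z) \<in> {(x, y). {x, y} \<in> T \<and> {x, y} \<noteq> {w, z}}\<^sup>*" by blast
        moreover have "(w, a) \<in> {(x, y). {x, y} \<in> T \<and> {x, y} \<noteq> {w, z}}"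
          using aw(1) \<open>z \<noteq> a\<close> \<open>a \<noteq> w\<close> by (auto simp: insert_commute doubleton_eq_iff)
        ultimately have "(w, z) \<in> {(x, y). {x, y} \<in> T \<and> {x, y} \<noteq> {w, z}}\<^sup>*"
          by (rule converse_rtrancl_into_rtrancl[rotated])
        then show False using acyclic_bridge[OF tree(2) z(3)] z(2) by blast
      qed
    qed
    let ?X = "B - \<D> - RR \<D>"
    have XB: "?X \<subseteq> B" by blast
    have \<rho>X: "\<rho> \<in> ?X"
      using \<rho>(1,2) aw \<D>'(2) by (auto simp: RR_def faces_def)
    have wX: "w \<in> ?X" using \<rho>(4) aw(3) by (auto simp: RR_def faces_def)
    have \<rho>w: "\<rho> \<subseteq> w"
    proof -
      have "w \<in> cofac \<rho>" using \<rho>(2) by simp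
      then show ?thesis by (simp add: cofac_def)
    qed
    have "elementary_collapse ?X (?X - {\<rho>, w})"
      unfolding elementary_collapse_iff[OF XB]
    proof (rule bexI[of _ \<rho>], rule bexI[of _ w], intro conjI ballI impI)
      show "\<rho> \<noteq> {}" using \<rho>(1) d2 Rid_B by auto
      show "aff_dim w = aff_dim \<rho> + 1" using \<rho> Rid_B Fac_B by simp
      show "H = w" if H: "H \<in> ?X" "\<rho> \<subseteq> H \<and> H \<noteq> \<rho>" for H
      proof -
        have "aff_dim \<rho> < aff_dim H" using dim_less[of \<rho> H] \<rho>X H by auto
        then have "H \<in> Fac" using dim_le[of H] H(1) \<rho>(1) Rid_B[of \<rho>] Fac_B[of H] by auto
        then have "H \<in> cofac \<rho>" using H by (simp add: cofac_def)
        then show ?thesis using \<rho>(2) H(1) aw(2) by auto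
      qed
    qed (use \<rho>X wX \<rho>w in auto)
    moreover have "?X - {\<rho>, w} = B - \<E> - RR \<E>" unfolding RE unfolding \<E>_def by blast
    ultimately have "B - {\<Delta>} \<searrow> B - \<E> - RR \<E>"
      using \<D>'(4) unfolding collapses_onto_def by (metis rtranclp.rtrancl_into_rtrancl)
    moreover have "\<forall>u\<in>\<E>. (\<Delta>, u) \<in> (?r \<E>)\<^sup>*" using reach by blast
    moreover have "\<Delta> \<in> \<E>" "\<E> \<subseteq> Fac" using \<D>'(1,2) \<rho>(4) by (simp_all add: \<E>_def)
    ultimately have "\<E> \<in> S" unfolding S_def mem_Collect_eq by (intro conjI)
    then have "\<D> = \<E>" using \<D>(2)[of \<E>] unfolding \<E>_def by blast
    then show False using aw(3) unfolding \<E>_def by blast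
  qed
  then have "RR \<D> = {\<rho> \<in> Rid. hit_by T \<rho>}" by (auto simp: RR_def cofac_def)
  then show ?thesis using \<D>'(4) K_complex_eq[OF T] \<open>\<D> = Fac\<close> by simp
qed

end

section \<open>Rearranging collapses: trading a facet for a boundary facet, and sorting by
  dimension\<close>

context ball_complex
begin

lemma elementary_collapseE:
  assumes "elementary_collapse X Y" "X \<subseteq> B"
  obtains a A where "a \<in> X" "A \<in> X" "a \<noteq> {}" "a \<subseteq> A" "aff_dim A = aff_dim a + 1"
    "\<forall>F\<in>X. a \<subseteq> F \<longrightarrow> F \<noteq> a \<longrightarrow> F = A" "Y = X - {a, A}"
  using assms(1) unfolding elementary_collapse_iff[OF assms(2)] by blast

lemma elementary_collapseI:
  assumes "X \<subseteq> B" "a \<in> X" "A \<in> X" "a \<noteq> {}" "a \<subseteq> A" "aff_dim A = aff_dim a + 1"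
    "\<And>F. F \<in> X \<Longrightarrow> a \<subseteq> F \<Longrightarrow> F \<noteq> a \<Longrightarrow> F = A" "Y = X - {a, A}"
  shows "elementary_collapse X Y"
  unfolding elementary_collapse_iff[OF assms(1)]
proof (rule bexI[of _ a], rule bexI[of _ A], intro conjI ballI impI)
  show "F = A" if "F \<in> X" "a \<subseteq> F \<and> F \<noteq> a" for F using assms(7)[of F] that by simp
qed (fact assms)+

text \<open>A surviving face belongs to no removed pair, and leaving it out cannot destroy the
  freeness of other faces.\<close>

lemma collapse_remove:
  assumes "elementary_collapse\<^sup>*\<^sup>* X C" "X \<subseteq> B" "\<sigma> \<in> C"
  shows "elementary_collapse\<^sup>*\<^sup>* (X - {\<sigma>}) (C - {\<sigma>})"
  using assms
proof (induction rule: converse_rtranclp_induct)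
  case (step X Y)
  obtain a A where a: "a \<in> X" "A \<in> X" "a \<noteq> {}" "a \<subseteq> A" "aff_dim A = aff_dim a + 1"
    "\<forall>F\<in>X. a \<subseteq> F \<longrightarrow> F \<noteq> a \<longrightarrow> F = A" "Y = X - {a, A}"
    by (rule elementary_collapseE[OF step(1,4)])
  have "\<sigma> \<in> Y" using collapses_subset[OF step(2)] step(5) by blast
  then have ne: "a \<noteq> \<sigma>" "A \<noteq> \<sigma>" using a(7) by auto
  have "elementary_collapse (X - {\<sigma>}) (Y - {\<sigma>})"
  proof (rule elementary_collapseI[of _ a A])
    show "F = A" if "F \<in> X - {\<sigma>}" "a \<subseteq> F" "F \<noteq> a" for F using bspec[OF a(6), of F] that by simp
    show "Y - {\<sigma>} = X - {\<sigma>} - {a, A}" using a(7) by blast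
  qed (use a(1-5) ne step(4) in auto)
  moreover have "elementary_collapse\<^sup>*\<^sup>* (Y - {\<sigma>}) (C - {\<sigma>})"
    using step(3,4,5) a(7) by blast
  ultimately show ?case by (rule converse_rtranclp_into_rtranclp)
qed simp

text \<open>An added face could only spoil the freeness of one of its own proper faces. These all
  survive in \<open>C\<close>, so none of them is ever removed.\<close>

lemma collapse_insert:
  assumes "elementary_collapse\<^sup>*\<^sup>* X C" "X \<subseteq> B" "\<sigma> \<in> B" "\<sigma> \<notin> X" "\<And>G. G \<in> B \<Longrightarrow> G \<subset> \<sigma> \<Longrightarrow> G \<in> C"
  shows "elementary_collapse\<^sup>*\<^sup>* (insert \<sigma> X) (insert \<sigma> C)"
  using assms(1,2,4)
proof (induction rule: converse_rtranclp_induct)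
  case (step X Y)
  obtain a A where a: "a \<in> X" "A \<in> X" "a \<noteq> {}" "a \<subseteq> A" "aff_dim A = aff_dim a + 1"
    "\<forall>F\<in>X. a \<subseteq> F \<longrightarrow> F \<noteq> a \<longrightarrow> F = A" "Y = X - {a, A}"
    by (rule elementary_collapseE[OF step(1,4)])
  have "\<not> a \<subseteq> \<sigma>"
  proof
    assume "a \<subseteq> \<sigma>"
    moreover have "a \<noteq> \<sigma>" using a(1) step(5) by blast
    ultimately have "a \<in> C" using assms(5)[of a] a(1) step(4) by blast
    then show False using collapses_subset[OF step(2)] a(7) by blast
  qed
  have "elementary_collapse (insert \<sigma> X) (insert \<sigma> Y)"
  proof (rule elementary_collapseI[of _ a A])
    show "F = A" if "F \<in> insert \<sigma> X" "a \<subseteq> F" "F \<noteq> a" for F using bspec[OF a(6), of F] that \<open>\<not> a \<subseteq> \<sigma>\<close> by auto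
    show "insert \<sigma> Y = insert \<sigma> X - {a, A}" using a(1,2,7) step(5) by blast
  qed (use a(1-5) step(4) assms(3) in auto)
  moreover have "elementary_collapse\<^sup>*\<^sup>* (insert \<sigma> Y) (insert \<sigma> C)"
    using step(3,4,5) a(7) by blast
  ultimately show ?case by (rule converse_rtranclp_into_rtranclp)
qed simp

text \<open>Since all proper faces of \<open>\<sigma>\<close> survive, \<open>\<sigma>\<close> is
  not the larger member of the pair in which it disappears; so it is the smaller one, with some
  partner \<open>\<Sigma>\<close>. Deleting this pair in advance keeps all other steps
  legal.\<close>

lemma collapse_pair_first:
  assumes "elementary_collapse\<^sup>*\<^sup>* X Y" "X \<subseteq> B" "\<sigma> \<in> X" "\<sigma> \<notin> Y" "\<And>G. G \<in> B \<Longrightarrow> G \<subset> \<sigma> \<Longrightarrow> G \<in> Y"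
  shows "\<exists>\<Sigma>\<in>X. \<sigma> \<subseteq> \<Sigma> \<and> aff_dim \<Sigma> = aff_dim \<sigma> + 1 \<and> \<Sigma> \<notin> Y \<and> elementary_collapse\<^sup>*\<^sup>* (X - {\<sigma>, \<Sigma>}) Y"
  using assms(1-3)
proof (induction rule: converse_rtranclp_induct)
  case base
  then show ?case using assms(4) by blast
next
  case (step X Z)
  obtain a A where a: "a \<in> X" "A \<in> X" "a \<noteq> {}" "a \<subseteq> A" "aff_dim A = aff_dim a + 1"
    "\<forall>F\<in>X. a \<subseteq> F \<longrightarrow> F \<noteq> a \<longrightarrow> F = A" "Z = X - {a, A}"
    by (rule elementary_collapseE[OF step(1,4)])
  have YZ: "Y \<subseteq> Z" using collapses_subset[OF step(2)] .
  show ?case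
  proof (cases "a = \<sigma>")
    case True
    then have "elementary_collapse\<^sup>*\<^sup>* (X - {\<sigma>, A}) Y" using step(2) a(7) by simp
    moreover have "A \<notin> Y" using YZ a(7) by blast
    ultimately show ?thesis using a(2,4,5) True by blast
  next
    case False
    have "A \<noteq> \<sigma>"
    proof
      assume "A = \<sigma>"
      moreover have "a \<noteq> A" using a(5) by auto
      ultimately have "a \<in> Y" using assms(5)[of a] a(1,4) step(4) by blast
      then show False using YZ a(7) by blast
    qed
    then have "\<sigma> \<in> Z" using False step(5) a(7) by blast
    moreover have "Z \<subseteq> B" using step(4) a(7) by blast
    ultimately obtain \<Sigma> where \<Sigma>: "\<Sigma> \<in> Z" "\<sigma> \<subseteq> \<Sigma>" "aff_dim \<Sigma> = aff_dim \<sigma> + 1" "\<Sigma> \<notin> Y"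
      "elementary_collapse\<^sup>*\<^sup>* (Z - {\<sigma>, \<Sigma>}) Y"
      using step(3) by blast
    have ne: "\<Sigma> \<noteq> a" "\<Sigma> \<noteq> A" using \<Sigma>(1) a(7) by auto
    have "elementary_collapse (X - {\<sigma>, \<Sigma>}) (Z - {\<sigma>, \<Sigma>})"
    proof (rule elementary_collapseI[of _ a A])
      show "F = A" if "F \<in> X - {\<sigma>, \<Sigma>}" "a \<subseteq> F" "F \<noteq> a" for F using bspec[OF a(6), of F] that by simp
      show "Z - {\<sigma>, \<Sigma>} = X - {\<sigma>, \<Sigma>} - {a, A}" using a(7) by blast
    qed (use a(1-5) step(4) False \<open>A \<noteq> \<sigma>\<close> ne in auto)
    then have "elementary_collapse\<^sup>*\<^sup>* (X - {\<sigma>, \<Sigma>}) Y"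
      using \<Sigma>(5) by (rule converse_rtranclp_into_rtranclp)
    moreover have "\<Sigma> \<in> X" using \<Sigma>(1) a(7) by blast
    ultimately show ?thesis using \<Sigma>(2-4) by blast
  qed
qed

text \<open>Remove \<open>\<sigma>\<close> together with the only facet \<open>\<Sigma>\<close>
  above it, and continue with the given collapse of \<open>B - {\<Sigma>}\<close>, leaving out
  \<open>\<sigma>\<close> from both ends.\<close>

lemma boundary_facet_collapse:
  assumes C: "seepage d B C" and all: "\<And>\<Delta>. \<Delta> \<in> Fac \<Longrightarrow> B - {\<Delta>} \<searrow> C"
    and \<sigma>: "\<sigma> \<in> Rid - IR"
  shows "B \<searrow> C - {\<sigma>}"
proof -
  have \<sigma>R: "\<sigma> \<in> Rid" "card (cofac \<sigma>) = 1" using \<sigma> card_cofac[of \<sigma>] by (auto simp: IR_def)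
  then obtain \<Sigma> where \<Sigma>: "cofac \<sigma> = {\<Sigma>}" using card_1_singletonE by blast
  then have "\<Sigma> \<in> cofac \<sigma>" by simp
  then have \<Sigma>F: "\<Sigma> \<in> Fac" "\<sigma> \<subseteq> \<Sigma>" by (auto simp: cofac_def)
  have \<sigma>C: "\<sigma> \<in> C" using seepageD(4)[OF C] \<sigma> by blast
  have "elementary_collapse B (B - {\<sigma>, \<Sigma>})"
  proof (rule elementary_collapseI[of _ \<sigma> \<Sigma>])
    show "\<sigma> \<in> B" "\<Sigma> \<in> B" "aff_dim \<Sigma> = aff_dim \<sigma> + 1" using \<sigma>R(1) \<Sigma>F(1) Rid_B Fac_B by auto
    show "\<sigma> \<noteq> {}" using \<sigma>R(1) Rid_B d2 by auto
    show "F = \<Sigma>" if F: "F \<in> B" "\<sigma> \<subseteq> F" "F \<noteq> \<sigma>" for F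
    proof -
      have "aff_dim \<sigma> < aff_dim F" using dim_less[of \<sigma> F] \<sigma>R(1) Rid_B F by blast
      then have "F \<in> Fac" using dim_le[OF F(1)] F(1) \<sigma>R(1) Rid_B[of \<sigma>] Fac_B[of F] by simp
      then have "F \<in> cofac \<sigma>" using F by (simp add: cofac_def)
      then show ?thesis using \<Sigma> by simp
    qed
  qed (use \<Sigma>F in auto)
  moreover have "elementary_collapse\<^sup>*\<^sup>* (B - {\<Sigma>} - {\<sigma>}) (C - {\<sigma>})"
    by (rule collapse_remove) (use all[OF \<Sigma>F(1)] \<sigma>C in \<open>auto simp: collapses_onto_def\<close>)
  moreover have "B - {\<sigma>, \<Sigma>} = B - {\<Sigma>} - {\<sigma>}" by blast
  ultimately show ?thesis unfolding collapses_onto_def by (metis converse_rtranclp_into_rtranclp)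
qed

text \<open>The boundary facet \<open>\<sigma>\<close> lies in the seepage with all its faces, so
  the pair removing it can be deleted in advance and \<open>\<sigma>\<close> put back at both ends.
  Its partner has dimension d, so it is a facet.\<close>

lemma facet_collapse_of_boundary:
  assumes C: "seepage d B C" and \<sigma>: "\<sigma> \<in> Rid - IR" and coll: "B \<searrow> C - {\<sigma>}"
  shows "\<exists>\<Sigma>\<in>Fac. B - {\<Sigma>} \<searrow> C"
proof -
  have \<sigma>C: "\<sigma> \<in> C" using seepageD(4)[OF C] \<sigma> by blast
  have \<sigma>B: "\<sigma> \<in> B" "aff_dim \<sigma> = int d - 1" using \<sigma> Rid_B by auto
  have low: "G \<in> C - {\<sigma>}" if "G \<in> B" "G \<subset> \<sigma>" for G
    using seepageD(2)[OF C] \<sigma>C that unfolding down_closed_def by blast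
  obtain \<Sigma> where \<Sigma>: "\<Sigma> \<in> B" "\<sigma> \<subseteq> \<Sigma>" "aff_dim \<Sigma> = aff_dim \<sigma> + 1"
    "elementary_collapse\<^sup>*\<^sup>* (B - {\<sigma>, \<Sigma>}) (C - {\<sigma>})"
    using collapse_pair_first[of B "C - {\<sigma>}" \<sigma>] coll \<sigma>B(1) low unfolding collapses_onto_def by blast
  have "\<Sigma> \<noteq> \<sigma>" using \<Sigma>(3) by auto
  have "elementary_collapse\<^sup>*\<^sup>* (insert \<sigma> (B - {\<sigma>, \<Sigma>})) (insert \<sigma> (C - {\<sigma>}))"
    by (rule collapse_insert[OF \<Sigma>(4) _ \<sigma>B(1) _ low]) auto
  moreover have "insert \<sigma> (B - {\<sigma>, \<Sigma>}) = B - {\<Sigma>}" using \<sigma>B(1) \<open>\<Sigma> \<noteq> \<sigma>\<close> by blast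
  moreover have "insert \<sigma> (C - {\<sigma>}) = C" using \<sigma>C by blast
  moreover have "\<Sigma> \<in> Fac" using \<Sigma>(1,3) \<sigma>B(2) Fac_B by simp
  ultimately show ?thesis unfolding collapses_onto_def by auto
qed

text \<open>Induction from the end of the collapse. \<open>R1\<close> collects the ridges that are
  removed together with facets. All of them are placed before the first \<open>seal\<close> step:
  having more ridges glued only helps the side condition of \<open>seal\<close>, while the
  attachments ignore the ridges glued before, which is why \<open>Rp\<close> is arbitrary.\<close>

lemma collapse_decompose:
  assumes "elementary_collapse\<^sup>*\<^sup>* X C" "X \<subseteq> B" and C: "seepage d B C"
  shows "\<exists>R1. R1 \<subseteq> X \<inter> IR \<and> (\<forall>Rp. attach\<^sup>*\<^sup>* (Fac - X, Rp) (Fac, Rp \<union> R1)) \<and> seal\<^sup>*\<^sup>* ((Rid - X) \<union> R1) IR"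
  using assms(1,2)
proof (induction rule: converse_rtranclp_induct)
  case base
  have "Fac - C = Fac" using seepageD(3)[OF C] by blast
  moreover have "Rid - C = IR" using seepageD(4)[OF C] unfolding IR_def by blast
  ultimately show ?case by (intro exI[of _ "{}"]) simp
next
  case (step X Y)
  obtain a A where a: "a \<in> X" "A \<in> X" "a \<noteq> {}" "a \<subseteq> A" "aff_dim A = aff_dim a + 1"
    "\<forall>F\<in>X. a \<subseteq> F \<longrightarrow> F \<noteq> a \<longrightarrow> F = A" "Y = X - {a, A}"
    by (rule elementary_collapseE[OF step(1,4)])
  have CY: "C \<subseteq> Y" using collapses_subset[OF step(2)] .
  have aB: "a \<in> B" "A \<in> B" using a(1,2) step(4) by auto
  have "Y \<subseteq> B" using a(7) step(4) by blast
  then obtain R1 where R1: "R1 \<subseteq> Y \<inter> IR" "\<And>Rp. attach\<^sup>*\<^sup>* (Fac - Y, Rp) (Fac, Rp \<union> R1)"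
    "seal\<^sup>*\<^sup>* ((Rid - Y) \<union> R1) IR"
    using step(3) by blast
  \<comment> \<open>A removed ridge is not in the seepage, whose ridges are exactly the boundary
    ridges.\<close>
  have inIR: "r \<in> IR" if "r \<in> Rid" "r \<notin> Y" for r
    using seepageD(4)[OF C] CY that by blast
  consider "A \<in> Fac" | "A \<in> Rid" | "aff_dim A \<le> int d - 2" using dim_cases[OF aB(2)] by blast
  then show ?case
  proof cases
    case 1
    have aR: "a \<in> Rid" using a(5) 1 aB(1) Fac_B Rid_B by simp
    have aI: "a \<in> IR" using inIR[OF aR] a(7) by simp
    obtain x y where xy: "x \<in> Fac" "y \<in> Fac" "x \<noteq> y" "cofac a = {x, y}" by (rule IR_pair[OF aI])
    have "A \<in> cofac a" using 1 a(4) by (simp add: cofac_def)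
    \<comment> \<open>Freeness of \<open>a\<close> means that its second facet has been removed
      already; \<open>A\<close> is attached to that one.\<close>
    then have "\<exists>\<Delta>0. \<Delta>0 \<in> cofac a \<and> \<Delta>0 \<noteq> A" using xy by auto
    then obtain \<Delta>0 where D0: "\<Delta>0 \<in> Fac" "a \<subseteq> \<Delta>0" "\<Delta>0 \<noteq> A" by (auto simp: cofac_def)
    have "\<Delta>0 \<noteq> a" using D0(1) aR Fac_B Rid_B by auto
    then have D0X: "\<Delta>0 \<notin> X" using bspec[OF a(6), of \<Delta>0] D0 by blast
    have FY: "Fac - Y = insert A (Fac - X)"
      using a(2,7) 1 aR Fac_B Rid_B by auto
    have RY: "Rid - Y = insert a (Rid - X)"
      using a(1,7) 1 aR Fac_B Rid_B by auto
    have att: "attach (Fac - X, Rp) (Fac - Y, insert a Rp)" for Rp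
      unfolding attach_def fst_conv snd_conv
      using 1 a(2,4) D0 D0X aR FY by (intro exI[of _ A] exI[of _ \<Delta>0] exI[of _ a]) simp
    have "attach\<^sup>*\<^sup>* (Fac - X, Rp) (Fac, Rp \<union> insert a R1)" for Rp
      using converse_rtranclp_into_rtranclp[OF att R1(2)[of "insert a Rp"]] by simp
    moreover have "seal\<^sup>*\<^sup>* ((Rid - X) \<union> insert a R1) IR" using R1(3) unfolding RY by simp
    moreover have "insert a R1 \<subseteq> X \<inter> IR" using R1(1) a(1,7) aI by blast
    ultimately show ?thesis by blast
  next
    case 2
    have da: "aff_dim a = int d - 2" using a(5) 2 Rid_B by simp
    have AI: "A \<in> IR" using inIR[OF 2] a(7) by simp
    have "A \<notin> Fac" "a \<notin> Fac" "a \<notin> Rid" using 2 da Fac_B Rid_B by auto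
    then have FY: "Fac - Y = Fac - X" and RY: "Rid - Y = insert A (Rid - X)"
      using a(2,7) 2 by auto
    have nA: "A \<notin> (Rid - X) \<union> R1" using R1(1) a(2,7) by blast
    \<comment> \<open>Freeness of \<open>a\<close> says that every ridge around it other than
      \<open>A\<close> has been removed.\<close>
    have "seal ((Rid - X) \<union> R1) (insert A ((Rid - X) \<union> R1))"
      unfolding seal_def
    proof (rule exI[of _ A], rule exI[of _ a], intro conjI ballI impI)
      show "r \<in> insert A (Rid - X \<union> R1)" if "r \<in> Rid" "a \<subseteq> r" for r
        using bspec[OF a(6), of r] that \<open>a \<notin> Rid\<close> by blast
    qed (use AI nA aB(1) da a(4) in auto)
    then have "seal\<^sup>*\<^sup>* ((Rid - X) \<union> R1) IR"
      using R1(3) unfolding RY by (simp add: converse_rtranclp_into_rtranclp)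
    moreover have "R1 \<subseteq> X \<inter> IR" using R1(1) a(7) by blast
    ultimately show ?thesis using R1(2) unfolding FY by blast
  next
    case 3
    then have "A \<notin> Fac" "a \<notin> Fac" "A \<notin> Rid" "a \<notin> Rid" using a(5) Fac_B Rid_B by auto
    then have "Fac - Y = Fac - X" "Rid - Y = Rid - X" using a(7) by auto
    then show ?thesis using R1 a(7) by (intro exI[of _ R1]) auto
  qed
qed

lemma facet_collapse_imp_constructible:
  assumes \<Delta>: "\<Delta> \<in> Fac" and C: "seepage d B C" and coll: "B - {\<Delta>} \<searrow> C"
  shows constructible
proof -
  obtain R1 where R1: "\<And>Rp. attach\<^sup>*\<^sup>* (Fac - (B - {\<Delta>}), Rp) (Fac, Rp \<union> R1)"
      "seal\<^sup>*\<^sup>* ((Rid - (B - {\<Delta>})) \<union> R1) IR"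
    using collapse_decompose[of "B - {\<Delta>}" C] coll C unfolding collapses_onto_def by blast
  have "Fac - (B - {\<Delta>}) = {\<Delta>}" using \<Delta> by (auto simp: faces_def)
  moreover have e: "Rid - (B - {\<Delta>}) = {}" using \<Delta> by (auto simp: faces_def)
  have "seal\<^sup>*\<^sup>* R1 IR" using R1(2) unfolding e by simp
  ultimately have "attach\<^sup>*\<^sup>* ({\<Delta>}, {}) (Fac, R1)" "seal\<^sup>*\<^sup>* R1 IR"
    using R1(1)[of "{}"] by simp_all
  then show ?thesis unfolding constructible_def using \<Delta> by blast
qed

text \<open>LC, tree, all facets and some facet form one cycle of implications. All facets, all
  boundary facets, some boundary facet, some facet form a second path, so the two boundary
  statements join the cycle. Passing from all to some uses that a facet and a boundary ridge
  exist.\<close>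

lemma all_equivalent_constructible:
  assumes LC: "LC d B \<longleftrightarrow> constructible"
  shows "all_equivalent
    [LC d B,
     \<exists>T C. dual_spanning_tree d B T \<and> seepage d B C \<and> K_complex d B T \<searrow> C,
     \<exists>C. seepage d B C \<and> (\<forall>\<Delta> \<in> facets d B. B - {\<Delta>} \<searrow> C),
     \<exists>\<Delta> \<in> facets d B. \<exists>C. seepage d B C \<and> B - {\<Delta>} \<searrow> C,
     \<exists>C. seepage d B C \<and> (\<forall>\<sigma> \<in> faces (int d - 1) (boundary d B). B \<searrow> C - {\<sigma>}),
     \<exists>\<sigma> \<in> faces (int d - 1) (boundary d B). \<exists>C. seepage d B C \<and> B \<searrow> C - {\<sigma>}]"
    (is "all_equivalent [?p1, ?p2, ?p3, ?p4, ?p5, ?p6]")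
proof -
  obtain \<rho> where \<rho>: "\<rho> \<in> Rid" "card (cofac \<rho>) = 1" by (rule boundary_ridge)
  have \<rho>b: "\<rho> \<in> Rid - IR" using \<rho> by (simp add: IR_def)
  obtain \<Delta>0 where \<Delta>0: "\<Delta>0 \<in> Fac" using cofac_nonempty[OF \<rho>(1)] by (auto simp: cofac_def)
  have 12: "?p1 \<Longrightarrow> ?p2" using LC constructible_imp_tree_collapse by simp
  have 23: "?p3" if p2: ?p2
  proof -
    obtain T C where TC: "dual_spanning_tree d B T" "seepage d B C" "K_complex d B T \<searrow> C" using p2 by blast
    have "B - {\<Delta>} \<searrow> C" if \<Delta>: "\<Delta> \<in> Fac" for \<Delta>
      using collapse_onto_K_complex[OF TC(1) \<Delta>] TC(3) unfolding collapses_onto_def by (rule rtranclp_trans)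
    then show ?p3 using TC(2) by blast
  qed
  have 34: "?p3 \<Longrightarrow> ?p4" using \<Delta>0 by blast
  have 41: "?p1" if ?p4 using that LC facet_collapse_imp_constructible by blast
  have 35: "?p5" if p3: ?p3
  proof -
    obtain C where C: "seepage d B C" "\<And>\<Delta>. \<Delta> \<in> Fac \<Longrightarrow> B - {\<Delta>} \<searrow> C" using p3 by blast
    show ?p5 unfolding boundary_ridges' using C(1) boundary_facet_collapse[OF C] by blast
  qed
  have 56: "?p6" if p5: ?p5 using p5 \<rho>b unfolding boundary_ridges' by blast
  have 64: "?p4" if p6: ?p6
  proof -
    obtain \<sigma> C where "\<sigma> \<in> Rid - IR" "seepage d B C" "B \<searrow> C - {\<sigma>}" using p6 unfolding boundary_ridges' by blast
    then show ?p4 using facet_collapse_of_boundary by blast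
  qed
  have "?p1 \<longleftrightarrow> ?p2" "?p1 \<longleftrightarrow> ?p3" "?p1 \<longleftrightarrow> ?p4" "?p1 \<longleftrightarrow> ?p5" "?p1 \<longleftrightarrow> ?p6"
    using 12 23 34 41 35 56 64 by argo+
  then show ?thesis unfolding all_equivalent_def by simp
qed

end

section \<open>The space obtained from a set of facets by gluing along a set of ridges\<close>

text \<open>\<open>code\<close> places pairs of a point and a facet into one type of points, so that
  all stages of a construction can live in the type prescribed by \<open>LC\<close>.\<close>

locale glued = ball_complex B d for B :: "'a::euclidean_space set set" and d +
  fixes code :: "'a \<times> 'a set \<Rightarrow> 'p" and \<D> R :: "'a set set"
  assumes inj_code: "inj_on code (UNIV \<times> facets d B)"
    and D_Fac: "\<D> \<subseteq> facets d B" and R_Rid: "R \<subseteq> faces (int d - 1) B"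
begin

text \<open>The gluing at the position \<open>x\<close>: the copies of \<open>x\<close> in two
  facets are identified when the facets are connected by this relation.\<close>

definition adj :: "'a \<Rightarrow> ('a set \<times> 'a set) set" where
  "adj x = {(\<Delta>, \<Delta>'). \<Delta> \<in> \<D> \<and> \<Delta>' \<in> \<D> \<and> (\<exists>\<rho>\<in>R. x \<in> \<rho> \<and> \<rho> \<subseteq> \<Delta> \<and> \<rho> \<subseteq> \<Delta>')}"

text \<open>A representative of the connected class of \<open>\<Delta>\<close>; by
  \<open>rep_eq_iff\<close> the choice depends on the class only, so coding it together with
  \<open>x\<close> names a point of the quotient.\<close>

definition rep :: "'a \<Rightarrow> 'a set \<Rightarrow> 'a set" where
  "rep x \<Delta> = (SOME E. (\<Delta>, E) \<in> (adj x)\<^sup>*)"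

definition pt :: "'a \<Rightarrow> 'a set \<Rightarrow> 'p" where
  "pt x \<Delta> = code (x, rep x \<Delta>)"

definition pos :: "'p \<Rightarrow> 'a" where
  "pos p = fst (inv_into (UNIV \<times> facets d B) code p)"

definition sheet :: "'p \<Rightarrow> 'a set" where
  "sheet p = snd (inv_into (UNIV \<times> facets d B) code p)"

definition points :: "'p set" where
  "points = {pt x \<Delta> | x \<Delta>. \<Delta> \<in> \<D> \<and> x \<in> \<Delta>}"

text \<open>The quotient topology of the disjoint union of the facets in
  \<open>\<D>\<close>.\<close>

definition Y :: "'p topology" where
  "Y = topology (\<lambda>U. U \<subseteq> points \<and> (\<forall>\<Delta>\<in>\<D>. openin (top_of_set \<Delta>) {x \<in> \<Delta>. pt x \<Delta> \<in> U}))"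

definition cell :: "'a set \<Rightarrow> 'a set \<Rightarrow> 'p set" where
  "cell F \<Delta> = (\<lambda>x. pt x \<Delta>) ` F"

definition CX :: "'p cell_complex" where
  "CX = \<lparr> space_of = Y, cells = {cell F \<Delta> | F \<Delta>. \<Delta> \<in> \<D> \<and> F \<in> B \<and> F \<subseteq> \<Delta> \<and> F \<noteq> {}} \<rparr>"

lemma D_B: "\<Delta> \<in> \<D> \<Longrightarrow> \<Delta> \<in> B" using D_Fac Fac_B by blast

lemma R_B: "\<rho> \<in> R \<Longrightarrow> \<rho> \<in> B" using R_Rid Rid_B by blast

lemma sym_conn: "(E, E') \<in> (adj x)\<^sup>* \<Longrightarrow> (E', E) \<in> (adj x)\<^sup>*"
proof -
  have "sym (adj x)" by (auto simp: sym_def adj_def)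
  then show "(E, E') \<in> (adj x)\<^sup>* \<Longrightarrow> (E', E) \<in> (adj x)\<^sup>*" using sym_rtrancl symD by metis
qed

lemma conn_in: "(\<Delta>, E) \<in> (adj x)\<^sup>* \<Longrightarrow> \<Delta> \<in> \<D> \<Longrightarrow> x \<in> \<Delta> \<Longrightarrow> E \<in> \<D> \<and> x \<in> E"
  by (induction rule: rtrancl_induct) (auto simp: adj_def)

lemma rep_conn: "(\<Delta>, rep x \<Delta>) \<in> (adj x)\<^sup>*"
  unfolding rep_def by (rule someI[of _ \<Delta>]) simp

lemma rep_eq_iff: "rep x \<Delta> = rep x E \<longleftrightarrow> (\<Delta>, E) \<in> (adj x)\<^sup>*"
proof
  assume "rep x \<Delta> = rep x E"
  then show "(\<Delta>, E) \<in> (adj x)\<^sup>*" using rep_conn[of \<Delta> x] sym_conn[OF rep_conn[of E x]] by (simp add: rtrancl_trans)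
next
  assume c: "(\<Delta>, E) \<in> (adj x)\<^sup>*"
  have "(\<Delta>, F) \<in> (adj x)\<^sup>* \<longleftrightarrow> (E, F) \<in> (adj x)\<^sup>*" for F
    using c sym_conn[OF c] rtrancl_trans by metis
  then show "rep x \<Delta> = rep x E" by (simp add: rep_def)
qed

lemma code_eq: "\<Delta> \<in> Fac \<Longrightarrow> E \<in> Fac \<Longrightarrow> code (x, \<Delta>) = code (y, E) \<longleftrightarrow> x = y \<and> \<Delta> = E"
  using inj_code by (auto simp: inj_on_def)

lemma rep_in: "\<Delta> \<in> \<D> \<Longrightarrow> x \<in> \<Delta> \<Longrightarrow> rep x \<Delta> \<in> \<D> \<and> x \<in> rep x \<Delta>"
  using conn_in[OF rep_conn] .

lemma pt_eq_iff: "\<Delta> \<in> \<D> \<Longrightarrow> x \<in> \<Delta> \<Longrightarrow> E \<in> \<D> \<Longrightarrow> y \<in> E \<Longrightarrow> pt x \<Delta> = pt y E \<longleftrightarrow> x = y \<and> (\<Delta>, E) \<in> (adj x)\<^sup>*"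
  using rep_in[of \<Delta> x] rep_in[of E y] D_Fac code_eq[of "rep x \<Delta>" "rep y E" x y] rep_eq_iff[of x \<Delta> E]
  unfolding pt_def by blast

lemma inv_code_pt: "\<Delta> \<in> \<D> \<Longrightarrow> x \<in> \<Delta> \<Longrightarrow> inv_into (UNIV \<times> facets d B) code (pt x \<Delta>) = (x, rep x \<Delta>)"
  unfolding pt_def using rep_in[of \<Delta> x] D_Fac by (intro inv_into_f_f[OF inj_code]) auto

lemma pos_pt: "\<Delta> \<in> \<D> \<Longrightarrow> x \<in> \<Delta> \<Longrightarrow> pos (pt x \<Delta>) = x"
  by (simp add: pos_def inv_code_pt)

lemma sheet_pt: "\<Delta> \<in> \<D> \<Longrightarrow> x \<in> \<Delta> \<Longrightarrow> sheet (pt x \<Delta>) = rep x \<Delta>"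
  by (simp add: sheet_def inv_code_pt)

lemma openin_Y: "openin Y U \<longleftrightarrow> U \<subseteq> points \<and> (\<forall>\<Delta>\<in>\<D>. openin (top_of_set \<Delta>) {x \<in> \<Delta>. pt x \<Delta> \<in> U})"
proof -
  have "istopology (\<lambda>U. U \<subseteq> points \<and> (\<forall>\<Delta>\<in>\<D>. openin (top_of_set \<Delta>) {x \<in> \<Delta>. pt x \<Delta> \<in> U}))"
    unfolding istopology_def
  proof (intro conjI allI impI ballI)
    fix S T \<Delta>
    assume "S \<subseteq> points \<and> (\<forall>\<Delta>\<in>\<D>. openin (top_of_set \<Delta>) {x \<in> \<Delta>. pt x \<Delta> \<in> S})"
      "T \<subseteq> points \<and> (\<forall>\<Delta>\<in>\<D>. openin (top_of_set \<Delta>) {x \<in> \<Delta>. pt x \<Delta> \<in> T})" "\<Delta> \<in> \<D>"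
    then have "openin (top_of_set \<Delta>) ({x \<in> \<Delta>. pt x \<Delta> \<in> S} \<inter> {x \<in> \<Delta>. pt x \<Delta> \<in> T})"
      by (intro openin_Int) auto
    moreover have "{x \<in> \<Delta>. pt x \<Delta> \<in> S} \<inter> {x \<in> \<Delta>. pt x \<Delta> \<in> T} = {x \<in> \<Delta>. pt x \<Delta> \<in> S \<inter> T}" by blast
    ultimately show "openin (top_of_set \<Delta>) {x \<in> \<Delta>. pt x \<Delta> \<in> S \<inter> T}" by simp
  next
    fix \<K> \<Delta>
    assume "\<forall>K\<in>\<K>. K \<subseteq> points \<and> (\<forall>\<Delta>\<in>\<D>. openin (top_of_set \<Delta>) {x \<in> \<Delta>. pt x \<Delta> \<in> K})" "\<Delta> \<in> \<D>"
    then have "openin (top_of_set \<Delta>) (\<Union>((\<lambda>K. {x \<in> \<Delta>. pt x \<Delta> \<in> K}) ` \<K>))"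
      by (intro openin_Union) auto
    moreover have "\<Union>((\<lambda>K. {x \<in> \<Delta>. pt x \<Delta> \<in> K}) ` \<K>) = {x \<in> \<Delta>. pt x \<Delta> \<in> \<Union>\<K>}" by blast
    ultimately show "openin (top_of_set \<Delta>) {x \<in> \<Delta>. pt x \<Delta> \<in> \<Union>\<K>}" by simp
  qed blast+
  then show ?thesis unfolding Y_def by (simp add: topology_inverse')
qed

lemma pt_in_points: "\<Delta> \<in> \<D> \<Longrightarrow> x \<in> \<Delta> \<Longrightarrow> pt x \<Delta> \<in> points"
  unfolding points_def by blast

lemma topspace_Y: "topspace Y = points"
proof -
  have "{x \<in> \<Delta>. pt x \<Delta> \<in> points} = \<Delta>" if "\<Delta> \<in> \<D>" for \<Delta> using pt_in_points[OF that] by blast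
  then have "openin Y points" unfolding openin_Y by simp
  moreover have "topspace Y \<subseteq> points" using openin_topspace[of Y] unfolding openin_Y by blast
  ultimately show ?thesis using openin_subset by blast
qed

lemma continuous_pt: "\<Delta> \<in> \<D> \<Longrightarrow> continuous_map (top_of_set \<Delta>) Y (\<lambda>x. pt x \<Delta>)"
  unfolding continuous_map_def topspace_Y using pt_in_points openin_Y by auto

lemma continuous_from_Y:
  assumes "\<And>\<Delta>. \<Delta> \<in> \<D> \<Longrightarrow> continuous_map (top_of_set \<Delta>) Z (\<lambda>x. f (pt x \<Delta>))"
  shows "continuous_map Y Z f"
  unfolding continuous_map_def topspace_Y
proof (intro conjI allI impI funcsetI)
  show "f p \<in> topspace Z" if "p \<in> points" for p
    using that assms unfolding points_def continuous_map_def by fastforce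
  fix U assume U: "openin Z U"
  show "openin Y {p \<in> points. f p \<in> U}"
    unfolding openin_Y
  proof (intro conjI ballI)
    fix \<Delta> assume \<Delta>: "\<Delta> \<in> \<D>"
    have "openin (top_of_set \<Delta>) {x \<in> topspace (top_of_set \<Delta>). f (pt x \<Delta>) \<in> U}"
      by (rule openin_continuous_map_preimage[OF assms[OF \<Delta>] U])
    moreover have "{x \<in> topspace (top_of_set \<Delta>). f (pt x \<Delta>) \<in> U} = {x \<in> \<Delta>. pt x \<Delta> \<in> {p \<in> points. f p \<in> U}}"
      using pt_in_points[OF \<Delta>] by auto
    ultimately show "openin (top_of_set \<Delta>) {x \<in> \<Delta>. pt x \<Delta> \<in> {p \<in> points. f p \<in> U}}" by simp
  qed blast
qed

lemma continuous_pos: "continuous_map Y euclidean pos"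
proof (rule continuous_from_Y)
  fix \<Delta> assume \<Delta>: "\<Delta> \<in> \<D>"
  show "continuous_map (top_of_set \<Delta>) euclidean (\<lambda>x. pos (pt x \<Delta>))"
    by (rule continuous_map_eq[of _ _ "\<lambda>x. x"]) (use pos_pt[OF \<Delta>] in auto)
qed

lemma finD: "finite \<D>" using D_Fac finFac finite_subset by blast

lemma compact_Y: "compact_space Y"
proof -
  have "compactin Y ((\<lambda>x. pt x \<Delta>) ` \<Delta>)" if "\<Delta> \<in> \<D>" for \<Delta>
    by (rule image_compactin[OF _ continuous_pt[OF that]])
      (use compactB[OF D_B[OF that]] in \<open>simp add: compactin_subtopology\<close>)
  then have "compactin Y (\<Union>\<Delta>\<in>\<D>. (\<lambda>x. pt x \<Delta>) ` \<Delta>)"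
    using finD by (intro compactin_Union) auto
  moreover have "(\<Union>\<Delta>\<in>\<D>. (\<lambda>x. pt x \<Delta>) ` \<Delta>) = points" unfolding points_def by blast
  ultimately show ?thesis by (simp add: compact_space_def topspace_Y)
qed

lemma pointsE: assumes "p \<in> points" obtains x \<Delta> where "p = pt x \<Delta>" "\<Delta> \<in> \<D>" "x \<in> \<Delta>"
  using assms unfolding points_def by blast

lemma face_carrier: assumes "x \<in> \<Delta>" "\<Delta> \<in> B"
  obtains F where "F \<in> B" "F \<subseteq> \<Delta>" "x \<in> rel_interior F" "F \<noteq> {}"
proof -
  obtain F where F: "F \<in> B" "F \<subseteq> \<Delta>" "x \<in> rel_interior F" using carrier_exists[OF assms] .
  have "F \<noteq> {}" using F(3) by auto
  then show thesis using that F by blast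
qed

text \<open>A glued ridge through \<open>y\<close> contains \<open>F\<close> and therefore
  \<open>x\<close>: near \<open>x\<close>, no connections arise that are absent at
  \<open>x\<close>.\<close>

lemma adj_mono:
  assumes "F \<in> B" "x \<in> rel_interior F" "\<And>H. H \<in> B \<Longrightarrow> y \<in> H \<Longrightarrow> F \<subseteq> H"
  shows "adj y \<subseteq> adj x"
proof -
  have "x \<in> F" using assms(2) rel_interior_subset[of F] by blast
  then have "x \<in> \<rho>" if "\<rho> \<in> R" "y \<in> \<rho>" for \<rho> using assms(3)[of \<rho>] that R_B by blast
  then show ?thesis unfolding adj_def by blast
qed

text \<open>A glued ridge through a relative interior point of \<open>F\<close> contains all of
  \<open>F\<close>.\<close>

lemma adj_carrier:
  assumes "F \<in> B" "x \<in> rel_interior F" "y \<in> F" shows "adj x \<subseteq> adj y"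
proof -
  have "y \<in> \<rho>" if "\<rho> \<in> R" "x \<in> \<rho>" for \<rho>
    using carrier_subset[OF assms(1) R_B[OF that(1)] assms(2) that(2)] assms(3) by blast
  then show ?thesis unfolding adj_def by blast
qed

text \<open>Points at different positions are separated by \<open>pos\<close>. Two points at the
  same position \<open>x\<close> belong to different classes of facets at \<open>x\<close>. Over the
  open star of the carrier of \<open>x\<close> no further connections occur, so the classes give
  disjoint open sets there.\<close>

lemma Hausdorff_Y: "Hausdorff_space Y"
  unfolding Hausdorff_space_def topspace_Y
proof (intro allI impI)
  fix p q assume pq: "p \<in> points \<and> q \<in> points \<and> p \<noteq> q"
  obtain x \<Delta> where p: "p = pt x \<Delta>" "\<Delta> \<in> \<D>" "x \<in> \<Delta>" using pq pointsE by blast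
  obtain y E where q: "q = pt y E" "E \<in> \<D>" "y \<in> E" using pq pointsE by blast
  show "\<exists>U V. openin Y U \<and> openin Y V \<and> p \<in> U \<and> q \<in> V \<and> disjnt U V"
  proof (cases "x = y")
    case False
    obtain U V where UV: "open U" "open V" "x \<in> U" "y \<in> V" "U \<inter> V = {}"
      using separation_t2[of x y] False by blast
    have "openin Y {p \<in> topspace Y. pos p \<in> U}" "openin Y {p \<in> topspace Y. pos p \<in> V}"
      using openin_continuous_map_preimage[OF continuous_pos] UV by auto
    moreover have "p \<in> {p \<in> topspace Y. pos p \<in> U}" "q \<in> {p \<in> topspace Y. pos p \<in> V}"
      using p q UV pos_pt pt_in_points topspace_Y by simp_all
    moreover have "disjnt {p \<in> topspace Y. pos p \<in> U} {p \<in> topspace Y. pos p \<in> V}"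
      using UV(5) unfolding disjnt_def by blast
    ultimately show ?thesis by blast
  next
    case True
    have nc: "(\<Delta>, E) \<notin> (adj x)\<^sup>*" using pq p q True pt_eq_iff[of \<Delta> x E y] by blast
    obtain F where F: "F \<in> B" "F \<subseteq> \<Delta>" "x \<in> rel_interior F" "F \<noteq> {}" by (rule face_carrier[OF p(3) D_B[OF p(2)]])
    define S where "S = - \<Union>{H\<in>B. \<not> F \<subseteq> H}"
    have oS: "open S" unfolding S_def using finB closedB by (intro open_Compl closed_Union) auto
    have mono: "(adj z)\<^sup>* \<subseteq> (adj x)\<^sup>*" if "z \<in> S" for z
      by (rule rtrancl_mono[OF adj_mono[OF F(1,3)]]) (use that in \<open>auto simp: S_def\<close>)
    have xS: "x \<in> S" unfolding S_def using carrier_subset[OF F(1) _ F(3)] by blast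
    \<comment> \<open>The part of the glued space over the open star that belongs to the class of
      \<open>E\<close> at \<open>x\<close>.\<close>
    define N where "N = (\<lambda>E. {pt z M | z M. M \<in> \<D> \<and> z \<in> M \<and> z \<in> S \<and> (E, M) \<in> (adj x)\<^sup>*})"
    have No: "openin Y (N E)" for E
      unfolding openin_Y
    proof (intro conjI ballI)
      show "N E \<subseteq> points" unfolding N_def using pt_in_points by blast
      fix M assume M: "M \<in> \<D>"
      have "{z \<in> M. pt z M \<in> N E} = (if (E, M) \<in> (adj x)\<^sup>* then M \<inter> S else {})"
      proof -
        have "z \<in> S \<and> (E, M) \<in> (adj x)\<^sup>*" if z: "z \<in> M" "pt z M \<in> N E" for z
        proof -
          obtain z' M' where z': "pt z M = pt z' M'" "M' \<in> \<D>" "z' \<in> M'" "z' \<in> S" "(E, M') \<in> (adj x)\<^sup>*"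
            using z(2) unfolding N_def by blast
          then have "z = z'" "(M, M') \<in> (adj z)\<^sup>*" using pt_eq_iff[OF M z(1) z'(2,3)] by auto
          then have "(M', M) \<in> (adj x)\<^sup>*" using mono[of z] z'(4) sym_conn by blast
          then show ?thesis using z'(4,5) \<open>z = z'\<close> rtrancl_trans by metis
        qed
        moreover have "pt z M \<in> N E" if "z \<in> M" "z \<in> S" "(E, M) \<in> (adj x)\<^sup>*" for z
          unfolding N_def using that M by blast
        ultimately show ?thesis by auto
      qed
      then show "openin (top_of_set M) {z \<in> M. pt z M \<in> N E}" using oS by (simp add: openin_open_Int)
    qed
    have "p \<in> N \<Delta>" "q \<in> N E" unfolding N_def using p q True xS by blast+
    moreover have "disjnt (N \<Delta>) (N E)"
    proof -
      have False if r: "r \<in> N \<Delta>" "r \<in> N E" for r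
      proof -
        obtain z M where z: "r = pt z M" "M \<in> \<D>" "z \<in> M" "z \<in> S" "(\<Delta>, M) \<in> (adj x)\<^sup>*"
          using r(1) unfolding N_def by blast
        obtain z' M' where z': "r = pt z' M'" "M' \<in> \<D>" "z' \<in> M'" "(E, M') \<in> (adj x)\<^sup>*"
          using r(2) unfolding N_def by blast
        have "pt z M = pt z' M'" using z(1) z'(1) by simp
        then have "(M, M') \<in> (adj z)\<^sup>*" using pt_eq_iff[OF z(2,3) z'(2,3)] by blast
        then have "(M, M') \<in> (adj x)\<^sup>*" using mono[OF z(4)] by blast
        then have "(\<Delta>, E) \<in> (adj x)\<^sup>*" using z(5) sym_conn[OF z'(4)] rtrancl_trans by metis
        then show False using nc by simp
      qed
      then show ?thesis unfolding disjnt_def by blast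
    qed
    ultimately show ?thesis using No by blast
  qed
qed

lemma cells_CX: "cells CX = {cell F \<Delta> | F \<Delta>. \<Delta> \<in> \<D> \<and> F \<in> B \<and> F \<subseteq> \<Delta> \<and> F \<noteq> {}}"
  and space_CX: "space_of CX = Y"
  by (auto simp: CX_def)

lemma cellI: "\<Delta> \<in> \<D> \<Longrightarrow> F \<in> B \<Longrightarrow> F \<subseteq> \<Delta> \<Longrightarrow> F \<noteq> {} \<Longrightarrow> cell F \<Delta> \<in> cells CX"
  unfolding cells_CX by blast

lemma cellE: assumes "c \<in> cells CX"
  obtains F \<Delta> where "c = cell F \<Delta>" "\<Delta> \<in> \<D>" "F \<in> B" "F \<subseteq> \<Delta>" "F \<noteq> {}"
  using assms unfolding cells_CX by blast

lemma inj_pt: "\<Delta> \<in> \<D> \<Longrightarrow> inj_on (\<lambda>x. pt x \<Delta>) \<Delta>"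
  using pos_pt[of \<Delta>] by (rule inj_on_inverseI)

lemma cell_homeomorphic:
  assumes "\<Delta> \<in> \<D>" "F \<in> B" "F \<subseteq> \<Delta>"
  shows "homeomorphic_map (top_of_set F) (subtopology Y (cell F \<Delta>)) (\<lambda>x. pt x \<Delta>)"
proof (rule continuous_imp_homeomorphic_map)
  show "continuous_map (top_of_set F) (subtopology Y (cell F \<Delta>)) (\<lambda>x. pt x \<Delta>)"
    unfolding continuous_map_in_subtopology
  proof
    show "continuous_map (top_of_set F) Y (\<lambda>x. pt x \<Delta>)"
      using continuous_map_from_subtopology_mono[OF continuous_pt[OF assms(1)] assms(3)] .
  qed (auto simp: cell_def)
  show "compact_space (top_of_set F)" using compactB[OF assms(2)] by (simp add: compact_space_subtopology)
  show "Hausdorff_space (subtopology Y (cell F \<Delta>))" by (rule Hausdorff_space_subtopology[OF Hausdorff_Y])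
  have "cell F \<Delta> \<subseteq> points" unfolding cell_def using pt_in_points[OF assms(1)] assms(3) by blast
  then show "(\<lambda>x. pt x \<Delta>) ` topspace (top_of_set F) = topspace (subtopology Y (cell F \<Delta>))"
    by (auto simp: topspace_Y cell_def)
  show "inj_on (\<lambda>x. pt x \<Delta>) (topspace (top_of_set F))" using inj_on_subset[OF inj_pt[OF assms(1)] assms(3)] by simp
qed

lemma cell_subset_iff:
  assumes "\<Delta> \<in> \<D>" "F \<subseteq> \<Delta>" "E \<in> \<D>" "G \<subseteq> E"
  shows "cell F \<Delta> \<subseteq> cell G E \<longleftrightarrow> F \<subseteq> G \<and> (\<forall>x\<in>F. (\<Delta>, E) \<in> (adj x)\<^sup>*)"
proof
  assume sub: "cell F \<Delta> \<subseteq> cell G E"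
  have "x \<in> G \<and> (\<Delta>, E) \<in> (adj x)\<^sup>*" if "x \<in> F" for x
  proof -
    have "pt x \<Delta> \<in> cell G E" using sub that unfolding cell_def by blast
    then obtain y where y: "pt x \<Delta> = pt y E" "y \<in> G" unfolding cell_def by blast
    then show ?thesis using pt_eq_iff[OF assms(1) _ assms(3), of x y] assms that by blast
  qed
  then show "F \<subseteq> G \<and> (\<forall>x\<in>F. (\<Delta>, E) \<in> (adj x)\<^sup>*)" by blast
next
  assume *: "F \<subseteq> G \<and> (\<forall>x\<in>F. (\<Delta>, E) \<in> (adj x)\<^sup>*)"
  have "pt x \<Delta> \<in> cell G E" if "x \<in> F" for x
  proof -
    have "pt x \<Delta> = pt x E" using pt_eq_iff[OF assms(1) _ assms(3), of x x] * assms that by blast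
    then show ?thesis using * that unfolding cell_def by blast
  qed
  then show "cell F \<Delta> \<subseteq> cell G E" unfolding cell_def[of F] by blast
qed

lemma cell_cong:
  assumes "\<Delta> \<in> \<D>" "F \<subseteq> \<Delta>" "E \<in> \<D>" "F \<subseteq> E" "\<And>x. x \<in> F \<Longrightarrow> (\<Delta>, E) \<in> (adj x)\<^sup>*"
  shows "cell F \<Delta> = cell F E"
  unfolding cell_def
proof (rule image_cong[OF refl])
  show "pt x \<Delta> = pt x E" if "x \<in> F" for x
    using pt_eq_iff[OF assms(1) _ assms(3), of x x] assms that by blast
qed

text \<open>A cell contained in \<open>cell G E\<close> can be rewritten as a face of the facet
  \<open>E\<close>, so the face poset below it is that of the simplex \<open>G\<close>.\<close>

lemma subcells:
  assumes "E \<in> \<D>" "G \<in> B" "G \<subseteq> E"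
  shows "{c \<in> cells CX. c \<subseteq> cell G E} = {cell F E | F. F \<in> B \<and> F \<subseteq> G \<and> F \<noteq> {}}"
proof (intro subset_antisym subsetI)
  fix c assume "c \<in> {c \<in> cells CX. c \<subseteq> cell G E}"
  then obtain F \<Delta> where F: "c = cell F \<Delta>" "\<Delta> \<in> \<D>" "F \<in> B" "F \<subseteq> \<Delta>" "F \<noteq> {}" "c \<subseteq> cell G E"
    using cellE by blast
  have *: "F \<subseteq> G" "\<And>x. x \<in> F \<Longrightarrow> (\<Delta>, E) \<in> (adj x)\<^sup>*"
    using F(6) unfolding F(1) cell_subset_iff[OF F(2,4) assms(1,3)] by auto
  have "cell F \<Delta> = cell F E" using cell_cong[OF F(2,4) assms(1)] * assms(3) by blast
  then show "c \<in> {cell F E | F. F \<in> B \<and> F \<subseteq> G \<and> F \<noteq> {}}" using F * by blast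
next
  fix c assume "c \<in> {cell F E | F. F \<in> B \<and> F \<subseteq> G \<and> F \<noteq> {}}"
  then obtain F where F: "c = cell F E" "F \<in> B" "F \<subseteq> G" "F \<noteq> {}" by blast
  then show "c \<in> {c \<in> cells CX. c \<subseteq> cell G E}"
    using cellI[OF assms(1) F(2)] assms(3) unfolding cell_def by blast
qed

lemma cell_same_subset_iff:
  assumes "E \<in> \<D>" "F \<subseteq> E" "G \<subseteq> E" shows "cell F E \<subseteq> cell G E \<longleftrightarrow> F \<subseteq> G"
  using cell_subset_iff[OF assms(1,2,1,3)] by blast

lemma cell_psubset_iff:
  assumes "E \<in> \<D>" "F \<subseteq> E" "G \<subseteq> E" shows "cell F E \<subset> cell G E \<longleftrightarrow> F \<subset> G"
  using cell_same_subset_iff[OF assms] cell_same_subset_iff[OF assms(1,3,2)] by blast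

lemma proper_faces_union_cell:
  assumes "E \<in> \<D>" "G \<in> B" "G \<subseteq> E"
  shows "proper_faces_union CX (cell G E) = (\<lambda>x. pt x E) ` rel_frontier G"
proof -
  have "{c' \<in> cells CX. c' \<subset> cell G E} = {c' \<in> {c \<in> cells CX. c \<subseteq> cell G E}. c' \<subset> cell G E}" by blast
  also have "\<dots> = {cell F E | F. F \<in> B \<and> F \<subset> G \<and> F \<noteq> {}}"
    unfolding subcells[OF assms]
  proof (intro subset_antisym subsetI)
    fix c assume "c \<in> {c' \<in> {cell F E | F. F \<in> B \<and> F \<subseteq> G \<and> F \<noteq> {}}. c' \<subset> cell G E}"
    then obtain F where F: "c = cell F E" "F \<in> B" "F \<subseteq> G" "F \<noteq> {}" "cell F E \<subset> cell G E" by blast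
    have "F \<subset> G" using F(5) cell_psubset_iff[OF assms(1) order_trans[OF F(3) assms(3)] assms(3)] by simp
    then show "c \<in> {cell F E | F. F \<in> B \<and> F \<subset> G \<and> F \<noteq> {}}" using F(1,2,4) by blast
  next
    fix c assume "c \<in> {cell F E | F. F \<in> B \<and> F \<subset> G \<and> F \<noteq> {}}"
    then obtain F where F: "c = cell F E" "F \<in> B" "F \<subset> G" "F \<noteq> {}" by blast
    then have FG: "F \<subseteq> G" by blast
    have "cell F E \<subset> cell G E"
      using F(3) cell_psubset_iff[OF assms(1) order_trans[OF FG assms(3)] assms(3)] by simp
    then show "c \<in> {c' \<in> {cell F E | F. F \<in> B \<and> F \<subseteq> G \<and> F \<noteq> {}}. c' \<subset> cell G E}"
      using F(1,2,4) FG by blast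
  qed
  finally have "proper_faces_union CX (cell G E) = \<Union>{cell F E | F. F \<in> B \<and> F \<subset> G \<and> F \<noteq> {}}"
    unfolding proper_faces_union_def by simp
  also have "\<dots> = (\<lambda>x. pt x E) ` \<Union>{F \<in> B. F \<subset> G}" unfolding cell_def by blast
  also have "\<Union>{F \<in> B. F \<subset> G} = rel_frontier G"
  proof -
    have "{F. F face_of G \<and> F \<noteq> G} = {F \<in> B. F \<subset> G}"
      using face_in[OF assms(2)] face_iff_subset[OF _ assms(2)] by blast
    then show ?thesis
      using rel_frontier_of_polyhedron_alt[OF polytope_imp_polyhedron[OF polytopeB[OF assms(2)]]] by simp
  qed
  finally show ?thesis .
qed

lemma cell_interior:
  assumes "E \<in> \<D>" "G \<in> B" "G \<subseteq> E"
  shows "cell G E - proper_faces_union CX (cell G E) = (\<lambda>x. pt x E) ` rel_interior G"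
proof -
  have rf: "rel_frontier G = G - rel_interior G" using closedB[OF assms(2)] by (simp add: rel_frontier_def)
  have inj: "inj_on (\<lambda>x. pt x E) G" using inj_on_subset[OF inj_pt[OF assms(1)] assms(3)] .
  have "cell G E - proper_faces_union CX (cell G E) = (\<lambda>x. pt x E) ` G - (\<lambda>x. pt x E) ` (G - rel_interior G)"
    unfolding proper_faces_union_cell[OF assms] rf unfolding cell_def ..
  also have "\<dots> = (\<lambda>x. pt x E) ` (G - (G - rel_interior G))"
    by (rule inj_on_image_set_diff[OF inj, symmetric]) auto
  also have "G - (G - rel_interior G) = rel_interior G" using rel_interior_subset[of G] by blast
  finally show ?thesis .
qed

lemma finite_regular_CX: "finite_regular_CW CX"
  unfolding finite_regular_CW_def space_CX
proof (intro conjI ballI impI)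
  show "Hausdorff_space Y" by (rule Hausdorff_Y)
  have "cells CX \<subseteq> (\<lambda>(F, \<Delta>). cell F \<Delta>) ` (B \<times> \<D>)" unfolding cells_CX by auto
  then show "finite (cells CX)" using finB finD by (meson finite_SigmaI finite_imageI finite_subset)
  show "topspace Y = \<Union>(cells CX)"
  proof (intro subset_antisym subsetI)
    fix p assume "p \<in> topspace Y"
    then obtain x \<Delta> where p: "p = pt x \<Delta>" "\<Delta> \<in> \<D>" "x \<in> \<Delta>" using pointsE topspace_Y by blast
    then have "p \<in> cell \<Delta> \<Delta>" "cell \<Delta> \<Delta> \<in> cells CX" using cellI[OF p(2) D_B[OF p(2)]] by (auto simp: cell_def)
    then show "p \<in> \<Union>(cells CX)" by blast
  next
    fix p assume "p \<in> \<Union>(cells CX)"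
    then obtain c where c: "c \<in> cells CX" "p \<in> c" by blast
    obtain F \<Delta> where "c = cell F \<Delta>" "\<Delta> \<in> \<D>" "F \<subseteq> \<Delta>" using cellE[OF c(1)] by blast
    then show "p \<in> topspace Y" using c(2) pt_in_points unfolding topspace_Y cell_def by blast
  qed
next
  fix c assume "c \<in> cells CX"
  then obtain F \<Delta> where F: "c = cell F \<Delta>" "\<Delta> \<in> \<D>" "F \<in> B" "F \<subseteq> \<Delta>" "F \<noteq> {}" by (rule cellE)
  define n where "n = nat (aff_dim F)"
  have "aff_dim F = int n" using empty_dim[OF F(3)] F(5) by (simp add: n_def)
  then obtain h where h: "homeomorphic_map (unit_ball n) (top_of_set F) h" "h ` unit_sphere_of_ball n = rel_frontier F"
    using convex_compact_unit_ball[OF compactB[OF F(3)] convexB[OF F(3)]] by blast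
  have "homeomorphic_map (unit_ball n) (subtopology Y c) ((\<lambda>x. pt x \<Delta>) \<circ> h)"
    unfolding F(1) by (rule homeomorphic_map_compose[OF h(1) cell_homeomorphic[OF F(2-4)]])
  moreover have "((\<lambda>x. pt x \<Delta>) \<circ> h) ` unit_sphere_of_ball n = proper_faces_union CX c"
    unfolding F(1) proper_faces_union_cell[OF F(2-4)] image_comp[symmetric] h(2) ..
  ultimately show "\<exists>n h. homeomorphic_map (unit_ball n) (subtopology Y c) h \<and>
        h ` unit_sphere_of_ball n = proper_faces_union CX c" by blast
next
  fix c c' assume c: "c \<in> cells CX" "c' \<in> cells CX" "c \<noteq> c'"
  obtain F \<Delta> where F: "c = cell F \<Delta>" "\<Delta> \<in> \<D>" "F \<in> B" "F \<subseteq> \<Delta>" "F \<noteq> {}" by (rule cellE[OF c(1)])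
  obtain G E where G: "c' = cell G E" "E \<in> \<D>" "G \<in> B" "G \<subseteq> E" "G \<noteq> {}" by (rule cellE[OF c(2)])
  have False if x: "x \<in> rel_interior F" and y: "y \<in> rel_interior G" and eq: "pt x \<Delta> = pt y E" for x y
  proof -
    have xF: "x \<in> F" "y \<in> G" using x y rel_interior_subset[of F] rel_interior_subset[of G] by auto
    then have *: "x = y" "(\<Delta>, E) \<in> (adj x)\<^sup>*" using pt_eq_iff[OF F(2) _ G(2), of x y] eq F(4) G(4) by auto
    then have FG: "F = G" using carrier_unique[OF F(3) G(3) x] y by simp
    \<comment> \<open>A connection at a relative interior point of \<open>F\<close> persists at
      every point of \<open>F\<close>, so one common interior point forces the two cells to
      coincide.\<close>
    have "(\<Delta>, E) \<in> (adj z)\<^sup>*" if "z \<in> F" for z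
      using rtrancl_mono[OF adj_carrier[OF F(3) x that]] *(2) by blast
    then have "cell F \<Delta> = cell F E" using cell_cong[OF F(2,4) G(2)] G(4) FG by blast
    then show False using c(3) F(1) G(1) FG by simp
  qed
  then show "(c - proper_faces_union CX c) \<inter> (c' - proper_faces_union CX c') = {}"
    unfolding F(1) G(1) cell_interior[OF F(2-4)] cell_interior[OF G(2-4)] by blast
qed

lemma boolean_lower_interval:
  assumes "c \<in> cells CX" shows "boolean_family (lower_interval CX c)"
proof -
  obtain G E where G: "c = cell G E" "E \<in> \<D>" "G \<in> B" "G \<subseteq> E" "G \<noteq> {}" by (rule cellE[OF assms])
  obtain g where g: "bij_betw g {..<card (verts G)} (verts G)"
    using ex_bij_betw_nat_finite[OF simplex_verts(1)[OF G(3)]] by (auto simp: atLeast0LessThan)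
  let ?V = "{..<card (verts G)}"
  have gi: "inj_on g ?V" "g ` ?V = verts G" using g by (auto simp: bij_betw_def)
  define f where "f = (\<lambda>A. cell (convex hull (g ` A)) E)"
  have A: "convex hull (g ` A) \<in> B" "verts (convex hull (g ` A)) = g ` A" "convex hull (g ` A) \<subseteq> G"
    if "A \<in> Pow ?V" for A
  proof -
    have "g ` A \<subseteq> verts G" using that gi(2) by blast
    then show "convex hull (g ` A) \<in> B" "verts (convex hull (g ` A)) = g ` A" "convex hull (g ` A) \<subseteq> G"
      using subset_verts[OF G(3)] by auto
  qed
  have iff: "A \<subseteq> A' \<longleftrightarrow> f A \<subseteq> f A'" if AA: "A \<in> Pow ?V" "A' \<in> Pow ?V" for A A'
  proof -
    have "f A \<subseteq> f A' \<longleftrightarrow> convex hull (g ` A) \<subseteq> convex hull (g ` A')"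
      unfolding f_def using cell_same_subset_iff[OF G(2)] A(3)[OF AA(1)] A(3)[OF AA(2)] G(4) by blast
    also have "\<dots> \<longleftrightarrow> g ` A \<subseteq> g ` A'"
      using verts_mono_iff[OF A(1)[OF AA(1)] A(1)[OF AA(2)]] A(2)[OF AA(1)] A(2)[OF AA(2)] by simp
    also have "\<dots> \<longleftrightarrow> A \<subseteq> A'" using AA inj_on_image_subset_iff[OF gi(1)] by simp
    finally show ?thesis by simp
  qed
  have "bij_betw f (Pow ?V) (lower_interval CX c)"
  proof (rule bij_betw_imageI)
    show "inj_on f (Pow ?V)" using iff by (intro inj_onI) blast
    have li: "lower_interval CX c = insert {} {cell F E | F. F \<in> B \<and> F \<subseteq> G \<and> F \<noteq> {}}"
      unfolding lower_interval_def G(1) subcells[OF G(2-4)] ..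
    show "f ` Pow ?V = lower_interval CX c"
    proof (intro subset_antisym subsetI)
      fix c' assume "c' \<in> f ` Pow ?V"
      then obtain A' where A': "A' \<in> Pow ?V" "c' = cell (convex hull (g ` A')) E" unfolding f_def by blast
      show "c' \<in> lower_interval CX c"
        unfolding li A'(2) using A[OF A'(1)] by (cases "convex hull (g ` A') = {}") (auto simp: cell_def)
    next
      fix c' assume "c' \<in> lower_interval CX c"
      then consider "c' = {}" | F where "c' = cell F E" "F \<in> B" "F \<subseteq> G" unfolding li by blast
      then show "c' \<in> f ` Pow ?V"
      proof cases
        case 1
        then have "c' = f {}" by (simp add: f_def cell_def)
        then show ?thesis by blast
      next
        case 2
        have "verts F \<subseteq> g ` ?V" using verts_mono_iff[OF 2(2) G(3)] 2(3) gi(2) by simp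
        then obtain A' where "A' \<subseteq> ?V" "verts F = g ` A'" by (rule subset_imageE)
        then have "c' = f A'" using simplex_verts(3)[OF 2(2)] 2(1) unfolding f_def by simp
        then show ?thesis using \<open>A' \<subseteq> ?V\<close> by blast
      qed
    qed
  qed
  then show ?thesis unfolding boolean_family_def
    by (intro exI[of _ ?V] exI[of _ f] conjI) (use iff in auto)
qed

text \<open>A cell is homeomorphic to its face, which is a ball of its affine dimension, and the
  dimension of a ball is a topological invariant.\<close>

lemma cells_of_dim_CX: "cells_of_dim n CX = {cell F \<Delta> | F \<Delta>. \<Delta> \<in> \<D> \<and> F \<in> B \<and> F \<subseteq> \<Delta> \<and> aff_dim F = int n}"
proof -
  have key: "subtopology Y (cell F \<Delta>) homeomorphic_space unit_ball n \<longleftrightarrow> aff_dim F = int n"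
    if F: "\<Delta> \<in> \<D>" "F \<in> B" "F \<subseteq> \<Delta>" "F \<noteq> {}" for F \<Delta>
  proof -
    define m where "m = nat (aff_dim F)"
    have m: "aff_dim F = int m" using empty_dim[OF F(2)] F(4) by (simp add: m_def)
    then obtain h where "homeomorphic_map (unit_ball m) (top_of_set F) h"
      using convex_compact_unit_ball[OF compactB[OF F(2)] convexB[OF F(2)]] by blast
    then have "unit_ball m homeomorphic_space top_of_set F" by (rule homeomorphic_map_imp_homeomorphic_space)
    then have 1: "unit_ball m homeomorphic_space subtopology Y (cell F \<Delta>)"
      using homeomorphic_map_imp_homeomorphic_space[OF cell_homeomorphic[OF F(1-3)]] homeomorphic_space_trans by blast
    show ?thesis
    proof
      assume "subtopology Y (cell F \<Delta>) homeomorphic_space unit_ball n"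
      then have "unit_ball m homeomorphic_space unit_ball n" using 1 homeomorphic_space_trans by blast
      then obtain g where "homeomorphic_map (unit_ball m) (unit_ball n) g" unfolding homeomorphic_space by blast
      then show "aff_dim F = int n" using homeomorphic_unit_balls_dim m by simp
    next
      assume "aff_dim F = int n"
      then have "m = n" using m by simp
      then show "subtopology Y (cell F \<Delta>) homeomorphic_space unit_ball n"
        using 1 homeomorphic_space_sym by blast
    qed
  qed
  show ?thesis unfolding cells_of_dim_def space_CX
  proof (intro subset_antisym subsetI)
    fix c assume "c \<in> {c \<in> cells CX. subtopology Y c homeomorphic_space unit_ball n}"
    then have c: "c \<in> cells CX" "subtopology Y c homeomorphic_space unit_ball n" by auto
    obtain F \<Delta> where F: "c = cell F \<Delta>" "\<Delta> \<in> \<D>" "F \<in> B" "F \<subseteq> \<Delta>" "F \<noteq> {}" by (rule cellE[OF c(1)])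
    then show "c \<in> {cell F \<Delta> | F \<Delta>. \<Delta> \<in> \<D> \<and> F \<in> B \<and> F \<subseteq> \<Delta> \<and> aff_dim F = int n}"
      using key[OF F(2-5)] c(2) by blast
  next
    fix c assume "c \<in> {cell F \<Delta> | F \<Delta>. \<Delta> \<in> \<D> \<and> F \<in> B \<and> F \<subseteq> \<Delta> \<and> aff_dim F = int n}"
    then obtain F \<Delta> where F: "c = cell F \<Delta>" "\<Delta> \<in> \<D>" "F \<in> B" "F \<subseteq> \<Delta>" "aff_dim F = int n" by blast
    have "F \<noteq> {}" using F(5) by auto
    then show "c \<in> {c \<in> cells CX. subtopology Y c homeomorphic_space unit_ball n}"
      using key[OF F(2-4)] F cellI[OF F(2-4)] by simp
  qed
qed

lemma d_cells: "cells_of_dim d CX = (\<lambda>\<Delta>. cell \<Delta> \<Delta>) ` \<D>"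
proof -
  have "F = \<Delta>" if "\<Delta> \<in> \<D>" "F \<in> B" "F \<subseteq> \<Delta>" "aff_dim F = int d" for F \<Delta>
    using facet_max[of F \<Delta>] that Fac_B D_B by blast
  moreover have "aff_dim \<Delta> = int d \<and> \<Delta> \<in> B" if "\<Delta> \<in> \<D>" for \<Delta> using that D_Fac Fac_B by blast
  ultimately show ?thesis unfolding cells_of_dim_CX by blast
qed

lemma int_d1: "int (d - 1) = int d - 1" using d2 by simp

lemma ridge_cell_cofaces:
  assumes "\<Delta> \<in> \<D>" "\<rho> \<in> Rid" "\<rho> \<subseteq> \<Delta>"
  shows "{D \<in> cells_of_dim d CX. cell \<rho> \<Delta> \<subseteq> D} = (\<lambda>E. cell E E) ` {E \<in> \<D> \<inter> cofac \<rho>. \<forall>x\<in>\<rho>. (\<Delta>, E) \<in> (adj x)\<^sup>*}"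
  unfolding d_cells
proof (intro subset_antisym subsetI)
  fix D assume "D \<in> {D \<in> (\<lambda>\<Delta>. cell \<Delta> \<Delta>) ` \<D>. cell \<rho> \<Delta> \<subseteq> D}"
  then obtain E where E: "D = cell E E" "E \<in> \<D>" "cell \<rho> \<Delta> \<subseteq> cell E E" by blast
  then show "D \<in> (\<lambda>E. cell E E) ` {E \<in> \<D> \<inter> cofac \<rho>. \<forall>x\<in>\<rho>. (\<Delta>, E) \<in> (adj x)\<^sup>*}"
    using cell_subset_iff[OF assms(1,3) E(2) order_refl] D_Fac unfolding cofac_def by blast
next
  fix D assume "D \<in> (\<lambda>E. cell E E) ` {E \<in> \<D> \<inter> cofac \<rho>. \<forall>x\<in>\<rho>. (\<Delta>, E) \<in> (adj x)\<^sup>*}"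
  then obtain E where E: "D = cell E E" "E \<in> \<D>" "E \<in> cofac \<rho>" "\<forall>x\<in>\<rho>. (\<Delta>, E) \<in> (adj x)\<^sup>*" by blast
  then show "D \<in> {D \<in> (\<lambda>\<Delta>. cell \<Delta> \<Delta>) ` \<D>. cell \<rho> \<Delta> \<subseteq> D}"
    using cell_subset_iff[OF assms(1,3) E(2) order_refl] unfolding cofac_def by blast
qed

text \<open>The d-cells above a ridge cell come from facets above that ridge in the ball, of which
  there are at most two.\<close>

lemma pseudomanifold_CX: "pseudomanifold d CX"
  unfolding pseudomanifold_def simplicial_CW_def
proof (intro conjI ballI)
  show "finite_regular_CW CX" by (rule finite_regular_CX)
  show "boolean_family (lower_interval CX c)" if "c \<in> cells CX" for c by (rule boolean_lower_interval[OF that])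
  show "\<exists>D\<in>cells_of_dim d CX. c \<subseteq> D" if c: "c \<in> cells CX" for c
  proof -
    obtain F \<Delta> where F: "c = cell F \<Delta>" "\<Delta> \<in> \<D>" "F \<subseteq> \<Delta>" using cellE[OF c] by blast
    then show ?thesis unfolding d_cells using cell_same_subset_iff[OF F(2,3) order_refl] by blast
  qed
  show "card {D \<in> cells_of_dim d CX. c \<subseteq> D} \<le> 2" if c: "c \<in> cells_of_dim (d - 1) CX" for c
  proof -
    obtain \<rho> \<Delta> where \<rho>: "c = cell \<rho> \<Delta>" "\<Delta> \<in> \<D>" "\<rho> \<in> Rid" "\<rho> \<subseteq> \<Delta>"
      using c unfolding cells_of_dim_CX int_d1 Rid_B by blast
    have "card {D \<in> cells_of_dim d CX. c \<subseteq> D} \<le> card {E \<in> \<D> \<inter> cofac \<rho>. \<forall>x\<in>\<rho>. (\<Delta>, E) \<in> (adj x)\<^sup>*}"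
      unfolding \<rho>(1) ridge_cell_cofaces[OF \<rho>(2-4)] by (rule card_image_le) (use fincofac in auto)
    also have "\<dots> \<le> card (cofac \<rho>)" by (rule card_mono[OF fincofac]) auto
    also have "\<dots> \<le> 2" by (rule card_cofac_le[OF \<rho>(3)])
    finally show ?thesis .
  qed
qed

lemma boundary_facetI:
  assumes "\<Delta> \<in> \<D>" "\<rho> \<in> Rid" "\<rho> \<subseteq> \<Delta>"
    and only: "\<And>E. E \<in> \<D> \<Longrightarrow> E \<in> cofac \<rho> \<Longrightarrow> \<forall>x\<in>\<rho>. (\<Delta>, E) \<in> (adj x)\<^sup>* \<Longrightarrow> E = \<Delta>"
  shows "cell \<rho> \<Delta> \<in> boundary_facets d CX"
proof -
  have "\<Delta> \<in> cofac \<rho>" using assms D_Fac unfolding cofac_def by blast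
  then have "{E \<in> \<D> \<inter> cofac \<rho>. \<forall>x\<in>\<rho>. (\<Delta>, E) \<in> (adj x)\<^sup>*} = {\<Delta>}" using only assms(1) by auto
  then have "card {D \<in> cells_of_dim d CX. cell \<rho> \<Delta> \<subseteq> D} = 1"
    unfolding ridge_cell_cofaces[OF assms(1-3)] by simp
  moreover have "cell \<rho> \<Delta> \<in> cells_of_dim (d - 1) CX"
    unfolding cells_of_dim_CX int_d1 using assms(1-3) Rid_B by blast
  ultimately show ?thesis unfolding boundary_facets_def by simp
qed

end

section \<open>One step of a construction as a gluing or an identification of glued spaces\<close>

locale glued_pair = G: glued B d code \<D> R + G': glued B d code \<D>' R'
  for B :: "'a::euclidean_space set set" and d and code :: "'a \<times> 'a set \<Rightarrow> 'p" and \<D> R \<D>' R' +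
  assumes D_mono: "\<D> \<subseteq> \<D>'" and R_mono: "R \<subseteq> R'"
begin

text \<open>The passage to the later stage. Identifications only increase, so by
  \<open>tr_pt\<close> the image does not depend on the facet in which a point is
  represented.\<close>

definition tr :: "'p \<Rightarrow> 'p" where
  "tr p = G'.pt (G.pos p) (G.sheet p)"

lemma conn_mono: "(E, E') \<in> (G.adj x)\<^sup>* \<Longrightarrow> (E, E') \<in> (G'.adj x)\<^sup>*"
proof -
  have "G.adj x \<subseteq> G'.adj x" unfolding G.adj_def G'.adj_def using D_mono R_mono by blast
  then show "(E, E') \<in> (G.adj x)\<^sup>* \<Longrightarrow> (E, E') \<in> (G'.adj x)\<^sup>*" using rtrancl_mono by blast
qed

lemma tr_pt: assumes "\<Delta> \<in> \<D>" "x \<in> \<Delta>" shows "tr (G.pt x \<Delta>) = G'.pt x \<Delta>"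
proof -
  have r: "G.rep x \<Delta> \<in> \<D>" "x \<in> G.rep x \<Delta>" using G.rep_in[OF assms] by auto
  have "(\<Delta>, G.rep x \<Delta>) \<in> (G'.adj x)\<^sup>*" by (rule conn_mono[OF G.rep_conn])
  then have "G'.pt x \<Delta> = G'.pt x (G.rep x \<Delta>)"
    using G'.pt_eq_iff[of \<Delta> x "G.rep x \<Delta>" x] assms r D_mono by blast
  then show ?thesis unfolding tr_def G.pos_pt[OF assms] G.sheet_pt[OF assms] by simp
qed

lemma continuous_tr: "continuous_map G.Y G'.Y tr"
proof (rule G.continuous_from_Y)
  fix \<Delta> assume \<Delta>: "\<Delta> \<in> \<D>"
  show "continuous_map (top_of_set \<Delta>) G'.Y (\<lambda>x. tr (G.pt x \<Delta>))"
    by (rule continuous_map_eq[OF G'.continuous_pt[of \<Delta>]]) (use \<Delta> D_mono tr_pt in auto)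
qed

lemma tr_cell: assumes "\<Delta> \<in> \<D>" "F \<subseteq> \<Delta>" shows "tr ` G.cell F \<Delta> = G'.cell F \<Delta>"
  unfolding G.cell_def G'.cell_def image_image
  by (rule image_cong[OF refl]) (use tr_pt[OF assms(1)] assms(2) in blast)

lemma tr_cells: "(\<lambda>c. tr ` c) ` cells G.CX = {G'.cell F \<Delta> | F \<Delta>. \<Delta> \<in> \<D> \<and> F \<in> B \<and> F \<subseteq> \<Delta> \<and> F \<noteq> {}}"
proof (intro subset_antisym subsetI)
  fix c assume "c \<in> (\<lambda>c. tr ` c) ` cells G.CX"
  then obtain c0 where c0: "c0 \<in> cells G.CX" "c = tr ` c0" by blast
  obtain F \<Delta> where F: "c0 = G.cell F \<Delta>" "\<Delta> \<in> \<D>" "F \<in> B" "F \<subseteq> \<Delta>" "F \<noteq> {}" by (rule G.cellE[OF c0(1)])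
  then show "c \<in> {G'.cell F \<Delta> | F \<Delta>. \<Delta> \<in> \<D> \<and> F \<in> B \<and> F \<subseteq> \<Delta> \<and> F \<noteq> {}}"
    using c0(2) tr_cell[OF F(2,4)] by blast
next
  fix c assume "c \<in> {G'.cell F \<Delta> | F \<Delta>. \<Delta> \<in> \<D> \<and> F \<in> B \<and> F \<subseteq> \<Delta> \<and> F \<noteq> {}}"
  then obtain F \<Delta> where F: "c = G'.cell F \<Delta>" "\<Delta> \<in> \<D>" "F \<in> B" "F \<subseteq> \<Delta>" "F \<noteq> {}" by blast
  have "c = tr ` G.cell F \<Delta>" using tr_cell[OF F(2,4)] F(1) by simp
  then show "c \<in> (\<lambda>c. tr ` c) ` cells G.CX" using G.cellI[OF F(2-5)] by blast
qed

text \<open>Earlier glued ridges involve old facets only (\<open>old\<close>), so the new facet is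
  connected to the rest solely through \<open>\<rho>\<close>. Hence the old space embeds, and it
  meets the new simplex exactly in the cell of \<open>\<rho>\<close>.\<close>

lemma glue_step:
  assumes \<Delta>: "\<Delta> \<in> G.Fac" "\<Delta> \<notin> \<D>" and \<Delta>0: "\<Delta>0 \<in> \<D>" and \<rho>: "\<rho> \<in> G.Rid" "\<rho> \<subseteq> \<Delta>" "\<rho> \<subseteq> \<Delta>0"
    and D': "\<D>' = insert \<Delta> \<D>" and R': "R' = insert \<rho> R"
    and old: "\<And>r. r \<in> R \<Longrightarrow> G.cofac r \<subseteq> \<D>"
  shows "glue_simplex d G.CX G'.CX"
proof -
  have \<Delta>0F: "\<Delta>0 \<in> G.Fac" "\<Delta>0 \<noteq> \<Delta>" using \<Delta>0 \<Delta>(2) G.D_Fac by auto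
  have co: "G.cofac \<rho> = {\<Delta>, \<Delta>0}"
    by (rule G.cofac_pair(1)[OF \<rho>(1)]) (use \<Delta>(1) \<Delta>0F \<rho> in \<open>auto simp: G.cofac_def\<close>)
  have \<Delta>D': "\<Delta> \<in> \<D>'" "\<Delta>0 \<in> \<D>'" using D' \<Delta>0 by auto
  \<comment> \<open>The new facet is a dead end: it is entered and left through
    \<open>\<rho>\<close>, and only from \<open>\<Delta>0\<close>, so connections between old facets
    need no detour through it.\<close>
  have path: "(E \<in> \<D> \<and> (\<Delta>1, E) \<in> (G.adj x)\<^sup>*) \<or> (E = \<Delta> \<and> x \<in> \<rho> \<and> (\<Delta>1, \<Delta>0) \<in> (G.adj x)\<^sup>*)"
    if "(\<Delta>1, E) \<in> (G'.adj x)\<^sup>*" "\<Delta>1 \<in> \<D>" for \<Delta>1 E x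
    using that
  proof (induction rule: rtrancl_induct)
    case base
    then show ?case by simp
  next
    case (step E E')
    obtain r where r: "E \<in> \<D>'" "E' \<in> \<D>'" "r \<in> R'" "x \<in> r" "r \<subseteq> E" "r \<subseteq> E'"
      using step(2) unfolding G'.adj_def by blast
    have EF: "E \<in> G.cofac r" "E' \<in> G.cofac r" using r G'.D_Fac unfolding G.cofac_def by auto
    have rr: "r = \<rho> \<or> (r \<in> R \<and> E \<in> \<D> \<and> E' \<in> \<D>)" using r(3) R' old[of r] EF by blast
    consider "r = \<rho>" "E = \<Delta>" | "r = \<rho>" "E = \<Delta>0" | "r \<in> R" "E \<in> \<D>" "E' \<in> \<D>"
      using rr EF(1) co by blast
    then show ?case
    proof cases
      case 1
      then have "(\<Delta>1, \<Delta>0) \<in> (G.adj x)\<^sup>*" using step(3) step(4) \<Delta>(2) by blast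
      then show ?thesis using EF(2) 1 co r(4) \<Delta>0 by blast
    next
      case 2
      then have "(\<Delta>1, \<Delta>0) \<in> (G.adj x)\<^sup>*" using step(3) step(4) \<Delta>0F(2) by blast
      then show ?thesis using EF(2) 2 co r(4) \<Delta>0 by blast
    next
      case 3
      have "(E, E') \<in> G.adj x" unfolding G.adj_def using 3 r by blast
      moreover have "(\<Delta>1, E) \<in> (G.adj x)\<^sup>*" using step(3) step(4) 3 \<Delta>(2) by blast
      ultimately show ?thesis using 3(3) rtrancl_into_rtrancl by metis
    qed
  qed
  have edge: "(\<Delta>0, \<Delta>) \<in> (G'.adj x)\<^sup>*" if "x \<in> \<rho>" for x
    unfolding G'.adj_def using that \<Delta>D' \<rho> R' by blast
  have bf: "G.cell \<rho> \<Delta>0 \<in> boundary_facets d G.CX"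
  proof (rule G.boundary_facetI[OF \<Delta>0 \<rho>(1,3)])
    show "E = \<Delta>0" if "E \<in> \<D>" "E \<in> G.cofac \<rho>" for E using that \<Delta>(2) unfolding co by auto
  qed
  have DD: "G'.cell \<Delta> \<Delta> \<in> cells_of_dim d G'.CX" unfolding G'.d_cells using \<Delta>D' by blast
  have inj: "inj_on tr (topspace G.Y)"
  proof (rule inj_onI)
    fix p q assume pq: "p \<in> topspace G.Y" "q \<in> topspace G.Y" "tr p = tr q"
    obtain x \<Delta>1 where p: "p = G.pt x \<Delta>1" "\<Delta>1 \<in> \<D>" "x \<in> \<Delta>1" by (rule G.pointsE[OF pq(1)[unfolded G.topspace_Y]])
    obtain y \<Delta>2 where q: "q = G.pt y \<Delta>2" "\<Delta>2 \<in> \<D>" "y \<in> \<Delta>2" by (rule G.pointsE[OF pq(2)[unfolded G.topspace_Y]])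
    have "G'.pt x \<Delta>1 = G'.pt y \<Delta>2" using pq(3) p q tr_pt by simp
    then have "x = y" "(\<Delta>1, \<Delta>2) \<in> (G'.adj x)\<^sup>*"
      using G'.pt_eq_iff[of \<Delta>1 x \<Delta>2 y] p(2,3) q(2,3) D_mono by auto
    moreover have "\<Delta>2 \<noteq> \<Delta>" using q(2) \<Delta>(2) by blast
    ultimately have "x = y" "(\<Delta>1, \<Delta>2) \<in> (G.adj x)\<^sup>*" using path[of \<Delta>1 \<Delta>2 x] p(2) by auto
    then show "p = q" using G.pt_eq_iff[of \<Delta>1 x \<Delta>2 y] p q by blast
  qed
  have emb: "embedding_map (space_of G.CX) (space_of G'.CX) tr"
    unfolding G.space_CX G'.space_CX
    by (rule injective_closed_imp_embedding_map[OF continuous_tr _ inj])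
      (rule T1_Spaces.continuous_imp_closed_map[OF continuous_tr G.compact_Y G'.Hausdorff_Y])
  have cl: "cells G'.CX = (\<lambda>c. tr ` c) ` cells G.CX \<union> {c \<in> cells G'.CX. c \<subseteq> G'.cell \<Delta> \<Delta>}"
  proof (intro subset_antisym subsetI)
    fix c assume c: "c \<in> cells G'.CX"
    then obtain F E where F: "c = G'.cell F E" "E \<in> \<D>'" "F \<in> B" "F \<subseteq> E" "F \<noteq> {}" by (rule G'.cellE)
    show "c \<in> (\<lambda>c. tr ` c) ` cells G.CX \<union> {c \<in> cells G'.CX. c \<subseteq> G'.cell \<Delta> \<Delta>}"
    proof (cases "E = \<Delta>")
      case True
      then have "c \<subseteq> G'.cell \<Delta> \<Delta>" using F(1,4) unfolding G'.cell_def by blast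
      then show ?thesis using c by blast
    next
      case False
      then have "E \<in> \<D>" using F(2) D' by blast
      then show ?thesis unfolding tr_cells using F by blast
    qed
  next
    fix c assume c: "c \<in> (\<lambda>c. tr ` c) ` cells G.CX \<union> {c \<in> cells G'.CX. c \<subseteq> G'.cell \<Delta> \<Delta>}"
    then show "c \<in> cells G'.CX" unfolding tr_cells using G'.cellI D_mono by blast
  qed
  have int: "tr ` topspace (space_of G.CX) \<inter> G'.cell \<Delta> \<Delta> = tr ` G.cell \<rho> \<Delta>0"
    unfolding tr_cell[OF \<Delta>0 \<rho>(3)] G.space_CX G.topspace_Y
  proof (intro subset_antisym subsetI)
    fix p assume p: "p \<in> tr ` G.points \<inter> G'.cell \<Delta> \<Delta>"
    then obtain q where q: "q \<in> G.points" "p = tr q" by blast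
    obtain x \<Delta>1 where x: "q = G.pt x \<Delta>1" "\<Delta>1 \<in> \<D>" "x \<in> \<Delta>1" by (rule G.pointsE[OF q(1)])
    have px: "p = G'.pt x \<Delta>1" using q(2) x tr_pt by simp
    obtain y where y: "y \<in> \<Delta>" "p = G'.pt y \<Delta>" using p unfolding G'.cell_def by blast
    have \<Delta>1: "\<Delta>1 \<in> \<D>'" using x(2) D_mono by blast
    have "x = y" "(\<Delta>1, \<Delta>) \<in> (G'.adj x)\<^sup>*"
      using G'.pt_eq_iff[OF \<Delta>1 x(3) \<Delta>D'(1) y(1)] px y(2) by auto
    then have *: "x \<in> \<rho>" "(\<Delta>1, \<Delta>0) \<in> (G.adj x)\<^sup>*" using path[of \<Delta>1 \<Delta> x] x(2) \<Delta>(2) by auto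
    then have "p = G'.pt x \<Delta>0"
      using px G'.pt_eq_iff[OF \<Delta>1 x(3) \<Delta>D'(2), of x] conn_mono[OF *(2)] \<rho>(3) by blast
    then show "p \<in> G'.cell \<rho> \<Delta>0" using *(1) unfolding G'.cell_def by blast
  next
    fix p assume "p \<in> G'.cell \<rho> \<Delta>0"
    then obtain x where x: "x \<in> \<rho>" "p = G'.pt x \<Delta>0" unfolding G'.cell_def by blast
    have x0: "x \<in> \<Delta>0" "x \<in> \<Delta>" using x(1) \<rho> by auto
    have "p = tr (G.pt x \<Delta>0)" using x(2) tr_pt[OF \<Delta>0 x0(1)] by simp
    then have "p \<in> tr ` G.points" using G.pt_in_points[OF \<Delta>0 x0(1)] by blast
    moreover have "p = G'.pt x \<Delta>" using x(2) G'.pt_eq_iff[OF \<Delta>D'(2) x0(1) \<Delta>D'(1) x0(2)] edge[OF x(1)] by simp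
    then have "p \<in> G'.cell \<Delta> \<Delta>" using x0(2) unfolding G'.cell_def by blast
    ultimately show "p \<in> tr ` G.points \<inter> G'.cell \<Delta> \<Delta>" by blast
  qed
  show ?thesis unfolding glue_simplex_def
    using bf DD emb cl int by blast
qed

text \<open>The two copies of \<open>s\<close> in its facets \<open>x1\<close> and \<open>x2\<close>
  are different boundary cells, since no glued ridge passes through the relative interior of
  \<open>s\<close>. They share the copy of \<open>F\<close>, since all other ridges around
  \<open>F\<close> are glued and connect \<open>x1\<close> with \<open>x2\<close>. Adding
  \<open>s\<close> to the glued ridges identifies precisely these two copies.\<close>

lemma identify_step:
  assumes full: "\<D> = G.Fac" "\<D>' = G.Fac" and s: "s \<in> G.IR" "s \<notin> R" and F: "F \<in> B" "aff_dim F = int d - 2" "F \<subseteq> s"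
    and near: "\<And>r. r \<in> G.Rid \<Longrightarrow> F \<subseteq> r \<Longrightarrow> r \<in> insert s R" and R': "R' = insert s R" and RI: "R \<subseteq> G.IR"
  shows "identify_facets d G.CX G'.CX"
proof -
  obtain x1 x2 where x: "x1 \<in> G.Fac" "x2 \<in> G.Fac" "x1 \<noteq> x2" "G.cofac s = {x1, x2}" by (rule G.IR_pair[OF s(1)])
  have sR: "s \<in> G.Rid" "s \<in> B" using s(1) G.Rid_B unfolding G.IR_def by auto
  have "x1 \<in> G.cofac s" "x2 \<in> G.cofac s" using x(4) by auto
  then have sx: "s \<subseteq> x1" "s \<subseteq> x2" unfolding G.cofac_def by auto
  have xD: "x1 \<in> \<D>" "x2 \<in> \<D>" "x1 \<in> \<D>'" "x2 \<in> \<D>'" using x full by auto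
  have sne: "s \<noteq> {}" using sR G.Rid_B G.d2 by auto
  obtain z0 where z0: "z0 \<in> rel_interior s" using G.rel_interior_nonempty[OF sR(2) sne] by blast
  have z0s: "z0 \<in> s" using z0 rel_interior_subset[of s] by blast
  \<comment> \<open>A ridge through a relative interior point of \<open>s\<close> contains
    \<open>s\<close>, hence equals \<open>s\<close>, which is not glued yet.\<close>
  have adj0: "G.adj z0 = {}"
  proof -
    have "r = s" if r: "r \<in> R" "z0 \<in> r" for r
    proof -
      have rB: "r \<in> G.Rid" "r \<in> B" using r(1) G.R_Rid G.Rid_B by auto
      have "s \<subseteq> r" by (rule G.carrier_subset[OF sR(2) rB(2) z0 r(2)])
      then show "r = s" using G.eq_if_dim[OF sR(2) rB(2)] sR rB G.Rid_B by simp
    qed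
    then show ?thesis using s(2) unfolding G.adj_def by blast
  qed
  have bf: "G.cell s a \<in> boundary_facets d G.CX" if a: "a \<in> {x1, x2}" for a
  proof (rule G.boundary_facetI)
    show "a \<in> \<D>" "s \<in> G.Rid" "s \<subseteq> a" using a xD sR sx by auto
    show "E = a" if "\<forall>x\<in>s. (a, E) \<in> (G.adj x)\<^sup>*" for E
    proof -
      have "(a, E) \<in> (G.adj z0)\<^sup>*" using that z0s by blast
      then show ?thesis unfolding adj0 by simp
    qed
  qed
  define h where "h = (\<lambda>p. G.pt (G.pos p) x2)"
  have h_pt: "h (G.pt z x1) = G.pt z x2" if "z \<in> s" for z
    using G.pos_pt[OF xD(1), of z] that sx unfolding h_def by auto
  have h_cell: "h ` G.cell H x1 = G.cell H x2" if "H \<subseteq> s" for H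
    unfolding G.cell_def image_image by (rule image_cong[OF refl]) (use h_pt that in blast)
  let ?\<sigma> = "G.cell s x1" and ?\<tau> = "G.cell s x2"
  have ne: "?\<sigma> \<noteq> ?\<tau>"
  proof
    assume "?\<sigma> = ?\<tau>"
    then have "?\<sigma> \<subseteq> ?\<tau>" by simp
    then have "(x1, x2) \<in> (G.adj z0)\<^sup>*" using G.cell_subset_iff[OF xD(1) sx(1) xD(2) sx(2)] z0s by blast
    then show False unfolding adj0 using x(3) by simp
  qed
  \<comment> \<open>All facets being present and all other ridges around \<open>F\<close> glued, the
    walk around \<open>F\<close> is a chain in \<open>adj z\<close> at each point of
    \<open>F\<close>.\<close>
  have parity: "(x1, x2) \<in> (G.adj z)\<^sup>*" if z: "z \<in> F" for z
  proof -
    have "(x1, x2) \<in> {(x, y). x \<in> G.Fac \<and> y \<in> G.Fac \<and> (\<exists>r\<in>G.Rid. F \<subseteq> r \<and> r \<noteq> s \<and> r \<subseteq> x \<and> r \<subseteq> y)}\<^sup>*"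
    proof (rule G.odd_star_parity[OF F(1,2) sR(1) F(3)])
      show "x1 \<in> G.cofac s" "x2 \<in> G.cofac s" "x1 \<noteq> x2" using x by auto
      show "card (G.cofac r) = 2" if "r \<in> G.Rid" "F \<subseteq> r" for r
      proof -
        have "r \<in> G.IR" using near[OF that] s(1) RI by blast
        then show ?thesis unfolding G.IR_def by simp
      qed
    qed
    moreover have "{(x, y). x \<in> G.Fac \<and> y \<in> G.Fac \<and> (\<exists>r\<in>G.Rid. F \<subseteq> r \<and> r \<noteq> s \<and> r \<subseteq> x \<and> r \<subseteq> y)} \<subseteq> G.adj z"
    proof clarify
      fix a b r assume ab: "a \<in> G.Fac" "b \<in> G.Fac" "r \<in> G.Rid" "F \<subseteq> r" "r \<noteq> s" "r \<subseteq> a" "r \<subseteq> b"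
      then have "r \<in> R" "z \<in> r" using near[of r] z by auto
      moreover have "a \<in> \<D>" "b \<in> \<D>" using ab(1,2) full(1) by simp_all
      ultimately show "(a, b) \<in> G.adj z" unfolding G.adj_def using ab(6,7) by blast
    qed
    ultimately show ?thesis by (rule subsetD[OF rtrancl_mono, rotated])
  qed
  have Fne: "F \<noteq> {}" using F(2) G.d2 by auto
  have Fx: "F \<subseteq> x1" "F \<subseteq> x2" using F(3) sx by auto
  have Fcell: "G.cell F x1 \<in> cells_of_dim (d - 2) G.CX"
  proof -
    have "aff_dim F = int (d - 2)" using F(2) G.d2 by simp
    then show ?thesis unfolding G.cells_of_dim_CX using xD(1) F(1) Fx(1) by blast
  qed
  have FI: "G.cell F x1 \<subseteq> ?\<sigma> \<inter> ?\<tau>"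
  proof -
    have "G.cell F x1 \<subseteq> ?\<sigma>" using F(3) unfolding G.cell_def by blast
    moreover have "G.cell F x1 \<subseteq> ?\<tau>" using G.cell_subset_iff[OF xD(1) Fx(1) xD(2) sx(2)] F(3) parity by blast
    ultimately show ?thesis by blast
  qed
  have cellpts: "G.cell s a \<subseteq> G.points" if "a \<in> {x1, x2}" for a
    unfolding G.cell_def using G.pt_in_points that xD sx by blast
  have hhom: "homeomorphic_map (subtopology G.Y ?\<sigma>) (subtopology G.Y ?\<tau>) h"
  proof (rule continuous_imp_homeomorphic_map)
    have pos_im: "G.pos ` ?\<sigma> \<subseteq> x2"
      unfolding G.cell_def using G.pos_pt[OF xD(1)] sx by fastforce
    have "continuous_map (subtopology G.Y ?\<sigma>) (top_of_set x2) G.pos"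
      unfolding continuous_map_in_subtopology
      using continuous_map_from_subtopology[OF G.continuous_pos] pos_im by auto
    from continuous_map_compose[OF this G.continuous_pt[OF xD(2)]]
    have "continuous_map (subtopology G.Y ?\<sigma>) G.Y h" unfolding h_def comp_def .
    moreover have "h ` ?\<sigma> = ?\<tau>" using h_cell by simp
    ultimately show "continuous_map (subtopology G.Y ?\<sigma>) (subtopology G.Y ?\<tau>) h"
      unfolding continuous_map_in_subtopology by auto
    have "compactin G.Y ?\<sigma>"
      unfolding G.cell_def by (rule image_compactin[OF _ G.continuous_pt[OF xD(1)]])
        (use G.compactB[OF sR(2)] sx in \<open>simp add: compactin_subtopology\<close>)
    then show "compact_space (subtopology G.Y ?\<sigma>)" by (simp add: compact_space_subtopology)
    show "Hausdorff_space (subtopology G.Y ?\<tau>)" by (rule Hausdorff_space_subtopology[OF G.Hausdorff_Y])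
    have t: "topspace (subtopology G.Y ?\<sigma>) = ?\<sigma>" "topspace (subtopology G.Y ?\<tau>) = ?\<tau>"
      using cellpts unfolding topspace_subtopology G.topspace_Y by blast+
    show "h ` topspace (subtopology G.Y ?\<sigma>) = topspace (subtopology G.Y ?\<tau>)" unfolding t by (rule h_cell) simp
    show "inj_on h (topspace (subtopology G.Y ?\<sigma>))" unfolding t
    proof (rule inj_onI)
      fix p q assume pq: "p \<in> ?\<sigma>" "q \<in> ?\<sigma>" "h p = h q"
      obtain z where z: "p = G.pt z x1" "z \<in> s" using pq(1) unfolding G.cell_def by blast
      obtain w where w: "q = G.pt w x1" "w \<in> s" using pq(2) unfolding G.cell_def by blast
      have "G.pt z x2 = G.pt w x2" using pq(3) z w h_pt by simp
      then have "z = w" using G.pt_eq_iff[OF xD(2) _ xD(2), of z w] z w sx by blast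
      then show "p = q" using z w by simp
    qed
  qed
  have hcells: "(\<lambda>c. h ` c) ` {c \<in> cells G.CX. c \<subseteq> ?\<sigma>} = {c \<in> cells G.CX. c \<subseteq> ?\<tau>}"
    unfolding G.subcells[OF xD(1) sR(2) sx(1)] G.subcells[OF xD(2) sR(2) sx(2)]
  proof (intro subset_antisym subsetI)
    fix c assume "c \<in> (\<lambda>c. h ` c) ` {G.cell F x1 | F. F \<in> B \<and> F \<subseteq> s \<and> F \<noteq> {}}"
    then obtain H where "c = h ` G.cell H x1" "H \<in> B" "H \<subseteq> s" "H \<noteq> {}" by blast
    then show "c \<in> {G.cell F x2 | F. F \<in> B \<and> F \<subseteq> s \<and> F \<noteq> {}}" using h_cell by blast
  next
    fix c assume "c \<in> {G.cell F x2 | F. F \<in> B \<and> F \<subseteq> s \<and> F \<noteq> {}}"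
    then obtain H where H: "c = G.cell H x2" "H \<in> B" "H \<subseteq> s" "H \<noteq> {}" by blast
    then have "c = h ` G.cell H x1" using h_cell by simp
    then show "c \<in> (\<lambda>c. h ` c) ` {G.cell F x1 | F. F \<in> B \<and> F \<subseteq> s \<and> F \<noteq> {}}" using H by blast
  qed
  have hfix: "h p = p" if p: "p \<in> ?\<sigma> \<inter> ?\<tau>" for p
  proof -
    obtain z where z: "p = G.pt z x1" "z \<in> s" using p unfolding G.cell_def by blast
    obtain w where w: "p = G.pt w x2" "w \<in> s" using p unfolding G.cell_def by blast
    have "z = w" using G.pt_eq_iff[OF xD(1) _ xD(2), of z w] z w sx by auto
    then show ?thesis using z w h_pt by simp
  qed
  have quot: "quotient_map G.Y G'.Y tr"
  proof (rule T1_Spaces.continuous_imp_quotient_map[OF continuous_tr G.compact_Y G'.Hausdorff_Y])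
    show "tr ` topspace G.Y = topspace G'.Y"
      unfolding G.topspace_Y G'.topspace_Y
    proof (intro subset_antisym subsetI)
      fix p assume "p \<in> tr ` G.points"
      then obtain q where q: "q \<in> G.points" "p = tr q" by blast
      obtain z \<Delta> where "q = G.pt z \<Delta>" "\<Delta> \<in> \<D>" "z \<in> \<Delta>" by (rule G.pointsE[OF q(1)])
      then show "p \<in> G'.points" using q(2) tr_pt G'.pt_in_points D_mono by auto
    next
      fix p assume "p \<in> G'.points"
      then obtain z \<Delta> where z: "p = G'.pt z \<Delta>" "\<Delta> \<in> \<D>'" "z \<in> \<Delta>" by (rule G'.pointsE)
      then have "\<Delta> \<in> \<D>" using full by simp
      then have "p = tr (G.pt z \<Delta>)" "G.pt z \<Delta> \<in> G.points" using z tr_pt G.pt_in_points by auto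
      then show "p \<in> tr ` G.points" by blast
    qed
  qed
  \<comment> \<open>However often a chain crosses \<open>s\<close>, it reduces to at most one
    crossing, in one of the two directions. These are the three cases in the description of the
    identification.\<close>
  have path: "(E, E') \<in> (G.adj z)\<^sup>* \<or> (z \<in> s \<and> ((E, x1) \<in> (G.adj z)\<^sup>* \<and> (x2, E') \<in> (G.adj z)\<^sup>* \<or>
      (E, x2) \<in> (G.adj z)\<^sup>* \<and> (x1, E') \<in> (G.adj z)\<^sup>*))" if "(E, E') \<in> (G'.adj z)\<^sup>*" for E E' z
    using that
  proof (induction rule: rtrancl_induct)
    case base
    then show ?case by simp
  next
    case (step M M')
    obtain r where r: "M \<in> \<D>'" "M' \<in> \<D>'" "r \<in> R'" "z \<in> r" "r \<subseteq> M" "r \<subseteq> M'"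
      using step(2) unfolding G'.adj_def by blast
    show ?case
    proof (cases "r = s")
      case False
      then have "r \<in> R" using r(3) R' by blast
      then have a: "(M, M') \<in> G.adj z" unfolding G.adj_def using r full by blast
      show ?thesis using step(3) rtrancl_into_rtrancl[OF _ a] by blast
    next
      case True
      have "M \<in> G.cofac s" "M' \<in> G.cofac s" using r(1,2,5,6) True full unfolding G.cofac_def by simp_all
      then have M: "M \<in> {x1, x2}" "M' \<in> {x1, x2}" unfolding x(4) .
      show ?thesis
      proof (cases "M = M'")
        case True
        then show ?thesis using step(3) by simp
      next
        case False
        have zs: "z \<in> s" using r(4) True by simp
        consider "M = x1" "M' = x2" | "M = x2" "M' = x1" using M False by auto
        then show ?thesis
        proof cases
          case 1
          then show ?thesis using step(3) zs G.sym_conn[of E x2 z] G.sym_conn[of x1 x2 z] rtrancl_trans[of E x2 "G.adj z" x1]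
            rtrancl_trans[of E x1 "G.adj z" x2] by blast
        next
          case 2
          then show ?thesis using step(3) zs G.sym_conn[of E x2 z] G.sym_conn[of x2 x1 z] rtrancl_trans[of E x2 "G.adj z" x1]
            rtrancl_trans[of E x1 "G.adj z" x2] by blast
        qed
      qed
    qed
  qed
  have edge: "(x1, x2) \<in> (G'.adj z)\<^sup>*" if "z \<in> s" for z
  proof -
    have "(x1, x2) \<in> G'.adj z" unfolding G'.adj_def using that xD sx R' by blast
    then show ?thesis by blast
  qed
  have in\<sigma>: "G.pt z E \<in> ?\<sigma> \<longleftrightarrow> z \<in> s \<and> (E, x1) \<in> (G.adj z)\<^sup>*" if E: "E \<in> \<D>" "z \<in> E" for z E
  proof
    assume "G.pt z E \<in> ?\<sigma>"
    then obtain w where w: "G.pt z E = G.pt w x1" "w \<in> s" unfolding G.cell_def by blast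
    then show "z \<in> s \<and> (E, x1) \<in> (G.adj z)\<^sup>*" using G.pt_eq_iff[OF E xD(1), of w] sx by blast
  next
    assume *: "z \<in> s \<and> (E, x1) \<in> (G.adj z)\<^sup>*"
    then have "G.pt z E = G.pt z x1" using G.pt_eq_iff[OF E xD(1), of z] sx by blast
    then show "G.pt z E \<in> ?\<sigma>" using * unfolding G.cell_def by blast
  qed
  have ident: "tr p = tr q \<longleftrightarrow> p = q \<or> p \<in> ?\<sigma> \<and> q = h p \<or> q \<in> ?\<sigma> \<and> p = h q"
    if p: "p \<in> G.points" and q: "q \<in> G.points" for p q
  proof -
    obtain z E where z: "p = G.pt z E" "E \<in> \<D>" "z \<in> E" by (rule G.pointsE[OF p])
    obtain w E' where w: "q = G.pt w E'" "E' \<in> \<D>" "w \<in> E'" by (rule G.pointsE[OF q])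
    have hp: "h p = G.pt z x2" "h q = G.pt w x2"
      unfolding h_def z(1) w(1) G.pos_pt[OF z(2,3)] G.pos_pt[OF w(2,3)] by auto
    have ED: "E \<in> \<D>'" "E' \<in> \<D>'" using z w D_mono by auto
    have 1: "tr p = tr q \<longleftrightarrow> z = w \<and> (E, E') \<in> (G'.adj z)\<^sup>*"
      unfolding z(1) w(1) tr_pt[OF z(2,3)] tr_pt[OF w(2,3)] by (rule G'.pt_eq_iff[OF ED(1) z(3) ED(2) w(3)])
    have 2: "p = q \<longleftrightarrow> z = w \<and> (E, E') \<in> (G.adj z)\<^sup>*"
      unfolding z(1) w(1) by (rule G.pt_eq_iff[OF z(2,3) w(2,3)])
    have 3: "p \<in> ?\<sigma> \<and> q = h p \<longleftrightarrow> z = w \<and> z \<in> s \<and> (E, x1) \<in> (G.adj z)\<^sup>* \<and> (x2, E') \<in> (G.adj z)\<^sup>*"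
    proof (cases "z \<in> s")
      case True
      have "q = h p \<longleftrightarrow> z = w \<and> (x2, E') \<in> (G.adj z)\<^sup>*"
        unfolding hp using G.pt_eq_iff[OF xD(2) _ w(2,3), of z] True sx w(1) by auto
      then show ?thesis using in\<sigma>[OF z(2,3)] z(1) by blast
    qed (use in\<sigma>[OF z(2,3)] z(1) in blast)
    have 4: "q \<in> ?\<sigma> \<and> p = h q \<longleftrightarrow> z = w \<and> z \<in> s \<and> (E', x1) \<in> (G.adj z)\<^sup>* \<and> (x2, E) \<in> (G.adj z)\<^sup>*"
    proof (cases "w \<in> s")
      case True
      have "p = h q \<longleftrightarrow> z = w \<and> (x2, E) \<in> (G.adj w)\<^sup>*"
        unfolding hp using G.pt_eq_iff[OF xD(2) _ z(2,3), of w] True sx z(1) by auto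
      then show ?thesis using in\<sigma>[OF w(2,3)] w(1) by blast
    qed (use in\<sigma>[OF w(2,3)] w(1) in blast)
    show ?thesis unfolding 1 2 3 4
    proof
      assume "z = w \<and> (E, E') \<in> (G'.adj z)\<^sup>*"
      then show "z = w \<and> (E, E') \<in> (G.adj z)\<^sup>* \<or>
        z = w \<and> z \<in> s \<and> (E, x1) \<in> (G.adj z)\<^sup>* \<and> (x2, E') \<in> (G.adj z)\<^sup>* \<or>
        z = w \<and> z \<in> s \<and> (E', x1) \<in> (G.adj z)\<^sup>* \<and> (x2, E) \<in> (G.adj z)\<^sup>*"
        using path[of E E' z] G.sym_conn[of E x2 z] G.sym_conn[of x1 E' z] by blast
    next
      assume a: "z = w \<and> (E, E') \<in> (G.adj z)\<^sup>* \<or>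
        z = w \<and> z \<in> s \<and> (E, x1) \<in> (G.adj z)\<^sup>* \<and> (x2, E') \<in> (G.adj z)\<^sup>* \<or>
        z = w \<and> z \<in> s \<and> (E', x1) \<in> (G.adj z)\<^sup>* \<and> (x2, E) \<in> (G.adj z)\<^sup>*"
      have A: "(E, E') \<in> (G'.adj z)\<^sup>*" if "z \<in> s" "(E, x1) \<in> (G.adj z)\<^sup>*" "(x2, E') \<in> (G.adj z)\<^sup>*" for E E'
        using rtrancl_trans[OF rtrancl_trans[OF conn_mono[OF that(2)] edge[OF that(1)]] conn_mono[OF that(3)]] .
      show "z = w \<and> (E, E') \<in> (G'.adj z)\<^sup>*"
        using a A[of E E'] A[of E' E] G'.sym_conn[of E' E z] conn_mono[of E E' z] by blast
    qed
  qed
  have cl: "cells G'.CX = (\<lambda>c. tr ` c) ` cells G.CX"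
  proof -
    have e: "\<D>' = \<D>" using full by simp
    show ?thesis unfolding tr_cells G'.cells_CX unfolding e ..
  qed
  show ?thesis
    unfolding identify_facets_def G.space_CX G'.space_CX G.topspace_Y
    by (rule bexI[OF _ bf[of x1]], rule bexI[OF _ bf[of x2]], rule bexI[OF _ Fcell], rule exI[of _ h], rule exI[of _ tr])
      (use ne FI hhom hcells hfix quot ident cl in simp_all)
qed

end

section \<open>First and last stage, and the local construction obtained from a combinatorial
  one\<close>

context glued
begin

lemma is_simplex_CX: assumes "\<D> = {\<Delta>}" shows "is_d_simplex d CX"
  unfolding is_d_simplex_def d_cells
proof (rule bexI[of _ "cell \<Delta> \<Delta>"], intro ballI)
  fix c assume "c \<in> cells CX"
  then obtain F E where "c = cell F E" "E \<in> \<D>" "F \<subseteq> E" using cellE by blast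
  then show "c \<subseteq> cell \<Delta> \<Delta>" using assms unfolding cell_def by blast
qed (use assms in blast)

text \<open>Two copies of \<open>x\<close> lie in facets that both contain the carrier of
  \<open>x\<close>. By \<open>star_connected\<close> these facets are joined through ridges
  containing the carrier, all interior and therefore glued, so \<open>pos\<close> is injective. Here
  the strong connectedness of stars in a ball is indispensable.\<close>

lemma iso_CX: assumes "\<D> = Fac" "R = IR" shows "cell_complex_iso CX (as_cell_complex B)"
proof -
  have conn: "(E, E') \<in> (adj x)\<^sup>*" if E: "E \<in> Fac" "E' \<in> Fac" "x \<in> E" "x \<in> E'" for E E' x
  proof -
    have EB: "E \<in> B" "E' \<in> B" using E Fac_B by auto
    obtain F where F: "F \<in> B" "F \<subseteq> E" "x \<in> rel_interior F" "F \<noteq> {}" by (rule face_carrier[OF E(3) EB(1)])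
    have FE': "F \<subseteq> E'" by (rule carrier_subset[OF F(1) EB(2) F(3) E(4)])
    have xF: "x \<in> F" using F(3) rel_interior_subset[of F] by blast
    note star_connected[OF F(1,4) E(1,2) F(2) FE']
    moreover have "{(x, y). x \<in> Fac \<and> y \<in> Fac \<and> (\<exists>\<rho>\<in>Rid. F \<subseteq> \<rho> \<and> \<rho> \<subseteq> x \<and> \<rho> \<subseteq> y)} \<subseteq> (adj x)\<^sup>*"
    proof clarify
      fix a b \<rho> assume ab: "a \<in> Fac" "b \<in> Fac" "\<rho> \<in> Rid" "F \<subseteq> \<rho>" "\<rho> \<subseteq> a" "\<rho> \<subseteq> b"
      show "(a, b) \<in> (adj x)\<^sup>*"
      proof (cases "a = b")
        case False
        have "\<rho> \<in> IR" by (rule cofac_pair(2)[OF ab(3), of a b]) (use ab False in \<open>auto simp: cofac_def\<close>)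
        then have "\<rho> \<in> R" "a \<in> \<D>" "b \<in> \<D>" using ab(1,2) assms by simp_all
        moreover have "x \<in> \<rho>" using xF ab(4) by blast
        ultimately have "(a, b) \<in> adj x" unfolding adj_def using ab(5,6) by blast
        then show ?thesis by blast
      qed simp
    qed
    ultimately show ?thesis by (rule subsetD[OF rtrancl_subset_rtrancl, rotated])
  qed
  have UB: "\<Union>B = \<Union>Fac"
  proof (intro subset_antisym subsetI)
    fix x assume "x \<in> \<Union>B"
    then obtain F where F: "F \<in> B" "x \<in> F" by blast
    obtain \<Delta> where "\<Delta> \<in> Fac" "F \<subseteq> \<Delta>" by (rule in_facet[OF F(1)])
    then show "x \<in> \<Union>Fac" using F(2) by blast
  qed (use Fac_B in blast)
  have pim: "pos ` points = \<Union>B"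
    unfolding UB
  proof (intro subset_antisym subsetI)
    fix y assume "y \<in> pos ` points"
    then obtain p where p: "p \<in> points" "y = pos p" by blast
    obtain x \<Delta> where "p = pt x \<Delta>" "\<Delta> \<in> \<D>" "x \<in> \<Delta>" by (rule pointsE[OF p(1)])
    then show "y \<in> \<Union>Fac" using p(2) pos_pt assms by auto
  next
    fix y assume "y \<in> \<Union>Fac"
    then obtain \<Delta> where "\<Delta> \<in> \<D>" "y \<in> \<Delta>" using assms by blast
    then show "y \<in> pos ` points" using pt_in_points pos_pt by (metis image_eqI)
  qed
  have hom: "homeomorphic_map Y (top_of_set (\<Union>B)) pos"
  proof (rule continuous_imp_homeomorphic_map[OF _ compact_Y])
    show "continuous_map Y (top_of_set (\<Union>B)) pos"
      unfolding continuous_map_in_subtopology topspace_Y using continuous_pos pim by auto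
    show "pos ` topspace Y = topspace (top_of_set (\<Union>B))" using pim by (simp add: topspace_Y)
    show "inj_on pos (topspace Y)" unfolding topspace_Y
    proof (rule inj_onI)
      fix p q assume pq: "p \<in> points" "q \<in> points" "pos p = pos q"
      obtain x E where x: "p = pt x E" "E \<in> \<D>" "x \<in> E" by (rule pointsE[OF pq(1)])
      obtain y E' where y: "q = pt y E'" "E' \<in> \<D>" "y \<in> E'" by (rule pointsE[OF pq(2)])
      have "x = y" using pq(3) x y pos_pt by simp
      moreover have "(E, E') \<in> (adj x)\<^sup>*" by (rule conn) (use x y \<open>x = y\<close> assms in auto)
      ultimately show "p = q" using pt_eq_iff[OF x(2,3) y(2,3)] x(1) y(1) by simp
    qed
  qed (simp add: Hausdorff_space_subtopology)
  have pc: "pos ` cell F \<Delta> = F" if "\<Delta> \<in> \<D>" "F \<subseteq> \<Delta>" for F \<Delta>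
  proof -
    have "pos (pt x \<Delta>) = x" if "x \<in> F" for x using pos_pt[OF \<open>\<Delta> \<in> \<D>\<close>] that \<open>F \<subseteq> \<Delta>\<close> by blast
    then show ?thesis unfolding cell_def image_image by simp
  qed
  have "B - {{}} = (\<lambda>c. pos ` c) ` cells CX"
  proof (intro subset_antisym subsetI)
    fix F assume F: "F \<in> B - {{}}"
    then obtain \<Delta> where "\<Delta> \<in> Fac" "F \<subseteq> \<Delta>" using in_facet[of F] by blast
    then have \<Delta>: "\<Delta> \<in> \<D>" "F \<subseteq> \<Delta>" using assms by auto
    have "cell F \<Delta> \<in> cells CX" by (rule cellI[OF \<Delta>(1) _ \<Delta>(2)]) (use F in auto)
    then show "F \<in> (\<lambda>c. pos ` c) ` cells CX" using pc[OF \<Delta>] by (metis image_eqI)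
  next
    fix F assume "F \<in> (\<lambda>c. pos ` c) ` cells CX"
    then obtain c where c: "c \<in> cells CX" "F = pos ` c" by blast
    obtain F' \<Delta> where "c = cell F' \<Delta>" "\<Delta> \<in> \<D>" "F' \<in> B" "F' \<subseteq> \<Delta>" "F' \<noteq> {}" by (rule cellE[OF c(1)])
    then show "F \<in> B - {{}}" using c(2) pc by simp
  qed
  then show ?thesis
    unfolding cell_complex_iso_def as_cell_complex_def space_CX using hom by auto
qed

end

context ball_complex
begin

text \<open>The coordinates of the point fill the first \<open>DIM('a)\<close> places of the
  sequence, and the number of the facet all later ones.\<close>

lemma exists_code: "\<exists>code :: 'a \<times> 'a set \<Rightarrow> nat \<Rightarrow> real. inj_on code (UNIV \<times> Fac)"
proof -
  obtain b where b: "bij_betw b {..<DIM('a)} (Basis :: 'a set)"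
    using ex_bij_betw_nat_finite[of "Basis :: 'a set"] by (auto simp: atLeast0LessThan)
  obtain idx :: "'a set \<Rightarrow> nat" where idx: "inj_on idx Fac"
    using finite_imp_inj_to_nat_seg[OF finFac] by blast
  define code where "code = (\<lambda>(x :: 'a, \<Delta>) n. if n < DIM('a) then x \<bullet> b n else real (idx \<Delta>))"
  have "inj_on code (UNIV \<times> Fac)"
  proof (rule inj_onI, clarify)
    fix x y :: 'a and \<Delta> E assume \<Delta>: "\<Delta> \<in> Fac" "E \<in> Fac" and eq: "code (x, \<Delta>) = code (y, E)"
    have "x \<bullet> b n = y \<bullet> b n" if "n < DIM('a)" for n
      using fun_cong[OF eq, of n] that by (simp add: code_def)
    then have "x \<bullet> v = y \<bullet> v" if "v \<in> Basis" for v
      using that b unfolding bij_betw_def by (metis imageE lessThan_iff)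
    then have "x = y" by (rule euclidean_eqI)
    moreover have "idx \<Delta> = idx E"
      using fun_cong[OF eq, of "DIM('a)"] by (simp add: code_def)
    then have "\<Delta> = E" using inj_onD[OF idx] \<Delta> by blast
    ultimately show "x = y \<and> \<Delta> = E" by simp
  qed
  then show ?thesis by blast
qed

text \<open>The states along the two phases are realised as glued spaces; \<open>glue_step\<close>
  serves the first phase, \<open>identify_step\<close> the second.\<close>

lemma constructible_imp_LC: assumes constructible shows "LC d B"
proof -
  obtain \<Delta> R1 where \<Delta>: "\<Delta> \<in> Fac" and att: "attach\<^sup>*\<^sup>* ({\<Delta>}, {}) (Fac, R1)" and se: "seal\<^sup>*\<^sup>* R1 IR"
    using assms unfolding constructible_def by blast
  obtain n f where f: "f 0 = ({\<Delta>}, {})" "f n = (Fac, R1)" "\<And>i. i < n \<Longrightarrow> attach (f i) (f (Suc i))"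
    using att unfolding rtranclp_power relpowp_fun_conv by blast
  obtain m g where g: "g 0 = R1" "g m = IR" "\<And>j. j < m \<Longrightarrow> seal (g j) (g (Suc j))"
    using se unfolding rtranclp_power relpowp_fun_conv by blast
  obtain code :: "'a \<times> 'a set \<Rightarrow> nat \<Rightarrow> real" where code: "inj_on code (UNIV \<times> Fac)"
    using exists_code by blast
  \<comment> \<open>The last clause is the hypothesis \<open>old\<close> of
    \<open>glue_step\<close>, and the cardinality matches the number of attachments with the number
    of facets.\<close>
  have inv: "fst (f i) \<subseteq> Fac \<and> snd (f i) \<subseteq> IR \<and> card (fst (f i)) = Suc i \<and> (\<forall>r\<in>snd (f i). cofac r \<subseteq> fst (f i))"
    if "i \<le> n" for i
    using that
  proof (induction i)
    case 0
    then show ?case using f(1) \<Delta> by simp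
  next
    case (Suc i)
    then have IH: "fst (f i) \<subseteq> Fac" "snd (f i) \<subseteq> IR" "card (fst (f i)) = Suc i" "\<And>r. r \<in> snd (f i) \<Longrightarrow> cofac r \<subseteq> fst (f i)"
      by auto
    obtain w a \<rho> where w: "w \<in> Fac" "w \<notin> fst (f i)" "a \<in> fst (f i)" "\<rho> \<in> Rid" "\<rho> \<subseteq> w" "\<rho> \<subseteq> a"
      "f (Suc i) = (insert w (fst (f i)), insert \<rho> (snd (f i)))"
      using f(3)[of i] Suc.prems unfolding attach_def by auto
    have aF: "a \<in> Fac" "w \<noteq> a" using w IH by auto
    have c: "cofac \<rho> = {w, a}" "\<rho> \<in> IR"
      using cofac_pair[OF w(4), of w a] w aF by (auto simp: cofac_def)
    have "finite (fst (f i))" using IH(1) finFac finite_subset by blast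
    then have "card (insert w (fst (f i))) = Suc (Suc i)" using w(2) IH(3) by simp
    moreover have "cofac r \<subseteq> insert w (fst (f i))" if "r \<in> insert \<rho> (snd (f i))" for r
      using that c(1) w(3) IH(4)[of r] by auto
    ultimately show ?case unfolding w(7) fst_conv snd_conv using IH(1,2) w(1) c(2) by blast
  qed
  define N where "N = card Fac"
  have N: "N = Suc n" using inv[of n] f(2) by (simp add: N_def)
  have ginv: "g j \<subseteq> IR" if "j \<le> m" for j
    using that
  proof (induction j)
    case 0
    then show ?case using inv[of n] f(2) g(1) by simp
  next
    case (Suc j)
    then show ?case using g(3)[of j] unfolding seal_def by auto
  qed
  define st where "st = (\<lambda>i. if i \<le> n then f i else (Fac, g (i - n)))"
  \<comment> \<open>Local constructions are numbered from 1, states from 0; the \<open>n\<close>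
    attachments lead to \<open>N = Suc n\<close> facets.\<close>
  define T where "T = (\<lambda>i. glued.CX B code (fst (st (i - 1))) (snd (st (i - 1))))"
  have IR_Rid: "IR \<subseteq> Rid" by (auto simp: IR_def)
  have st_ok: "fst (st i) \<subseteq> Fac \<and> snd (st i) \<subseteq> IR" if "i \<le> n + m" for i
    using inv[of i] ginv[of "i - n"] that by (auto simp: st_def)
  have gl: "glued B d code (fst (st i)) (snd (st i))" if "i \<le> n + m" for i
    by unfold_locales (use code st_ok[OF that] IR_Rid in auto)
  show ?thesis
    unfolding LC_def Let_def N_def[symmetric]
  proof (intro exI[of _ T] exI[of _ "N + m"] conjI ballI)
    show "1 \<le> N" "N \<le> N + m" using N by auto
    show "pseudomanifold d (T i)" if "i \<in> {1..N + m}" for i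
      unfolding T_def by (rule glued.pseudomanifold_CX[OF gl]) (use that N in auto)
    show "is_d_simplex d (T 1)"
    proof -
      interpret glued B d code "fst (st 0)" "snd (st 0)" by (rule gl) simp
      show ?thesis unfolding T_def using is_simplex_CX[of \<Delta>] f(1) by (simp add: st_def)
    qed
    show "glue_simplex d (T i) (T (i + 1))" if i: "i \<in> {1..<N}" for i
    proof -
      define j where "j = i - 1"
      have j: "j < n" "i = Suc j" using i N by (auto simp: j_def)
      obtain w a \<rho> where w: "w \<in> Fac" "w \<notin> fst (f j)" "a \<in> fst (f j)" "\<rho> \<in> Rid" "\<rho> \<subseteq> w" "\<rho> \<subseteq> a"
        "f (Suc j) = (insert w (fst (f j)), insert \<rho> (snd (f j)))"
        using f(3)[OF j(1)] unfolding attach_def by auto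
      have s: "st j = f j" "st (Suc j) = f (Suc j)" using j by (auto simp: st_def)
      interpret G1: glued B d code "fst (f j)" "snd (f j)" using gl[of j] j s by simp
      interpret G2: glued B d code "fst (f (Suc j))" "snd (f (Suc j))" using gl[of "Suc j"] j s by simp
      interpret glued_pair B d code "fst (f j)" "snd (f j)" "fst (f (Suc j))" "snd (f (Suc j))"
        by unfold_locales (auto simp: w(7))
      have "glue_simplex d G1.CX G2.CX"
        by (rule glue_step[OF w(1-6)]) (use w(7) inv[of j] j in auto)
      then show ?thesis unfolding T_def j(2) using s by simp
    qed
    show "identify_facets d (T i) (T (i + 1))" if i: "i \<in> {N..<N + m}" for i
    proof -
      define j where "j = i - N"
      have j: "j < m" "i = Suc (n + j)" using i N by (auto simp: j_def)
      obtain s F where s: "s \<in> IR" "s \<notin> g j" "F \<in> B" "aff_dim F = int d - 2" "F \<subseteq> s"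
         "\<And>r. r \<in> Rid \<Longrightarrow> F \<subseteq> r \<Longrightarrow> r \<in> insert s (g j)" "g (Suc j) = insert s (g j)"
        using g(3)[OF j(1)] unfolding seal_def by auto
      have st1: "st (n + j) = (Fac, g j)" using f(2) g(1) by (auto simp: st_def)
      have st2: "st (Suc (n + j)) = (Fac, g (Suc j))" by (auto simp: st_def)
      interpret G1: glued B d code Fac "g j" using gl[of "n + j"] j st1 by simp
      interpret G2: glued B d code Fac "g (Suc j)" using gl[of "Suc (n + j)"] j st2 by simp
      interpret glued_pair B d code Fac "g j" Fac "g (Suc j)" by unfold_locales (auto simp: s(7))
      have "identify_facets d G1.CX G2.CX"
        by (rule identify_step[OF refl refl s]) (use ginv[of j] j in auto)
      then show ?thesis unfolding T_def j(2) using st1 st2 by simp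
    qed
    show "cell_complex_iso (T (N + m)) (as_cell_complex B)"
    proof -
      have s: "st (n + m) = (Fac, IR)" using f(2) g(1,2) by (auto simp: st_def)
      interpret glued B d code Fac IR using gl[of "n + m"] s by simp
      show ?thesis unfolding T_def using iso_CX s N by simp
    qed
  qed
qed

end

section \<open>Finite regular cell complexes: open cells, carriers, compactness\<close>

definition inner :: "'p cell_complex \<Rightarrow> 'p set \<Rightarrow> 'p set" where
  "inner T c = c - proper_faces_union T c"

lemma inner_subset: "inner T c \<subseteq> c" by (auto simp: inner_def)

lemma innerD: "x \<in> inner T c \<Longrightarrow> x \<in> c" by (simp add: inner_def)

locale regular_complex =
  fixes T :: "'p cell_complex"
  assumes cw: "finite_regular_CW T"
begin

lemma Hausdorff: "Hausdorff_space (space_of T)"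
  using cw unfolding finite_regular_CW_def by (elim conjE)

lemma fin: "finite (cells T)"
  using cw unfolding finite_regular_CW_def by (elim conjE)

lemma topspace: "topspace (space_of T) = \<Union>(cells T)"
  using cw unfolding finite_regular_CW_def by (elim conjE)

lemma ball_map: assumes "c \<in> cells T"
  obtains n h where "homeomorphic_map (unit_ball n) (subtopology (space_of T) c) h" "h ` unit_sphere_of_ball n = proper_faces_union T c"
proof -
  have "\<forall>c \<in> cells T. \<exists>n h. homeomorphic_map (unit_ball n) (subtopology (space_of T) c) h \<and>
        h ` unit_sphere_of_ball n = proper_faces_union T c"
    using cw unfolding finite_regular_CW_def by (elim conjE)
  then show thesis using assms that by blast
qed

lemma inner_disjoint: "c \<in> cells T \<Longrightarrow> c' \<in> cells T \<Longrightarrow> x \<in> inner T c \<Longrightarrow> x \<in> inner T c' \<Longrightarrow> c = c'"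
proof -
  have "\<forall>c \<in> cells T. \<forall>c' \<in> cells T. c \<noteq> c' \<longrightarrow>
        (c - proper_faces_union T c) \<inter> (c' - proper_faces_union T c') = {}"
    using cw unfolding finite_regular_CW_def by (elim conjE)
  then show "c \<in> cells T \<Longrightarrow> c' \<in> cells T \<Longrightarrow> x \<in> inner T c \<Longrightarrow> x \<in> inner T c' \<Longrightarrow> c = c'"
    unfolding inner_def by blast
qed

lemma cell_subset: "c \<in> cells T \<Longrightarrow> c \<subseteq> topspace (space_of T)"
  unfolding topspace by blast

lemma topspace_cell: "c \<in> cells T \<Longrightarrow> topspace (subtopology (space_of T) c) = c"
  using cell_subset[of c] by (auto simp: topspace_subtopology)

text \<open>The centre of the ball is mapped off the image of the sphere.\<close>

lemma inner_nonempty: assumes "c \<in> cells T" shows "inner T c \<noteq> {}"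
proof -
  obtain n h where h: "homeomorphic_map (unit_ball n) (subtopology (space_of T) c) h" "h ` unit_sphere_of_ball n = proper_faces_union T c"
    by (rule ball_map[OF assms])
  have o: "(\<lambda>i. 0) \<in> topspace (unit_ball n)" "(\<lambda>i. 0) \<notin> unit_sphere_of_ball n"
    using zero_in_open_unit_ball[of n] unit_ball_minus_sphere[of n] by auto
  have "h (\<lambda>i. 0) \<in> c"
    using homeomorphic_imp_surjective_map[OF h(1)] o(1) topspace_cell[OF assms] by blast
  moreover have "h (\<lambda>i. 0) \<notin> h ` unit_sphere_of_ball n"
  proof
    assume "h (\<lambda>i. 0) \<in> h ` unit_sphere_of_ball n"
    then obtain y where y: "y \<in> unit_sphere_of_ball n" "h (\<lambda>i. 0) = h y" by blast
    have "y \<in> topspace (unit_ball n)" using y(1) by (simp add: unit_sphere_of_ball_def)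
    then have "(\<lambda>i. 0) = y" using inj_onD[OF homeomorphic_imp_injective_map[OF h(1)] y(2) o(1)] by simp
    then show False using y(1) o(2) by simp
  qed
  ultimately show ?thesis unfolding inner_def h(2)[symmetric] by blast
qed

lemma nonempty: "c \<in> cells T \<Longrightarrow> c \<noteq> {}"
  using inner_nonempty[of c] inner_subset[of T c] by blast

lemma carrier: assumes "c \<in> cells T" "x \<in> c"
  obtains c' where "c' \<in> cells T" "c' \<subseteq> c" "x \<in> inner T c'"
proof -
  let ?A = "{c' \<in> cells T. c' \<subseteq> c \<and> x \<in> c'}"
  have "finite ?A" "c \<in> ?A" using fin assms by auto
  then obtain m where m: "m \<in> ?A" "\<And>b. b \<in> ?A \<Longrightarrow> b \<subseteq> m \<Longrightarrow> m = b"
    by (metis (no_types, lifting) finite_has_minimal2)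
  have "x \<notin> proper_faces_union T m"
  proof
    assume "x \<in> proper_faces_union T m"
    then obtain b where "b \<in> cells T" "b \<subset> m" "x \<in> b" unfolding proper_faces_union_def by blast
    then show False using m(1) m(2)[of b] by blast
  qed
  then show thesis using that m(1) unfolding inner_def by blast
qed

lemma carrier_subset: assumes "c \<in> cells T" "c' \<in> cells T" "x \<in> inner T c'" "x \<in> c" shows "c' \<subseteq> c"
proof -
  obtain b where b: "b \<in> cells T" "b \<subseteq> c" "x \<in> inner T b" by (rule carrier[OF assms(1,4)])
  have "b = c'" by (rule inner_disjoint[OF b(1) assms(2) b(3) assms(3)])
  then show ?thesis using b(2) by simp
qed

text \<open>The unit ball is a closed subset of a product of compact intervals and single
  points.\<close>

lemma compact_cell: assumes "c \<in> cells T" shows "compact_space (subtopology (space_of T) c)"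
proof -
  obtain n h where h: "homeomorphic_map (unit_ball n) (subtopology (space_of T) c) h"
    and "h ` unit_sphere_of_ball n = proper_faces_union T c"
    by (rule ball_map[OF assms])
  have "compact_space (unit_ball n)"
  proof -
    have "{x. (\<Sum>i<n. x i ^ 2) \<le> 1 \<and> (\<forall>i\<ge>n. x i = 0)} \<subseteq> PiE UNIV (\<lambda>i :: nat. if i < n then {-1..1::real} else {0})"
    proof
      fix x :: "nat \<Rightarrow> real" assume "x \<in> {x. (\<Sum>i<n. x i ^ 2) \<le> 1 \<and> (\<forall>i\<ge>n. x i = 0)}"
      then have x: "(\<Sum>i<n. x i ^ 2) \<le> 1" and z: "\<And>i. n \<le> i \<Longrightarrow> x i = 0" by auto
      have "x i \<in> (if i < n then {-1..1} else {0})" for i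
      proof (cases "i < n")
        case True
        have "x i ^ 2 \<le> (\<Sum>i<n. x i ^ 2)" using True by (intro member_le_sum) auto
        then have "x i ^ 2 \<le> 1" using x by simp
        then have "\<bar>x i\<bar> \<le> 1" by (simp add: abs_square_le_1)
        then show ?thesis using True by auto
      qed (use z in simp)
      then show "x \<in> PiE UNIV (\<lambda>i :: nat. if i < n then {-1..1::real} else {0})" by (simp add: PiE_UNIV_domain)
    qed
    moreover have "compactin (powertop_real UNIV) (PiE UNIV (\<lambda>i :: nat. if i < n then {-1..1::real} else {0}))"
      by (subst compactin_PiE) auto
    moreover have "closedin (powertop_real UNIV) {x :: nat \<Rightarrow> real. (\<Sum>i<n. x i ^ 2) \<le> 1 \<and> (\<forall>i\<ge>n. x i = 0)}"
    proof -
      have "closedin (powertop_real UNIV) {x \<in> topspace (powertop_real (UNIV :: nat set)). (\<Sum>i<n. x i ^ 2) \<in> {..1}}"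
        by (rule closedin_continuous_map_preimage[of _ euclideanreal]) (intro continuous_intros continuous_map_product_projection | simp)+
      moreover have "closedin (powertop_real UNIV) (topspace (Euclidean_space n))"
        using closedin_Euclidean_space by (simp add: topspace_Euclidean_space)
      ultimately have "closedin (powertop_real UNIV) ({x \<in> topspace (powertop_real (UNIV :: nat set)). (\<Sum>i<n. x i ^ 2) \<in> {..1}} \<inter> topspace (Euclidean_space n))"
        by (rule closedin_Int)
      moreover have "{x \<in> topspace (powertop_real (UNIV :: nat set)). (\<Sum>i<n. x i ^ 2) \<in> {..1}} \<inter> topspace (Euclidean_space n)
        = {x :: nat \<Rightarrow> real. (\<Sum>i<n. x i ^ 2) \<le> 1 \<and> (\<forall>i\<ge>n. x i = 0)}"
        by (auto simp: topspace_Euclidean_space)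
      ultimately show ?thesis by simp
    qed
    ultimately have "compactin (powertop_real UNIV) {x :: nat \<Rightarrow> real. (\<Sum>i<n. x i ^ 2) \<le> 1 \<and> (\<forall>i\<ge>n. x i = 0)}"
      using closed_compactin by blast
    moreover have "unit_ball n = subtopology (powertop_real UNIV) {x :: nat \<Rightarrow> real. (\<Sum>i<n. x i ^ 2) \<le> 1 \<and> (\<forall>i\<ge>n. x i = 0)}"
      unfolding unit_ball_def Euclidean_space_def subtopology_subtopology by (rule arg_cong[of _ _ "subtopology _"]) auto
    ultimately show ?thesis by (simp add: compact_space_subtopology)
  qed
  then show ?thesis
    using homeomorphic_compact_space[OF homeomorphic_map_imp_homeomorphic_space[OF h]] by simp
qed

end

lemma boolean_family_rank:
  assumes "boolean_family I"
  shows "\<exists>r. card I = 2 ^ r" "finite I"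
proof -
  obtain V :: "nat set" and f where V: "finite V" "bij_betw f (Pow V) I"
    using assms unfolding boolean_family_def by blast
  then show "finite I" using bij_betw_finite by (metis finite_Pow_iff)
  have "card I = 2 ^ card V" using bij_betw_same_card[OF V(2)] card_Pow[OF V(1)] by simp
  then show "\<exists>r. card I = 2 ^ r" by blast
qed

section \<open>Identifications are injective on cells when the quotient is again simplicial\<close>

locale identification = A: regular_complex T + A': regular_complex T'
  for T :: "'p cell_complex" and T' :: "'q cell_complex" +
  fixes \<sigma> \<tau> :: "'p set" and h :: "'p \<Rightarrow> 'p" and q :: "'p \<Rightarrow> 'q"
  assumes bool: "\<And>c. c \<in> cells T \<Longrightarrow> boolean_family (lower_interval T c)"
    and bool': "\<And>c. c \<in> cells T' \<Longrightarrow> boolean_family (lower_interval T' c)"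
    and \<sigma>: "\<sigma> \<in> cells T" and \<tau>: "\<tau> \<in> cells T"
    and hhom: "homeomorphic_map (subtopology (space_of T) \<sigma>) (subtopology (space_of T) \<tau>) h"
    and hcells: "(\<lambda>c. h ` c) ` {c \<in> cells T. c \<subseteq> \<sigma>} = {c \<in> cells T. c \<subseteq> \<tau>}"
    and hfix: "\<And>x. x \<in> \<sigma> \<inter> \<tau> \<Longrightarrow> h x = x"
    and quot: "quotient_map (space_of T) (space_of T') q"
    and ident: "\<And>x y. x \<in> topspace (space_of T) \<Longrightarrow> y \<in> topspace (space_of T) \<Longrightarrow>
           q x = q y \<longleftrightarrow> x = y \<or> x \<in> \<sigma> \<and> y = h x \<or> y \<in> \<sigma> \<and> x = h y"
    and cells': "cells T' = (\<lambda>c. q ` c) ` cells T"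
begin

lemma inj_h: "inj_on h \<sigma>" and h_onto: "h ` \<sigma> = \<tau>"
  using homeomorphic_imp_injective_map[OF hhom] homeomorphic_imp_surjective_map[OF hhom]
  unfolding A.topspace_cell[OF \<sigma>] A.topspace_cell[OF \<tau>] .

lemma h_cell: assumes "c \<in> cells T" "c \<subseteq> \<sigma>" shows "h ` c \<in> cells T \<and> h ` c \<subseteq> \<tau>"
proof -
  have "h ` c \<in> (\<lambda>c. h ` c) ` {c \<in> cells T. c \<subseteq> \<sigma>}" using assms by (intro imageI) simp
  then show ?thesis unfolding hcells by simp
qed

lemma h_cellE: assumes "c \<in> cells T" "c \<subseteq> \<tau>" obtains b where "b \<in> cells T" "b \<subseteq> \<sigma>" "c = h ` b"
proof -
  have "c \<in> (\<lambda>c. h ` c) ` {c \<in> cells T. c \<subseteq> \<sigma>}" using assms unfolding hcells by simp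
  then obtain b where "b \<in> {c \<in> cells T. c \<subseteq> \<sigma>}" "c = h ` b" by blast
  then show thesis using that[of b] by simp
qed

lemma top: "c \<in> cells T \<Longrightarrow> x \<in> c \<Longrightarrow> x \<in> topspace (space_of T)"
  using A.cell_subset[of c] by blast

lemma q_h: assumes "x \<in> \<sigma>" shows "q (h x) = q x"
proof -
  have "h x \<in> \<tau>" using assms h_onto by blast
  then show ?thesis using ident[OF top[OF \<sigma> assms] top[OF \<tau>], of "h x"] assms by simp
qed

lemma q_h_image: "b \<subseteq> \<sigma> \<Longrightarrow> q ` h ` b = q ` b"
  unfolding image_image by (rule image_cong[OF refl]) (use q_h in blast)

lemma inner_h: assumes "b \<in> cells T" "b \<subseteq> \<sigma>" "x \<in> inner T b" shows "h x \<in> inner T (h ` b)"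
proof -
  have xb: "x \<in> b" by (rule innerD[OF assms(3)])
  have "h x \<notin> proper_faces_union T (h ` b)"
  proof
    assume "h x \<in> proper_faces_union T (h ` b)"
    then obtain c where c: "c \<in> cells T" "c \<subset> h ` b" "h x \<in> c" unfolding proper_faces_union_def by blast
    have "c \<subseteq> \<tau>" using c(2) h_cell[OF assms(1,2)] by blast
    then obtain b' where b': "b' \<in> cells T" "b' \<subseteq> \<sigma>" "c = h ` b'" using h_cellE[OF c(1)] by blast
    obtain z where z: "z \<in> b'" "h x = h z" using c(3) b'(3) by blast
    have "x = z" by (rule inj_onD[OF inj_h z(2)]) (use xb z assms(2) b'(2) in auto)
    then have "b \<subseteq> b'" using A.carrier_subset[OF b'(1) assms(1,3)] z(1) by simp
    then show False using c(2) b'(3) by blast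
  qed
  then show ?thesis using xb unfolding inner_def by blast
qed

lemma q_cell: "c \<in> cells T \<Longrightarrow> q ` c \<in> cells T'" unfolding cells' by blast

text \<open>The three alternatives mirror the three ways in which two points can have the same
  image; taking carriers turns them into statements about cells.\<close>

lemma q_fibre:
  assumes "a \<in> cells T" "b \<in> cells T" "x \<in> inner T b" "y \<in> a" "q x = q y"
  shows "b \<subseteq> a \<or> b \<subseteq> \<sigma> \<and> h ` b \<subseteq> a \<or> (\<exists>b'\<in>cells T. b' \<subseteq> a \<and> b' \<subseteq> \<sigma> \<and> b = h ` b')"
proof -
  have xb: "x \<in> b" by (rule innerD[OF assms(3)])
  consider "x = y" | "x \<in> \<sigma>" "y = h x" | "y \<in> \<sigma>" "x = h y"
    using ident[OF top[OF assms(2) xb] top[OF assms(1,4)]] assms(5) by blast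
  then show ?thesis
  proof cases
    case 1
    then show ?thesis using A.carrier_subset[OF assms(1,2,3)] assms(4) by blast
  next
    case 2
    have b: "b \<subseteq> \<sigma>" by (rule A.carrier_subset[OF \<sigma> assms(2,3) 2(1)])
    have "h ` b \<subseteq> a"
      by (rule A.carrier_subset[OF assms(1) _ inner_h[OF assms(2) b assms(3)]]) (use h_cell[OF assms(2) b] 2(2) assms(4) in auto)
    then show ?thesis using b by blast
  next
    case 3
    obtain b' where b': "b' \<in> cells T" "b' \<subseteq> a" "y \<in> inner T b'" by (rule A.carrier[OF assms(1,4)])
    have s: "b' \<subseteq> \<sigma>" by (rule A.carrier_subset[OF \<sigma> b'(1,3) 3(1)])
    have "h y \<in> inner T (h ` b')" by (rule inner_h[OF b'(1) s b'(3)])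
    then have "b = h ` b'" using A.inner_disjoint[OF assms(2) _ assms(3)] h_cell[OF b'(1) s] 3(2) by blast
    then show ?thesis using b' s by blast
  qed
qed

lemma inner_q: assumes "b \<in> cells T" "x \<in> inner T b" shows "q x \<in> inner T' (q ` b)"
proof -
  have xb: "x \<in> b" by (rule innerD[OF assms(2)])
  then have "q x \<in> q ` b" by blast
  then obtain c where c: "c \<in> cells T'" "c \<subseteq> q ` b" "q x \<in> inner T' c" by (rule A'.carrier[OF q_cell[OF assms(1)]])
  obtain a where a: "a \<in> cells T" "c = q ` a" using c(1) unfolding cells' by blast
  have "q x \<in> q ` a" using innerD[OF c(3)] a(2) by simp
  then obtain y where y: "y \<in> a" "q x = q y" by blast
  have "q ` b \<subseteq> q ` a"
    using q_fibre[OF a(1) assms y]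
  proof (elim disjE conjE bexE)
    assume "b \<subseteq> \<sigma>" "h ` b \<subseteq> a"
    then show ?thesis using q_h_image[of b] by blast
  next
    fix b' assume "b' \<subseteq> a" "b' \<subseteq> \<sigma>" "b = h ` b'"
    then show ?thesis using q_h_image[of b'] by blast
  qed blast
  then have "c = q ` b" using c(2) a(2) by blast
  then show ?thesis using c(3) by simp
qed

text \<open>Its cardinality serves as a rank of cells: strictly monotone under inclusion and
  preserved by \<open>h\<close>.\<close>

definition dn :: "'p set \<Rightarrow> 'p set set" where
  "dn c = {b \<in> cells T. b \<subseteq> c}"

lemma finite_dn: "finite (dn c)" using A.fin by (simp add: dn_def)

lemma card_dn_less: assumes "b \<in> cells T" "a \<subset> b" shows "card (dn a) < card (dn b)"
proof (rule psubset_card_mono[OF finite_dn])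
  have "b \<in> dn b" "b \<notin> dn a" using assms unfolding dn_def by auto
  then show "dn a \<subset> dn b" using assms(2) unfolding dn_def by blast
qed

lemma card_dn_h: assumes "b \<in> cells T" "b \<subseteq> \<sigma>" shows "card (dn (h ` b)) = card (dn b)"
proof -
  have "bij_betw (\<lambda>c. h ` c) (dn b) (dn (h ` b))"
  proof (rule bij_betw_imageI)
    show "inj_on (\<lambda>c. h ` c) (dn b)"
    proof (rule inj_onI)
      fix x y assume xy: "x \<in> dn b" "y \<in> dn b" "h ` x = h ` y"
      have "x \<subseteq> \<sigma>" "y \<subseteq> \<sigma>" using xy(1,2) assms(2) unfolding dn_def by auto
      then show "x = y" using inj_on_image_eq_iff[OF inj_h] xy(3) by blast
    qed
    show "(\<lambda>c. h ` c) ` dn b = dn (h ` b)"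
    proof (intro subset_antisym subsetI)
      fix c assume "c \<in> (\<lambda>c. h ` c) ` dn b"
      then obtain c0 where c0: "c0 \<in> cells T" "c0 \<subseteq> b" "c = h ` c0" unfolding dn_def by blast
      have "c0 \<subseteq> \<sigma>" using c0(2) assms(2) by blast
      then show "c \<in> dn (h ` b)" using h_cell[OF c0(1)] c0 unfolding dn_def by blast
    next
      fix c assume "c \<in> dn (h ` b)"
      then have c: "c \<in> cells T" "c \<subseteq> h ` b" unfolding dn_def by auto
      then have "c \<subseteq> \<tau>" using h_cell[OF assms] by blast
      then obtain c0 where c0: "c0 \<in> cells T" "c0 \<subseteq> \<sigma>" "c = h ` c0" using h_cellE[OF c(1)] by blast
      have "c0 \<subseteq> b" using inj_on_image_subset_iff[OF inj_h c0(2) assms(2)] c(2) c0(3) by simp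
      then show "c \<in> (\<lambda>c. h ` c) ` dn b" using c0 unfolding dn_def by blast
    qed
  qed
  then show ?thesis by (rule bij_betw_same_card[symmetric])
qed

text \<open>In each case of \<open>q_fibre\<close> a cell of the same rank as \<open>b\<close> would
  lie in the smaller cell \<open>a\<close>.\<close>

lemma q_strict: assumes "a \<in> cells T" "b \<in> cells T" "a \<subset> b" shows "\<not> q ` b \<subseteq> q ` a"
proof
  assume sub: "q ` b \<subseteq> q ` a"
  obtain x where x: "x \<in> inner T b" using A.inner_nonempty[OF assms(2)] by blast
  have "q x \<in> q ` a" using x inner_subset[of T b] sub by blast
  then obtain y where y: "y \<in> a" "q x = q y" by blast
  show False using q_fibre[OF assms(1,2) x y]
  proof (elim disjE conjE bexE)
    assume "b \<subseteq> a" then show False using assms(3) by blast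
  next
    assume b: "b \<subseteq> \<sigma>" "h ` b \<subseteq> a"
    have "card (dn (h ` b)) < card (dn b)" by (rule card_dn_less[OF assms(2)]) (use b(2) assms(3) in blast)
    then show False using card_dn_h[OF assms(2) b(1)] by simp
  next
    fix b' assume b': "b' \<in> cells T" "b' \<subseteq> a" "b' \<subseteq> \<sigma>" "b = h ` b'"
    have "card (dn b') < card (dn b)" by (rule card_dn_less[OF assms(2)]) (use b'(2) assms(3) in blast)
    then show False using card_dn_h[OF b'(1,3)] b'(4) by simp
  qed
qed

text \<open>A point interior to \<open>c'\<close> is matched with a point of \<open>c\<close>. By
  \<open>q_strict\<close> the carrier of that point is all of \<open>c\<close>, so the description
  of the fibres of \<open>q\<close> can be read on the level of cells.\<close>

lemma same_image:
  assumes "c \<in> cells T" "c' \<in> cells T" "q ` c = q ` c'"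
  shows "c = c' \<or> c \<subseteq> \<sigma> \<and> c' = h ` c \<or> c' \<subseteq> \<sigma> \<and> c = h ` c'"
proof -
  obtain x where x: "x \<in> inner T c'" using A.inner_nonempty[OF assms(2)] by blast
  have xc: "x \<in> c'" by (rule innerD[OF x])
  have "q x \<in> q ` c" using xc assms(3) by blast
  then obtain y where y: "y \<in> c" "q x = q y" by blast
  obtain b where b: "b \<in> cells T" "b \<subseteq> c" "y \<in> inner T b" by (rule A.carrier[OF assms(1) y(1)])
  have bq: "q ` b = q ` c'"
    using A'.inner_disjoint[OF q_cell[OF b(1)] q_cell[OF assms(2)] inner_q[OF b(1,3)]] inner_q[OF assms(2) x] y(2) by simp
  have "b = c"
  proof (rule ccontr)
    assume "b \<noteq> c"
    then have "\<not> q ` c \<subseteq> q ` b" using q_strict[OF b(1) assms(1)] b(2) by blast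
    then show False using bq assms(3) by simp
  qed
  then have yc: "y \<in> inner T c" using b(3) by simp
  consider "x = y" | "x \<in> \<sigma>" "y = h x" | "y \<in> \<sigma>" "x = h y"
    using ident[OF top[OF assms(2) xc] top[OF assms(1) y(1)]] y(2) by blast
  then show ?thesis
  proof cases
    case 1
    then show ?thesis using A.inner_disjoint[OF assms(1,2) yc] x by simp
  next
    case 2
    have s: "c' \<subseteq> \<sigma>" by (rule A.carrier_subset[OF \<sigma> assms(2) x 2(1)])
    have "y \<in> inner T (h ` c')" using inner_h[OF assms(2) s x] 2(2) by simp
    then have "c = h ` c'" using A.inner_disjoint[OF assms(1) _ yc] h_cell[OF assms(2) s] by blast
    then show ?thesis using s by blast
  next
    case 3
    have s: "c \<subseteq> \<sigma>" by (rule A.carrier_subset[OF \<sigma> assms(1) yc 3(1)])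
    have "x \<in> inner T (h ` c)" using inner_h[OF assms(1) s yc] 3(2) by simp
    then have "c' = h ` c" using A.inner_disjoint[OF assms(2) _ x] h_cell[OF assms(1) s] by blast
    then show ?thesis using s by blast
  qed
qed

lemma lower_q: assumes "c \<in> cells T" "c' \<in> cells T'" "c' \<subseteq> q ` c"
  obtains b where "b \<in> cells T" "b \<subseteq> c" "c' = q ` b"
proof -
  obtain z where z: "z \<in> inner T' c'" using A'.inner_nonempty[OF assms(2)] by blast
  then have "z \<in> q ` c" using inner_subset[of T' c'] assms(3) by blast
  then obtain w where w: "w \<in> c" "z = q w" by blast
  obtain b where b: "b \<in> cells T" "b \<subseteq> c" "w \<in> inner T b" by (rule A.carrier[OF assms(1) w(1)])
  have "q w \<in> inner T' (q ` b)" by (rule inner_q[OF b(1,3)])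
  then have "c' = q ` b" using A'.inner_disjoint[OF assms(2) q_cell[OF b(1)] z] w(2) by simp
  then show thesis using that b by blast
qed

lemma lower_interval_q: assumes "c \<in> cells T"
  shows "lower_interval T' (q ` c) = (\<lambda>b. q ` b) ` lower_interval T c"
proof (intro subset_antisym subsetI)
  fix c' assume "c' \<in> lower_interval T' (q ` c)"
  then consider "c' = {}" | "c' \<in> cells T'" "c' \<subseteq> q ` c" unfolding lower_interval_def by blast
  then show "c' \<in> (\<lambda>b. q ` b) ` lower_interval T c"
  proof cases
    case 2
    obtain b where "b \<in> cells T" "b \<subseteq> c" "c' = q ` b" by (rule lower_q[OF assms 2])
    then show ?thesis unfolding lower_interval_def by blast
  qed (simp add: lower_interval_def)
next
  fix c' assume "c' \<in> (\<lambda>b. q ` b) ` lower_interval T c"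
  then consider "c' = {}" | b where "b \<in> cells T" "b \<subseteq> c" "c' = q ` b" unfolding lower_interval_def by blast
  then show "c' \<in> lower_interval T' (q ` c)"
  proof cases
    case 2
    then show ?thesis using q_cell[OF 2(1)] unfolding lower_interval_def by blast
  qed (simp add: lower_interval_def)
qed

text \<open>Induction over the rank. A coatom \<open>b0\<close> below \<open>b\<close> carries half
  of the boolean interval and keeps its size by induction; its image is strictly smaller than that
  of \<open>b\<close>. So the interval of the image has more than half the size of the one below
  \<open>b\<close>, and being a power of two it has at least the full size.\<close>

lemma card_lower_ge: assumes "b \<in> cells T" shows "card (lower_interval T b) \<le> card (lower_interval T' (q ` b))"
  using assms
proof (induction "card (dn b)" arbitrary: b rule: less_induct)
  case less
  obtain V :: "nat set" and f where V: "finite V" and f: "bij_betw f (Pow V) (lower_interval T b)"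
    and m: "\<forall>A\<in>Pow V. \<forall>A'\<in>Pow V. A \<subseteq> A' \<longleftrightarrow> f A \<subseteq> f A'"
    using bool[OF less(2)] unfolding boolean_family_def by blast
  have mono: "A \<subseteq> A' \<longleftrightarrow> f A \<subseteq> f A'" if "A \<in> Pow V" "A' \<in> Pow V" for A A'
    using bspec[OF bspec[OF m that(1)] that(2)] .
  have fim: "f ` Pow V = lower_interval T b" and finj: "inj_on f (Pow V)" using f by (auto simp: bij_betw_def)
  have cV: "card (lower_interval T b) = 2 ^ card V" using bij_betw_same_card[OF f] card_Pow[OF V] by simp
  have bne: "b \<noteq> {}" using A.nonempty[OF less(2)] .
  have two: "{{}, b} \<subseteq> lower_interval T b" using less(2) by (simp add: lower_interval_def)
  have finl: "finite (lower_interval T b)" using A.fin by (simp add: lower_interval_def)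
  have "V \<noteq> {}"
  proof
    assume "V = {}"
    then have "card (lower_interval T b) = 1" using cV by simp
    then have "card {{}, b} \<le> 1" using card_mono[OF finl two] by simp
    then show False using bne by simp
  qed
  then obtain v where v: "v \<in> V" by blast
  have topV: "f V = b"
  proof -
    obtain W where W: "W \<subseteq> V" "f W = b" 
    proof -
      have "b \<in> f ` Pow V" using two unfolding fim by simp
      then show thesis using that by auto
    qed
    have "f W \<subseteq> f V" using mono[of W V] W(1) by simp
    moreover have "f V \<subseteq> b" using fim unfolding lower_interval_def by blast
    ultimately show ?thesis using W(2) by blast
  qed
  \<comment> \<open>The coatom obtained by dropping one atom from the boolean coordinates of
    \<open>b\<close>.\<close>
  define b0 where "b0 = f (V - {v})"
  have b0l: "b0 \<in> lower_interval T b" using fim unfolding b0_def by blast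
  have b0sub: "b0 \<subset> b"
  proof -
    have "b0 \<subseteq> b" using b0l unfolding lower_interval_def by auto
    moreover have "b0 \<noteq> b"
    proof
      assume "b0 = b"
      then have "f (V - {v}) = f V" using topV b0_def by simp
      then have "V - {v} = V" using inj_onD[OF finj] by blast
      then show False using v by blast
    qed
    ultimately show ?thesis by blast
  qed
  have low0: "lower_interval T b0 = f ` Pow (V - {v})"
  proof (intro subset_antisym subsetI)
    fix a assume a: "a \<in> lower_interval T b0"
    then have "a \<in> lower_interval T b" "a \<subseteq> b0" using b0sub unfolding lower_interval_def by auto
    then obtain W where W: "W \<subseteq> V" "a = f W" using fim by blast
    then have "W \<subseteq> V - {v}" using mono[of W "V - {v}"] \<open>a \<subseteq> b0\<close> unfolding b0_def by auto
    then show "a \<in> f ` Pow (V - {v})" using W(2) by blast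
  next
    fix a assume "a \<in> f ` Pow (V - {v})"
    then obtain W where W: "W \<subseteq> V - {v}" "a = f W" by blast
    then have "a \<subseteq> b0" using mono[of W "V - {v}"] unfolding b0_def by auto
    moreover have "a \<in> lower_interval T b" using W fim by blast
    ultimately show "a \<in> lower_interval T b0" unfolding lower_interval_def by blast
  qed
  have "inj_on f (Pow (V - {v}))" by (rule inj_on_subset[OF finj]) auto
  then have c0: "card (lower_interval T b0) = 2 ^ (card V - 1)"
    unfolding low0 using V v by (simp add: card_image card_Pow)
  obtain r' where r': "card (lower_interval T' (q ` b)) = 2 ^ r'"
    using boolean_family_rank(1)[OF bool'[OF q_cell[OF less(2)]]] by blast
  have finl': "finite (lower_interval T' c)" for c using A'.fin by (simp add: lower_interval_def)
  have "2 ^ (card V - 1) < (2::nat) ^ r'"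
  proof (cases "b0 = {}")
    case True
    have sub: "{{}, q ` b} \<subseteq> lower_interval T' (q ` b)" using q_cell[OF less(2)] by (simp add: lower_interval_def)
    have "card {{}, q ` b} \<le> 2 ^ r'" using card_mono[OF finl' sub] r' by simp
    moreover have "card {{}, q ` b} = 2" using bne by simp
    moreover have "card (lower_interval T b0) = 1"
    proof -
      have "lower_interval T b0 = {{}}" unfolding True lower_interval_def using A.nonempty[of "{}"] by auto
      then show ?thesis by simp
    qed
    ultimately show ?thesis using c0 by simp
  next
    case False
    then have b0c: "b0 \<in> cells T" using b0l unfolding lower_interval_def by simp
    have le: "card (lower_interval T b0) \<le> card (lower_interval T' (q ` b0))"
      by (rule less(1)[OF card_dn_less[OF less(2) b0sub] b0c])
    have "q ` b0 \<subset> q ` b" using q_strict[OF b0c less(2) b0sub] b0sub by blast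
    moreover have "q ` b \<in> lower_interval T' (q ` b)" using q_cell[OF less(2)] by (simp add: lower_interval_def)
    moreover have "q ` b \<notin> lower_interval T' (q ` b0)"
      using \<open>q ` b0 \<subset> q ` b\<close> A'.nonempty[OF q_cell[OF less(2)]] unfolding lower_interval_def by blast
    moreover have "lower_interval T' (q ` b0) \<subseteq> lower_interval T' (q ` b)"
      using \<open>q ` b0 \<subset> q ` b\<close> unfolding lower_interval_def by blast
    ultimately have "lower_interval T' (q ` b0) \<subset> lower_interval T' (q ` b)" by blast
    then have "card (lower_interval T' (q ` b0)) < card (lower_interval T' (q ` b))"
      by (rule psubset_card_mono[OF finl'])
    then show ?thesis using le c0 r' by linarith
  qed
  then have "card V - 1 < r'" by simp
  then have "card V \<le> r'" by simp
  then show ?case unfolding cV r' by simp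
qed

lemma inj_q_lower: assumes "c \<in> cells T" shows "inj_on (\<lambda>b. q ` b) (lower_interval T c)"
proof (rule eq_card_imp_inj_on)
  show f: "finite (lower_interval T c)" using A.fin by (simp add: lower_interval_def)
  show "card ((\<lambda>b. q ` b) ` lower_interval T c) = card (lower_interval T c)"
    using card_lower_ge[OF assms] card_image_le[OF f, of "\<lambda>b. q ` b"] unfolding lower_interval_q[OF assms] by simp
qed

text \<open>If \<open>x\<close> and \<open>h x\<close> both lie in \<open>c\<close>, their carriers
  are faces of \<open>c\<close> with the same image, hence equal. Then \<open>x\<close> lies in both
  identified cells and is fixed by \<open>h\<close>. So no cell is folded onto itself.\<close>

lemma inj_q: assumes "c \<in> cells T" shows "inj_on q c"
proof -
  have key: False if x: "x \<in> c" "x \<in> \<sigma>" "h x \<in> c" "h x \<noteq> x" for x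
  proof -
    obtain a where a: "a \<in> cells T" "a \<subseteq> c" "x \<in> inner T a" by (rule A.carrier[OF assms x(1)])
    have s: "a \<subseteq> \<sigma>" by (rule A.carrier_subset[OF \<sigma> a(1,3) x(2)])
    have ha: "h ` a \<in> cells T" "h ` a \<subseteq> \<tau>" using h_cell[OF a(1) s] by auto
    have "h ` a \<subseteq> c" by (rule A.carrier_subset[OF assms ha(1) inner_h[OF a(1) s a(3)] x(3)])
    then have "a \<in> lower_interval T c" "h ` a \<in> lower_interval T c" using a ha unfolding lower_interval_def by auto
    then have "a = h ` a" using inj_onD[OF inj_q_lower[OF assms]] q_h_image[OF s] by blast
    then have "x \<in> \<tau>" using ha(2) innerD[OF a(3)] by blast
    then show False using hfix[of x] x(2,4) by blast
  qed
  show ?thesis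
  proof (rule inj_onI)
    fix x y assume xy: "x \<in> c" "y \<in> c" "q x = q y"
    consider "x = y" | "x \<in> \<sigma>" "y = h x" | "y \<in> \<sigma>" "x = h y"
      using ident[OF top[OF assms xy(1)] top[OF assms xy(2)]] xy(3) by blast
    then show "x = y"
    proof cases
      case 2 then show ?thesis using key[of x] xy(1,2) by metis
    next
      case 3 then show ?thesis using key[of y] xy(1,2) by metis
    qed
  qed
qed

lemma q_homeomorphic: assumes "c \<in> cells T"
  shows "homeomorphic_map (subtopology (space_of T) c) (subtopology (space_of T') (q ` c)) q"
proof (rule continuous_imp_homeomorphic_map)
  have "continuous_map (space_of T) (space_of T') q" using quot quotient_imp_continuous_map by blast
  then show "continuous_map (subtopology (space_of T) c) (subtopology (space_of T') (q ` c)) q"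
    unfolding continuous_map_in_subtopology A.topspace_cell[OF assms] by (simp add: continuous_map_from_subtopology)
  show "compact_space (subtopology (space_of T) c)" by (rule A.compact_cell[OF assms])
  show "Hausdorff_space (subtopology (space_of T') (q ` c))" by (rule Hausdorff_space_subtopology[OF A'.Hausdorff])
  show "q ` topspace (subtopology (space_of T) c) = topspace (subtopology (space_of T') (q ` c))"
    unfolding A.topspace_cell[OF assms] A'.topspace_cell[OF q_cell[OF assms]] ..
  show "inj_on q (topspace (subtopology (space_of T) c))"
    unfolding A.topspace_cell[OF assms] by (rule inj_q[OF assms])
qed

end

section \<open>Embedding a complex into the result of gluing a simplex\<close>

locale gluing = A: regular_complex T + A': regular_complex T'
  for T :: "'p cell_complex" and T' :: "'q cell_complex" +
  fixes e :: "'p \<Rightarrow> 'q"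
  assumes emb: "embedding_map (space_of T) (space_of T') e"
    and e_cell: "\<And>c. c \<in> cells T \<Longrightarrow> e ` c \<in> cells T'"
begin

lemma inj_e: "inj_on e (topspace (space_of T))"
  using emb unfolding embedding_map_def by (simp add: homeomorphic_imp_injective_map)

lemma e_homeomorphic: assumes "c \<in> cells T"
  shows "homeomorphic_map (subtopology (space_of T) c) (subtopology (space_of T') (e ` c)) e"
proof -
  have h: "homeomorphic_map (space_of T) (subtopology (space_of T') (e ` topspace (space_of T))) e"
    using emb by (simp add: embedding_map_def)
  have c: "c \<subseteq> topspace (space_of T)" by (rule A.cell_subset[OF assms])
  have "homeomorphic_map (subtopology (space_of T) c) (subtopology (subtopology (space_of T') (e ` topspace (space_of T))) (e ` c)) e"
  proof (rule homeomorphic_map_subtopologies[OF h])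
    have "topspace (space_of T) \<inter> c = c" using c by blast
    moreover have "topspace (subtopology (space_of T') (e ` topspace (space_of T))) \<inter> e ` c = e ` c"
      using A'.cell_subset[OF e_cell[OF assms]] c by (auto simp: topspace_subtopology)
    ultimately show "e ` (topspace (space_of T) \<inter> c) = topspace (subtopology (space_of T') (e ` topspace (space_of T))) \<inter> e ` c"
      by simp
  qed
  moreover have "subtopology (subtopology (space_of T') (e ` topspace (space_of T))) (e ` c) = subtopology (space_of T') (e ` c)"
    unfolding subtopology_subtopology using c by (intro arg_cong[of _ _ "subtopology _"]) blast
  ultimately show ?thesis by simp
qed

lemma proper_faces_union_e: assumes "c \<in> cells T"
  shows "proper_faces_union T' (e ` c) = e ` proper_faces_union T c"
proof -
  obtain n k where k: "homeomorphic_map (unit_ball n) (subtopology (space_of T) c) k" "k ` unit_sphere_of_ball n = proper_faces_union T c"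
    by (rule A.ball_map[OF assms])
  obtain m l where l: "homeomorphic_map (unit_ball m) (subtopology (space_of T') (e ` c)) l" "l ` unit_sphere_of_ball m = proper_faces_union T' (e ` c)"
    by (rule A'.ball_map[OF e_cell[OF assms]])
  obtain l' where l': "homeomorphic_maps (unit_ball m) (subtopology (space_of T') (e ` c)) l l'"
    using l(1) homeomorphic_map_maps by blast
  then have l'h: "homeomorphic_map (subtopology (space_of T') (e ` c)) (unit_ball m) l'"
    using homeomorphic_maps_map by blast
  have "homeomorphic_map (unit_ball n) (unit_ball m) (l' \<circ> (e \<circ> k))"
    by (rule homeomorphic_map_compose[OF homeomorphic_map_compose[OF k(1) e_homeomorphic[OF assms]] l'h])
  then have s: "(l' \<circ> (e \<circ> k)) ` unit_sphere_of_ball n = unit_sphere_of_ball m" by (rule homeomorphic_unit_ball_sphere)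
  have sub: "proper_faces_union T c \<subseteq> c" by (auto simp: proper_faces_union_def)
  have ll': "l (l' y) = y" if "y \<in> e ` c" for y
  proof -
    have "y \<in> topspace (subtopology (space_of T') (e ` c))" using that A'.topspace_cell[OF e_cell[OF assms]] by simp
    then show ?thesis using l' unfolding homeomorphic_maps_def by blast
  qed
  have "proper_faces_union T' (e ` c) = l ` l' ` e ` proper_faces_union T c"
    unfolding l(2)[symmetric] s[symmetric] k(2)[symmetric] by (simp add: image_comp comp_assoc)
  also have "\<dots> = e ` proper_faces_union T c"
    unfolding image_image by (rule image_cong[OF refl]) (use ll' sub in blast)
  finally show ?thesis .
qed

lemma inner_e: assumes "c \<in> cells T" "x \<in> inner T c" shows "e x \<in> inner T' (e ` c)"
proof -
  have x: "x \<in> c" "x \<notin> proper_faces_union T c" using assms(2) unfolding inner_def by auto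
  have "e x \<notin> e ` proper_faces_union T c"
  proof
    assume "e x \<in> e ` proper_faces_union T c"
    then obtain y where y: "y \<in> proper_faces_union T c" "e x = e y" by blast
    have "y \<in> c" using y(1) by (auto simp: proper_faces_union_def)
    then have "x = y" using inj_onD[OF inj_e y(2)] A.cell_subset[OF assms(1)] x(1) by blast
    then show False using y(1) x(2) by simp
  qed
  then show ?thesis using x(1) unfolding inner_def proper_faces_union_e[OF assms(1)] by blast
qed

lemma lower_e: assumes "c \<in> cells T" "c' \<in> cells T'" "c' \<subseteq> e ` c"
  obtains b where "b \<in> cells T" "b \<subseteq> c" "c' = e ` b"
proof -
  obtain z where z: "z \<in> inner T' c'" using A'.inner_nonempty[OF assms(2)] by blast
  then have "z \<in> e ` c" using inner_subset[of T' c'] assms(3) by blast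
  then obtain w where w: "w \<in> c" "z = e w" by blast
  obtain b where b: "b \<in> cells T" "b \<subseteq> c" "w \<in> inner T b" by (rule A.carrier[OF assms(1) w(1)])
  have "e w \<in> inner T' (e ` b)" by (rule inner_e[OF b(1,3)])
  then have "c' = e ` b" using A'.inner_disjoint[OF assms(2) e_cell[OF b(1)] z] w(2) by simp
  then show thesis using that b by blast
qed

end

section \<open>Stages of a local construction folded into the ball\<close>

text \<open>\<open>\<Phi>\<close> tells which face of the ball a cell of the stage will finally
  become. It is injective on every single cell, but several cells may have the same destiny until
  they are identified.\<close>

locale folded = ball_complex B d for B :: "'a::euclidean_space set set" and d +
  fixes T :: "'p cell_complex" and \<Phi> :: "'p \<Rightarrow> 'a"
  assumes pm: "pseudomanifold d T"
    and inj_fold: "\<And>c. c \<in> cells T \<Longrightarrow> inj_on \<Phi> c"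
    and fold_in: "\<And>c. c \<in> cells T \<Longrightarrow> \<Phi> ` c \<in> B"
    and fold_dim: "\<And>c n. c \<in> cells T \<Longrightarrow> c \<in> cells_of_dim n T \<longleftrightarrow> aff_dim (\<Phi> ` c) = int n"
    and fold_face: "\<And>c G. c \<in> cells T \<Longrightarrow> G \<in> B \<Longrightarrow> G \<noteq> {} \<Longrightarrow> G \<subseteq> \<Phi> ` c \<Longrightarrow> \<exists>c'\<in>cells T. c' \<subseteq> c \<and> \<Phi> ` c' = G"
begin

abbreviation "dc \<equiv> cells_of_dim d T"
abbreviation "rc \<equiv> cells_of_dim (d - 1) T"
abbreviation "fc \<equiv> cells_of_dim (d - 2) T"

definition nb :: "'p set \<Rightarrow> 'p set set" where
  "nb c = {D \<in> dc. c \<subseteq> D}"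

text \<open>Recorded as faces of the ball rather than cells of the stage, so that different stages
  can be compared.\<close>

definition sealed :: "'a set set" where
  "sealed = (\<lambda>c. \<Phi> ` c) ` {r \<in> rc. card (nb r) = 2}"

text \<open>The boundary is not pinched along (d-2)-cells. Therefore, when two boundary facets
  sharing \<open>F\<close> are identified, no boundary facet around \<open>F\<close>
  remains.\<close>

definition normal_boundary :: bool where
  "normal_boundary \<longleftrightarrow> (\<forall>F\<in>fc. card {r \<in> boundary_facets d T. F \<subseteq> r} \<le> 2)"

text \<open>A (d-2)-cell off the boundary has no further copies that are still to be identified with
  it.\<close>

definition unique_lifts :: bool where
  "unique_lifts \<longleftrightarrow> (\<forall>F\<in>fc. (\<forall>r\<in>boundary_facets d T. \<not> F \<subseteq> r) \<longrightarrow> (\<forall>F'\<in>cells T. \<Phi> ` F' = \<Phi> ` F \<longrightarrow> F' = F))"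

lemma int_d1: "int (d - 1) = int d - 1" and int_d2: "int (d - 2) = int d - 2"
  using d2 by auto

lemma simplicial: "simplicial_CW T"
  using pm unfolding pseudomanifold_def by (elim conjE)

lemma fin: "finite (cells T)"
  using simplicial unfolding simplicial_CW_def finite_regular_CW_def by (elim conjE)

lemma dim_cells: "cells_of_dim n T \<subseteq> cells T" by (auto simp: cells_of_dim_def)

lemma fin_dim: "finite (cells_of_dim n T)" using finite_subset[OF dim_cells fin] .

lemma dc_iff: "c \<in> dc \<longleftrightarrow> c \<in> cells T \<and> \<Phi> ` c \<in> Fac"
  using fold_dim[of c d] fold_in[of c] dim_cells[of d] Fac_B by blast

lemma rc_iff: "c \<in> rc \<longleftrightarrow> c \<in> cells T \<and> \<Phi> ` c \<in> Rid"
  using fold_dim[of c "d - 1"] fold_in[of c] dim_cells[of "d - 1"] Rid_B unfolding int_d1 by blast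

lemma fc_iff: "c \<in> fc \<longleftrightarrow> c \<in> cells T \<and> aff_dim (\<Phi> ` c) = int d - 2"
  using fold_dim[of c "d - 2"] dim_cells[of "d - 2"] unfolding int_d2 by blast

lemma same_fold: "c \<in> cells T \<Longrightarrow> a \<subseteq> c \<Longrightarrow> b \<subseteq> c \<Longrightarrow> \<Phi> ` a = \<Phi> ` b \<Longrightarrow> a = b"
  using inj_on_image_eq_iff[OF inj_fold] by blast

lemma sub_dim_eq:
  assumes "a \<in> cells T" "b \<in> cells T" "a \<subseteq> b" "aff_dim (\<Phi> ` a) = aff_dim (\<Phi> ` b)" shows "a = b"
proof -
  have "\<Phi> ` a = \<Phi> ` b"
    by (rule eq_if_dim[OF fold_in[OF assms(1)] fold_in[OF assms(2)] image_mono[OF assms(3)] assms(4)])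
  then show ?thesis by (rule same_fold[OF assms(2,3) order_refl])
qed

lemma rc_sub_eq: "a \<in> rc \<Longrightarrow> b \<in> rc \<Longrightarrow> a \<subseteq> b \<Longrightarrow> a = b"
  using sub_dim_eq[of a b] rc_iff[of a] rc_iff[of b] Rid_B by simp

lemma dc_sub_eq: "a \<in> dc \<Longrightarrow> b \<in> dc \<Longrightarrow> a \<subseteq> b \<Longrightarrow> a = b"
  using sub_dim_eq[of a b] dc_iff[of a] dc_iff[of b] Fac_B by simp

lemma finite_nb: "finite (nb c)" using fin_dim[of d] by (simp add: nb_def)

lemma nb_nonempty: assumes "c \<in> cells T" shows "nb c \<noteq> {}"
proof -
  have "\<forall>c\<in>cells T. \<exists>D\<in>cells_of_dim d T. c \<subseteq> D"
    using pm unfolding pseudomanifold_def by (elim conjE)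
  then show ?thesis using assms unfolding nb_def by blast
qed

lemma card_nb_le: assumes "r \<in> rc" shows "card (nb r) \<le> 2"
proof -
  have "\<forall>\<rho>\<in>cells_of_dim (d - 1) T. card {D \<in> cells_of_dim d T. \<rho> \<subseteq> D} \<le> 2"
    using pm unfolding pseudomanifold_def by (elim conjE)
  then show ?thesis using assms unfolding nb_def by blast
qed

lemma bf_iff: "r \<in> boundary_facets d T \<longleftrightarrow> r \<in> rc \<and> card (nb r) = 1"
  by (simp add: boundary_facets_def nb_def)

lemma bf_cells: "r \<in> boundary_facets d T \<Longrightarrow> r \<in> cells T"
  unfolding bf_iff using dim_cells by blast

lemma fin_bf: "finite (boundary_facets d T)"
  by (rule finite_subset[OF _ fin]) (use bf_cells in blast)

lemma card_nb_two: assumes "r \<in> rc" "D \<in> nb r" "E \<in> nb r" "D \<noteq> E" shows "card (nb r) = 2"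
proof -
  have "card {D, E} \<le> card (nb r)" by (rule card_mono[OF finite_nb]) (use assms in simp)
  then show ?thesis using card_nb_le[OF assms(1)] assms(4) by simp
qed

lemma sealedI: "r \<in> rc \<Longrightarrow> D \<in> nb r \<Longrightarrow> E \<in> nb r \<Longrightarrow> D \<noteq> E \<Longrightarrow> \<Phi> ` r \<in> sealed"
  unfolding sealed_def using card_nb_two[of r D E] by blast

lemma sealedE: assumes "s \<in> sealed"
  obtains r D E where "s = \<Phi> ` r" "r \<in> rc" "D \<in> nb r" "E \<in> nb r" "D \<noteq> E"
proof -
  obtain r where r: "s = \<Phi> ` r" "r \<in> rc" "card (nb r) = 2" using assms unfolding sealed_def by blast
  obtain D E where "nb r = {D, E}" "D \<noteq> E" using r(3) unfolding card_2_iff by blast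
  then show thesis using that[OF r(1,2), of D E] by simp
qed

lemma not_bf: assumes "r \<in> rc" "r \<notin> boundary_facets d T" shows "card (nb r) = 2"
proof -
  have "r \<in> cells T" using assms(1) rc_iff by blast
  then have "card (nb r) \<noteq> 0" using nb_nonempty finite_nb by simp
  moreover have "card (nb r) \<noteq> 1" using assms bf_iff by blast
  ultimately show ?thesis using card_nb_le[OF assms(1)] by linarith
qed

lemma bf_unique: assumes "r \<in> boundary_facets d T" "D \<in> nb r" "E \<in> nb r" shows "D = E"
proof -
  have "card (nb r) = 1" using assms(1) bf_iff by blast
  then show ?thesis using assms(2,3) by (auto simp: card_1_singleton_iff)
qed

lemma bfI: assumes "r \<in> rc" "\<And>D E. D \<in> nb r \<Longrightarrow> E \<in> nb r \<Longrightarrow> D = E" shows "r \<in> boundary_facets d T"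
proof (rule ccontr)
  assume "r \<notin> boundary_facets d T"
  then have "card (nb r) = 2" by (rule not_bf[OF assms(1)])
  then obtain D E where "nb r = {D, E}" "D \<noteq> E" unfolding card_2_iff by blast
  then show False using assms(2)[of D E] by simp
qed

lemma ridges_between: assumes "D \<in> dc" "F \<in> fc" "F \<subseteq> D" shows "card {r \<in> rc. F \<subseteq> r \<and> r \<subseteq> D} \<le> 2"
proof -
  have D: "D \<in> cells T" "\<Phi> ` D \<in> B" "aff_dim (\<Phi> ` D) = int d" using assms(1) dc_iff Fac_B by auto
  have F: "F \<in> cells T" "aff_dim (\<Phi> ` F) = int d - 2" using assms(2) fc_iff by auto
  let ?A = "{r \<in> rc. F \<subseteq> r \<and> r \<subseteq> D}"
  let ?H = "{H \<in> B. \<Phi> ` F \<subseteq> H \<and> H \<subseteq> \<Phi> ` D \<and> aff_dim H = aff_dim (\<Phi> ` F) + 1}"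
  have two: "card ?H = 2"
    by (rule codim_one_between[OF fold_in[OF F(1)] D(2) image_mono[OF assms(3)]]) (use D F in simp)
  have "inj_on (\<lambda>r. \<Phi> ` r) ?A"
    by (rule inj_onI) (use same_fold[OF D(1)] in blast)
  moreover have "(\<lambda>r. \<Phi> ` r) ` ?A \<subseteq> ?H"
  proof
    fix H assume "H \<in> (\<lambda>r. \<Phi> ` r) ` ?A"
    then obtain r where r: "H = \<Phi> ` r" "r \<in> rc" "F \<subseteq> r" "r \<subseteq> D" by blast
    have "\<Phi> ` r \<in> Rid" using r(2) rc_iff by blast
    then show "H \<in> ?H" using r(1) image_mono[OF r(3), of \<Phi>] image_mono[OF r(4), of \<Phi>] F(2) Rid_B by simp
  qed
  moreover have "finite ?H" using finB by simp
  ultimately have "card ?A \<le> card ?H" by (rule card_inj_on_le)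
  then show ?thesis using two by simp
qed

lemma normal_boundary_simplex: assumes "is_d_simplex d T" shows normal_boundary
proof -
  obtain D where D: "D \<in> dc" "\<And>c. c \<in> cells T \<Longrightarrow> c \<subseteq> D" using assms unfolding is_d_simplex_def by blast
  show ?thesis unfolding normal_boundary_def
  proof
    fix F assume F: "F \<in> fc"
    have "F \<subseteq> D" using F D(2) fc_iff by blast
    have "{r \<in> boundary_facets d T. F \<subseteq> r} \<subseteq> {r \<in> rc. F \<subseteq> r \<and> r \<subseteq> D}"
      using D(2) bf_cells bf_iff by blast
    then have "card {r \<in> boundary_facets d T. F \<subseteq> r} \<le> card {r \<in> rc. F \<subseteq> r \<and> r \<subseteq> D}"
      by (rule card_mono[rotated]) (use fin_dim[of "d - 1"] in simp)
    then show "card {r \<in> boundary_facets d T. F \<subseteq> r} \<le> 2"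
      using ridges_between[OF D(1) F \<open>F \<subseteq> D\<close>] by simp
  qed
qed

lemma simplex_dc: assumes "is_d_simplex d T" obtains D where "dc = {D}"
proof -
  obtain D where D: "D \<in> dc" "\<And>c. c \<in> cells T \<Longrightarrow> c \<subseteq> D" using assms unfolding is_d_simplex_def by blast
  have "E = D" if "E \<in> dc" for E using dc_sub_eq[OF that D(1)] D(2) that dc_iff by blast
  then show thesis using that D(1) by blast
qed

lemma sealed_simplex: assumes "is_d_simplex d T" shows "sealed = {}"
proof -
  obtain D where "dc = {D}" by (rule simplex_dc[OF assms])
  then have one: "E = E'" if "E \<in> nb r" "E' \<in> nb r" for E E' r using that unfolding nb_def by simp
  have False if s: "s \<in> sealed" for s
  proof -
    obtain r E E' where "s = \<Phi> ` r" "r \<in> rc" "E \<in> nb r" "E' \<in> nb r" "E \<noteq> E'" by (rule sealedE[OF s])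
    then show False using one[of E r E'] by simp
  qed
  then show ?thesis by blast
qed

end

text \<open>Common to gluings and identifications: a map that is a homeomorphism on each cell and
  lifts the faces of image cells transports a fold backwards.\<close>

lemma (in ball_complex) folded_pull:
  assumes F': "folded B d T' \<Phi>'" and pm: "pseudomanifold d T"
    and cell: "\<And>c. c \<in> cells T \<Longrightarrow> g ` c \<in> cells T'"
    and hom: "\<And>c. c \<in> cells T \<Longrightarrow> homeomorphic_map (subtopology (space_of T) c) (subtopology (space_of T') (g ` c)) g"
    and top: "\<And>c. c \<in> cells T \<Longrightarrow> topspace (subtopology (space_of T) c) = c"
    and lower: "\<And>c c'. c \<in> cells T \<Longrightarrow> c' \<in> cells T' \<Longrightarrow> c' \<subseteq> g ` c \<Longrightarrow> \<exists>b\<in>cells T. b \<subseteq> c \<and> c' = g ` b"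
  shows "folded B d T (\<Phi>' \<circ> g)"
proof -
  interpret F': folded B d T' \<Phi>' by (rule F')
  show ?thesis
  proof
    show "pseudomanifold d T" by (rule pm)
    show "inj_on (\<Phi>' \<circ> g) c" if c: "c \<in> cells T" for c
    proof (rule comp_inj_on)
      show "inj_on g c" using homeomorphic_imp_injective_map[OF hom[OF c]] unfolding top[OF c] .
      show "inj_on \<Phi>' (g ` c)" by (rule F'.inj_fold[OF cell[OF c]])
    qed
    show "(\<Phi>' \<circ> g) ` c \<in> B" if c: "c \<in> cells T" for c
      unfolding image_comp[symmetric] by (rule F'.fold_in[OF cell[OF c]])
    show "c \<in> cells_of_dim n T \<longleftrightarrow> aff_dim ((\<Phi>' \<circ> g) ` c) = int n" if c: "c \<in> cells T" for c n
    proof -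
      have h: "subtopology (space_of T) c homeomorphic_space subtopology (space_of T') (g ` c)"
        using homeomorphic_map_imp_homeomorphic_space[OF hom[OF c]] .
      have "c \<in> cells_of_dim n T \<longleftrightarrow> subtopology (space_of T) c homeomorphic_space unit_ball n"
        using c by (simp add: cells_of_dim_def)
      also have "\<dots> \<longleftrightarrow> subtopology (space_of T') (g ` c) homeomorphic_space unit_ball n"
      proof
        assume "subtopology (space_of T) c homeomorphic_space unit_ball n"
        then show "subtopology (space_of T') (g ` c) homeomorphic_space unit_ball n"
          by (rule homeomorphic_space_trans[OF iffD1[OF homeomorphic_space_sym h]])
      qed (rule homeomorphic_space_trans[OF h])
      also have "\<dots> \<longleftrightarrow> g ` c \<in> cells_of_dim n T'"
        using cell[OF c] by (simp add: cells_of_dim_def)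
      also have "\<dots> \<longleftrightarrow> aff_dim (\<Phi>' ` g ` c) = int n" by (rule F'.fold_dim[OF cell[OF c]])
      finally show ?thesis by (simp add: image_comp)
    qed
    show "\<exists>c'\<in>cells T. c' \<subseteq> c \<and> (\<Phi>' \<circ> g) ` c' = G"
      if c: "c \<in> cells T" and G: "G \<in> B" "G \<noteq> {}" "G \<subseteq> (\<Phi>' \<circ> g) ` c" for c G
    proof -
      have "G \<subseteq> \<Phi>' ` g ` c" using G(3) by (simp add: image_comp)
      then obtain c' where c': "c' \<in> cells T'" "c' \<subseteq> g ` c" "\<Phi>' ` c' = G"
        using F'.fold_face[OF cell[OF c] G(1,2)] by blast
      obtain b where "b \<in> cells T" "b \<subseteq> c" "c' = g ` b" using lower[OF c c'(1,2)] by blast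
      then show ?thesis using c'(3) by (auto simp: image_comp)
    qed
  qed
qed

section \<open>Gluing a simplex is an attachment\<close>

locale glue_fold = F: folded B d T \<Phi> + F': folded B d T' \<Phi>' + gluing T T' e
  for B :: "'a::euclidean_space set set" and d and T :: "'p cell_complex" and \<Phi>
    and T' :: "'q cell_complex" and \<Phi>' and e +
  fixes \<rho> D
  assumes comp: "\<And>c. c \<in> cells T \<Longrightarrow> \<Phi> ` c = \<Phi>' ` e ` c"
    and \<rho>: "\<rho> \<in> boundary_facets d T" and D: "D \<in> F'.dc"
    and new_cells: "cells T' = (\<lambda>c. e ` c) ` cells T \<union> {c \<in> cells T'. c \<subseteq> D}"
    and meet: "e ` topspace (space_of T) \<inter> D = e ` \<rho>"
begin

lemma e_sub_iff: assumes "a \<in> cells T" "b \<in> cells T" shows "e ` a \<subseteq> e ` b \<longleftrightarrow> a \<subseteq> b"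
  using inj_on_image_subset_iff[OF inj_e A.cell_subset[OF assms(1)] A.cell_subset[OF assms(2)]] .

lemma e_eq_iff: assumes "a \<in> cells T" "b \<in> cells T" shows "e ` a = e ` b \<longleftrightarrow> a = b"
  using inj_on_image_eq_iff[OF inj_e A.cell_subset[OF assms(1)] A.cell_subset[OF assms(2)]] .

lemma e_dc: "c \<in> cells T \<Longrightarrow> e ` c \<in> F'.dc \<longleftrightarrow> c \<in> F.dc"
  using F.dc_iff[of c] F'.dc_iff[of "e ` c"] e_cell[of c] comp[of c] by simp

lemma e_rc: "c \<in> cells T \<Longrightarrow> e ` c \<in> F'.rc \<longleftrightarrow> c \<in> F.rc"
  using F.rc_iff[of c] F'.rc_iff[of "e ` c"] e_cell[of c] comp[of c] by simp

lemma e_fc: "c \<in> cells T \<Longrightarrow> e ` c \<in> F'.fc \<longleftrightarrow> c \<in> F.fc"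
  using F.fc_iff[of c] F'.fc_iff[of "e ` c"] e_cell[of c] comp[of c] by simp

lemma \<rho>_cell: "\<rho> \<in> cells T" "\<rho> \<in> F.rc"
  using F.bf_cells[OF \<rho>] \<rho> F.bf_iff by auto

lemma old_or_new: assumes "c \<in> cells T'" shows "(\<exists>c0\<in>cells T. c = e ` c0) \<or> c \<subseteq> D"
proof -
  have "c \<in> (\<lambda>c. e ` c) ` cells T \<union> {c \<in> cells T'. c \<subseteq> D}" using assms new_cells by simp
  then show ?thesis by blast
qed

lemma e_in_D: assumes "c \<in> cells T" "c' \<subseteq> e ` c" "c' \<subseteq> D" shows "c' \<subseteq> e ` \<rho>"
proof -
  have "e ` c \<subseteq> e ` topspace (space_of T)" using A.cell_subset[OF assms(1)] by (rule image_mono)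
  then have "c' \<subseteq> e ` topspace (space_of T) \<inter> D" using assms(2,3) by blast
  then show ?thesis unfolding meet .
qed

lemma \<rho>_D: "e ` \<rho> \<subseteq> D" unfolding meet[symmetric] by (rule Int_lower2)

lemma D_new: "c \<in> cells T \<Longrightarrow> D \<noteq> e ` c"
proof
  assume c: "c \<in> cells T" "D = e ` c"
  have "D \<subseteq> e ` \<rho>" by (rule e_in_D[OF c(1)]) (use c(2) in auto)
  then have "D = e ` \<rho>" using \<rho>_D by blast
  then have "\<rho> \<in> F.dc" using e_dc[OF \<rho>_cell(1)] D by simp
  then have "\<Phi> ` \<rho> \<in> F.Fac" "\<Phi> ` \<rho> \<in> F.Rid" using \<rho>_cell(2) F.dc_iff F.rc_iff by blast+
  then show False using F.Fac_B F.Rid_B by simp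
qed

lemma dc': "F'.dc = insert D ((\<lambda>c. e ` c) ` F.dc)"
proof (intro subset_antisym subsetI)
  fix c assume c: "c \<in> F'.dc"
  then have cc: "c \<in> cells T'" using F'.dc_iff by blast
  show "c \<in> insert D ((\<lambda>c. e ` c) ` F.dc)"
    using old_or_new[OF cc]
  proof
    assume "\<exists>c0\<in>cells T. c = e ` c0"
    then obtain c0 where c0: "c0 \<in> cells T" "c = e ` c0" by blast
    then have "c0 \<in> F.dc" using e_dc[OF c0(1)] c by simp
    then show ?thesis using c0(2) by blast
  next
    assume "c \<subseteq> D"
    then have "c = D" by (rule F'.dc_sub_eq[OF c D])
    then show ?thesis by simp
  qed
next
  fix c assume "c \<in> insert D ((\<lambda>c. e ` c) ` F.dc)"
  then show "c \<in> F'.dc"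
  proof
    assume "c \<in> (\<lambda>c. e ` c) ` F.dc"
    then obtain c0 where c0: "c0 \<in> F.dc" "c = e ` c0" by blast
    then have "c0 \<in> cells T" using F.dc_iff by blast
    then show ?thesis using e_dc[of c0] c0 by simp
  qed (use D in simp)
qed

lemma nb_e: assumes "r \<in> cells T" "E \<in> F.nb r" shows "e ` E \<in> F'.nb (e ` r)"
proof -
  have "E \<in> F.dc" "r \<subseteq> E" using assms(2) by (auto simp: F.nb_def)
  then show ?thesis unfolding F'.nb_def dc' by blast
qed

lemma D_nb: "D \<in> F'.nb (e ` \<rho>)" unfolding F'.nb_def using D \<rho>_D by simp

lemma obtain_E\<rho>: obtains E where "E \<in> F.dc" "\<rho> \<subseteq> E" "e ` E \<in> F'.nb (e ` \<rho>)" "e ` E \<noteq> D"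
proof -
  obtain E where E: "E \<in> F.nb \<rho>" using F.nb_nonempty[OF \<rho>_cell(1)] by blast
  then have E': "E \<in> F.dc" "\<rho> \<subseteq> E" "E \<in> cells T" using F.dc_iff by (auto simp: F.nb_def)
  show thesis using that[OF E'(1,2) nb_e[OF \<rho>_cell(1) E]] D_new[OF E'(3)] by blast
qed

lemma bf_e: assumes "r \<in> cells T" "e ` r \<in> boundary_facets d T'" shows "r \<in> boundary_facets d T - {\<rho>}"
proof -
  have rr: "r \<in> F.rc" using assms(2) F'.bf_iff e_rc[OF assms(1)] by blast
  have "r \<in> boundary_facets d T"
  proof (rule F.bfI[OF rr])
    fix E E' assume E: "E \<in> F.nb r" "E' \<in> F.nb r"
    have "e ` E = e ` E'" by (rule F'.bf_unique[OF assms(2) nb_e[OF assms(1) E(1)] nb_e[OF assms(1) E(2)]])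
    moreover have "E \<in> cells T" "E' \<in> cells T" using E F.dc_iff by (auto simp: F.nb_def)
    ultimately show "E = E'" using e_eq_iff by blast
  qed
  moreover have "r \<noteq> \<rho>"
  proof
    assume "r = \<rho>"
    obtain E where E\<rho>: "E \<in> F.dc" "\<rho> \<subseteq> E" and E: "e ` E \<in> F'.nb (e ` \<rho>)" "e ` E \<noteq> D" by (rule obtain_E\<rho>)
    show False using E F'.bf_unique[OF assms(2), of "e ` E" D] D_nb \<open>r = \<rho>\<close> by simp
  qed
  ultimately show ?thesis by simp
qed

lemma normal_boundary_glue: assumes F.normal_boundary shows F'.normal_boundary
  unfolding F'.normal_boundary_def
proof
  fix G assume G: "G \<in> F'.fc"
  have Gc: "G \<in> cells T'" using G F'.fc_iff by blast
  let ?X = "{r \<in> boundary_facets d T'. G \<subseteq> r}"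
  let ?O = "{r \<in> boundary_facets d T - {\<rho>}. G \<subseteq> e ` r}"
  let ?N = "{r \<in> F'.rc - {e ` \<rho>}. G \<subseteq> r \<and> r \<subseteq> D}"
  have sub: "?X \<subseteq> (\<lambda>r. e ` r) ` ?O \<union> ?N"
  proof
    fix r assume r: "r \<in> ?X"
    have rb: "r \<in> boundary_facets d T'" "G \<subseteq> r" using r by auto
    have rc: "r \<in> cells T'" "r \<in> F'.rc" using rb(1) F'.bf_cells F'.bf_iff by auto
    show "r \<in> (\<lambda>r. e ` r) ` ?O \<union> ?N"
      using old_or_new[OF rc(1)]
    proof
      assume "\<exists>c0\<in>cells T. r = e ` c0"
      then obtain r0 where r0: "r0 \<in> cells T" "r = e ` r0" by blast
      then have "r0 \<in> boundary_facets d T - {\<rho>}" using bf_e[OF r0(1)] rb(1) by simp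
      then have "r0 \<in> ?O" using r0(2) rb(2) by simp
      then have "r \<in> (\<lambda>r. e ` r) ` ?O" unfolding r0(2) by (rule imageI)
      then show ?thesis by (rule UnI1)
    next
      assume rD: "r \<subseteq> D"
      have "r \<noteq> e ` \<rho>"
      proof
        assume "r = e ` \<rho>"
        then have "\<rho> \<in> boundary_facets d T - {\<rho>}" using bf_e[OF \<rho>_cell(1)] rb(1) by simp
        then show False by simp
      qed
      then show ?thesis using rc(2) rb(2) rD by blast
    qed
  qed
  have finO: "finite ?O" using F.fin_bf by simp
  have finN: "finite ?N" using F'.fin_dim[of "d - 1"] by simp
  have c1: "card ?X \<le> card ?O + card ?N"
  proof -
    have "card ?X \<le> card ((\<lambda>r. e ` r) ` ?O \<union> ?N)" by (rule card_mono[OF _ sub]) (use finO finN in simp)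
    also have "\<dots> \<le> card ((\<lambda>r. e ` r) ` ?O) + card ?N" by (rule card_Un_le)
    also have "\<dots> \<le> card ?O + card ?N" using card_image_le[OF finO] by simp
    finally show ?thesis .
  qed
  \<comment> \<open>When \<open>G\<close> lies in the gluing ridge, \<open>\<rho>\<close> itself
    occupies one of the two places allowed before the gluing.\<close>
  have old: "card ?O + (if G \<subseteq> e ` \<rho> then 1 else 0) \<le> 2" if ex: "\<exists>c0\<in>cells T. G \<subseteq> e ` c0"
  proof -
    obtain c0 where c0: "c0 \<in> cells T" "G \<subseteq> e ` c0" using ex by blast
    obtain G0 where G0: "G0 \<in> cells T" "G = e ` G0" using lower_e[OF c0(1) Gc c0(2)] by blast
    have "G0 \<in> F.fc" using e_fc[OF G0(1)] G G0(2) by simp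
    then have le: "card {r \<in> boundary_facets d T. G0 \<subseteq> r} \<le> 2" using assms unfolding F.normal_boundary_def by blast
    have iff: "G \<subseteq> e ` r \<longleftrightarrow> G0 \<subseteq> r" if "r \<in> boundary_facets d T" for r
      using e_sub_iff[OF G0(1) F.bf_cells[OF that]] G0(2) by simp
    have eq: "?O = {r \<in> boundary_facets d T. G0 \<subseteq> r} - {\<rho>}"
    proof (rule Set.set_eqI)
      show "r \<in> ?O \<longleftrightarrow> r \<in> {r \<in> boundary_facets d T. G0 \<subseteq> r} - {\<rho>}" for r
        using iff[of r] by (cases "r \<in> boundary_facets d T") (simp_all add: conj_commute)
    qed
    show ?thesis
    proof (cases "G \<subseteq> e ` \<rho>")
      case True
      then have in\<rho>: "\<rho> \<in> {r \<in> boundary_facets d T. G0 \<subseteq> r}" using iff[OF \<rho>] \<rho> by simp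
      have "card ?O = card {r \<in> boundary_facets d T. G0 \<subseteq> r} - 1"
        unfolding eq by (rule card_Diff_singleton[OF in\<rho>])
      then show ?thesis using le True by simp
    next
      case False
      have "card ?O \<le> card {r \<in> boundary_facets d T. G0 \<subseteq> r}"
        unfolding eq by (rule card_mono) (use F.fin_bf in auto)
      then show ?thesis using le False by simp
    qed
  qed
  show "card ?X \<le> 2"
  proof (cases "G \<subseteq> D")
    case False
    then have "?N = {}" by blast
    then have "card ?N = 0" by (simp only: card.empty)
    moreover have "\<exists>c0\<in>cells T. G \<subseteq> e ` c0" using old_or_new[OF Gc] False by blast
    ultimately show ?thesis using old c1 by simp
  next
    case True
    have N2: "card {r \<in> F'.rc. G \<subseteq> r \<and> r \<subseteq> D} \<le> 2" by (rule F'.ridges_between[OF D G True])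
    have eqN: "?N = {r \<in> F'.rc. G \<subseteq> r \<and> r \<subseteq> D} - {e ` \<rho>}" by blast
    show ?thesis
    proof (cases "G \<subseteq> e ` \<rho>")
      case g\<rho>: True
      have "e ` \<rho> \<in> {r \<in> F'.rc. G \<subseteq> r \<and> r \<subseteq> D}" using g\<rho> \<rho>_D e_rc[OF \<rho>_cell(1)] \<rho>_cell(2) by simp
      then have "card ?N = card {r \<in> F'.rc. G \<subseteq> r \<and> r \<subseteq> D} - 1"
        unfolding eqN by (rule card_Diff_singleton)
      then have "card ?N \<le> 1" using N2 by simp
      moreover have "card ?O \<le> 1" using old \<rho>_cell(1) g\<rho> by auto
      ultimately show ?thesis using c1 by simp
    next
      case ng: False
      have "?O = {}"
      proof -
        have False if "r \<in> ?O" for r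
        proof -
          have "r \<in> cells T" "G \<subseteq> e ` r" using that F.bf_cells by auto
          then show False using e_in_D[of r G] True ng by blast
        qed
        then show ?thesis by blast
      qed
      then have "card ?O = 0" by (simp only: card.empty)
      moreover have "card ?N \<le> card {r \<in> F'.rc. G \<subseteq> r \<and> r \<subseteq> D}"
        unfolding eqN by (rule card_mono) (use F'.fin_dim[of "d - 1"] in auto)
      ultimately show ?thesis using c1 N2 by simp
    qed
  qed
qed

text \<open>The new simplex meets the old part only in the cell of \<open>\<rho>\<close>, so this is
  the only ridge that gains a second d-cell.\<close>

lemma sealed_glue: "F'.sealed = insert (\<Phi> ` \<rho>) F.sealed"
proof (intro subset_antisym subsetI)
  fix s assume "s \<in> F'.sealed"
  then obtain r E E' where r: "s = \<Phi>' ` r" "r \<in> F'.rc" "E \<in> F'.nb r" "E' \<in> F'.nb r" "E \<noteq> E'"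
    by (rule F'.sealedE)
  have rcell: "r \<in> cells T'" using r(2) F'.rc_iff by blast
  have sub: "r \<subseteq> E" "r \<subseteq> E'" "E \<in> F'.dc" "E' \<in> F'.dc" using r(3,4) by (auto simp: F'.nb_def)
  have withD: "s \<in> insert (\<Phi> ` \<rho>) F.sealed" if rD: "r \<subseteq> D" and X: "X \<in> F.dc" "r \<subseteq> e ` X" for X
  proof -
    have Xc: "X \<in> cells T" using X(1) F.dc_iff by blast
    have "r \<subseteq> e ` \<rho>" by (rule e_in_D[OF Xc X(2) rD])
    then have "r = e ` \<rho>" using F'.rc_sub_eq[OF r(2)] e_rc[OF \<rho>_cell(1)] \<rho>_cell(2) by blast
    then show ?thesis using r(1) comp[OF \<rho>_cell(1)] by simp
  qed
  consider "E = D" | "E' = D" | X X' where "X \<in> F.dc" "E = e ` X" "X' \<in> F.dc" "E' = e ` X'"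
    using sub(3,4) unfolding dc' by blast
  then show "s \<in> insert (\<Phi> ` \<rho>) F.sealed"
  proof cases
    case 1
    then obtain X' where "X' \<in> F.dc" "E' = e ` X'" using sub(4) r(5) unfolding dc' by blast
    then show ?thesis using withD[of X'] sub 1 by blast
  next
    case 2
    then obtain X where "X \<in> F.dc" "E = e ` X" using sub(3) r(5) unfolding dc' by blast
    then show ?thesis using withD[of X] sub 2 by blast
  next
    case 3
    have X: "X \<in> cells T" "X' \<in> cells T" using 3 F.dc_iff by auto
    have "r \<subseteq> e ` X" using sub(1) 3(2) by simp
    then obtain r0 where r0: "r0 \<in> cells T" "r0 \<subseteq> X" "r = e ` r0" by (rule lower_e[OF X(1) rcell])
    have "r0 \<subseteq> X'" using e_sub_iff[OF r0(1) X(2)] sub(2) r0(3) 3(4) by simp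
    have "r0 \<in> F.rc" using e_rc[OF r0(1)] r(2) r0(3) by simp
    moreover have "X \<noteq> X'" using r(5) 3 by blast
    ultimately have "\<Phi> ` r0 \<in> F.sealed"
      using F.sealedI[of r0 X X'] 3(1,3) r0(2) \<open>r0 \<subseteq> X'\<close> by (simp add: F.nb_def)
    then show ?thesis using r(1) r0(3) comp[OF r0(1)] by simp
  qed
next
  fix s assume "s \<in> insert (\<Phi> ` \<rho>) F.sealed"
  then show "s \<in> F'.sealed"
  proof
    assume s: "s = \<Phi> ` \<rho>"
    obtain E where E\<rho>: "E \<in> F.dc" "\<rho> \<subseteq> E" and E: "e ` E \<in> F'.nb (e ` \<rho>)" "e ` E \<noteq> D" by (rule obtain_E\<rho>)
    have "e ` \<rho> \<in> F'.rc" using e_rc[OF \<rho>_cell(1)] \<rho>_cell(2) by simp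
    then have "\<Phi>' ` e ` \<rho> \<in> F'.sealed" by (rule F'.sealedI[OF _ E(1) D_nb E(2)])
    then show ?thesis using s comp[OF \<rho>_cell(1)] by simp
  next
    assume "s \<in> F.sealed"
    then obtain r E E' where r: "s = \<Phi> ` r" "r \<in> F.rc" "E \<in> F.nb r" "E' \<in> F.nb r" "E \<noteq> E'"
      by (rule F.sealedE)
    have rc: "r \<in> cells T" using r(2) F.rc_iff by blast
    have "E \<in> cells T" "E' \<in> cells T" using r(3,4) F.dc_iff by (auto simp: F.nb_def)
    then have ne: "e ` E \<noteq> e ` E'" using e_eq_iff[of E E'] r(5) by simp
    have "e ` r \<in> F'.rc" using e_rc[OF rc] r(2) by simp
    then have "\<Phi>' ` e ` r \<in> F'.sealed" by (rule F'.sealedI[OF _ nb_e[OF rc r(3)] nb_e[OF rc r(4)] ne])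
    then show ?thesis using r(1) comp[OF rc] by simp
  qed
qed

text \<open>Injectivity on the d-cells of the later stage guarantees that the facet under the new
  simplex was not present before.\<close>

lemma attach_glue:
  assumes inj: "inj_on (\<lambda>D. \<Phi>' ` D) F'.dc"
  shows "F.attach ((\<lambda>D. \<Phi> ` D) ` F.dc, F.sealed) ((\<lambda>D. \<Phi>' ` D) ` F'.dc, F'.sealed)"
proof -
  obtain E where E: "E \<in> F.dc" "\<rho> \<subseteq> E" and E': "e ` E \<in> F'.nb (e ` \<rho>)" "e ` E \<noteq> D" by (rule obtain_E\<rho>)
  have DF: "\<Phi>' ` D \<in> F.Fac" using D F'.dc_iff by blast
  have new: "\<Phi>' ` D \<notin> (\<lambda>D. \<Phi> ` D) ` F.dc"
  proof
    assume "\<Phi>' ` D \<in> (\<lambda>D. \<Phi> ` D) ` F.dc"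
    then obtain X where X: "X \<in> F.dc" "\<Phi>' ` D = \<Phi> ` X" by blast
    have Xc: "X \<in> cells T" using X(1) F.dc_iff by blast
    have "\<Phi>' ` D = \<Phi>' ` e ` X" using X(2) comp[OF Xc] by simp
    moreover have "e ` X \<in> F'.dc" using e_dc[OF Xc] X(1) by simp
    ultimately have "D = e ` X" using inj_onD[OF inj] D by blast
    then show False using D_new[OF Xc] by simp
  qed
  have im: "(\<lambda>D. \<Phi>' ` D) ` F'.dc = insert (\<Phi>' ` D) ((\<lambda>D. \<Phi> ` D) ` F.dc)"
  proof -
    have "\<Phi>' ` e ` X = \<Phi> ` X" if "X \<in> F.dc" for X using comp[of X] that F.dc_iff by simp
    then have "(\<lambda>D. \<Phi>' ` D) ` (\<lambda>c. e ` c) ` F.dc = (\<lambda>D. \<Phi> ` D) ` F.dc"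
      unfolding image_image[of "\<lambda>D. \<Phi>' ` D"] by (rule image_cong[OF refl])
    then show ?thesis unfolding dc' by simp
  qed
  have \<rho>D: "\<Phi> ` \<rho> \<subseteq> \<Phi>' ` D" unfolding comp[OF \<rho>_cell(1)] using \<rho>_D by (rule image_mono)
  have \<rho>R: "\<Phi> ` \<rho> \<in> F.Rid" using \<rho>_cell(2) F.rc_iff by blast
  show ?thesis unfolding F.attach_def fst_conv snd_conv im sealed_glue
    by (rule exI[of _ "\<Phi>' ` D"], rule exI[of _ "\<Phi> ` E"], rule exI[of _ "\<Phi> ` \<rho>"])
      (use DF new E(1) \<rho>R \<rho>D image_mono[OF E(2), of \<Phi>] in simp)
qed

end

section \<open>Identifying two boundary facets is a sealing\<close>

locale ident_fold = F: folded B d T \<Phi> + F': folded B d T' \<Phi>' + identification T T' \<sigma> \<tau> h q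
  for B :: "'a::euclidean_space set set" and d and T :: "'p cell_complex" and \<Phi>
    and T' :: "'q cell_complex" and \<Phi>' and \<sigma> \<tau> h q +
  fixes Fc
  assumes comp: "\<And>c. c \<in> cells T \<Longrightarrow> \<Phi> ` c = \<Phi>' ` q ` c"
    and distinct: "\<sigma> \<noteq> \<tau>" and \<sigma>b: "\<sigma> \<in> boundary_facets d T" and \<tau>b: "\<tau> \<in> boundary_facets d T"
    and Fc: "Fc \<in> F.fc" "Fc \<subseteq> \<sigma>" "Fc \<subseteq> \<tau>"
    and injd: "inj_on (\<lambda>D. \<Phi> ` D) F.dc"
begin

lemma q_dc: "c \<in> cells T \<Longrightarrow> q ` c \<in> F'.dc \<longleftrightarrow> c \<in> F.dc"
  using F.dc_iff[of c] F'.dc_iff[of "q ` c"] q_cell[of c] comp[of c] by simp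

lemma q_rc: "c \<in> cells T \<Longrightarrow> q ` c \<in> F'.rc \<longleftrightarrow> c \<in> F.rc"
  using F.rc_iff[of c] F'.rc_iff[of "q ` c"] q_cell[of c] comp[of c] by simp

lemma q_fc: "c \<in> cells T \<Longrightarrow> q ` c \<in> F'.fc \<longleftrightarrow> c \<in> F.fc"
  using F.fc_iff[of c] F'.fc_iff[of "q ` c"] q_cell[of c] comp[of c] by simp

lemma lift: assumes "c' \<in> cells T'" obtains c where "c \<in> cells T" "c' = q ` c"
proof -
  have "c' \<in> (\<lambda>c. q ` c) ` cells T" using assms unfolding cells' .
  then show thesis using that by blast
qed

lemma lift_dc: assumes "D' \<in> F'.dc" obtains D where "D \<in> F.dc" "D' = q ` D"
proof -
  have "D' \<in> cells T'" using assms F'.dc_iff by blast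
  then obtain D where D: "D \<in> cells T" "D' = q ` D" by (rule lift)
  then show thesis using that[of D] q_dc[OF D(1)] assms by simp
qed

lemma nb_cells: "E \<in> F.nb r \<Longrightarrow> E \<in> F.dc" "E \<in> F.nb r \<Longrightarrow> E \<in> cells T" "E \<in> F.nb r \<Longrightarrow> r \<subseteq> E"
  using F.dc_iff[of E] by (auto simp: F.nb_def)

lemma nb_q: assumes "E \<in> F.nb r" shows "q ` E \<in> F'.nb (q ` r)"
proof -
  have "q ` E \<in> F'.dc" using q_dc[OF nb_cells(2)[OF assms]] nb_cells(1)[OF assms] by simp
  then show ?thesis unfolding F'.nb_def using image_mono[OF nb_cells(3)[OF assms]] by simp
qed

lemma dc_eq: assumes "D \<in> F.dc" "E \<in> F.dc" "q ` D = q ` E" shows "D = E"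
proof -
  have "D \<in> cells T" "E \<in> cells T" using assms(1,2) F.dc_iff by auto
  then have "\<Phi> ` D = \<Phi> ` E" using comp[of D] comp[of E] assms(3) by simp
  then show ?thesis by (rule inj_onD[OF injd _ assms(1,2)])
qed

lemma injd': "inj_on (\<lambda>D. \<Phi>' ` D) F'.dc"
proof (rule inj_onI)
  fix D' E' assume D': "D' \<in> F'.dc" and E': "E' \<in> F'.dc" and eq: "\<Phi>' ` D' = \<Phi>' ` E'"
  obtain D where D: "D \<in> F.dc" "D' = q ` D" by (rule lift_dc[OF D'])
  obtain E where E: "E \<in> F.dc" "E' = q ` E" by (rule lift_dc[OF E'])
  have "D \<in> cells T" "E \<in> cells T" using D(1) E(1) F.dc_iff by auto
  then have "\<Phi> ` D = \<Phi> ` E" using comp[of D] comp[of E] D(2) E(2) eq by simp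
  then have "D = E" by (rule inj_onD[OF injd _ D(1) E(1)])
  then show "D' = E'" using D(2) E(2) by simp
qed

lemma q_\<tau>: "q ` \<tau> = q ` \<sigma>"
  using q_h_image[of \<sigma>] unfolding h_onto by simp

lemma \<Phi>_\<tau>: "\<Phi> ` \<tau> = \<Phi> ` \<sigma>"
  using comp[OF \<sigma>] comp[OF \<tau>] q_\<tau> by simp

lemma \<sigma>_rc: "\<sigma> \<in> F.rc" and \<tau>_rc: "\<tau> \<in> F.rc"
  using \<sigma>b \<tau>b F.bf_iff by auto

text \<open>\<open>\<sigma>\<close> and \<open>\<tau>\<close> have the same image in the ball, but
  \<open>\<Phi>\<close> is injective on each d-cell, so they cannot lie in the same one.\<close>

lemma sides_distinct: assumes "D \<in> F.nb \<sigma>" "E \<in> F.nb \<tau>" shows "D \<noteq> E"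
proof
  assume "D = E"
  then have "\<tau> = \<sigma>" using F.same_fold[OF nb_cells(2)[OF assms(2)], of \<tau> \<sigma>] nb_cells(3)[OF assms(1)] nb_cells(3)[OF assms(2)] \<Phi>_\<tau> by simp
  then show False using distinct by simp
qed

lemma sides: obtains D E where "D \<in> F.nb \<sigma>" "E \<in> F.nb \<tau>" "D \<noteq> E" "q ` D \<in> F'.nb (q ` \<sigma>)" "q ` E \<in> F'.nb (q ` \<sigma>)" "q ` D \<noteq> q ` E"
proof -
  obtain D where D: "D \<in> F.nb \<sigma>" using F.nb_nonempty[OF \<sigma>] by blast
  obtain E where E: "E \<in> F.nb \<tau>" using F.nb_nonempty[OF \<tau>] by blast
  have ne: "D \<noteq> E" by (rule sides_distinct[OF D E])
  then have "q ` D \<noteq> q ` E" using dc_eq[OF nb_cells(1)[OF D] nb_cells(1)[OF E]] by blast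
  moreover have "q ` E \<in> F'.nb (q ` \<sigma>)" using nb_q[OF E] unfolding q_\<tau> .
  ultimately show thesis using that[OF D E ne nb_q[OF D]] by simp
qed

lemma glued_not_bf: "q ` \<sigma> \<notin> boundary_facets d T'"
proof
  assume b: "q ` \<sigma> \<in> boundary_facets d T'"
  obtain D E where "D \<in> F.nb \<sigma>" "E \<in> F.nb \<tau>" "D \<noteq> E" "q ` D \<in> F'.nb (q ` \<sigma>)" "q ` E \<in> F'.nb (q ` \<sigma>)" "q ` D \<noteq> q ` E"
    by (rule sides)
  then show False using F'.bf_unique[OF b, of "q ` D" "q ` E"] by simp
qed

lemma bf_q: assumes "r \<in> cells T" "q ` r \<in> boundary_facets d T'" shows "r \<in> boundary_facets d T - {\<sigma>, \<tau>}"
proof -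
  have rr: "r \<in> F.rc" using q_rc[OF assms(1)] assms(2) F'.bf_iff by blast
  have "r \<in> boundary_facets d T"
  proof (rule F.bfI[OF rr])
    fix D E assume D: "D \<in> F.nb r" and E: "E \<in> F.nb r"
    have "q ` D = q ` E" by (rule F'.bf_unique[OF assms(2) nb_q[OF D] nb_q[OF E]])
    then show "D = E" by (rule dc_eq[OF nb_cells(1)[OF D] nb_cells(1)[OF E]])
  qed
  moreover have "r \<noteq> \<sigma>" using assms(2) glued_not_bf by auto
  moreover have "r \<noteq> \<tau>" using assms(2) glued_not_bf q_\<tau> by auto
  ultimately show ?thesis by simp
qed

text \<open>Boundary facets only disappear: one of \<open>T'\<close> comes from one of
  \<open>T\<close> other than \<open>\<sigma>\<close> and \<open>\<tau>\<close>. A cell below it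
  comes from a cell that agrees with \<open>c\<close> up to \<open>h\<close>.\<close>

lemma bf_liftE: assumes "r' \<in> boundary_facets d T'" "c \<in> cells T" "q ` c \<subseteq> r'"
  obtains r b where "r \<in> boundary_facets d T - {\<sigma>, \<tau>}" "r' = q ` r" "b \<in> cells T" "b \<subseteq> r" "q ` c = q ` b"
    "c = b \<or> c \<subseteq> \<sigma> \<and> b = h ` c \<or> b \<subseteq> \<sigma> \<and> c = h ` b"
proof -
  obtain r where r: "r \<in> cells T" "r' = q ` r" by (rule lift[OF F'.bf_cells[OF assms(1)]])
  have rb: "r \<in> boundary_facets d T - {\<sigma>, \<tau>}" using bf_q[OF r(1)] assms(1) r(2) by simp
  have "q ` c \<subseteq> q ` r" using assms(3) r(2) by simp
  then obtain b where b: "b \<in> cells T" "b \<subseteq> r" "q ` c = q ` b" by (rule lower_q[OF r(1) q_cell[OF assms(2)]])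
  show thesis by (rule that[OF rb r(2) b same_image[OF assms(2) b(1,3)]])
qed

lemma h_fix: "b \<subseteq> \<sigma> \<Longrightarrow> b \<subseteq> \<tau> \<Longrightarrow> h ` b = b"
  using hfix by (force simp: image_iff subset_iff)

lemma h_sub: "b \<subseteq> \<sigma> \<Longrightarrow> h ` b \<subseteq> \<tau>"
  using h_onto by blast

text \<open>If the (d-2)-cell arises from two different cells, one lies in \<open>\<sigma>\<close>
  and the other in \<open>\<tau>\<close>, and each contributes at most one boundary facet besides
  these. Otherwise it arises from a single cell, and its boundary facets come from those of that
  cell.\<close>

lemma normal_boundary_ident: assumes F.normal_boundary shows F'.normal_boundary
  unfolding F'.normal_boundary_def
proof
  fix G assume G: "G \<in> F'.fc"
  have Gc: "G \<in> cells T'" using G F'.fc_iff by blast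
  obtain c where c: "c \<in> cells T" "G = q ` c" by (rule lift[OF Gc])
  let ?X = "{r \<in> boundary_facets d T'. G \<subseteq> r}"
  define S where "S b = {r \<in> boundary_facets d T. b \<subseteq> r}" for b
  have finS: "finite (S b)" for b using F.fin_bf by (simp add: S_def)
  have S2: "card (S b) \<le> 2" if "b \<in> cells T" "q ` b = q ` c" for b
  proof -
    have "b \<in> F.fc" using q_fc[OF that(1)] that(2) G c(2) by simp
    then show ?thesis using assms unfolding F.normal_boundary_def S_def by blast
  qed
  have S1: "card (S b - {\<sigma>, \<tau>}) \<le> 1" if b: "b \<in> cells T" "q ` b = q ` c" and s: "s \<in> S b" "s \<in> {\<sigma>, \<tau>}" for b s
  proof -
    have "card (S b - {\<sigma>, \<tau>}) \<le> card (S b - {s})"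
      by (rule card_mono) (use finS s(2) in auto)
    also have "\<dots> = card (S b) - 1" by (rule card_Diff_singleton[OF s(1)])
    finally show ?thesis using S2[OF b] by simp
  qed
  show "card ?X \<le> 2"
  proof (cases "\<exists>b0\<in>cells T. q ` b0 = q ` c \<and> b0 \<subseteq> \<sigma> \<and> h ` b0 \<noteq> b0")
    case True
    then obtain b0 where b0: "b0 \<in> cells T" "q ` b0 = q ` c" "b0 \<subseteq> \<sigma>" "h ` b0 \<noteq> b0" by blast
    have hb: "h ` b0 \<in> cells T" "h ` b0 \<subseteq> \<tau>" "q ` h ` b0 = q ` c"
      using h_cell[OF b0(1,3)] q_h_image[OF b0(3)] b0(2) by auto
    have sub: "?X \<subseteq> (\<lambda>r. q ` r) ` (S b0 - {\<sigma>, \<tau>}) \<union> (\<lambda>r. q ` r) ` (S (h ` b0) - {\<sigma>, \<tau>})"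
    proof
      fix r' assume "r' \<in> ?X"
      then have r': "r' \<in> boundary_facets d T'" "q ` b0 \<subseteq> r'" using c(2) b0(2) by auto
      obtain r b where r: "r \<in> boundary_facets d T - {\<sigma>, \<tau>}" "r' = q ` r" "b \<in> cells T" "b \<subseteq> r" "q ` b0 = q ` b"
        "b0 = b \<or> b0 \<subseteq> \<sigma> \<and> b = h ` b0 \<or> b \<subseteq> \<sigma> \<and> b0 = h ` b"
        by (rule bf_liftE[OF r'(1) b0(1) r'(2)])
      have "\<not> (b \<subseteq> \<sigma> \<and> b0 = h ` b)"
      proof
        assume "b \<subseteq> \<sigma> \<and> b0 = h ` b"
        then have "b0 \<subseteq> \<tau>" using h_sub[of b] by simp
        then show False using h_fix[OF b0(3)] b0(4) by simp
      qed
      then have "b = b0 \<or> b = h ` b0" using r(6) by blast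
      then have "r \<in> S b0 - {\<sigma>, \<tau>} \<or> r \<in> S (h ` b0) - {\<sigma>, \<tau>}" using r(1,4) unfolding S_def by auto
      then show "r' \<in> (\<lambda>r. q ` r) ` (S b0 - {\<sigma>, \<tau>}) \<union> (\<lambda>r. q ` r) ` (S (h ` b0) - {\<sigma>, \<tau>})"
        unfolding r(2) by (elim disjE) (rule UnI1, erule imageI, rule UnI2, erule imageI)
    qed
    have "card ?X \<le> card ((\<lambda>r. q ` r) ` (S b0 - {\<sigma>, \<tau>}) \<union> (\<lambda>r. q ` r) ` (S (h ` b0) - {\<sigma>, \<tau>}))"
      by (rule card_mono[OF _ sub]) (use finS in simp)
    also have "\<dots> \<le> card ((\<lambda>r. q ` r) ` (S b0 - {\<sigma>, \<tau>})) + card ((\<lambda>r. q ` r) ` (S (h ` b0) - {\<sigma>, \<tau>}))"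
      by (rule card_Un_le)
    also have "\<dots> \<le> card (S b0 - {\<sigma>, \<tau>}) + card (S (h ` b0) - {\<sigma>, \<tau>})"
      by (intro add_mono card_image_le) (use finS in auto)
    also have "\<dots> \<le> 1 + 1"
      by (intro add_mono S1[OF b0(1,2), of \<sigma>] S1[OF hb(1,3), of \<tau>]) (use \<sigma>b \<tau>b b0(3) hb(2) in \<open>auto simp: S_def\<close>)
    finally show ?thesis by simp
  next
    case False
    then have fix': "h ` b = b" if "b \<in> cells T" "q ` b = q ` c" "b \<subseteq> \<sigma>" for b using that by blast
    have sub: "?X \<subseteq> (\<lambda>r. q ` r) ` S c"
    proof
      fix r' assume "r' \<in> ?X"
      then have r': "r' \<in> boundary_facets d T'" "q ` c \<subseteq> r'" using c(2) by auto
      obtain r b where r: "r \<in> boundary_facets d T - {\<sigma>, \<tau>}" "r' = q ` r" "b \<in> cells T" "b \<subseteq> r" "q ` c = q ` b"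
        "c = b \<or> c \<subseteq> \<sigma> \<and> b = h ` c \<or> b \<subseteq> \<sigma> \<and> c = h ` b"
        by (rule bf_liftE[OF r'(1) c(1) r'(2)])
      have "c = b" using r(6) fix'[OF c(1) refl] fix'[OF r(3) r(5)[symmetric]] by auto
      then have "r \<in> S c" using r(1,4) by (simp add: S_def)
      then show "r' \<in> (\<lambda>r. q ` r) ` S c" unfolding r(2) by (rule imageI)
    qed
    have "card ?X \<le> card ((\<lambda>r. q ` r) ` S c)" by (rule card_mono[OF _ sub]) (use finS in simp)
    also have "\<dots> \<le> card (S c)" by (rule card_image_le[OF finS])
    finally show ?thesis using S2[OF c(1) refl] by simp
  qed
qed

text \<open>A cell off the boundary of \<open>T\<close> is contained in neither
  \<open>\<sigma>\<close> nor \<open>\<tau>\<close>, so it is untouched by the identification. Its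
  image is again off the boundary, and uniqueness there pulls back.\<close>

lemma unique_lifts_ident: assumes F'.unique_lifts shows F.unique_lifts
  unfolding F.unique_lifts_def
proof (intro ballI impI)
  fix c c' assume c: "c \<in> F.fc" and nob: "\<forall>r\<in>boundary_facets d T. \<not> c \<subseteq> r"
    and c': "c' \<in> cells T" and eq: "\<Phi> ` c' = \<Phi> ` c"
  have cc: "c \<in> cells T" using c F.fc_iff by blast
  have n\<sigma>: "\<not> c \<subseteq> \<sigma>" and n\<tau>: "\<not> c \<subseteq> \<tau>" using nob \<sigma>b \<tau>b by auto
  have nob': "\<forall>r'\<in>boundary_facets d T'. \<not> q ` c \<subseteq> r'"
  proof (intro ballI notI)
    fix r' assume r': "r' \<in> boundary_facets d T'" "q ` c \<subseteq> r'"
    obtain r b where r: "r \<in> boundary_facets d T - {\<sigma>, \<tau>}" "r' = q ` r" "b \<in> cells T" "b \<subseteq> r" "q ` c = q ` b"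
      "c = b \<or> c \<subseteq> \<sigma> \<and> b = h ` c \<or> b \<subseteq> \<sigma> \<and> c = h ` b"
      by (rule bf_liftE[OF r'(1) cc r'(2)])
    have "c = b" using r(6) n\<sigma> n\<tau> h_sub[of b] by auto
    then show False using nob r(1,4) by simp
  qed
  have "q ` c \<in> F'.fc" using q_fc[OF cc] c by simp
  moreover have "\<Phi>' ` q ` c' = \<Phi>' ` q ` c" using comp[OF cc] comp[OF c'] eq by simp
  ultimately have "q ` c = q ` c'"
    using assms nob' q_cell[OF c'] unfolding F'.unique_lifts_def by metis
  then have "c = c' \<or> c \<subseteq> \<sigma> \<and> c' = h ` c \<or> c' \<subseteq> \<sigma> \<and> c = h ` c'" by (rule same_image[OF cc c'])
  then show "c' = c" using n\<sigma> n\<tau> h_sub[of c'] by auto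
qed

text \<open>If two d-cells meet in a common ridge only after the identification, their two lifts of
  that ridge differ, so by \<open>same_image\<close> one of them is \<open>\<sigma>\<close>.\<close>

lemma sealed_ident: "F'.sealed = insert (\<Phi> ` \<sigma>) F.sealed"
proof (intro subset_antisym subsetI)
  fix s assume s: "s \<in> F'.sealed"
  obtain r' D' E' where r': "s = \<Phi>' ` r'" "r' \<in> F'.rc" "D' \<in> F'.nb r'" "E' \<in> F'.nb r'" "D' \<noteq> E'"
    by (rule F'.sealedE[OF s])
  have r'c: "r' \<in> cells T'" using r'(2) F'.rc_iff by blast
  have D': "D' \<in> F'.dc" "r' \<subseteq> D'" and E': "E' \<in> F'.dc" "r' \<subseteq> E'" using r'(3,4) by (auto simp: F'.nb_def)
  obtain D where D: "D \<in> F.dc" "D' = q ` D" by (rule lift_dc[OF D'(1)])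
  obtain E where E: "E \<in> F.dc" "E' = q ` E" by (rule lift_dc[OF E'(1)])
  have cells: "D \<in> cells T" "E \<in> cells T" using D(1) E(1) F.dc_iff by auto
  obtain a where a: "a \<in> cells T" "a \<subseteq> D" "r' = q ` a" by (rule lower_q[OF cells(1) r'c D'(2)[unfolded D(2)]])
  obtain b where b: "b \<in> cells T" "b \<subseteq> E" "r' = q ` b" by (rule lower_q[OF cells(2) r'c E'(2)[unfolded E(2)]])
  have ar: "a \<in> F.rc" and br: "b \<in> F.rc" using q_rc[OF a(1)] q_rc[OF b(1)] a(3) b(3) r'(2) by auto
  have sa: "s = \<Phi> ` a" and sb: "s = \<Phi> ` b" using comp[OF a(1)] comp[OF b(1)] a(3) b(3) r'(1) by auto
  have "a = b \<or> a \<subseteq> \<sigma> \<or> b \<subseteq> \<sigma>" using same_image[OF a(1) b(1)] a(3) b(3) by auto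
  then show "s \<in> insert (\<Phi> ` \<sigma>) F.sealed"
  proof (elim disjE)
    assume "a = b"
    then have "D \<in> F.nb a" "E \<in> F.nb a" using a(2) b(2) D(1) E(1) by (auto simp: F.nb_def)
    moreover have "D \<noteq> E" using r'(5) D(2) E(2) by auto
    ultimately have "\<Phi> ` a \<in> F.sealed" by (rule F.sealedI[OF ar])
    then show ?thesis using sa by simp
  next
    assume "a \<subseteq> \<sigma>"
    then have "a = \<sigma>" by (rule F.rc_sub_eq[OF ar \<sigma>_rc])
    then show ?thesis using sa by simp
  next
    assume "b \<subseteq> \<sigma>"
    then have "b = \<sigma>" by (rule F.rc_sub_eq[OF br \<sigma>_rc])
    then show ?thesis using sb by simp
  qed
next
  fix s assume "s \<in> insert (\<Phi> ` \<sigma>) F.sealed"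
  then show "s \<in> F'.sealed"
  proof
    assume s: "s = \<Phi> ` \<sigma>"
    obtain D E where "D \<in> F.nb \<sigma>" "E \<in> F.nb \<tau>" "D \<noteq> E" and DE: "q ` D \<in> F'.nb (q ` \<sigma>)" "q ` E \<in> F'.nb (q ` \<sigma>)" "q ` D \<noteq> q ` E"
      by (rule sides)
    have "q ` \<sigma> \<in> F'.rc" using q_rc[OF \<sigma>] \<sigma>_rc by simp
    then have "\<Phi>' ` q ` \<sigma> \<in> F'.sealed" by (rule F'.sealedI[OF _ DE])
    then show ?thesis using s comp[OF \<sigma>] by simp
  next
    assume s: "s \<in> F.sealed"
    obtain r D E where r: "s = \<Phi> ` r" "r \<in> F.rc" "D \<in> F.nb r" "E \<in> F.nb r" "D \<noteq> E"
      by (rule F.sealedE[OF s])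
    have rc: "r \<in> cells T" using r(2) F.rc_iff by blast
    have "q ` r \<in> F'.rc" using q_rc[OF rc] r(2) by simp
    moreover have "q ` D \<noteq> q ` E" using dc_eq[OF nb_cells(1)[OF r(3)] nb_cells(1)[OF r(4)]] r(5) by blast
    ultimately have "\<Phi>' ` q ` r \<in> F'.sealed" by (rule F'.sealedI[OF _ nb_q[OF r(3)] nb_q[OF r(4)]])
    then show ?thesis using r(1) comp[OF rc] by simp
  qed
qed

text \<open>By \<open>normal_boundary\<close>, \<open>\<sigma>\<close> and \<open>\<tau>\<close> are
  the only boundary facets around \<open>Fc\<close>, so afterwards \<open>q\<close>
  Fc\<open>is off the boundary. By\<close>unique_lifts\<open>it is then the only cell over its
  image, so every ridge of the ball around that image lifts to a ridge around\<close>q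
  \<open>Fc\<close>, which lies in two d-cells. This is the side condition of
  \<open>seal\<close>.\<close>

lemma seal_ident:
  assumes nb: F.normal_boundary and ul: F'.unique_lifts
    and surj: "\<And>G. G \<in> B \<Longrightarrow> G \<noteq> {} \<Longrightarrow> \<exists>c\<in>cells T'. \<Phi>' ` c = G"
  shows "F.seal F.sealed F'.sealed"
proof -
  obtain D E where D: "D \<in> F.nb \<sigma>" and E: "E \<in> F.nb \<tau>" and ne: "D \<noteq> E"
    and "q ` D \<in> F'.nb (q ` \<sigma>)" "q ` E \<in> F'.nb (q ` \<sigma>)" "q ` D \<noteq> q ` E" by (rule sides)
  have sR: "\<Phi> ` \<sigma> \<in> F.Rid" using \<sigma>_rc F.rc_iff by blast
  have cof: "\<Phi> ` X \<in> F.cofac (\<Phi> ` r)" if "X \<in> F.nb r" for X r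
  proof -
    have "\<Phi> ` X \<in> F.Fac" using nb_cells(1)[OF that] F.dc_iff by blast
    then show ?thesis unfolding F.cofac_def using image_mono[OF nb_cells(3)[OF that]] by simp
  qed
  have neq: "\<Phi> ` X \<noteq> \<Phi> ` Y" if "X \<in> F.nb r" "Y \<in> F.nb r'" "X \<noteq> Y" for X Y r r'
    using inj_onD[OF injd _ nb_cells(1)[OF that(1)] nb_cells(1)[OF that(2)]] that(3) by blast
  have cD: "\<Phi> ` D \<in> F.cofac (\<Phi> ` \<sigma>)" by (rule cof[OF D])
  have cE: "\<Phi> ` E \<in> F.cofac (\<Phi> ` \<sigma>)" using cof[OF E] unfolding \<Phi>_\<tau> .
  have IR: "\<Phi> ` \<sigma> \<in> F.IR" by (rule F.cofac_pair(2)[OF sR cD cE neq[OF D E ne]])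
  \<comment> \<open>If the ridge were sealed already, the facets above it would be those of a ridge
    cell \<open>r\<close> with two d-cells. One of these would be \<open>D\<close>, and injectivity
    of the fold on \<open>D\<close> would give \<open>r = \<sigma>\<close>, although
    \<open>\<sigma>\<close> is a boundary facet.\<close>
  have new: "\<Phi> ` \<sigma> \<notin> F.sealed"
  proof
    assume s: "\<Phi> ` \<sigma> \<in> F.sealed"
    obtain r X Y where r: "\<Phi> ` \<sigma> = \<Phi> ` r" "r \<in> F.rc" "X \<in> F.nb r" "Y \<in> F.nb r" "X \<noteq> Y"
      by (rule F.sealedE[OF s])
    have "F.cofac (\<Phi> ` \<sigma>) = {\<Phi> ` X, \<Phi> ` Y}"
      by (rule F.cofac_pair(1)[OF sR _ _ neq[OF r(3,4,5)]]) (use cof[OF r(3)] cof[OF r(4)] r(1) in simp_all)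
    then have "\<Phi> ` D = \<Phi> ` X \<or> \<Phi> ` D = \<Phi> ` Y" using cD by simp
    then have "D = X \<or> D = Y" using neq[OF D r(3)] neq[OF D r(4)] by blast
    then have "r \<subseteq> D" using nb_cells(3)[OF r(3)] nb_cells(3)[OF r(4)] by blast
    then have "\<sigma> = r" by (rule F.same_fold[OF nb_cells(2)[OF D] nb_cells(3)[OF D] _ r(1)])
    then show False using F.bf_unique[OF \<sigma>b, of X Y] r(3,4,5) by simp
  qed
  have Fcc: "Fc \<in> cells T" using Fc(1) F.fc_iff by blast
  have nob: "\<forall>r'\<in>boundary_facets d T'. \<not> q ` Fc \<subseteq> r'"
  proof (intro ballI notI)
    fix r' assume r': "r' \<in> boundary_facets d T'" "q ` Fc \<subseteq> r'"
    obtain r b where r: "r \<in> boundary_facets d T - {\<sigma>, \<tau>}" "r' = q ` r" "b \<in> cells T" "b \<subseteq> r" "q ` Fc = q ` b"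
      "Fc = b \<or> Fc \<subseteq> \<sigma> \<and> b = h ` Fc \<or> b \<subseteq> \<sigma> \<and> Fc = h ` b"
      by (rule bf_liftE[OF r'(1) Fcc r'(2)])
    have "b = Fc"
      using r(6)
    proof (elim disjE conjE)
      assume "b \<subseteq> \<sigma>" "Fc = h ` b"
      then have "h ` b = h ` Fc" using h_fix[OF Fc(2,3)] by simp
      then show ?thesis using inj_on_image_eq_iff[OF inj_h \<open>b \<subseteq> \<sigma>\<close> Fc(2)] by simp
    qed (use h_fix[OF Fc(2,3)] in simp_all)
    then have "{\<sigma>, \<tau>, r} \<subseteq> {r \<in> boundary_facets d T. Fc \<subseteq> r}" using r(1,4) \<sigma>b \<tau>b Fc(2,3) by simp
    then have "card {\<sigma>, \<tau>, r} \<le> card {r \<in> boundary_facets d T. Fc \<subseteq> r}"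
      by (rule card_mono[rotated]) (use F.fin_bf in simp)
    also have "\<dots> \<le> 2" using nb Fc(1) unfolding F.normal_boundary_def by blast
    moreover have "card {\<sigma>, \<tau>, r} = 3" using distinct r(1) by (simp add: eq_commute[of \<sigma> r] eq_commute[of \<tau> r])
    ultimately show False by simp
  qed
  have around: "r \<in> F'.sealed" if r: "r \<in> F.Rid" "\<Phi> ` Fc \<subseteq> r" for r
  proof -
    have nemp: "\<Phi> ` Fc \<noteq> {}" using A.nonempty[OF Fcc] by simp
    then have "r \<noteq> {}" using r(2) by blast
    moreover have "r \<in> B" using r(1) F.Rid_B by blast
    ultimately obtain c where c: "c \<in> cells T'" "\<Phi>' ` c = r" using surj[of r] by blast
    have cr: "c \<in> F'.rc" using F'.rc_iff c r(1) by blast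
    have "\<Phi> ` Fc \<subseteq> \<Phi>' ` c" using r(2) c(2) by simp
    then obtain c' where c': "c' \<in> cells T'" "c' \<subseteq> c" "\<Phi>' ` c' = \<Phi> ` Fc"
      using F'.fold_face[OF c(1) F.fold_in[OF Fcc] nemp] by blast
    have "q ` Fc \<in> F'.fc" using q_fc[OF Fcc] Fc(1) by simp
    moreover have "\<Phi>' ` c' = \<Phi>' ` q ` Fc" using c'(3) comp[OF Fcc] by simp
    ultimately have "c' = q ` Fc" using ul nob c'(1) unfolding F'.unique_lifts_def by metis
    then have "c \<notin> boundary_facets d T'" using nob c'(2) by blast
    then have "card (F'.nb c) = 2" by (rule F'.not_bf[OF cr])
    then have "c \<in> {r \<in> F'.rc. card (F'.nb r) = 2}" using cr by simp
    then show ?thesis unfolding F'.sealed_def c(2)[symmetric] by (rule imageI)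
  qed
  have Fdim: "aff_dim (\<Phi> ` Fc) = int d - 2" using Fc(1) F.fc_iff by blast
  show ?thesis unfolding F.seal_def
    by (rule exI[of _ "\<Phi> ` \<sigma>"], rule exI[of _ "\<Phi> ` Fc"])
      (use IR new F.fold_in[OF Fcc] Fdim image_mono[OF Fc(2)] around sealed_ident in simp)
qed

end

section \<open>Pulling folds back through the steps of a local construction\<close>

text \<open>\<open>glue_simplex\<close> with the embedding as a parameter, and likewise
  \<open>fold_map\<close> for \<open>identify_facets\<close>: the maps of all steps have to be
  chosen once and then composed.\<close>

definition glue_map :: "nat \<Rightarrow> 'p cell_complex \<Rightarrow> 'q cell_complex \<Rightarrow> ('p \<Rightarrow> 'q) \<Rightarrow> bool" where
  "glue_map d T T' e \<longleftrightarrow>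
     (\<exists>\<rho> \<in> boundary_facets d T. \<exists>D \<in> cells_of_dim d T'.
        embedding_map (space_of T) (space_of T') e \<and>
        cells T' = (\<lambda>c. e ` c) ` cells T \<union> {c \<in> cells T'. c \<subseteq> D} \<and>
        e ` topspace (space_of T) \<inter> D = e ` \<rho>)"

definition fold_map :: "nat \<Rightarrow> 'p cell_complex \<Rightarrow> 'q cell_complex \<Rightarrow> ('p \<Rightarrow> 'q) \<Rightarrow> bool" where
  "fold_map d T T' q \<longleftrightarrow>
     (\<exists>\<sigma> \<in> boundary_facets d T. \<exists>\<tau> \<in> boundary_facets d T. \<exists>F \<in> cells_of_dim (d - 2) T. \<exists>h.
        \<sigma> \<noteq> \<tau> \<and> F \<subseteq> \<sigma> \<inter> \<tau> \<and>
        homeomorphic_map (subtopology (space_of T) \<sigma>) (subtopology (space_of T) \<tau>) h \<and>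
        (\<lambda>c. h ` c) ` {c \<in> cells T. c \<subseteq> \<sigma>} = {c \<in> cells T. c \<subseteq> \<tau>} \<and>
        (\<forall>x \<in> \<sigma> \<inter> \<tau>. h x = x) \<and>
        quotient_map (space_of T) (space_of T') q \<and>
        (\<forall>x \<in> topspace (space_of T). \<forall>y \<in> topspace (space_of T).
           q x = q y \<longleftrightarrow> x = y \<or> x \<in> \<sigma> \<and> y = h x \<or> y \<in> \<sigma> \<and> x = h y) \<and>
        cells T' = (\<lambda>c. q ` c) ` cells T)"

lemma glue_simplex_map: "glue_simplex d T T' \<Longrightarrow> \<exists>e. glue_map d T T' e"
  unfolding glue_simplex_def glue_map_def by (elim bexE exE) (rule exI, intro bexI)

lemma identify_facets_map: "identify_facets d T T' \<Longrightarrow> \<exists>q. fold_map d T T' q"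
  unfolding identify_facets_def fold_map_def by (elim bexE exE) (rule exI, intro bexI exI)

lemma pseudomanifold_regular: "pseudomanifold d T \<Longrightarrow> regular_complex T"
  unfolding pseudomanifold_def simplicial_CW_def by unfold_locales simp

lemma pseudomanifold_boolean: "pseudomanifold d T \<Longrightarrow> c \<in> cells T \<Longrightarrow> boolean_family (lower_interval T c)"
  unfolding pseudomanifold_def simplicial_CW_def by blast

lemma glue_mapE:
  assumes pm: "pseudomanifold d T" "pseudomanifold d T'" and "glue_map d T T' e"
  obtains \<rho> D where "gluing T T' e" "\<rho> \<in> boundary_facets d T" "D \<in> cells_of_dim d T'"
    "cells T' = (\<lambda>c. e ` c) ` cells T \<union> {c \<in> cells T'. c \<subseteq> D}" "e ` topspace (space_of T) \<inter> D = e ` \<rho>"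
proof -
  obtain \<rho> D where \<rho>: "\<rho> \<in> boundary_facets d T" and D: "D \<in> cells_of_dim d T'"
    and emb: "embedding_map (space_of T) (space_of T') e"
    and new: "cells T' = (\<lambda>c. e ` c) ` cells T \<union> {c \<in> cells T'. c \<subseteq> D}" and meet: "e ` topspace (space_of T) \<inter> D = e ` \<rho>"
    using assms(3) unfolding glue_map_def by (elim bexE conjE)
  have cell: "e ` c \<in> cells T'" if "c \<in> cells T" for c
    by (subst new) (rule UnI1, rule imageI, rule that)
  interpret A: regular_complex T by (rule pseudomanifold_regular[OF pm(1)])
  interpret A': regular_complex T' by (rule pseudomanifold_regular[OF pm(2)])
  have "gluing T T' e" by unfold_locales (rule emb, rule cell)
  then show thesis using \<rho> D new meet by (rule that)
qed

lemma fold_mapE: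
  assumes pm: "pseudomanifold d T" "pseudomanifold d T'" and "fold_map d T T' q"
  obtains \<sigma> \<tau> h F where "identification T T' \<sigma> \<tau> h q" "\<sigma> \<in> boundary_facets d T" "\<tau> \<in> boundary_facets d T" "\<sigma> \<noteq> \<tau>"
    "F \<in> cells_of_dim (d - 2) T" "F \<subseteq> \<sigma>" "F \<subseteq> \<tau>"
proof -
  obtain \<sigma> \<tau> F h where \<sigma>: "\<sigma> \<in> boundary_facets d T" and \<tau>: "\<tau> \<in> boundary_facets d T" and F: "F \<in> cells_of_dim (d - 2) T"
    and ne: "\<sigma> \<noteq> \<tau>" and Fs: "F \<subseteq> \<sigma> \<inter> \<tau>"
    and hh: "homeomorphic_map (subtopology (space_of T) \<sigma>) (subtopology (space_of T) \<tau>) h"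
    and hc: "(\<lambda>c. h ` c) ` {c \<in> cells T. c \<subseteq> \<sigma>} = {c \<in> cells T. c \<subseteq> \<tau>}"
    and hf: "\<forall>x \<in> \<sigma> \<inter> \<tau>. h x = x"
    and qu: "quotient_map (space_of T) (space_of T') q"
    and id: "\<forall>x \<in> topspace (space_of T). \<forall>y \<in> topspace (space_of T).
           q x = q y \<longleftrightarrow> x = y \<or> x \<in> \<sigma> \<and> y = h x \<or> y \<in> \<sigma> \<and> x = h y"
    and cs: "cells T' = (\<lambda>c. q ` c) ` cells T"
    using assms(3) unfolding fold_map_def by (elim bexE exE conjE)
  interpret A: regular_complex T by (rule pseudomanifold_regular[OF pm(1)])
  interpret A': regular_complex T' by (rule pseudomanifold_regular[OF pm(2)])
  have b: "r \<in> cells T" if "r \<in> boundary_facets d T" for r using that by (simp add: boundary_facets_def cells_of_dim_def)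
  have "identification T T' \<sigma> \<tau> h q"
    by unfold_locales
      (rule pseudomanifold_boolean[OF pm(1)], assumption, rule pseudomanifold_boolean[OF pm(2)], assumption,
       rule b[OF \<sigma>], rule b[OF \<tau>], rule hh, rule hc, rule bspec[OF hf], assumption, rule qu,
       rule bspec[OF bspec[OF id]], assumption, assumption, rule cs)
  then show thesis by (rule that[OF _ \<sigma> \<tau> ne F]) (use Fs in auto)
qed

context ball_complex
begin

lemma folded_glue:
  assumes F': "folded B d T' \<Phi>'" and pm: "pseudomanifold d T" and g: "glue_map d T T' e"
  shows "folded B d T (\<Phi>' \<circ> e)" "\<exists>\<rho> D. glue_fold B d T (\<Phi>' \<circ> e) T' \<Phi>' e \<rho> D"
proof -
  interpret F': folded B d T' \<Phi>' by (rule F')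
  obtain \<rho> D where gl: "gluing T T' e" and \<rho>: "\<rho> \<in> boundary_facets d T" and D: "D \<in> cells_of_dim d T'"
    and new: "cells T' = (\<lambda>c. e ` c) ` cells T \<union> {c \<in> cells T'. c \<subseteq> D}" and meet: "e ` topspace (space_of T) \<inter> D = e ` \<rho>"
    by (rule glue_mapE[OF pm F'.pm g])
  interpret gluing T T' e by (rule gl)
  show F: "folded B d T (\<Phi>' \<circ> e)"
  proof (rule folded_pull[OF F' pm])
    show "\<exists>b\<in>cells T. b \<subseteq> c \<and> c' = e ` b" if "c \<in> cells T" "c' \<in> cells T'" "c' \<subseteq> e ` c" for c c'
      using lower_e[OF that] by metis
  qed (erule e_cell e_homeomorphic A.topspace_cell)+
  interpret F: folded B d T "\<Phi>' \<circ> e" by (rule F)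
  have "glue_fold B d T (\<Phi>' \<circ> e) T' \<Phi>' e \<rho> D"
    by unfold_locales (simp add: image_comp, rule \<rho>, rule D, rule new, rule meet)
  then show "\<exists>\<rho> D. glue_fold B d T (\<Phi>' \<circ> e) T' \<Phi>' e \<rho> D" by blast
qed

lemma folded_ident:
  assumes F': "folded B d T' \<Phi>'" and pm: "pseudomanifold d T" and g: "fold_map d T T' q"
  shows "folded B d T (\<Phi>' \<circ> q)"
    and "inj_on (\<lambda>D. (\<Phi>' \<circ> q) ` D) (cells_of_dim d T) \<Longrightarrow> \<exists>\<sigma> \<tau> h F. ident_fold B d T (\<Phi>' \<circ> q) T' \<Phi>' \<sigma> \<tau> h q F"
    and "cells T' = (\<lambda>c. q ` c) ` cells T"
proof -
  interpret F': folded B d T' \<Phi>' by (rule F')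
  obtain \<sigma> \<tau> h F where gl: "identification T T' \<sigma> \<tau> h q" and \<sigma>b: "\<sigma> \<in> boundary_facets d T" and \<tau>b: "\<tau> \<in> boundary_facets d T"
    and ne: "\<sigma> \<noteq> \<tau>" and F: "F \<in> cells_of_dim (d - 2) T" "F \<subseteq> \<sigma>" "F \<subseteq> \<tau>"
    by (rule fold_mapE[OF pm F'.pm g])
  interpret identification T T' \<sigma> \<tau> h q by (rule gl)
  show fo: "folded B d T (\<Phi>' \<circ> q)"
  proof (rule folded_pull[OF F' pm])
    show "\<exists>b\<in>cells T. b \<subseteq> c \<and> c' = q ` b" if "c \<in> cells T" "c' \<in> cells T'" "c' \<subseteq> q ` c" for c c'
      using lower_q[OF that] by metis
  qed (erule q_cell q_homeomorphic A.topspace_cell)+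
  interpret F: folded B d T "\<Phi>' \<circ> q" by (rule fo)
  show "\<exists>\<sigma> \<tau> h F. ident_fold B d T (\<Phi>' \<circ> q) T' \<Phi>' \<sigma> \<tau> h q F"
    if inj: "inj_on (\<lambda>D. (\<Phi>' \<circ> q) ` D) (cells_of_dim d T)"
  proof -
    have "ident_fold B d T (\<Phi>' \<circ> q) T' \<Phi>' \<sigma> \<tau> h q F"
      by unfold_locales (simp add: image_comp, rule ne, rule \<sigma>b, rule \<tau>b, rule F(1), rule F(2), rule F(3), rule inj)
    then show ?thesis by blast
  qed
  show "cells T' = (\<lambda>c. q ` c) ` cells T" by (rule cells')
qed

end

context ball_complex
begin

lemma aff_dim_iff_unit_ball:
  assumes G: "G \<in> B" "G \<noteq> {}"
  shows "top_of_set G homeomorphic_space unit_ball n \<longleftrightarrow> aff_dim G = int n"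
proof -
  have "aff_dim G \<noteq> -1" using G(2) by (simp add: aff_dim_empty)
  then have "aff_dim G \<ge> 0" using aff_dim_geq[of G] by linarith
  then obtain m where m: "aff_dim G = int m" using nonneg_int_cases by blast
  have "\<exists>k. k simplex G" using scB G(1) unfolding simplicial_complex_def by blast
  then have cc: "compact G" "convex G" using compact_simplex convex_simplex by blast+
  obtain g where g: "homeomorphic_map (unit_ball m) (top_of_set G) g" "g ` unit_sphere_of_ball m = rel_frontier G"
    by (rule convex_compact_unit_ball[OF cc m])
  have hs: "unit_ball m homeomorphic_space top_of_set G" by (rule homeomorphic_map_imp_homeomorphic_space[OF g(1)])
  show ?thesis
  proof
    assume "top_of_set G homeomorphic_space unit_ball n"
    then have "unit_ball m homeomorphic_space unit_ball n" by (rule homeomorphic_space_trans[OF hs])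
    then obtain h where "homeomorphic_map (unit_ball m) (unit_ball n) h" unfolding homeomorphic_space by blast
    then have "m = n" by (rule homeomorphic_unit_balls_dim)
    then show "aff_dim G = int n" using m by simp
  next
    assume "aff_dim G = int n"
    then have "m = n" using m by simp
    then show "top_of_set G homeomorphic_space unit_ball n" using hs homeomorphic_space_sym[of "unit_ball m" "top_of_set G"] by simp
  qed
qed

text \<open>At the last stage the fold is the isomorphism itself; affine dimension is recognised
  topologically by \<open>aff_dim_iff_unit_ball\<close>.\<close>

lemma folded_iso:
  assumes pm: "pseudomanifold d T" and hom: "homeomorphic_map (space_of T) (top_of_set (\<Union>B)) f"
    and cells_f: "B - {{}} = (\<lambda>c. f ` c) ` cells T"
  shows "folded B d T f"
proof -
  interpret A: regular_complex T by (rule pseudomanifold_regular[OF pm])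
  have inj: "inj_on f (topspace (space_of T))" by (rule homeomorphic_imp_injective_map[OF hom])
  have cell: "f ` c \<in> B" "f ` c \<noteq> {}" if "c \<in> cells T" for c
  proof -
    have "f ` c \<in> B - {{}}" unfolding cells_f by (rule imageI[OF that])
    then show "f ` c \<in> B" "f ` c \<noteq> {}" by blast+
  qed
  have sub: "f ` c \<subseteq> \<Union>B" if "c \<in> cells T" for c using cell(1)[OF that] by blast
  show ?thesis
  proof
    show "pseudomanifold d T" by (rule pm)
    show "inj_on f c" if "c \<in> cells T" for c by (rule inj_on_subset[OF inj A.cell_subset[OF that]])
    show "f ` c \<in> B" if "c \<in> cells T" for c by (rule cell(1)[OF that])
    show "c \<in> cells_of_dim n T \<longleftrightarrow> aff_dim (f ` c) = int n" if c: "c \<in> cells T" for c n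
    proof -
      have "homeomorphic_map (subtopology (space_of T) c) (subtopology (top_of_set (\<Union>B)) (f ` c)) f"
        by (rule homeomorphic_map_subtopologies[OF hom])
          (use A.cell_subset[OF c] sub[OF c] in \<open>simp add: Int_absorb1 homeomorphic_imp_surjective_map[OF hom]\<close>)
      moreover have "subtopology (top_of_set (\<Union>B)) (f ` c) = top_of_set (f ` c)"
        using sub[OF c] by (simp add: subtopology_subtopology Int_absorb1)
      ultimately have hs: "subtopology (space_of T) c homeomorphic_space top_of_set (f ` c)"
        using homeomorphic_map_imp_homeomorphic_space by metis
      have "subtopology (space_of T) c homeomorphic_space unit_ball n \<longleftrightarrow> top_of_set (f ` c) homeomorphic_space unit_ball n"
      proof
        assume "subtopology (space_of T) c homeomorphic_space unit_ball n"
        then show "top_of_set (f ` c) homeomorphic_space unit_ball n"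
          by (rule homeomorphic_space_trans[OF iffD1[OF homeomorphic_space_sym hs]])
      qed (rule homeomorphic_space_trans[OF hs])
      then show ?thesis using c aff_dim_iff_unit_ball[OF cell[OF c]] by (simp add: cells_of_dim_def)
    qed
    show "\<exists>c'\<in>cells T. c' \<subseteq> c \<and> f ` c' = G" if c: "c \<in> cells T" and G: "G \<in> B" "G \<noteq> {}" "G \<subseteq> f ` c" for c G
    proof -
      have "G \<in> (\<lambda>c. f ` c) ` cells T" using G(1,2) unfolding cells_f[symmetric] by blast
      then obtain c' where c': "c' \<in> cells T" "G = f ` c'" by blast
      have "f ` c' \<subseteq> f ` c" using G(3) c'(2) by simp
      then have "c' \<subseteq> c" using inj_on_image_subset_iff[OF inj A.cell_subset[OF c'(1)] A.cell_subset[OF c]] by simp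
      then show ?thesis using c' by blast
    qed
  qed
qed

end

section \<open>A whole local construction, folded into the ball\<close>

locale folded_construction = ball_complex B d for B :: "'a::euclidean_space set set" and d +
  fixes T :: "nat \<Rightarrow> 'p cell_complex" and k and m :: "nat \<Rightarrow> 'p \<Rightarrow> 'p" and f :: "'p \<Rightarrow> 'a"
  assumes N1: "1 \<le> card Fac" and Nk: "card Fac \<le> k"
    and pm: "\<And>i. 1 \<le> i \<Longrightarrow> i \<le> k \<Longrightarrow> pseudomanifold d (T i)"
    and start: "is_d_simplex d (T 1)"
    and glue: "\<And>i. 1 \<le> i \<Longrightarrow> i < card Fac \<Longrightarrow> glue_map d (T i) (T (Suc i)) (m i)"
    and ident: "\<And>i. card Fac \<le> i \<Longrightarrow> i < k \<Longrightarrow> fold_map d (T i) (T (Suc i)) (m i)"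
    and hom: "homeomorphic_map (space_of (T k)) (top_of_set (\<Union>B)) f"
    and cells_f: "B - {{}} = (\<lambda>c. f ` c) ` cells (T k)"
begin

text \<open>The recursion counts steps back from the end, so \<open>fold_to i\<close> is
  \<open>f\<close> composed with \<open>m (k - 1)\<close>, ..., \<open>m i\<close>.\<close>

primrec unfolding_map :: "nat \<Rightarrow> 'p \<Rightarrow> 'a" where
  "unfolding_map 0 = f"
| "unfolding_map (Suc n) = unfolding_map n \<circ> m (k - Suc n)"

definition fold_to :: "nat \<Rightarrow> 'p \<Rightarrow> 'a" where
  "fold_to i = unfolding_map (k - i)"

lemma fold_to_k: "fold_to k = f"
  by (simp add: fold_to_def)

lemma fold_to_Suc: assumes "i < k" shows "fold_to i = fold_to (Suc i) \<circ> m i"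
proof -
  have "k - i = Suc (k - Suc i)" "k - Suc (k - Suc i) = i" using assms by auto
  then show ?thesis by (simp add: fold_to_def)
qed

lemma fold: "1 \<le> i \<Longrightarrow> i \<le> k \<Longrightarrow> folded B d (T i) (fold_to i)"
proof -
  assume i: "1 \<le> i" and "i \<le> k"
  from \<open>i \<le> k\<close> show ?thesis
  proof (induction i rule: inc_induct)
    case base
    show ?case unfolding fold_to_k by (rule folded_iso[OF pm hom cells_f]) (use N1 Nk in auto)
  next
    case (step n)
    have n: "1 \<le> n" "n < k" using step.hyps i by auto
    have p: "pseudomanifold d (T n)" by (rule pm) (use n in auto)
    show ?case unfolding fold_to_Suc[OF n(2)]
    proof (cases "n < card Fac")
      case True
      show "folded B d (T n) (fold_to (Suc n) \<circ> m n)"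
        by (rule folded_glue(1)[OF step.IH p glue[OF n(1) True]])
    next
      case False
      then show "folded B d (T n) (fold_to (Suc n) \<circ> m n)"
        by (intro folded_ident(1)[OF step.IH p ident]) (use n in auto)
    qed
  qed
qed

lemma glue_step:
  assumes "1 \<le> i" "i < card Fac"
  obtains \<rho> D where "glue_fold B d (T i) (fold_to i) (T (Suc i)) (fold_to (Suc i)) (m i) \<rho> D"
proof -
  have "\<exists>\<rho> D. glue_fold B d (T i) (fold_to (Suc i) \<circ> m i) (T (Suc i)) (fold_to (Suc i)) (m i) \<rho> D"
    by (rule folded_glue(2)[OF fold pm glue]) (use assms Nk in auto)
  then show thesis using that fold_to_Suc[of i] assms Nk by auto
qed

text \<open>In the second phase every cell of the next stage is an image of a cell, so surjectivity
  pulls back from the last stage.\<close>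

lemma surj: "card Fac \<le> i \<Longrightarrow> i \<le> k \<Longrightarrow> G \<in> B \<Longrightarrow> G \<noteq> {} \<Longrightarrow> \<exists>c\<in>cells (T i). fold_to i ` c = G"
proof -
  assume i: "card Fac \<le> i" and "i \<le> k" and G: "G \<in> B" "G \<noteq> {}"
  from \<open>i \<le> k\<close> show ?thesis
  proof (induction i rule: inc_induct)
    case base
    have "G \<in> (\<lambda>c. f ` c) ` cells (T k)" using G unfolding cells_f[symmetric] by blast
    then show ?case unfolding fold_to_k by blast
  next
    case (step n)
    have n: "card Fac \<le> n" "n < k" "1 \<le> n" using step.hyps i N1 by auto
    have im: "cells (T (Suc n)) = (\<lambda>c. m n ` c) ` cells (T n)"
      by (rule folded_ident(3)[OF fold pm ident]) (use n in auto)
    obtain c' where c': "c' \<in> cells (T (Suc n))" "fold_to (Suc n) ` c' = G" using step.IH by blast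
    obtain c where c: "c \<in> cells (T n)" "c' = m n ` c" using c'(1) unfolding im by blast
    have "fold_to n ` c = G" unfolding fold_to_Suc[OF n(2)] using c(2) c'(2) by (simp add: image_comp)
    then show ?case using c(1) by blast
  qed
qed

lemma card_facets_le: "1 \<le> i \<Longrightarrow> i \<le> card Fac \<Longrightarrow> card (cells_of_dim d (T i)) \<le> i"
proof (induction i rule: dec_induct)
  case base
  interpret F: folded B d "T 1" "fold_to 1" by (rule fold) (use N1 Nk in auto)
  obtain D where "cells_of_dim d (T 1) = {D}" by (rule F.simplex_dc[OF start])
  then show ?case by simp
next
  case (step n)
  obtain \<rho> D where "glue_fold B d (T n) (fold_to n) (T (Suc n)) (fold_to (Suc n)) (m n) \<rho> D"
    by (rule glue_step) (use step in auto)
  then interpret glue_fold B d "T n" "fold_to n" "T (Suc n)" "fold_to (Suc n)" "m n" \<rho> D .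
  have "card (cells_of_dim d (T (Suc n))) \<le> Suc (card ((\<lambda>c. m n ` c) ` cells_of_dim d (T n)))"
    unfolding dc' by (rule card_insert_le_m1) (use card_insert_if F.fin_dim in auto)
  also have "\<dots> \<le> Suc (card (cells_of_dim d (T n)))" using card_image_le[OF F.fin_dim] by simp
  finally show ?case using step by simp
qed

lemma facets_onto: assumes "card Fac \<le> i" "i \<le> k" shows "(\<lambda>D. fold_to i ` D) ` cells_of_dim d (T i) = Fac"
proof -
  interpret F: folded B d "T i" "fold_to i" by (rule fold) (use assms N1 in auto)
  show ?thesis
  proof (intro subset_antisym subsetI)
    fix D assume D: "D \<in> Fac"
    then have "D \<in> B" "D \<noteq> {}" using Fac_B by auto
    then obtain c where c: "c \<in> cells (T i)" "fold_to i ` c = D" using surj[OF assms] by blast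
    have "c \<in> F.dc" using F.dc_iff c D by blast
    then show "D \<in> (\<lambda>D. fold_to i ` D) ` cells_of_dim d (T i)" unfolding c(2)[symmetric] by (rule imageI)
  qed (use F.dc_iff in blast)
qed

text \<open>Pigeonhole: at the end of the first phase there are at most as many d-cells as facets,
  and they cover all facets.\<close>

lemma facets_inj_N: "inj_on (\<lambda>D. fold_to (card Fac) ` D) (cells_of_dim d (T (card Fac)))"
proof -
  interpret F: folded B d "T (card Fac)" "fold_to (card Fac)" by (rule fold) (use Nk N1 in auto)
  have onto: "card ((\<lambda>D. fold_to (card Fac) ` D) ` F.dc) = card Fac" using facets_onto[of "card Fac"] Nk by simp
  have "card F.dc \<le> card Fac" by (rule card_facets_le) (use N1 in auto)
  moreover have "card ((\<lambda>D. fold_to (card Fac) ` D) ` F.dc) \<le> card F.dc" by (rule card_image_le[OF F.fin_dim])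
  ultimately show ?thesis using onto by (intro eq_card_imp_inj_on F.fin_dim) simp
qed

lemma ident_step:
  assumes "card Fac \<le> i" "i < k" and inj: "inj_on (\<lambda>D. fold_to i ` D) (cells_of_dim d (T i))"
  obtains \<sigma> \<tau> h F where "ident_fold B d (T i) (fold_to i) (T (Suc i)) (fold_to (Suc i)) \<sigma> \<tau> h (m i) F"
proof -
  have "\<exists>\<sigma> \<tau> h F. ident_fold B d (T i) (fold_to (Suc i) \<circ> m i) (T (Suc i)) (fold_to (Suc i)) \<sigma> \<tau> h (m i) F"
    by (rule folded_ident(2)[OF fold pm ident]) (use assms N1 fold_to_Suc[OF assms(2)] in auto)
  then show thesis using that fold_to_Suc[OF assms(2)] by auto
qed

text \<open>From the end of the first phase the property goes backward, because the earlier stages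
  embed, and forward through the identifications by \<open>injd'\<close>.\<close>

lemma facets_inj: assumes "1 \<le> i" "i \<le> k" shows "inj_on (\<lambda>D. fold_to i ` D) (cells_of_dim d (T i))"
proof (cases "i \<le> card Fac")
  case True
  then show ?thesis
  proof (induction i rule: inc_induct)
    case base
    show ?case by (rule facets_inj_N)
  next
    case (step n)
    obtain \<rho> D where "glue_fold B d (T n) (fold_to n) (T (Suc n)) (fold_to (Suc n)) (m n) \<rho> D"
      by (rule glue_step) (use step.hyps assms(1) in auto)
    then interpret glue_fold B d "T n" "fold_to n" "T (Suc n)" "fold_to (Suc n)" "m n" \<rho> D .
    show ?case
    proof (rule inj_onI)
      fix X Y assume X: "X \<in> F.dc" and Y: "Y \<in> F.dc" and eq: "fold_to n ` X = fold_to n ` Y"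
      have c: "X \<in> cells (T n)" "Y \<in> cells (T n)" using X Y F.dc_iff by auto
      have "fold_to (Suc n) ` m n ` X = fold_to (Suc n) ` m n ` Y" using eq comp[OF c(1)] comp[OF c(2)] by simp
      then have "m n ` X = m n ` Y"
        by (rule inj_onD[OF step.IH]) (use e_dc[OF c(1)] e_dc[OF c(2)] X Y in auto)
      then show "X = Y" using e_eq_iff[OF c] by simp
    qed
  qed
next
  case False
  then have "card Fac \<le> i" by simp
  then show ?thesis using assms(2)
  proof (induction i rule: dec_induct)
    case base
    show ?case by (rule facets_inj_N)
  next
    case (step n)
    obtain \<sigma> \<tau> h F where "ident_fold B d (T n) (fold_to n) (T (Suc n)) (fold_to (Suc n)) \<sigma> \<tau> h (m n) F"
      by (rule ident_step[OF step.hyps(1)]) (use step in auto)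
    then interpret ident_fold B d "T n" "fold_to n" "T (Suc n)" "fold_to (Suc n)" \<sigma> \<tau> h "m n" F .
    show ?case by (rule injd')
  qed
qed

text \<open>At the last stage the fold is injective; \<open>unique_lifts_ident\<close> carries the
  property backward.\<close>

lemma unique: "card Fac \<le> i \<Longrightarrow> i \<le> k \<Longrightarrow> folded.unique_lifts d (T i) (fold_to i)"
proof -
  assume i: "card Fac \<le> i" and "i \<le> k"
  from \<open>i \<le> k\<close> show ?thesis
  proof (induction i rule: inc_induct)
    case base
    interpret F: folded B d "T k" "fold_to k" by (rule fold) (use Nk N1 in auto)
    interpret A: regular_complex "T k" by (rule pseudomanifold_regular[OF F.pm])
    show ?case unfolding F.unique_lifts_def
    proof (intro ballI impI)
      fix c c' assume "c \<in> F.fc" "c' \<in> cells (T k)" "fold_to k ` c' = fold_to k ` c"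
      moreover have "inj_on f (topspace (space_of (T k)))" by (rule homeomorphic_imp_injective_map[OF hom])
      ultimately show "c' = c"
        using inj_on_image_eq_iff[of f _ c' c] A.cell_subset[of c] A.cell_subset[of c'] F.fc_iff[of c] unfolding fold_to_k by blast
    qed
  next
    case (step n)
    have n: "card Fac \<le> n" "n < k" "1 \<le> n" "n \<le> k" using step.hyps i N1 by auto
    obtain \<sigma> \<tau> h F where "ident_fold B d (T n) (fold_to n) (T (Suc n)) (fold_to (Suc n)) \<sigma> \<tau> h (m n) F"
      by (rule ident_step[OF n(1,2) facets_inj[OF n(3,4)]])
    then interpret ident_fold B d "T n" "fold_to n" "T (Suc n)" "fold_to (Suc n)" \<sigma> \<tau> h "m n" F .
    show ?case by (rule unique_lifts_ident[OF step.IH])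
  qed
qed

text \<open>In contrast to \<open>unique\<close>, this invariant starts at the single simplex and is
  carried forward.\<close>

lemma normal: "1 \<le> i \<Longrightarrow> i \<le> k \<Longrightarrow> folded.normal_boundary d (T i)"
proof (induction i rule: dec_induct)
  case base
  interpret F: folded B d "T 1" "fold_to 1" by (rule fold) (use N1 Nk in auto)
  show ?case by (rule F.normal_boundary_simplex[OF start])
next
  case (step n)
  have n: "1 \<le> n" "n < k" "n \<le> k" using step by auto
  have nb: "folded.normal_boundary d (T n)" by (rule step.IH[OF n(3)])
  show ?case
  proof (cases "n < card Fac")
    case True
    obtain \<rho> D where "glue_fold B d (T n) (fold_to n) (T (Suc n)) (fold_to (Suc n)) (m n) \<rho> D"
      by (rule glue_step[OF n(1) True])
    then interpret glue_fold B d "T n" "fold_to n" "T (Suc n)" "fold_to (Suc n)" "m n" \<rho> D .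
    show ?thesis by (rule normal_boundary_glue[OF nb])
  next
    case False
    then have N: "card Fac \<le> n" by simp
    obtain \<sigma> \<tau> h F where "ident_fold B d (T n) (fold_to n) (T (Suc n)) (fold_to (Suc n)) \<sigma> \<tau> h (m n) F"
      by (rule ident_step[OF N n(2) facets_inj[OF n(1,3)]])
    then interpret ident_fold B d "T n" "fold_to n" "T (Suc n)" "fold_to (Suc n)" \<sigma> \<tau> h "m n" F .
    show ?thesis by (rule normal_boundary_ident[OF nb])
  qed
qed

lemma attach_path:
  "1 \<le> i \<Longrightarrow> i \<le> card Fac \<Longrightarrow>
    attach\<^sup>*\<^sup>* ((\<lambda>D. fold_to 1 ` D) ` cells_of_dim d (T 1), {})
      ((\<lambda>D. fold_to i ` D) ` cells_of_dim d (T i), folded.sealed d (T i) (fold_to i))"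
proof (induction i rule: dec_induct)
  case base
  interpret F: folded B d "T 1" "fold_to 1" by (rule fold) (use N1 Nk in auto)
  show ?case unfolding F.sealed_simplex[OF start] by (rule rtranclp.rtrancl_refl)
next
  case (step n)
  obtain \<rho> D where "glue_fold B d (T n) (fold_to n) (T (Suc n)) (fold_to (Suc n)) (m n) \<rho> D"
    by (rule glue_step) (use step in auto)
  then interpret glue_fold B d "T n" "fold_to n" "T (Suc n)" "fold_to (Suc n)" "m n" \<rho> D .
  have "inj_on (\<lambda>D. fold_to (Suc n) ` D) F'.dc" by (rule facets_inj) (use step Nk in auto)
  from attach_glue[OF this] show ?case
    by (rule rtranclp.rtrancl_into_rtrancl[rotated]) (use step in auto)
qed

lemma seal_path:
  "card Fac \<le> i \<Longrightarrow> i \<le> k \<Longrightarrow>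
    seal\<^sup>*\<^sup>* (folded.sealed d (T (card Fac)) (fold_to (card Fac))) (folded.sealed d (T i) (fold_to i))"
proof (induction i rule: dec_induct)
  case base
  show ?case by (rule rtranclp.rtrancl_refl)
next
  case (step n)
  have n: "card Fac \<le> n" "n < k" "1 \<le> n" "n \<le> k" using step N1 by auto
  obtain \<sigma> \<tau> h F where "ident_fold B d (T n) (fold_to n) (T (Suc n)) (fold_to (Suc n)) \<sigma> \<tau> h (m n) F"
    by (rule ident_step[OF n(1,2) facets_inj[OF n(3,4)]])
  then interpret ident_fold B d "T n" "fold_to n" "T (Suc n)" "fold_to (Suc n)" \<sigma> \<tau> h "m n" F .
  have "seal F.sealed F'.sealed"
    by (rule seal_ident[OF normal[OF n(3,4)] unique surj]) (use n in auto)
  then show ?case by (rule rtranclp.rtrancl_into_rtrancl[OF step.IH[OF n(4)]])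
qed

text \<open>The last fold is an isomorphism, so two d-cells share a ridge cell exactly when their
  facets share the ridge.\<close>

lemma sealed_k: "folded.sealed d (T k) (fold_to k) = IR"
proof -
  have k1: "1 \<le> k" using N1 Nk by simp
  interpret F: folded B d "T k" "fold_to k" by (rule fold[OF k1 order_refl])
  interpret A: regular_complex "T k" by (rule pseudomanifold_regular[OF F.pm])
  have inj: "inj_on (fold_to k) (topspace (space_of (T k)))"
    unfolding fold_to_k by (rule homeomorphic_imp_injective_map[OF hom])
  have nbD: "X \<in> F.dc" "r \<subseteq> X" if "X \<in> F.nb r" for X r using that by (auto simp: F.nb_def)
  show ?thesis
  proof (intro subset_antisym subsetI)
    fix s assume s: "s \<in> F.sealed"
    obtain r X Y where r: "s = fold_to k ` r" "r \<in> F.rc" "X \<in> F.nb r" "Y \<in> F.nb r" "X \<noteq> Y" by (rule F.sealedE[OF s])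
    have ne: "fold_to k ` X \<noteq> fold_to k ` Y"
      using inj_onD[OF facets_inj[OF k1 order_refl] _ nbD(1)[OF r(3)] nbD(1)[OF r(4)]] r(5) by blast
    have "fold_to k ` Z \<in> cofac s" if Z: "Z \<in> F.nb r" for Z
    proof -
      have "fold_to k ` Z \<in> Fac" using nbD(1)[OF Z] F.dc_iff by blast
      then show ?thesis unfolding cofac_def r(1) using image_mono[OF nbD(2)[OF Z]] by simp
    qed
    note cof = this[OF r(3)] this[OF r(4)]
    have "s \<in> Rid" using r(1,2) F.rc_iff by blast
    then show "s \<in> IR" by (rule cofac_pair(2)[OF _ cof ne])
  next
    fix s assume s: "s \<in> IR"
    have sR: "s \<in> Rid" using s by (simp add: IR_def)
    have sB: "s \<in> B" "s \<noteq> {}" using sR Rid_B d2 by auto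
    obtain x y where xy: "x \<in> Fac" "y \<in> Fac" "x \<noteq> y" "cofac s = {x, y}" by (rule IR_pair[OF s])
    have sub: "s \<subseteq> x" "s \<subseteq> y"
    proof -
      have "x \<in> cofac s" "y \<in> cofac s" using xy(4) by auto
      then show "s \<subseteq> x" "s \<subseteq> y" by (auto simp: cofac_def)
    qed
    obtain r where r: "r \<in> cells (T k)" "fold_to k ` r = s" using surj[OF Nk order_refl sB] by blast
    have lift: "\<exists>X\<in>F.nb r. fold_to k ` X = z" if z: "z \<in> Fac" "s \<subseteq> z" for z
    proof -
      have "z \<in> B" "z \<noteq> {}" using z sB Fac_B by auto
      then obtain X where X: "X \<in> cells (T k)" "fold_to k ` X = z" using surj[OF Nk order_refl] by blast
      have "fold_to k ` r \<subseteq> fold_to k ` X" using z(2) r(2) X(2) by simp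
      then have "r \<subseteq> X" using inj_on_image_subset_iff[OF inj A.cell_subset[OF r(1)] A.cell_subset[OF X(1)]] by simp
      moreover have "X \<in> F.dc" using F.dc_iff X z(1) by blast
      ultimately show ?thesis using X(2) by (auto simp: F.nb_def)
    qed
    obtain X Y where X: "X \<in> F.nb r" "fold_to k ` X = x" and Y: "Y \<in> F.nb r" "fold_to k ` Y = y"
      using lift[OF xy(1) sub(1)] lift[OF xy(2) sub(2)] by blast
    have "r \<in> F.rc" using F.rc_iff r sR by blast
    moreover have "X \<noteq> Y" using X(2) Y(2) xy(3) by blast
    ultimately have "fold_to k ` r \<in> F.sealed" using F.sealedI[OF _ X(1) Y(1)] by simp
    then show "s \<in> F.sealed" using r(2) by simp
  qed
qed

lemma constructible: constructible
proof -
  interpret F: folded B d "T 1" "fold_to 1" by (rule fold) (use N1 Nk in auto)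
  obtain D where D: "cells_of_dim d (T 1) = {D}" by (rule F.simplex_dc[OF start])
  have "fold_to 1 ` D \<in> Fac" using F.dc_iff D by blast
  moreover have "attach\<^sup>*\<^sup>* ({fold_to 1 ` D}, {}) (Fac, folded.sealed d (T (card Fac)) (fold_to (card Fac)))"
    using attach_path[OF N1 order_refl] facets_onto[OF order_refl Nk] D by simp
  moreover have "seal\<^sup>*\<^sup>* (folded.sealed d (T (card Fac)) (fold_to (card Fac))) IR"
    using seal_path[OF Nk order_refl] unfolding sealed_k .
  ultimately show ?thesis unfolding constructible_def by blast
qed

end

text \<open>The maps of the gluing steps and of the identification steps are chosen as one sequence
  \<open>m\<close>; outside the range of steps its values are arbitrary.\<close>

lemma (in ball_complex) LC_imp_constructible: assumes "LC d B" shows constructible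
proof -
  obtain T :: "nat \<Rightarrow> (nat \<Rightarrow> real) cell_complex" and k where N1: "card Fac \<ge> 1" and Nk: "k \<ge> card Fac"
    and pm: "\<forall>i \<in> {1..k}. pseudomanifold d (T i)" and start: "is_d_simplex d (T 1)"
    and gl: "\<forall>i \<in> {1..<card Fac}. glue_simplex d (T i) (T (i + 1))"
    and id: "\<forall>i \<in> {card Fac..<k}. identify_facets d (T i) (T (i + 1))"
    and iso: "cell_complex_iso (T k) (as_cell_complex B)"
    using assms unfolding LC_def Let_def by (elim exE conjE)
  obtain f where f: "homeomorphic_map (space_of (T k)) (top_of_set (\<Union>B)) f" "B - {{}} = (\<lambda>c. f ` c) ` cells (T k)"
    using iso unfolding cell_complex_iso_def as_cell_complex_def by auto
  have "\<exists>g. (1 \<le> i \<longrightarrow> i < card Fac \<longrightarrow> glue_map d (T i) (T (Suc i)) g) \<and>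
      (card Fac \<le> i \<longrightarrow> i < k \<longrightarrow> fold_map d (T i) (T (Suc i)) g)" for i
  proof (cases "i < card Fac")
    case True
    then show ?thesis using bspec[OF gl, of i] glue_simplex_map[of d "T i" "T (Suc i)"] by (cases "1 \<le> i") auto
  next
    case False
    then show ?thesis using bspec[OF id, of i] identify_facets_map[of d "T i" "T (Suc i)"] by (cases "i < k") auto
  qed
  then obtain m where m: "\<And>i. (1 \<le> i \<longrightarrow> i < card Fac \<longrightarrow> glue_map d (T i) (T (Suc i)) (m i)) \<and>
      (card Fac \<le> i \<longrightarrow> i < k \<longrightarrow> fold_map d (T i) (T (Suc i)) (m i))"
    by metis
  interpret folded_construction B d T k m f
    by unfold_locales (use N1 Nk pm start m f in auto)
  show ?thesis by (rule constructible)
qed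

theorem theorem3p10:
  fixes d :: nat and B :: "'a::euclidean_space set set"
  assumes "d \<ge> 2" and "simplicial_ball d B"
  shows "all_equivalent
    [LC d B,
     \<exists>T C. dual_spanning_tree d B T \<and> seepage d B C \<and> K_complex d B T \<searrow> C,
     \<exists>C. seepage d B C \<and> (\<forall>\<Delta> \<in> facets d B. B - {\<Delta>} \<searrow> C),
     \<exists>\<Delta> \<in> facets d B. \<exists>C. seepage d B C \<and> B - {\<Delta>} \<searrow> C,
     \<exists>C. seepage d B C \<and> (\<forall>\<sigma> \<in> faces (int d - 1) (boundary d B). B \<searrow> C - {\<sigma>}),
     \<exists>\<sigma> \<in> faces (int d - 1) (boundary d B). \<exists>C. seepage d B C \<and> B \<searrow> C - {\<sigma>}]"
proof -
  interpret ball_complex B d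
    by unfold_locales (use assms in \<open>auto simp: simplicial_ball_def\<close>)
  show ?thesis
    by (rule all_equivalent_constructible) (use LC_imp_constructible constructible_imp_LC in blast)
qed

end
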